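(* Let $A$ be a Lie algebroid over a compact manifold $M$. Let $j_0$ and $j_1$ be two integrable almost complex structures on $A$ which are connected by a smooth family $j_t$ ($t\in[0,1]$) of integrable almost complex structures on $A$. Assume that there exists a smooth family $z_t\in\Gamma(A^{0,1}_t)$ such that $\bar\partial_t\overline{z_t}=-2\,\dot j_t$ for all $t$, where $\dot j_t=\frac{d}{dt}j_t$. Then $j_0$ and $j_1$ are isomorphic, i.e. there exists a Lie algebroid automorphism $\phi$ of $A$ such that $j_1=\phi^{-1}\circ j_0\circ\phi$.
   Context: An integrable almost complex structure on a Lie algebroid $A\to M$ is a bundle map $j:A\to A$ over $\mathrm{id}_M$ with $j^2=-\mathrm{id}$ and vanishing Nijenhuis tensor: $[jX,jY]-[X,Y]-j([jX,Y]+[X,jY])=0$ for all $X,Y\in\Gamma(A)$. The complexification $A\otimes\mathbb{C}$ is the direct sum $A^{1,0}\oplus A^{0,1}$ of the eigenbundles of $j$ for the eigenvalues $+i$ and $-i$, which are Lie subalgebroids. $A^{1,0}$ is an $A^{0,1}$-module via $X\triangleright Y=\mathrm{pr}^{1,0}[X,Y]$ for $X\in\Gamma(A^{0,1})$, $Y\in\Gamma(A^{1,0})$, where $\mathrm{pr}^{1,0}:A\otimes\mathbb{C}\to A^{1,0}$ is the projection along $A^{0,1}$. $\bar\partial$ is the differential of the Lie algebroid cohomology of $A^{0,1}$ with values in this module; in degree $0$, $\bar\partial:\Gamma(A^{1,0})\to\Gamma((A^{0,1})^*\otimes A^{1,0})$, $(\bar\partial Y)(X)=X\triangleright Y$. The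 subscript $t$ refers to $j_t$. Note $\overline{z_t}\in\Gamma(A^{1,0}_t)$; since $\dot j_tj_t+j_t\dot j_t=0$, $\dot j_t$ maps $A^{0,1}_t$ to $A^{1,0}_t$, and its restriction to $A^{0,1}_t$ is regarded as an element of $\Gamma((A^{0,1}_t)^*\otimes A^{1,0}_t)$. A Lie algebroid automorphism of $A$ is a vector bundle automorphism, covering a diffeomorphism of $M$, compatible with anchor and bracket. *)

theory Defs
  imports "HOL-Analysis.Analysis"
begin

section \<open>Smooth maps between subsets of Euclidean spaces\<close>

primrec Ck_on :: "nat \<Rightarrow> 'a::euclidean_space set \<Rightarrow> ('a \<Rightarrow> 'b::euclidean_space) \<Rightarrow> bool" where
  "Ck_on 0 W f \<longleftrightarrow> continuous_on W f"
| "Ck_on (Suc k) W f \<longleftrightarrow> (\<forall>x\<in>W. f differentiable (at x)) \<and>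
      (\<forall>v. Ck_on k W (\<lambda>x. frechet_derivative f (at x) v))"

text \<open>On a set that need not be open (such as a product with the interval \<open>[0,1]\<close>, or an open
  subset of a proper linear subspace), smooth means: locally the restriction of a smooth map
  defined on an open subset of the ambient space.\<close>

definition smooth_on :: "'a::euclidean_space set \<Rightarrow> ('a \<Rightarrow> 'b::euclidean_space) \<Rightarrow> bool" where
  "smooth_on S f \<longleftrightarrow> (\<forall>x\<in>S. \<exists>W g. open W \<and> x \<in> W \<and> (\<forall>k. Ck_on k W g) \<and> (\<forall>y\<in>W \<inter> S. g y = f y))"


section \<open>Smooth manifolds\<close>

text \<open>The manifold is the whole type \<open>'m\<close>. A chart \<open>(U, \<kappa>)\<close> maps \<open>U\<close> onto an open subset of
  the linear subspace \<open>model_space M\<close> of \<open>'e\<close>; the dimension of the manifold is the dimension of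
  this subspace. Allowing a subspace admits dimension 0, which no Euclidean space type has, and
  so Lie algebras as Lie algebroids over a point.\<close>

record ('m, 'e) manifold =
  model_space :: "'e set"
  charts :: "('m set \<times> ('m \<Rightarrow> 'e)) set"

definition smooth_manifold ::
  "('m::{t2_space,second_countable_topology}, 'e::euclidean_space, 'z) manifold_scheme \<Rightarrow> bool" where
  "smooth_manifold M \<longleftrightarrow>
     subspace (model_space M) \<and>
     (\<Union>(U,\<kappa>)\<in>charts M. U) = UNIV \<and>
     (\<forall>(U,\<kappa>)\<in>charts M. open U \<and> openin (top_of_set (model_space M)) (\<kappa> ` U) \<and>
        homeomorphism U (\<kappa> ` U) \<kappa> (inv_into U \<kappa>)) \<and>
     (\<forall>(U,\<kappa>)\<in>charts M. \<forall>(U',\<kappa>')\<in>charts M.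
        smooth_on (\<kappa> ` (U \<inter> U')) (\<lambda>y. \<kappa>' (inv_into U \<kappa> y)))"

text \<open>Smoothness of a map defined on an open subset \<open>S\<close> of the manifold, and of a family of
  such maps (jointly in the parameter \<open>t \<in> T\<close> and the point).\<close>

definition smooth_fun_on ::
  "('m, 'e::euclidean_space, 'z) manifold_scheme \<Rightarrow> 'm set \<Rightarrow> ('m \<Rightarrow> 'b::euclidean_space) \<Rightarrow> bool" where
  "smooth_fun_on M S f \<longleftrightarrow>
     (\<forall>(U,\<kappa>)\<in>charts M. smooth_on (\<kappa> ` (U \<inter> S)) (\<lambda>y. f (inv_into U \<kappa> y)))"

definition smooth_family_on ::
  "('m, 'e::euclidean_space, 'z) manifold_scheme \<Rightarrow> real set \<Rightarrow> 'm set \<Rightarrow>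
     (real \<Rightarrow> 'm \<Rightarrow> 'b::euclidean_space) \<Rightarrow> bool" where
  "smooth_family_on M T S f \<longleftrightarrow>
     (\<forall>(U,\<kappa>)\<in>charts M. smooth_on (T \<times> \<kappa> ` (U \<inter> S)) (\<lambda>(t,y). f t (inv_into U \<kappa> y)))"

abbreviation smooth_function ::
  "('m, 'e::euclidean_space, 'z) manifold_scheme \<Rightarrow> ('m \<Rightarrow> real) \<Rightarrow> bool" where
  "smooth_function M \<equiv> smooth_fun_on M UNIV"

definition smooth_map ::
  "('m::topological_space, 'e::euclidean_space, 'z) manifold_scheme \<Rightarrow> ('m \<Rightarrow> 'm) \<Rightarrow> bool" where
  "smooth_map M f \<longleftrightarrow> continuous_on UNIV f \<and>
     (\<forall>(U,\<kappa>)\<in>charts M. smooth_fun_on M (f -` U) (\<lambda>x. \<kappa> (f x)))"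

definition diffeomorphism ::
  "('m::topological_space, 'e::euclidean_space, 'z) manifold_scheme \<Rightarrow> ('m \<Rightarrow> 'm) \<Rightarrow> bool" where
  "diffeomorphism M f \<longleftrightarrow> bij f \<and> smooth_map M f \<and> smooth_map M (inv f)"

text \<open>Tangent vectors at \<open>x\<close> are the derivations at \<open>x\<close> of the algebra of smooth functions. They are
  extended by 0 to all other functions, so that equality of tangent vectors is equality.\<close>

definition tangent_space ::
  "('m, 'e::euclidean_space, 'z) manifold_scheme \<Rightarrow> 'm \<Rightarrow> (('m \<Rightarrow> real) \<Rightarrow> real) set" where
  "tangent_space M x = {D.
     (\<forall>g h c d. smooth_function M g \<longrightarrow> smooth_function M h \<longrightarrow>
        D (\<lambda>y. c * g y + d * h y) = c * D g + d * D h) \<and>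
     (\<forall>g h. smooth_function M g \<longrightarrow> smooth_function M h \<longrightarrow>
        D (\<lambda>y. g y * h y) = D g * h x + g x * D h) \<and>
     (\<forall>g. \<not> smooth_function M g \<longrightarrow> D g = 0)}"

definition tangent_map ::
  "('m, 'e::euclidean_space, 'z) manifold_scheme \<Rightarrow> ('m \<Rightarrow> 'm) \<Rightarrow>
     (('m \<Rightarrow> real) \<Rightarrow> real) \<Rightarrow> ('m \<Rightarrow> real) \<Rightarrow> real" where
  "tangent_map M f D = (\<lambda>g. if smooth_function M g then D (\<lambda>y. g (f y)) else 0)"

definition smooth_vector_field ::
  "('m, 'e::euclidean_space, 'z) manifold_scheme \<Rightarrow> ('m \<Rightarrow> ('m \<Rightarrow> real) \<Rightarrow> real) \<Rightarrow> bool" where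
  "smooth_vector_field M V \<longleftrightarrow> (\<forall>x. V x \<in> tangent_space M x) \<and>
     (\<forall>g. smooth_function M g \<longrightarrow> smooth_function M (\<lambda>x. V x g))"


section \<open>Smooth vector bundles\<close>

definition linear_between ::
  "'v::real_vector set \<Rightarrow> 'w::real_vector set \<Rightarrow> ('v \<Rightarrow> 'w) \<Rightarrow> bool" where
  "linear_between S T f \<longleftrightarrow> f ` S \<subseteq> T \<and>
     (\<forall>a\<in>S. \<forall>b\<in>S. \<forall>c d. f (c *\<^sub>R a + d *\<^sub>R b) = c *\<^sub>R f a + d *\<^sub>R f b)"

text \<open>The fibres are linear subspaces of one real vector space \<open>'v\<close>, which only serves as a container:
  it carries no topology, may have infinite dimension, and the position of the fibres in it is
  arbitrary, so every family of vector spaces can be presented in this way. The smooth structure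
  comes from the local trivialisations alone. A local trivialisation \<open>(U, \<psi>)\<close>
  consists of linear isomorphisms \<open>\<psi> x\<close>, for \<open>x \<in> U\<close>, of the fibre at \<open>x\<close> onto the typical fibre,
  a linear subspace of \<open>'f\<close> (possibly 0).\<close>

record ('m, 'e, 'v, 'f) vector_bundle = "('m, 'e) manifold" +
  fibre :: "'m \<Rightarrow> 'v set"
  typical_fibre :: "'f set"
  trivs :: "('m set \<times> ('m \<Rightarrow> 'v \<Rightarrow> 'f)) set"

text \<open>Smoothness of fibrewise linear maps between trivial bundles is tested on each fixed vector
  \<open>w\<close> of the typical fibre; since that has finite dimension, this is joint smoothness.\<close>

definition smooth_vector_bundle ::
  "('m::{t2_space,second_countable_topology}, 'e::euclidean_space,
    'v::real_vector, 'f::euclidean_space, 'z) vector_bundle_scheme \<Rightarrow> bool" where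
  "smooth_vector_bundle A \<longleftrightarrow>
     smooth_manifold A \<and>
     subspace (typical_fibre A) \<and>
     (\<forall>x. subspace (fibre A x)) \<and>
     (\<Union>(U,\<psi>)\<in>trivs A. U) = UNIV \<and>
     (\<forall>(U,\<psi>)\<in>trivs A. open U \<and>
        (\<forall>x\<in>U. linear_between (fibre A x) (typical_fibre A) (\<psi> x) \<and>
               bij_betw (\<psi> x) (fibre A x) (typical_fibre A))) \<and>
     (\<forall>(U,\<psi>)\<in>trivs A. \<forall>(U',\<psi>')\<in>trivs A. \<forall>w\<in>typical_fibre A.
        smooth_fun_on A (U \<inter> U') (\<lambda>x. \<psi>' x (inv_into (fibre A x) (\<psi> x) w)))"

definition sections ::
  "('m, 'e::euclidean_space, 'v, 'f::euclidean_space, 'z) vector_bundle_scheme \<Rightarrow> ('m \<Rightarrow> 'v) set" where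
  "sections A = {X. (\<forall>x. X x \<in> fibre A x) \<and>
     (\<forall>(U,\<psi>)\<in>trivs A. smooth_fun_on A U (\<lambda>x. \<psi> x (X x)))}"

text \<open>Smooth vector bundle maps \<open>A \<rightarrow> A\<close> covering \<open>f\<close>, and smooth families of vector bundle
  endomorphisms covering the identity.\<close>

definition bundle_map ::
  "('m::topological_space, 'e::euclidean_space, 'v::real_vector, 'f::euclidean_space, 'z)
     vector_bundle_scheme \<Rightarrow> ('m \<Rightarrow> 'm) \<Rightarrow> ('m \<Rightarrow> 'v \<Rightarrow> 'v) \<Rightarrow> bool" where
  "bundle_map A f \<Phi> \<longleftrightarrow> smooth_map A f \<and>
     (\<forall>x. linear_between (fibre A x) (fibre A (f x)) (\<Phi> x)) \<and>
     (\<forall>(U,\<psi>)\<in>trivs A. \<forall>(U',\<psi>')\<in>trivs A. \<forall>w\<in>typical_fibre A.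
        smooth_fun_on A (U \<inter> f -` U') (\<lambda>x. \<psi>' (f x) (\<Phi> x (inv_into (fibre A x) (\<psi> x) w))))"

definition smooth_endo_family ::
  "('m, 'e::euclidean_space, 'v, 'f::euclidean_space, 'z) vector_bundle_scheme \<Rightarrow> real set \<Rightarrow>
     (real \<Rightarrow> 'm \<Rightarrow> 'v \<Rightarrow> 'v) \<Rightarrow> bool" where
  "smooth_endo_family A T j \<longleftrightarrow>
     (\<forall>(U,\<psi>)\<in>trivs A. \<forall>(U',\<psi>')\<in>trivs A. \<forall>w\<in>typical_fibre A.
        smooth_family_on A T (U \<inter> U') (\<lambda>t x. \<psi>' x (j t x (inv_into (fibre A x) (\<psi> x) w))))"

definition bundle_automorphism ::
  "('m::topological_space, 'e::euclidean_space, 'v::real_vector, 'f::euclidean_space, 'z)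
     vector_bundle_scheme \<Rightarrow> ('m \<Rightarrow> 'm) \<Rightarrow> ('m \<Rightarrow> 'v \<Rightarrow> 'v) \<Rightarrow> bool" where
  "bundle_automorphism A f \<Phi> \<longleftrightarrow> diffeomorphism A f \<and> bundle_map A f \<Phi> \<and>
     (\<forall>x. bij_betw (\<Phi> x) (fibre A x) (fibre A (f x))) \<and>
     bundle_map A (inv f) (\<lambda>y. inv_into (fibre A (inv f y)) (\<Phi> (inv f y)))"

text \<open>Derivative of a curve in the fibre at \<open>x\<close>. The fibre has no norm, so the derivative is taken
  in the local trivialisations around \<open>x\<close>.\<close>

definition fibre_vector_derivative ::
  "('m, 'e, 'v, 'f::euclidean_space, 'z) vector_bundle_scheme \<Rightarrow> 'm \<Rightarrow> real set \<Rightarrow>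
     (real \<Rightarrow> 'v) \<Rightarrow> real \<Rightarrow> 'v" where
  "fibre_vector_derivative A x T \<gamma> t = (THE b. b \<in> fibre A x \<and>
     (\<forall>(U,\<psi>)\<in>trivs A. x \<in> U \<longrightarrow>
        ((\<lambda>s. \<psi> x (\<gamma> s)) has_vector_derivative \<psi> x b) (at t within T)))"


section \<open>Lie algebroids\<close>

record ('m, 'e, 'v, 'f) lie_algebroid = "('m, 'e, 'v, 'f) vector_bundle" +
  anchor :: "'m \<Rightarrow> 'v \<Rightarrow> ('m \<Rightarrow> real) \<Rightarrow> real"
  bracket :: "('m \<Rightarrow> 'v) \<Rightarrow> ('m \<Rightarrow> 'v) \<Rightarrow> 'm \<Rightarrow> 'v"

text \<open>The anchor is a fibrewise linear map to the tangent bundle. It is smooth iff it maps smooth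
  sections to smooth vector fields. That it is a morphism of Lie algebras on sections follows from the
  Jacobi and Leibniz identities.\<close>

definition is_lie_algebroid ::
  "('m::{t2_space,second_countable_topology}, 'e::euclidean_space,
    'v::real_vector, 'f::euclidean_space, 'z) lie_algebroid_scheme \<Rightarrow> bool" where
  "is_lie_algebroid A \<longleftrightarrow>
     smooth_vector_bundle A \<and>
     (\<forall>x. \<forall>a\<in>fibre A x. anchor A x a \<in> tangent_space A x) \<and>
     (\<forall>x. \<forall>a\<in>fibre A x. \<forall>b\<in>fibre A x. \<forall>c d g.
        anchor A x (c *\<^sub>R a + d *\<^sub>R b) g = c * anchor A x a g + d * anchor A x b g) \<and>
     (\<forall>X\<in>sections A. smooth_vector_field A (\<lambda>x. anchor A x (X x))) \<and>
     (\<forall>X\<in>sections A. \<forall>Y\<in>sections A. bracket A X Y \<in> sections A) \<and>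
     (\<forall>X\<in>sections A. \<forall>Y\<in>sections A. \<forall>Z\<in>sections A. \<forall>c d.
        bracket A (\<lambda>x. c *\<^sub>R X x + d *\<^sub>R Y x) Z =
          (\<lambda>x. c *\<^sub>R bracket A X Z x + d *\<^sub>R bracket A Y Z x)) \<and>
     (\<forall>X\<in>sections A. \<forall>Y\<in>sections A. bracket A X Y = (\<lambda>x. - bracket A Y X x)) \<and>
     (\<forall>X\<in>sections A. \<forall>Y\<in>sections A. \<forall>Z\<in>sections A. \<forall>x.
        bracket A X (bracket A Y Z) x + bracket A Y (bracket A Z X) x
          + bracket A Z (bracket A X Y) x = 0) \<and>
     (\<forall>X\<in>sections A. \<forall>Y\<in>sections A. \<forall>g. smooth_function A g \<longrightarrow>
        bracket A X (\<lambda>x. g x *\<^sub>R Y x) =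
          (\<lambda>x. g x *\<^sub>R bracket A X Y x + anchor A x (X x) g *\<^sub>R Y x))"

definition lie_algebroid_automorphism ::
  "('m::topological_space, 'e::euclidean_space, 'v::real_vector, 'f::euclidean_space, 'z)
     lie_algebroid_scheme \<Rightarrow> ('m \<Rightarrow> 'm) \<Rightarrow> ('m \<Rightarrow> 'v \<Rightarrow> 'v) \<Rightarrow> bool" where
  "lie_algebroid_automorphism A f \<Phi> \<longleftrightarrow>
     bundle_automorphism A f \<Phi> \<and>
     (\<forall>x. \<forall>a\<in>fibre A x. anchor A (f x) (\<Phi> x a) = tangent_map A f (anchor A x a)) \<and>
     (\<forall>X\<in>sections A. \<forall>Y\<in>sections A.
        (let push = (\<lambda>Z y. \<Phi> (inv f y) (Z (inv f y)))
         in push (bracket A X Y) = bracket A (push X) (push Y)))"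


section \<open>Integrable almost complex structures\<close>

definition integrable_acs ::
  "('m::topological_space, 'e::euclidean_space, 'v::real_vector, 'f::euclidean_space, 'z)
     lie_algebroid_scheme \<Rightarrow> ('m \<Rightarrow> 'v \<Rightarrow> 'v) \<Rightarrow> bool" where
  "integrable_acs A j \<longleftrightarrow>
     bundle_map A id j \<and>
     (\<forall>x. \<forall>a\<in>fibre A x. j x (j x a) = - a) \<and>
     (\<forall>X\<in>sections A. \<forall>Y\<in>sections A. \<forall>x.
        bracket A (\<lambda>y. j y (X y)) (\<lambda>y. j y (Y y)) x - bracket A X Y x
        - j x (bracket A (\<lambda>y. j y (X y)) Y x + bracket A X (\<lambda>y. j y (Y y)) x) = 0)"

definition isomorphic_acs ::
  "('m::topological_space, 'e::euclidean_space, 'v::real_vector, 'f::euclidean_space, 'z)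
     lie_algebroid_scheme \<Rightarrow> ('m \<Rightarrow> 'v \<Rightarrow> 'v) \<Rightarrow> ('m \<Rightarrow> 'v \<Rightarrow> 'v) \<Rightarrow> bool" where
  "isomorphic_acs A j0 j1 \<longleftrightarrow> (\<exists>f \<Phi>. lie_algebroid_automorphism A f \<Phi> \<and>
     (\<forall>x. \<forall>a\<in>fibre A x. j1 x a = inv_into (fibre A x) (\<Phi> x) (j0 (f x) (\<Phi> x a))))"

definition acs_derivative ::
  "('m, 'e, 'v, 'f::euclidean_space, 'z) vector_bundle_scheme \<Rightarrow> (real \<Rightarrow> 'm \<Rightarrow> 'v \<Rightarrow> 'v) \<Rightarrow>
     real \<Rightarrow> 'm \<Rightarrow> 'v \<Rightarrow> 'v" where
  "acs_derivative A j t x a = fibre_vector_derivative A x {0..1} (\<lambda>s. j s x a) t"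


section \<open>Complexification\<close>

text \<open>The pair \<open>(a, b)\<close> stands for \<open>a + \<i> b\<close>.\<close>

definition cscale :: "complex \<Rightarrow> 'v::real_vector \<times> 'v \<Rightarrow> 'v \<times> 'v" where
  "cscale c w = (Re c *\<^sub>R fst w - Im c *\<^sub>R snd w, Im c *\<^sub>R fst w + Re c *\<^sub>R snd w)"

definition cconj :: "'v::real_vector \<times> 'v \<Rightarrow> 'v \<times> 'v" where
  "cconj w = (fst w, - snd w)"

definition cext :: "('v \<Rightarrow> 'v) \<Rightarrow> 'v \<times> 'v \<Rightarrow> 'v \<times> 'v" where
  "cext h w = (h (fst w), h (snd w))"

definition csections ::
  "('m, 'e::euclidean_space, 'v, 'f::euclidean_space, 'z) vector_bundle_scheme \<Rightarrow>
     ('m \<Rightarrow> 'v \<times> 'v) set" where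
  "csections A = {Z. (\<lambda>x. fst (Z x)) \<in> sections A \<and> (\<lambda>x. snd (Z x)) \<in> sections A}"

definition smooth_csection_family ::
  "('m, 'e::euclidean_space, 'v, 'f::euclidean_space, 'z) vector_bundle_scheme \<Rightarrow> real set \<Rightarrow>
     (real \<Rightarrow> 'm \<Rightarrow> 'v \<times> 'v) \<Rightarrow> bool" where
  "smooth_csection_family A T z \<longleftrightarrow>
     (\<forall>t\<in>T. z t \<in> csections A) \<and>
     (\<forall>(U,\<psi>)\<in>trivs A.
        smooth_family_on A T U (\<lambda>t x. \<psi> x (fst (z t x))) \<and>
        smooth_family_on A T U (\<lambda>t x. \<psi> x (snd (z t x))))"

definition cbracket ::
  "('m, 'e, 'v::real_vector, 'f, 'z) lie_algebroid_scheme \<Rightarrow>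
     ('m \<Rightarrow> 'v \<times> 'v) \<Rightarrow> ('m \<Rightarrow> 'v \<times> 'v) \<Rightarrow> 'm \<Rightarrow> 'v \<times> 'v" where
  "cbracket A Z W x =
     (let Z1 = (\<lambda>y. fst (Z y)); Z2 = (\<lambda>y. snd (Z y));
          W1 = (\<lambda>y. fst (W y)); W2 = (\<lambda>y. snd (W y))
      in (bracket A Z1 W1 x - bracket A Z2 W2 x, bracket A Z1 W2 x + bracket A Z2 W1 x))"

definition bundle10 ::
  "('m, 'e, 'v::real_vector, 'f, 'z) vector_bundle_scheme \<Rightarrow> ('m \<Rightarrow> 'v \<Rightarrow> 'v) \<Rightarrow> 'm \<Rightarrow> ('v \<times> 'v) set" where
  "bundle10 A j x = {w \<in> fibre A x \<times> fibre A x. cext (j x) w = cscale \<i> w}"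

definition bundle01 ::
  "('m, 'e, 'v::real_vector, 'f, 'z) vector_bundle_scheme \<Rightarrow> ('m \<Rightarrow> 'v \<Rightarrow> 'v) \<Rightarrow> 'm \<Rightarrow> ('v \<times> 'v) set" where
  "bundle01 A j x = {w \<in> fibre A x \<times> fibre A x. cext (j x) w = cscale (- \<i>) w}"

definition sections01 ::
  "('m, 'e::euclidean_space, 'v::real_vector, 'f::euclidean_space, 'z) vector_bundle_scheme \<Rightarrow>
     ('m \<Rightarrow> 'v \<Rightarrow> 'v) \<Rightarrow> ('m \<Rightarrow> 'v \<times> 'v) set" where
  "sections01 A j = {Z \<in> csections A. \<forall>x. Z x \<in> bundle01 A j x}"

definition pr10 ::
  "('m, 'e, 'v::real_vector, 'f, 'z) vector_bundle_scheme \<Rightarrow> ('m \<Rightarrow> 'v \<Rightarrow> 'v) \<Rightarrow>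
     'm \<Rightarrow> 'v \<times> 'v \<Rightarrow> 'v \<times> 'v" where
  "pr10 A j x w = (THE u. u \<in> bundle10 A j x \<and> w - u \<in> bundle01 A j x)"

text \<open>The differential of \<open>Y\<close>, a section of \<open>bundle10\<close>, evaluated on a section \<open>X\<close> of
  \<open>bundle01\<close>.\<close>

definition dbar ::
  "('m, 'e, 'v::real_vector, 'f, 'z) lie_algebroid_scheme \<Rightarrow> ('m \<Rightarrow> 'v \<Rightarrow> 'v) \<Rightarrow>
     ('m \<Rightarrow> 'v \<times> 'v) \<Rightarrow> ('m \<Rightarrow> 'v \<times> 'v) \<Rightarrow> 'm \<Rightarrow> 'v \<times> 'v" where
  "dbar A j Y X x = pr10 A j x (cbracket A X Y x)"

lemma pr10_eq:
  fixes A :: "('m, 'e, 'v::real_vector, 'f, 'z) vector_bundle_scheme"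
  assumes sub: "subspace (fibre A x)"
    and lin: "linear_between (fibre A x) (fibre A x) (j x)"
    and sq: "\<And>a. a \<in> fibre A x \<Longrightarrow> j x (j x a) = - a"
    and w: "w \<in> fibre A x \<times> fibre A x"
  shows "pr10 A j x w = (1/2) *\<^sub>R (w - cscale \<i> (cext (j x) w))"
    and "pr10 A j x w \<in> bundle10 A j x"
    and "w - pr10 A j x w \<in> bundle01 A j x"
proof -
  define E where "E = fibre A x"
  define J where "J = j x"
  obtain a b where ab: "w = (a, b)" "a \<in> E" "b \<in> E" using w E_def by auto
  have JE: "J c \<in> E" if "c \<in> E" for c using lin that by (auto simp: linear_between_def E_def J_def)
  have comb: "c *\<^sub>R p + d *\<^sub>R q \<in> E" if "p \<in> E" "q \<in> E" for c d p q
    using sub that by (simp add: E_def subspace_add subspace_scale)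
  have comb': "c *\<^sub>R p - d *\<^sub>R q \<in> E" if "p \<in> E" "q \<in> E" for c d p q
    using sub that by (simp add: E_def subspace_diff subspace_scale)
  have J2: "J (c *\<^sub>R p + d *\<^sub>R q) = c *\<^sub>R J p + d *\<^sub>R J q" if "p \<in> E" "q \<in> E" for c d p q
    using lin that by (auto simp: linear_between_def E_def J_def)
  have JJ: "J (J p) = - p" if "p \<in> E" for p using sq that by (simp add: E_def J_def)
  define u where "u = (1/2) *\<^sub>R (w - cscale \<i> (cext (j x) w))"
  have u: "u = ((1/2) *\<^sub>R a + (1/2) *\<^sub>R J b, (1/2) *\<^sub>R b + (-1/2) *\<^sub>R J a)"
    by (simp add: u_def ab cscale_def cext_def J_def algebra_simps)
  have wu: "w - u = ((1/2) *\<^sub>R a + (-1/2) *\<^sub>R J b, (1/2) *\<^sub>R b + (1/2) *\<^sub>R J a)"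
  proof -
    have half: "p - ((1/2) *\<^sub>R p + q) = (1/2) *\<^sub>R p - q" for p q :: 'v
      using scaleR_left_diff_distrib[of 1 "1/2" p] by (simp add: algebra_simps)
    show ?thesis
      unfolding u ab by (simp add: half half[of _ 0, simplified])
  qed
  have u1: "J ((1/2) *\<^sub>R a + (1/2) *\<^sub>R J b) = (1/2) *\<^sub>R J a + (1/2) *\<^sub>R (- b)"
    and u2: "J ((1/2) *\<^sub>R b + (-1/2) *\<^sub>R J a) = (1/2) *\<^sub>R J b + (-1/2) *\<^sub>R (- a)"
    and u3: "J ((1/2) *\<^sub>R a + (-1/2) *\<^sub>R J b) = (1/2) *\<^sub>R J a + (-1/2) *\<^sub>R (- b)"
    and u4: "J ((1/2) *\<^sub>R b + (1/2) *\<^sub>R J a) = (1/2) *\<^sub>R J b + (1/2) *\<^sub>R (- a)"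
    using ab by (simp_all only: J2 JE JJ)
  have u10: "u \<in> bundle10 A j x"
    unfolding u bundle10_def E_def[symmetric] J_def[symmetric]
    using ab by (simp add: cext_def cscale_def comb comb' JE u1[simplified] u2[simplified])
  have u01: "w - u \<in> bundle01 A j x"
    unfolding wu bundle01_def E_def[symmetric] J_def[symmetric]
    using ab by (simp add: cext_def cscale_def comb comb' JE u3[simplified] u4[simplified])
  have uniq: "v = u" if "v \<in> bundle10 A j x" "w - v \<in> bundle01 A j x" for v
  proof -
    obtain p q where pq: "v = (p, q)" by (cases v)
    have "p \<in> E" "q \<in> E" "J p = - q" "J q = p"
      using that(1) by (auto simp: pq bundle10_def cext_def cscale_def E_def J_def)
    moreover have "J (a - p) = b - q" "J (b - q) = - (a - p)"
      using that(2) by (auto simp: pq ab bundle01_def cext_def cscale_def J_def)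
    moreover have "J (a - p) = J a - J p" "J (b - q) = J b - J q"
      using J2[of a p 1 "-1"] J2[of b q 1 "-1"] ab calculation by auto
    ultimately have "J a = b - 2 *\<^sub>R q" "J b = 2 *\<^sub>R p - a"
      by (simp_all add: algebra_simps scaleR_2 eq_diff_eq)
    then show ?thesis
      by (simp add: pq u scaleR_diff_right)
  qed
  have "pr10 A j x w = u"
    unfolding pr10_def by (rule the_equality) (use u10 u01 uniq in blast)+
  then show "pr10 A j x w = (1/2) *\<^sub>R (w - cscale \<i> (cext (j x) w))"
    and "pr10 A j x w \<in> bundle10 A j x" and "w - pr10 A j x w \<in> bundle01 A j x"
    using u10 u01 unfolding u_def by metis+
qed

end

theory Submission
  imports Defs "HOL-Analysis.Analysis"
begin

text \<open>Moser's trick. Write \<open>z\<^sub>t = a + \<i> b\<close>, so that \<open>b = j\<^sub>t a\<close>. Evaluating \<open>\<partial>\<close>-bar of the conjugate of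
  \<open>z\<^sub>t\<close> on \<open>X + \<i> j\<^sub>t X\<close> and using that the Nijenhuis tensor vanishes on \<open>(X, a)\<close>, the hypothesis becomes
  \<open>d/dt j\<^sub>t X = - ([j\<^sub>t X, b] - j\<^sub>t [X, b]) / 2\<close>, that is, \<open>d/dt j\<^sub>t = - L\<^sub>u j\<^sub>t\<close> for the time-dependent
  section \<open>u\<^sub>t = - b / 2\<close>. Hence the flow of \<open>u\<close> on \<open>A\<close> conjugates \<open>j\<^sub>s\<close> to \<open>j\<^sub>t\<close>. In coordinates this flow
  solves \<open>\<phi>' = a(\<phi>)\<close>, \<open>\<Phi>' = B(\<phi>) \<Phi>\<close>; it respects the anchor and the bracket because the defects solve
  homogeneous linear equations with initial value \<open>0\<close>, by the compatibility of the anchor with the bracket and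
  by the Jacobi identity. Flows are unique, so the local ones agree where they meet; as \<open>M\<close> is compact, finitely
  many of them give a flow on \<open>M\<close> for times \<open>|t - s| < \<epsilon>\<close>, and \<open>j\<^sub>0\<close> and \<open>j\<^sub>1\<close> are joined by finitely many
  such conjugations.\<close>

subsection \<open>Smoothness with a continuous parameter\<close>

text \<open>The hypotheses give families on [0,1] only, while a flow wants a field at all times.
  Freezing the section outside [0,1] keeps it continuous in t but may destroy differentiability at
  the ends. So smoothness is asked in the point alone, with all derivatives jointly continuous in
  the time. This is enough: flows are used between fixed times, and the only derivatives in time are
  those of the differential equations and that of the almost complex structure. For the dependence
  on the point, increments are not estimated but written exactly, as coordinate increments times
  continuous coefficients; integrals, resolvents, flows and derivations are all differentiated from
  such formulas. The other obstacle is that bracket and anchor know only global sections and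
  functions. Hence locality comes from bump functions, local frames and coordinates are extended
  globally, and flows are compared by testing them on global objects. Model spaces that are proper
  subspaces bring in fixed projections throughout.\<close>

text \<open>\<open>Ckp k P W f\<close> asks that the derivatives of \<open>f p\<close> up to order \<open>k\<close> be jointly continuous in the
  parameter \<open>p\<close> and the point; in \<open>p\<close> itself nothing beyond continuity is asked, so \<open>P\<close> may be any set.\<close>

primrec Ckp :: "nat \<Rightarrow> 'p::topological_space set \<Rightarrow> 'a::euclidean_space set \<Rightarrow>
    ('p \<Rightarrow> 'a \<Rightarrow> 'b::real_normed_vector) \<Rightarrow> bool" where
  "Ckp 0 P W f \<longleftrightarrow> continuous_on (P \<times> W) (\<lambda>(p,x). f p x)"
| "Ckp (Suc k) P W f \<longleftrightarrow> continuous_on (P \<times> W) (\<lambda>(p,x). f p x) \<and>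
     (\<forall>p\<in>P. \<forall>x\<in>W. f p differentiable (at x)) \<and>
     (\<forall>v. Ckp k P W (\<lambda>p x. frechet_derivative (f p) (at x) v))"

definition csm :: "'p::topological_space set \<Rightarrow> 'a::euclidean_space set \<Rightarrow>
    ('p \<Rightarrow> 'a \<Rightarrow> 'b::real_normed_vector) \<Rightarrow> bool" where
  "csm P W f \<longleftrightarrow> (\<forall>k. Ckp k P W f)"

declare Ckp.simps(2)[simp del]

text \<open>A one-point parameter set turns smoothness without parameter into a special case, so
  that each closure rule is proved once.\<close>

abbreviation sm :: "'a::euclidean_space set \<Rightarrow> ('a \<Rightarrow> 'b::real_normed_vector) \<Rightarrow> bool" where
  "sm W f \<equiv> csm {0::real} W (\<lambda>_. f)"

lemma Ckp_cont: "Ckp k P W f \<Longrightarrow> continuous_on (P \<times> W) (\<lambda>(p,x). f p x)"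
  by (cases k) (auto simp: Ckp.simps(2))

lemma Ckp_cont2:
  assumes "Ckp k P W f" "continuous_on S g" "continuous_on S h"
    and "\<And>s. s \<in> S \<Longrightarrow> g s \<in> P" "\<And>s. s \<in> S \<Longrightarrow> h s \<in> W"
  shows "continuous_on S (\<lambda>s. f (g s) (h s))"
proof -
  have "continuous_on S (\<lambda>s. (\<lambda>(p,x). f p x) (g s, h s))"
    by (rule continuous_on_compose2[OF Ckp_cont[OF assms(1)]])
       (use assms in \<open>auto intro!: continuous_intros\<close>)
  then show ?thesis by simp
qed

text \<open>\<open>frechet_derivative\<close> is a choice among all derivatives at the point. As f
  and g have the same derivatives there, the choices coincide, whether or not a derivative
  exists.\<close>

lemma frechet_derivative_cong:
  assumes "open W" "x \<in> W" "\<And>y. y \<in> W \<Longrightarrow> f y = g y"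
  shows "frechet_derivative f (at x) = frechet_derivative g (at x)"
proof -
  have "(f has_derivative D) (at x) \<longleftrightarrow> (g has_derivative D) (at x)" for D
  proof
    show "(g has_derivative D) (at x)" if "(f has_derivative D) (at x)"
      by (rule has_derivative_transform_within_open[OF that assms(1,2)]) (use assms in auto)
    show "(f has_derivative D) (at x)" if "(g has_derivative D) (at x)"
      by (rule has_derivative_transform_within_open[OF that assms(1,2)]) (use assms in auto)
  qed
  then show ?thesis by (simp add: frechet_derivative_def)
qed

lemma Ckp_cong:
  assumes "open W" "\<And>p x. p \<in> P \<Longrightarrow> x \<in> W \<Longrightarrow> f p x = g p x" "Ckp k P W f"
  shows "Ckp k P W g"
  using assms(2,3)
proof (induction k arbitrary: f g)
  case 0
  then show ?case by (subst Ckp.simps, subst continuous_on_cong[OF refl, where g="\<lambda>(p,x). f p x"]) auto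
next
  case (Suc k)
  have c: "continuous_on (P \<times> W) (\<lambda>(p,x). g p x)"
    using Suc.prems Ckp_cont[OF Suc.prems(2)] by (subst continuous_on_cong[OF refl, where g="\<lambda>(p,x). f p x"]) auto
  have d: "g p differentiable (at x)" if "p \<in> P" "x \<in> W" for p x
  proof -
    from Suc.prems(2) that have "f p differentiable (at x)" by (simp add: Ckp.simps(2))
    then obtain D where D: "(f p has_derivative D) (at x)"
      unfolding differentiable_def by blast
    have "(g p has_derivative D) (at x)"
      by (rule has_derivative_transform_within_open[OF D assms(1) that(2)]) (use Suc.prems that in auto)
    then show ?thesis by (auto simp: differentiable_def)
  qed
  have "Ckp k P W (\<lambda>p x. frechet_derivative (g p) (at x) v)" for v
  proof (rule Suc.IH)
    show "Ckp k P W (\<lambda>p x. frechet_derivative (f p) (at x) v)" using Suc.prems by (simp add: Ckp.simps(2))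
    show "frechet_derivative (f p) (at x) v = frechet_derivative (g p) (at x) v" if "p \<in> P" "x \<in> W" for p x
      using frechet_derivative_cong[OF assms(1) that(2), of "f p" "g p"] Suc.prems(1) that by simp
  qed
  with c d show ?case by (simp add: Ckp.simps(2))
qed

lemma Ckp_Suc_le: "Ckp (Suc k) P W f \<Longrightarrow> Ckp k P W f"
proof (induction k arbitrary: f)
  case (Suc k)
  then show ?case by (metis Ckp.simps(2))
qed (simp add: Ckp.simps(2))

lemma Ckp_le: "Ckp l P W f \<Longrightarrow> k \<le> l \<Longrightarrow> Ckp k P W f"
  by (induction l) (auto simp: le_Suc_eq simp del: Ckp.simps intro: Ckp_Suc_le)

lemma Ckp_subset: "Ckp k P W f \<Longrightarrow> P' \<subseteq> P \<Longrightarrow> W' \<subseteq> W \<Longrightarrow> Ckp k P' W' f"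
proof (induction k arbitrary: f)
  case 0
  then show ?case by (auto elim!: continuous_on_subset)
next
  case (Suc k)
  have "continuous_on (P' \<times> W') (\<lambda>(p,x). f p x)"
    by (rule continuous_on_subset[OF Ckp_cont[OF Suc.prems(1)]]) (use Suc.prems in auto)
  moreover have "Ckp k P' W' (\<lambda>p x. frechet_derivative (f p) (at x) v)" for v
    using Suc by (simp add: Ckp.simps(2))
  ultimately show ?case using Suc.prems by (simp add: subset_iff Ckp.simps(2))
qed

text \<open>Derivatives on an open set are unique, so an explicit formula D may replace
  \<open>frechet_derivative\<close>. Most closure rules below amount to finding D and recognising
  it, by induction, as an expression of order k.\<close>

lemma Ckp_SucI:
  assumes "open W" "continuous_on (P \<times> W) (\<lambda>(p,x). f p x)"
    "\<And>p x. p \<in> P \<Longrightarrow> x \<in> W \<Longrightarrow> (f p has_derivative D p x) (at x)"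
    "\<And>v. Ckp k P W (\<lambda>p x. D p x v)"
  shows "Ckp (Suc k) P W f"
proof -
  have "Ckp k P W (\<lambda>p x. frechet_derivative (f p) (at x) v)" for v
  proof (rule Ckp_cong[OF assms(1) _ assms(4)[of v]])
    show "D p x v = frechet_derivative (f p) (at x) v" if "p \<in> P" "x \<in> W" for p x
      using frechet_derivative_at[OF assms(3)[OF that]] by simp
  qed
  moreover have "f p differentiable (at x)" if "p \<in> P" "x \<in> W" for p x
    using assms(3)[OF that] differentiableI by blast
  ultimately show ?thesis using assms(2) unfolding Ckp.simps(2) by blast
qed

lemma Ckp_SucD:
  assumes "Ckp (Suc k) P W f"
  shows "p \<in> P \<Longrightarrow> x \<in> W \<Longrightarrow> (f p has_derivative frechet_derivative (f p) (at x)) (at x)"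
    and "Ckp k P W (\<lambda>p x. frechet_derivative (f p) (at x) v)"
  using assms by (auto simp: frechet_derivative_works[symmetric] Ckp.simps(2))

section \<open>Closure rules of order k\<close>

lemma continuous_on_fst_comp: "continuous_on P c \<Longrightarrow> continuous_on (P \<times> W) (\<lambda>(p,x). c p)"
  unfolding case_prod_beta by (rule continuous_on_compose2[of P c]) (auto intro!: continuous_on_fst continuous_on_id)

lemma Ckp_const:
  fixes c :: "'p::topological_space \<Rightarrow> 'b::real_normed_vector" and W :: "'a::euclidean_space set"
  shows "continuous_on P c \<Longrightarrow> open W \<Longrightarrow> Ckp k P W (\<lambda>p x. c p)"
proof (induction k arbitrary: c)
  case 0
  then show ?case by (simp add: continuous_on_fst_comp)
next
  case (Suc k)
  show ?case
  proof (rule Ckp_SucI[where D="\<lambda>p x v. 0"])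
    show "Ckp k P W (\<lambda>p x. (0::'b))" by (rule Suc.IH[OF continuous_on_const Suc.prems(2)])
    show "((\<lambda>x. c p) has_derivative (\<lambda>v. 0)) (at x)" for p and x :: 'a by (rule has_derivative_const)
    show "continuous_on (P \<times> W) (\<lambda>(p, x). c p)" by (rule continuous_on_fst_comp[OF Suc.prems(1)])
  qed (fact Suc.prems(2))
qed

lemma Ckp_bounded_linear:
  assumes "bounded_linear L" "open W" shows "Ckp k P W f \<Longrightarrow> Ckp k P W (\<lambda>p x. L (f p x))"
proof (induction k arbitrary: f)
  case 0
  then show ?case using bounded_linear.continuous_on[OF assms(1) 0[simplified]] by (simp add: case_prod_beta)
next
  case (Suc k)
  show ?case
  proof (rule Ckp_SucI[where D="\<lambda>p x v. L (frechet_derivative (f p) (at x) v)"])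
    show "continuous_on (P \<times> W) (\<lambda>(p, x). L (f p x))"
      using bounded_linear.continuous_on[OF assms(1) Ckp_cont[OF Suc.prems]] by (simp add: case_prod_beta)
    show "((\<lambda>x. L (f p x)) has_derivative (\<lambda>v. L (frechet_derivative (f p) (at x) v))) (at x)"
      if "p \<in> P" "x \<in> W" for p x
      by (rule bounded_linear.has_derivative[OF assms(1) Ckp_SucD(1)[OF Suc.prems that]])
    show "Ckp k P W (\<lambda>p x. L (frechet_derivative (f p) (at x) v))" for v
      by (rule Suc.IH[OF Ckp_SucD(2)[OF Suc.prems]])
  qed (fact assms)
qed

lemma Ckp_id: "open W \<Longrightarrow> Ckp k P W (\<lambda>p x. x)"
proof (cases k)
  case 0
  then show ?thesis by (simp add: case_prod_beta continuous_on_snd)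
next
  case (Suc l)
  assume "open W"
  then show ?thesis unfolding Suc
    by (intro Ckp_SucI[where D="\<lambda>p x v. v"])
      (simp_all add: case_prod_beta continuous_on_snd Ckp_const)
qed

lemma Ckp_linear: "linear L \<Longrightarrow> open W \<Longrightarrow> Ckp k P W (\<lambda>p x. L x)"
  using Ckp_bounded_linear[OF _ _ Ckp_id, of L W k P] linear_conv_bounded_linear by blast

lemma Ckp_add:
  assumes "open W" shows "Ckp k P W f \<Longrightarrow> Ckp k P W g \<Longrightarrow> Ckp k P W (\<lambda>p x. f p x + g p x)"
proof (induction k arbitrary: f g)
  case 0
  then show ?case by (auto simp: case_prod_beta intro!: continuous_intros)
next
  case (Suc k)
  show ?case
  proof (rule Ckp_SucI[where D="\<lambda>p x v. frechet_derivative (f p) (at x) v + frechet_derivative (g p) (at x) v"])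
    show "continuous_on (P \<times> W) (\<lambda>(p, x). f p x + g p x)"
      using Ckp_cont[OF Suc.prems(1)] Ckp_cont[OF Suc.prems(2)]
      by (auto simp: case_prod_beta intro!: continuous_on_add)
    show "((\<lambda>x. f p x + g p x) has_derivative
        (\<lambda>v. frechet_derivative (f p) (at x) v + frechet_derivative (g p) (at x) v)) (at x)"
      if "p \<in> P" "x \<in> W" for p x
      by (rule has_derivative_add[OF Ckp_SucD(1)[OF Suc.prems(1) that] Ckp_SucD(1)[OF Suc.prems(2) that]])
    show "Ckp k P W (\<lambda>p x. frechet_derivative (f p) (at x) v + frechet_derivative (g p) (at x) v)" for v
      by (rule Suc.IH[OF Ckp_SucD(2)[OF Suc.prems(1)] Ckp_SucD(2)[OF Suc.prems(2)]])
  qed (fact assms)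
qed

lemma Ckp_sum:
  assumes "open W" "\<And>i. i \<in> I \<Longrightarrow> Ckp k P W (f i)" shows "Ckp k P W (\<lambda>p x. \<Sum>i\<in>I. f i p x)"
proof (cases "finite I")
  case True
  then show ?thesis using assms(2)
    by (induction) (simp_all add: Ckp_const Ckp_add assms(1))
qed (simp add: Ckp_const assms(1))

lemma (in bounded_bilinear) Ckp:
  assumes "open W"
  shows "Ckp k P W f \<Longrightarrow> Ckp k P W g \<Longrightarrow> Ckp k P W (\<lambda>p x. prod (f p x) (g p x))"
proof (induction k arbitrary: f g)
  case 0
  then show ?case by (auto simp: case_prod_beta intro!: continuous_on)
next
  case (Suc k)
  show ?case
  proof (rule Ckp_SucI[where D="\<lambda>p x v. prod (f p x) (frechet_derivative (g p) (at x) v) +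
       prod (frechet_derivative (f p) (at x) v) (g p x)"])
    show "continuous_on (P \<times> W) (\<lambda>(p, x). prod (f p x) (g p x))"
      using Ckp_cont[OF Suc.prems(1)] Ckp_cont[OF Suc.prems(2)]
      by (auto simp: case_prod_beta intro!: continuous_on)
    show "((\<lambda>x. prod (f p x) (g p x)) has_derivative (\<lambda>v. prod (f p x) (frechet_derivative (g p) (at x) v) +
       prod (frechet_derivative (f p) (at x) v) (g p x))) (at x)"
      if "p \<in> P" "x \<in> W" for p x
      by (rule FDERIV[OF Ckp_SucD(1)[OF Suc.prems(1) that] Ckp_SucD(1)[OF Suc.prems(2) that]])
    \<comment> \<open>Each Leibniz term has one differentiated and one plain factor. The plain one
      is weakened to order k, and the induction hypothesis is used for arbitrary pairs of
      factors.\<close>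
    show "Ckp k P W (\<lambda>p x. prod (f p x) (frechet_derivative (g p) (at x) v) +
       prod (frechet_derivative (f p) (at x) v) (g p x))" for v
      by (intro Ckp_add assms Suc.IH Ckp_Suc_le[OF Suc.prems(1)] Ckp_Suc_le[OF Suc.prems(2)]
          Ckp_SucD(2)[OF Suc.prems(1)] Ckp_SucD(2)[OF Suc.prems(2)])
  qed (fact assms)
qed

text \<open>Nothing is differentiated in the parameter, so a continuous change h suffices. This
  admits clamping the time to [0,1] and the substitutions inside parameter integrals.\<close>

lemma Ckp_reparam:
  assumes "continuous_on Q h" "h ` Q \<subseteq> P" "open W"
  shows "Ckp k P W f \<Longrightarrow> Ckp k Q W (\<lambda>q x. f (h q) x)"
proof (induction k arbitrary: f)
  case 0
  have "continuous_on (Q \<times> W) (\<lambda>z. f (h (fst z)) (snd z))"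
    by (rule Ckp_cont2[OF 0, where g="\<lambda>z. h (fst z)"])
       (use assms in \<open>auto intro!: continuous_on_compose2[OF assms(1)] continuous_intros\<close>)
  then show ?case by (simp add: case_prod_beta)
next
  case (Suc k)
  have "continuous_on (Q \<times> W) (\<lambda>z. f (h (fst z)) (snd z))"
    by (rule Ckp_cont2[OF Suc.prems, where g="\<lambda>z. h (fst z)"])
       (use assms in \<open>auto intro!: continuous_on_compose2[OF assms(1)] continuous_intros\<close>)
  moreover have "Ckp k Q W (\<lambda>q x. frechet_derivative (f (h q)) (at x) v)" for v
    by (rule Suc.IH[OF Ckp_SucD(2)[OF Suc.prems]])
  moreover have "f (h q) differentiable (at x)" if "q \<in> Q" "x \<in> W" for q x
    using Suc.prems that assms(2) by (auto simp: Ckp.simps(2))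
  ultimately show ?case by (simp add: case_prod_beta Ckp.simps(2))
qed

lemma Ckp_local:
  assumes "\<And>p x. p \<in> P \<Longrightarrow> x \<in> W \<Longrightarrow> \<exists>S V. open S \<and> open V \<and> p \<in> S \<and> x \<in> V \<and> Ckp k (P \<inter> S) (W \<inter> V) f"
  shows "Ckp k P W f"
  using assms
proof (induction k arbitrary: f)
  case 0
  show ?case unfolding Ckp.simps
  proof (subst continuous_on_def, rule ballI)
    fix y assume y: "y \<in> P \<times> W"
    obtain p x where px: "y = (p,x)" "p \<in> P" "x \<in> W" using y by auto
    obtain S V where SV: "open S" "open V" "p \<in> S" "x \<in> V" and
      "Ckp 0 (P \<inter> S) (W \<inter> V) f" using 0[OF px(2,3)] by blast
    moreover have eq: "(P \<inter> S) \<times> (W \<inter> V) = (S \<times> V) \<inter> (P \<times> W)" by blast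
    ultimately have "continuous_on ((S \<times> V) \<inter> (P \<times> W)) (\<lambda>(p,x). f p x)" by simp
    moreover have y': "y \<in> S \<times> V" using px SV by simp
    ultimately have c: "((\<lambda>(p,x). f p x) \<longlongrightarrow> (\<lambda>(p,x). f p x) y) (at y within ((S \<times> V) \<inter> (P \<times> W)))"
      using y unfolding continuous_on_def by blast
    have "at y within ((S \<times> V) \<inter> (P \<times> W)) = at y within (P \<times> W)"
      by (rule at_within_nhd[OF y' open_Times[OF SV(1,2)]]) blast
    with c show "((\<lambda>(p,x). f p x) \<longlongrightarrow> (\<lambda>(p,x). f p x) y) (at y within (P \<times> W))"
      by metis
  qed
next
  case (Suc k)
  have "Ckp 0 P W f"
  proof (rule Suc.IH[THEN Ckp_le])
    show "\<exists>S V. open S \<and> open V \<and> p \<in> S \<and> x \<in> V \<and> Ckp k (P \<inter> S) (W \<inter> V) f" if px: "p \<in> P" "x \<in> W" for p x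
    proof -
      obtain S V where "open S" "open V" "p \<in> S" "x \<in> V" and C: "Ckp (Suc k) (P \<inter> S) (W \<inter> V) f"
        using Suc.prems[OF px] by blast
      then show ?thesis using Ckp_Suc_le[OF C] by (intro exI[of _ S] exI[of _ V]) simp
    qed
  qed simp
  moreover have "f p differentiable (at x)" if px: "p \<in> P" "x \<in> W" for p x
  proof -
    obtain S V where "p \<in> S" "x \<in> V" and "Ckp (Suc k) (P \<inter> S) (W \<inter> V) f"
      using Suc.prems[OF px] by blast
    with px show ?thesis by (auto simp: Ckp.simps(2))
  qed
  moreover have "Ckp k P W (\<lambda>p x. frechet_derivative (f p) (at x) v)" for v
  proof (rule Suc.IH)
    show "\<exists>S V. open S \<and> open V \<and> p \<in> S \<and> x \<in> V \<and> Ckp k (P \<inter> S) (W \<inter> V) (\<lambda>p x. frechet_derivative (f p) (at x) v)"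
      if px: "p \<in> P" "x \<in> W" for p x
    proof -
      obtain S V where "open S" "open V" "p \<in> S" "x \<in> V" and C: "Ckp (Suc k) (P \<inter> S) (W \<inter> V) f"
        using Suc.prems[OF px] by blast
      then show ?thesis using Ckp_SucD(2)[OF C] by (intro exI[of _ S] exI[of _ V]) simp
    qed
  qed
  ultimately show ?case by (simp add: Ckp.simps(2))
qed

section \<open>Operators given by their values on the standard basis\<close>

definition rank_one :: "'a::euclidean_space \<Rightarrow> 'b::real_normed_vector \<Rightarrow> 'a \<Rightarrow>\<^sub>L 'b" where
  "rank_one b c = blinfun_scaleR_left c o\<^sub>L blinfun_inner_left b"

lemma rank_one_apply [simp]: "blinfun_apply (rank_one b c) h = (h \<bullet> b) *\<^sub>R c"
  by (simp add: rank_one_def)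

lemma bounded_linear_rank_one: "bounded_linear (rank_one b)"
  unfolding rank_one_def
  by (rule bounded_linear_compose[OF bounded_bilinear.bounded_linear_left[OF bounded_bilinear_blinfun_compose]
        bounded_linear_blinfun_scaleR_left])

text \<open>The linear extension of the values of f on the standard basis; f itself may be any
  function. As a finite sum of rank-one operators, each depending on one value linearly, it inherits
  continuity and smoothness in a parameter from these values.\<close>

definition blinfun_of :: "('a::euclidean_space \<Rightarrow> 'b::real_normed_vector) \<Rightarrow> 'a \<Rightarrow>\<^sub>L 'b" where
  "blinfun_of f = (\<Sum>b\<in>Basis. rank_one b (f b))"

lemma blinfun_of_apply: "blinfun_apply (blinfun_of f) h = (\<Sum>b\<in>Basis. (h \<bullet> b) *\<^sub>R f b)"
  by (simp add: blinfun_of_def blinfun.sum_left)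

lemma blinfun_of_linear: "linear f \<Longrightarrow> blinfun_apply (blinfun_of f) h = f h"
  using linear_sum[of f "\<lambda>b. (h \<bullet> b) *\<^sub>R b" Basis] euclidean_representation[of h]
  by (simp add: blinfun_of_apply linear_cmul)

lemma blinfun_of_blinfun: "blinfun_of (blinfun_apply F) = F"
  by (rule blinfun_eqI) (simp add: blinfun_of_linear blinfun.bounded_linear_right bounded_linear.linear)

lemma continuous_on_blinfun_of:
  assumes "\<And>b. b \<in> Basis \<Longrightarrow> continuous_on S (\<lambda>s. f s b)"
  shows "continuous_on S (\<lambda>s. blinfun_of (f s))"
  unfolding blinfun_of_def
  by (intro continuous_on_sum bounded_linear.continuous_on[OF bounded_linear_rank_one] assms)

lemma Ckp_blinfun_of:
  assumes "open W" "\<And>b. b \<in> Basis \<Longrightarrow> Ckp k P W (\<lambda>p x. f p x b)"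
  shows "Ckp k P W (\<lambda>p x. blinfun_of (f p x))"
  unfolding blinfun_of_def
  by (intro Ckp_sum assms(1) Ckp_bounded_linear[OF bounded_linear_rank_one] assms(2))

lemma Ckp_compose:
  fixes f :: "'p::topological_space \<Rightarrow> 'c::euclidean_space \<Rightarrow> 'd::real_normed_vector"
    and g :: "'p \<Rightarrow> 'a::euclidean_space \<Rightarrow> 'c"
  assumes W: "open W" "open W'" and g: "\<And>p x. p \<in> P \<Longrightarrow> x \<in> W \<Longrightarrow> g p x \<in> W'"
  shows "Ckp k P W' f \<Longrightarrow> Ckp k P W g \<Longrightarrow> Ckp k P W (\<lambda>p x. f p (g p x))"
proof (induction k arbitrary: f)
  case 0
  have "continuous_on (P \<times> W) (\<lambda>z. f (fst z) ((\<lambda>(p,x). g p x) z))"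
    by (rule Ckp_cont2[OF 0(1)]) (use 0(2) g in \<open>auto intro!: continuous_intros\<close>)
  then show ?case by (simp add: case_prod_beta)
next
  case (Suc k)
  \<comment> \<open>The chain rule written in a basis: f is differentiated only in fixed directions
    b, the only ones that \<open>Ckp\<close> speaks of, and the moving direction enters through
    scalar factors.\<close>
  let ?D = "\<lambda>p x v. \<Sum>b\<in>Basis. (frechet_derivative (g p) (at x) v \<bullet> b) *\<^sub>R frechet_derivative (f p) (at (g p x)) b"
  show ?case
  proof (rule Ckp_SucI[where D="?D"])
    have "continuous_on (P \<times> W) (\<lambda>z. f (fst z) ((\<lambda>(p,x). g p x) z))"
      by (rule Ckp_cont2[OF Suc.prems(1)]) (use Ckp_cont[OF Suc.prems(2)] g in \<open>auto intro!: continuous_intros\<close>)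
    then show "continuous_on (P \<times> W) (\<lambda>(p,x). f p (g p x))" by (simp add: case_prod_beta)
    show "((\<lambda>x. f p (g p x)) has_derivative ?D p x) (at x)" if px: "p \<in> P" "x \<in> W" for p x
    proof -
      let ?F = "frechet_derivative (f p) (at (g p x))" and ?G = "frechet_derivative (g p) (at x)"
      have F: "(f p has_derivative ?F) (at (g p x))" using Ckp_SucD(1)[OF Suc.prems(1) px(1) g[OF px]] .
      have "?D p x = (\<lambda>v. ?F (?G v))"
        using blinfun_of_linear[OF has_derivative_linear[OF F]] unfolding blinfun_of_apply by metis
      then show ?thesis
        using has_derivative_compose[OF Ckp_SucD(1)[OF Suc.prems(2) px] F] by simp
    qed
    show "Ckp k P W (\<lambda>p x. ?D p x v)" for v
    proof (intro Ckp_sum W bounded_bilinear.Ckp[OF bounded_bilinear_scaleR])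
      fix b :: 'c assume "b \<in> Basis"
      show "Ckp k P W (\<lambda>p x. frechet_derivative (g p) (at x) v \<bullet> b)"
        by (rule Ckp_bounded_linear[OF bounded_linear_inner_left W(1) Ckp_SucD(2)[OF Suc.prems(2)]])
      show "Ckp k P W (\<lambda>p x. frechet_derivative (f p) (at (g p x)) b)"
        by (rule Suc.IH[OF Ckp_SucD(2)[OF Suc.prems(1)] Ckp_Suc_le[OF Suc.prems(2)]])
    qed
  qed (fact W)
qed

lemma Ckp_inverse:
  fixes f :: "'p::topological_space \<Rightarrow> 'a::euclidean_space \<Rightarrow> real"
  assumes "open W" and nz: "\<And>p x. p \<in> P \<Longrightarrow> x \<in> W \<Longrightarrow> f p x \<noteq> 0"
  shows "Ckp k P W f \<Longrightarrow> Ckp k P W (\<lambda>p x. inverse (f p x))"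
proof (induction k)
  case 0
  then show ?case using nz by (auto simp: case_prod_beta intro!: continuous_on_inverse)
next
  case (Suc k)
  have IH: "Ckp k P W (\<lambda>p x. inverse (f p x))" by (rule Suc.IH[OF Ckp_Suc_le[OF Suc.prems]])
  show ?case
  proof (rule Ckp_SucI[where D="\<lambda>p x v. - (inverse (f p x) * frechet_derivative (f p) (at x) v * inverse (f p x))"])
    show "continuous_on (P \<times> W) (\<lambda>(p,x). inverse (f p x))"
      using nz Ckp_cont[OF Suc.prems] by (auto simp: case_prod_beta intro!: continuous_on_inverse)
    show "((\<lambda>x. inverse (f p x)) has_derivative
       (\<lambda>v. - (inverse (f p x) * frechet_derivative (f p) (at x) v * inverse (f p x)))) (at x)"
      if "p \<in> P" "x \<in> W" for p x
      by (rule Deriv.has_derivative_inverse[OF nz[OF that] Ckp_SucD(1)[OF Suc.prems that]])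
    show "Ckp k P W (\<lambda>p x. - (inverse (f p x) * frechet_derivative (f p) (at x) v * inverse (f p x)))" for v
      by (intro Ckp_bounded_linear[OF bounded_linear_minus[OF bounded_linear_ident]] assms(1) IH
           bounded_bilinear.Ckp[OF bounded_bilinear_mult] Ckp_SucD(2)[OF Suc.prems])
  qed (fact assms)
qed

text \<open>The bridge to the notion of smoothness in the statement. In positive order
  \<open>Ck_on\<close> does not repeat continuity, which follows from differentiability; the point p
  makes the parameter set nonempty.\<close>

lemma Ck_on_iff_Ckp: "p \<in> P \<Longrightarrow> Ck_on k W f \<longleftrightarrow> Ckp k P W (\<lambda>_. f)"
proof (induction k arbitrary: f)
  case 0
  have "continuous_on W f" if "continuous_on (P \<times> W) (\<lambda>(p, y). f y)"
    using continuous_on_compose2[OF that, of W "\<lambda>x. (p,x)"] 0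
    by (simp add: continuous_on_Pair continuous_on_id image_subset_iff)
  moreover have "continuous_on (P \<times> W) (\<lambda>(p, y). f y)" if "continuous_on W f"
    unfolding case_prod_beta by (rule continuous_on_compose2[OF that]) (auto intro!: continuous_intros)
  ultimately show ?case by auto
next
  case (Suc k)
  have "continuous_on (P \<times> W) (\<lambda>(p, y). f y)" if d: "\<forall>x\<in>W. f differentiable at x"
  proof -
    have "continuous_on W f"
      by (rule differentiable_imp_continuous_on) (use d in \<open>simp add: differentiable_on_def differentiable_at_withinI\<close>)
    then show ?thesis
      unfolding case_prod_beta by (rule continuous_on_compose2) (auto intro!: continuous_intros)
  qed
  then show ?case using Suc by (auto simp: Ckp.simps(2))
qed

lemma Ckp_joint:
  assumes "T \<times> W \<subseteq> W'" "open W" shows "Ck_on k W' F \<Longrightarrow> Ckp k T W (\<lambda>t x. F (t,x))"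
proof (induction k arbitrary: F)
  case 0
  then show ?case using assms by (auto simp: case_prod_beta elim: continuous_on_subset)
next
  case (Suc k)
  have d: "F differentiable (at (t,x))" if "t \<in> T" "x \<in> W" for t x
    using Suc.prems that assms(1) unfolding Ck_on.simps by blast
  \<comment> \<open>The derivative in x alone is the total derivative in the directions (0,v); in
    the time direction only continuity is kept.\<close>
  show ?case
  proof (rule Ckp_SucI[where D="\<lambda>t x v. frechet_derivative F (at (t,x)) (0,v)"])
    have "continuous_on (T \<times> W) F"
      by (rule differentiable_imp_continuous_on) (use d in \<open>auto simp: differentiable_on_def intro: differentiable_at_withinI\<close>)
    then show "continuous_on (T \<times> W) (\<lambda>(t, x). F (t, x))" by (simp add: case_prod_beta)
    show "((\<lambda>y. F (t, y)) has_derivative (\<lambda>v. frechet_derivative F (at (t, x)) (0, v))) (at x)"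
      if "t \<in> T" "x \<in> W" for t x
    proof -
      have "((\<lambda>y. (t,y)) has_derivative (\<lambda>v. (0,v))) (at x)"
        by (intro has_derivative_Pair has_derivative_const has_derivative_ident)
      from has_derivative_compose[OF this frechet_derivative_works[THEN iffD1, OF d[OF that]]]
      show ?thesis .
    qed
    show "Ckp k T W (\<lambda>t x. frechet_derivative F (at (t, x)) (0, v))" for v
      using Suc.prems by (intro Suc.IH[of "\<lambda>z. frechet_derivative F (at z) (0,v)"]) simp
  qed (fact assms)
qed

text \<open>Caratheodory's form of differentiability: the increment has coefficients K that are
  continuous at x, and replacing them by their values at x costs o(|y - x|). It is applied where the
  increment can be computed exactly.\<close>

lemma has_derivative_factorI:
  fixes f :: "'a::euclidean_space \<Rightarrow> 'b::real_normed_vector"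
  assumes W: "open W" "x \<in> W"
    and eq: "\<And>y. y \<in> W \<Longrightarrow> f y - f x = (\<Sum>b\<in>Basis. ((y - x) \<bullet> b) *\<^sub>R K b y)"
    and K: "\<And>b. b \<in> Basis \<Longrightarrow> isCont (K b) x"
  shows "(f has_derivative (\<lambda>h. \<Sum>b\<in>Basis. (h \<bullet> b) *\<^sub>R K b x)) (at x)"
proof -
  obtain e where e: "e > 0" "ball x e \<subseteq> W" using W open_contains_ball by blast
  have bl: "bounded_linear (\<lambda>h. \<Sum>b\<in>Basis. (h \<bullet> b) *\<^sub>R K b x)"
    using blinfun.bounded_linear_right[of "blinfun_of (\<lambda>b. K b x)"] by (simp add: blinfun_of_apply)
  show ?thesis
  proof (rule has_derivativeI_sandwich[OF e(1) bl, where H="\<lambda>y. \<Sum>b\<in>Basis. norm (K b y - K b x)"])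
    fix y assume y: "y \<noteq> x" "dist y x < e"
    then have "y \<in> W" using e(2) by (auto simp: dist_commute)
    then have "f y - f x - (\<Sum>b\<in>Basis. ((y - x) \<bullet> b) *\<^sub>R K b x) = (\<Sum>b\<in>Basis. ((y - x) \<bullet> b) *\<^sub>R (K b y - K b x))"
      by (simp add: eq sum_subtractf scaleR_diff_right)
    also have "norm \<dots> \<le> (\<Sum>b\<in>Basis. norm (y - x) * norm (K b y - K b x))"
      by (rule sum_norm_le) (simp add: Basis_le_norm mult_right_mono)
    finally show "norm (f y - f x - (\<Sum>b\<in>Basis. ((y - x) \<bullet> b) *\<^sub>R K b x)) / norm (y - x)
        \<le> (\<Sum>b\<in>Basis. norm (K b y - K b x))"
      using y(1) by (simp add: sum_distrib_left[symmetric] divide_le_eq mult.commute)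
  next
    have "((\<lambda>y. \<Sum>b\<in>(Basis::'a set). norm (K b y - K b x)) \<longlongrightarrow> (\<Sum>b\<in>(Basis::'a set). norm (K b x - K b x))) (at x)"
      using K unfolding isCont_def by (intro tendsto_sum tendsto_norm tendsto_diff tendsto_const) auto
    then show "((\<lambda>y. \<Sum>b\<in>(Basis::'a set). norm (K b y - K b x)) \<longlongrightarrow> 0) (at x)" by simp
  qed
qed

lemma continuous_on_integral01:
  fixes g :: "'a::topological_space \<Rightarrow> real \<Rightarrow> 'b::banach"
  assumes "continuous_on (S \<times> {0..1}) (\<lambda>(s,\<theta>). g s \<theta>)"
  shows "continuous_on S (\<lambda>s. integral {0..1} (g s))"
  using integral_continuous_on_param[of S 0 1 g] assms by simp

text \<open>The fundamental theorem of calculus along the segment, with the directional derivative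
  expanded in the standard basis. The coefficients are integrals of derivatives and inherit their
  continuity.\<close>

lemma hadamard:
  fixes f :: "'a::euclidean_space \<Rightarrow> 'b::banach"
  assumes seg: "closed_segment x y \<subseteq> W"
    and D: "\<And>z. z \<in> W \<Longrightarrow> (f has_derivative D z) (at z)"
    and cont: "\<And>v. continuous_on W (\<lambda>z. D z v)"
  shows "f y - f x = (\<Sum>b\<in>Basis. ((y - x) \<bullet> b) *\<^sub>R integral {0..1} (\<lambda>\<theta>. D (x + \<theta> *\<^sub>R (y - x)) b))"
proof -
  have inW: "x + \<theta> *\<^sub>R (y - x) \<in> W" if "\<theta> \<in> {0..1}" for \<theta>
  proof -
    have "x + \<theta> *\<^sub>R (y - x) = (1 - \<theta>) *\<^sub>R x + \<theta> *\<^sub>R y" by (simp add: algebra_simps)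
    then have "x + \<theta> *\<^sub>R (y - x) \<in> closed_segment x y"
      using that unfolding closed_segment_def by force
    then show ?thesis using seg by blast
  qed
  have lin: "D z h = (\<Sum>b\<in>Basis. (h \<bullet> b) *\<^sub>R D z b)" if "z \<in> W" for z h
    using blinfun_of_linear[OF has_derivative_linear[OF D[OF that]], of h] by (simp add: blinfun_of_apply)
  have vd: "((\<lambda>\<theta>. f (x + \<theta> *\<^sub>R (y - x))) has_vector_derivative D (x + \<theta> *\<^sub>R (y - x)) (y - x)) (at \<theta> within {0..1})"
    if "\<theta> \<in> {0..1}" for \<theta>
  proof -
    have a: "((\<lambda>\<theta>. x + \<theta> *\<^sub>R (y - x)) has_derivative (\<lambda>h. h *\<^sub>R (y - x))) (at \<theta> within {0..1})"
      by (auto intro!: derivative_eq_intros)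
    have "((\<lambda>\<theta>. f (x + \<theta> *\<^sub>R (y - x))) has_derivative (\<lambda>h. D (x + \<theta> *\<^sub>R (y - x)) (h *\<^sub>R (y - x)))) (at \<theta> within {0..1})"
      by (rule has_derivative_compose[OF a D[OF inW[OF that]]])
    then show ?thesis
      using has_derivative_linear[OF D[OF inW[OF that]]]
      by (simp add: has_vector_derivative_def linear_cmul)
  qed
  have "((\<lambda>\<theta>. D (x + \<theta> *\<^sub>R (y - x)) (y - x)) has_integral f (x + 1 *\<^sub>R (y - x)) - f (x + 0 *\<^sub>R (y - x))) {0..1}"
    by (rule fundamental_theorem_of_calculus) (auto intro!: vd)
  then have "f y - f x = integral {0..1} (\<lambda>\<theta>. D (x + \<theta> *\<^sub>R (y - x)) (y - x))"
    by (simp add: integral_unique)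
  also have "\<dots> = integral {0..1} (\<lambda>\<theta>. \<Sum>b\<in>Basis. ((y - x) \<bullet> b) *\<^sub>R D (x + \<theta> *\<^sub>R (y - x)) b)"
    by (rule integral_cong) (use lin inW in blast)
  also have "\<dots> = (\<Sum>b\<in>Basis. integral {0..1} (\<lambda>\<theta>. ((y - x) \<bullet> b) *\<^sub>R D (x + \<theta> *\<^sub>R (y - x)) b))"
  proof (rule integral_sum)
    fix b :: 'a
    have "continuous_on {0..1} (\<lambda>\<theta>. D (x + \<theta> *\<^sub>R (y - x)) b)"
      by (rule continuous_on_compose2[OF cont]) (use inW in \<open>auto intro!: continuous_intros\<close>)
    then show "(\<lambda>\<theta>. ((y - x) \<bullet> b) *\<^sub>R D (x + \<theta> *\<^sub>R (y - x)) b) integrable_on {0..1}"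
      by (intro integrable_continuous_interval continuous_intros)
  qed simp
  finally show ?thesis by simp
qed

lemma Ckp_Suc_hadamard:
  fixes f :: "'p::topological_space \<Rightarrow> 'a::euclidean_space \<Rightarrow> 'b::banach"
  assumes f: "Ckp (Suc k) P W f" and "p \<in> P" and seg: "closed_segment x y \<subseteq> W"
  shows "f p y - f p x = (\<Sum>b\<in>Basis. ((y - x) \<bullet> b) *\<^sub>R
     integral {0..1} (\<lambda>\<theta>. frechet_derivative (f p) (at (x + \<theta> *\<^sub>R (y - x))) b))"
proof (rule hadamard[OF seg])
  show "(f p has_derivative frechet_derivative (f p) (at z)) (at z)" if "z \<in> W" for z
    by (rule Ckp_SucD(1)[OF f assms(2) that])
  show "continuous_on W (\<lambda>z. frechet_derivative (f p) (at z) v)" for v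
    by (rule Ckp_cont2[OF Ckp_SucD(2)[OF f], where g="\<lambda>_. p"]) (use assms(2) in \<open>auto intro!: continuous_intros\<close>)
qed

text \<open>Differentiation under the integral sign without a limit theorem: Hadamard's formula in
  the integrand gives the increment of the integral exactly, with continuous coefficients. The
  integration variable counts as part of the continuous parameter.\<close>

lemma Ckp_integral:
  fixes g :: "'p::topological_space \<times> real \<Rightarrow> 'a::euclidean_space \<Rightarrow> 'b::banach"
  assumes W: "open W"
  shows "Ckp k (P \<times> {0..1}) W g \<Longrightarrow> Ckp k P W (\<lambda>p x. integral {0..1} (\<lambda>\<theta>. g (p,\<theta>) x))"
proof (induction k arbitrary: g)
  have cont: "continuous_on (P \<times> W) (\<lambda>(p,x). integral {0..1} (\<lambda>\<theta>. g (p,\<theta>) x))"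
    if "Ckp k (P \<times> {0..1}) W g" for k and g :: "'p \<times> real \<Rightarrow> 'a \<Rightarrow> 'b"
  proof -
    have "continuous_on ((P \<times> W) \<times> {0..1}) (\<lambda>z. g (fst (fst z), snd z) (snd (fst z)))"
      by (rule Ckp_cont2[OF that, where g="\<lambda>z. (fst (fst z), snd z)"]) (auto intro!: continuous_intros)
    then have "continuous_on (P \<times> W) (\<lambda>s. integral {0..1} (\<lambda>\<theta>. g (fst s, \<theta>) (snd s)))"
      by (intro continuous_on_integral01) (simp add: case_prod_beta)
    then show ?thesis by (simp add: case_prod_beta)
  qed
  {
    case 0
    then show ?case using cont[of 0] by simp
  next
    case (Suc k)
    let ?d = "\<lambda>b q x. frechet_derivative (g q) (at x) b"
    let ?D = "\<lambda>p x v. \<Sum>b\<in>Basis. (v \<bullet> b) *\<^sub>R integral {0..1} (\<lambda>\<theta>. ?d b (p,\<theta>) x)"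
    show ?case
    proof (rule Ckp_SucI[where D="?D"])
      show "continuous_on (P \<times> W) (\<lambda>(p,x). integral {0..1} (\<lambda>\<theta>. g (p,\<theta>) x))"
        by (rule cont[OF Suc.prems])
      show "Ckp k P W (\<lambda>p x. ?D p x v)" for v
        by (intro Ckp_sum W bounded_bilinear.Ckp[OF bounded_bilinear_scaleR] Ckp_const continuous_on_const
             Suc.IH Ckp_SucD(2)[OF Suc.prems])
      show "((\<lambda>x. integral {0..1} (\<lambda>\<theta>. g (p,\<theta>) x)) has_derivative ?D p x) (at x)"
        if px: "p \<in> P" "x \<in> W" for p x
      proof -
        obtain r where r: "r > 0" "ball x r \<subseteq> W" using W px open_contains_ball by blast
        \<comment> \<open>The Hadamard coefficients of the integral: \<sigma> runs along the segment
          from x to y, \<theta> over the range of integration. At y = x the inner integrand is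
          constant, which gives \<open>?D\<close>.\<close>
        define K where "K b y = integral {0..1} (\<lambda>\<theta>. integral {0..1} (\<lambda>\<sigma>. ?d b (p,\<theta>) (x + \<sigma> *\<^sub>R (y - x))))" for b y
        have seg: "x + \<sigma> *\<^sub>R (y - x) \<in> W" "closed_segment x y \<subseteq> W" if "y \<in> ball x r" "\<sigma> \<in> {0..1}" for y \<sigma>
        proof -
          have "convex (ball x r)" "x \<in> ball x r" using r by auto
          then have c: "closed_segment x y \<subseteq> ball x r" using that(1) by (simp add: closed_segment_subset)
          then show "closed_segment x y \<subseteq> W" using r by blast
          have "x + \<sigma> *\<^sub>R (y - x) = (1 - \<sigma>) *\<^sub>R x + \<sigma> *\<^sub>R y" by (simp add: algebra_simps)
          then have "x + \<sigma> *\<^sub>R (y - x) \<in> closed_segment x y"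
            using that unfolding closed_segment_def by force
          then show "x + \<sigma> *\<^sub>R (y - x) \<in> W" using c r by blast
        qed
        have c1: "continuous_on ((ball x r \<times> {0..1}) \<times> {0..1}) (\<lambda>z. ?d b (p, snd (fst z)) (x + snd z *\<^sub>R (fst (fst z) - x)))" for b
          by (rule Ckp_cont2[OF Ckp_SucD(2)[OF Suc.prems], where g="\<lambda>z. (p, snd (fst z))"])
            (use seg(1) px in \<open>auto intro!: continuous_intros\<close>)
        then have c2: "continuous_on (ball x r \<times> {0..1}) (\<lambda>s. integral {0..1} (\<lambda>\<sigma>. ?d b (p, snd s) (x + \<sigma> *\<^sub>R (fst s - x))))" for b
          by (intro continuous_on_integral01) (simp add: case_prod_beta)
        then have cK: "continuous_on (ball x r) (K b)" for b
          unfolding K_def by (intro continuous_on_integral01) (simp add: case_prod_beta)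
        have cg: "continuous_on {0..1} (\<lambda>\<theta>. g (p,\<theta>) y)" if "y \<in> W" for y
          by (rule Ckp_cont2[OF Suc.prems, where g="\<lambda>\<theta>. (p,\<theta>)"]) (use px that in \<open>auto intro!: continuous_intros\<close>)
        have "((\<lambda>x. integral {0..1} (\<lambda>\<theta>. g (p,\<theta>) x)) has_derivative (\<lambda>h. \<Sum>b\<in>Basis. (h \<bullet> b) *\<^sub>R K b x)) (at x)"
        proof (rule has_derivative_factorI[of "ball x r"])
          show "isCont (K b) x" for b using cK r by (simp add: continuous_on_eq_continuous_at)
          fix y assume y: "y \<in> ball x r"
          then have "y \<in> W" using r by blast
          then have "integral {0..1} (\<lambda>\<theta>. g (p,\<theta>) y) - integral {0..1} (\<lambda>\<theta>. g (p,\<theta>) x)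
              = integral {0..1} (\<lambda>\<theta>. g (p,\<theta>) y - g (p,\<theta>) x)"
            using cg px by (intro integral_diff[symmetric] integrable_continuous_interval) auto
          also have "\<dots> = integral {0..1} (\<lambda>\<theta>. \<Sum>b\<in>Basis. ((y - x) \<bullet> b) *\<^sub>R
               integral {0..1} (\<lambda>\<sigma>. ?d b (p,\<theta>) (x + \<sigma> *\<^sub>R (y - x))))"
            by (rule integral_cong) (use px in \<open>intro Ckp_Suc_hadamard[OF Suc.prems _ seg(2)[OF y, of 0]], auto\<close>)
          also have "\<dots> = (\<Sum>b\<in>Basis. integral {0..1} (\<lambda>\<theta>. ((y - x) \<bullet> b) *\<^sub>R
               integral {0..1} (\<lambda>\<sigma>. ?d b (p,\<theta>) (x + \<sigma> *\<^sub>R (y - x)))))"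
          proof (rule integral_sum)
            fix b :: 'a
            have "continuous_on {0..1} (\<lambda>\<theta>. integral {0..1} (\<lambda>\<sigma>. ?d b (p,\<theta>) (x + \<sigma> *\<^sub>R (y - x))))"
              using continuous_on_compose2[OF c2[of b], of "{0..1}" "\<lambda>\<theta>. (y,\<theta>)"] y
              by (simp add: continuous_on_Pair continuous_on_id image_subset_iff)
            then show "(\<lambda>\<theta>. ((y - x) \<bullet> b) *\<^sub>R integral {0..1} (\<lambda>\<sigma>. ?d b (p,\<theta>) (x + \<sigma> *\<^sub>R (y - x)))) integrable_on {0..1}"
              by (intro integrable_continuous_interval continuous_intros)
          qed simp
          finally show "integral {0..1} (\<lambda>\<theta>. g (p,\<theta>) y) - integral {0..1} (\<lambda>\<theta>. g (p,\<theta>) x)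
              = (\<Sum>b\<in>Basis. ((y - x) \<bullet> b) *\<^sub>R K b y)"
            by (simp add: K_def)
        qed (use r in auto)
        then show ?thesis by (simp add: K_def)
      qed
    qed (fact W)
  }
qed

subsection \<open>Ordinary differential equations\<close>

text \<open>The integral of \<open>h\<close> from \<open>s\<close> to \<open>t\<close>, pulled back to \<open>[0,1]\<close> so that \<open>t < s\<close> needs no case distinction and
  smooth dependence on \<open>s\<close> and \<open>t\<close> is that of a parameter integral.\<close>

definition SI :: "(real \<Rightarrow> 'b::banach) \<Rightarrow> real \<Rightarrow> real \<Rightarrow> 'b" where
  "SI h s t = (t - s) *\<^sub>R integral {0..1} (\<lambda>\<theta>. h (s + \<theta> * (t - s)))"

lemma SI_same [simp]: "SI h s s = 0"
  by (simp add: SI_def)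

text \<open>The substitution of s + \<theta> (t - s) in the fundamental theorem; the affine map
  covers both orders of s and t, and convexity keeps it in I.\<close>

lemma SI_unique:
  assumes I: "convex I" "s \<in> I" "t \<in> I"
    and X: "\<And>\<tau>. \<tau> \<in> I \<Longrightarrow> (X has_vector_derivative h \<tau>) (at \<tau> within I)"
  shows "X t - X s = SI h s t"
proof -
  have inI: "s + \<theta> * (t - s) \<in> I" if "\<theta> \<in> {0..1}" for \<theta>
  proof -
    have "s + \<theta> * (t - s) = (1 - \<theta>) *\<^sub>R s + \<theta> *\<^sub>R t" by (simp add: algebra_simps)
    then show ?thesis using convexD[OF I, of "1 - \<theta>" \<theta>] that by simp
  qed
  have "((\<lambda>\<theta>. X (s + \<theta> * (t - s))) has_vector_derivative (t - s) *\<^sub>R h (s + \<theta> * (t - s))) (at \<theta> within {0..1})"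
    if "\<theta> \<in> {0..1}" for \<theta>
  proof -
    have "((\<lambda>\<theta>. s + \<theta> * (t - s)) has_vector_derivative (t - s)) (at \<theta> within {0..1})"
      unfolding has_real_derivative_iff_has_vector_derivative[symmetric]
      by (auto intro!: derivative_eq_intros)
    moreover have "(X has_vector_derivative h (s + \<theta> * (t - s))) (at (s + \<theta> * (t - s)) within (\<lambda>\<theta>. s + \<theta> * (t - s)) ` {0..1})"
      by (rule has_vector_derivative_within_subset[OF X[OF inI[OF that]]]) (use inI in blast)
    ultimately show ?thesis using vector_diff_chain_within by (fastforce simp: o_def)
  qed
  then have "((\<lambda>\<theta>. (t - s) *\<^sub>R h (s + \<theta> * (t - s))) has_integral X (s + 1 * (t - s)) - X (s + 0 * (t - s))) {0..1}"
    by (intro fundamental_theorem_of_calculus) auto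
  from integral_unique[OF this] show ?thesis by (simp add: SI_def)
qed

lemma SI_has_vector_derivative:
  assumes "continuous_on UNIV h"
  shows "((\<lambda>t. SI h s t) has_vector_derivative h t) (at t)"
proof -
  \<comment> \<open>An interval with s and t in its interior, whatever their order, so that an
    antiderivative on it has a two-sided derivative at t.\<close>
  define a b where "a = min s t - 1" and "b = max s t + 1"
  have st: "s \<in> {a..b}" "t \<in> {a<..<b}" by (auto simp: a_def b_def)
  obtain g where g: "\<And>x. x \<in> {a..b} \<Longrightarrow> (g has_vector_derivative h x) (at x within {a..b})"
    using antiderivative_continuous[of a b h] continuous_on_subset[OF assms] by auto
  have eq: "g x - g s = SI h s x" if "x \<in> {a<..<b}" for x
    by (rule SI_unique[of "{a..b}"]) (use g st that in auto)
  have "(g has_vector_derivative h t) (at t within {a<..<b})"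
    by (rule has_vector_derivative_within_subset[OF g]) (use st in auto)
  then have "(g has_vector_derivative h t) (at t)"
    using st(2) by (simp add: at_within_open[OF st(2)])
  then have "((\<lambda>x. g x - g s) has_vector_derivative h t) (at t)"
    using has_vector_derivative_diff[OF _ has_vector_derivative_const] by fastforce
  then show ?thesis
    by (rule has_vector_derivative_transform_within_open[where S="{a<..<b}"]) (use st eq in auto)
qed

text \<open>Gronwall's inequality through a weighted maximum. Let m be the maximum of exp(-2L(\<tau>
  - s)) |d|. Integrating |d'| <= L |d| up to a point of maximum bounds |d| there by at most half its
  own value, since the rate 2L in the weight returns the factor 1/2; hence m = 0.\<close>

lemma ode_zero:
  fixes d :: "real \<Rightarrow> 'b::real_normed_vector"
  assumes I: "convex I" "s \<in> I" "t \<in> I" and d0: "d s = 0" and L0: "L \<ge> 0"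
    and d: "\<And>\<tau>. \<tau> \<in> I \<Longrightarrow> (d has_vector_derivative d' \<tau>) (at \<tau> within I)"
    and L: "\<And>\<tau>. \<tau> \<in> I \<Longrightarrow> norm (d' \<tau>) \<le> L * norm (d \<tau>)"
  shows "d t = 0"
proof -
  have fwd: "d t = 0" if I: "{s..t} \<subseteq> I" "s \<le> t" and d0: "d s = 0"
    and d: "\<And>\<tau>. \<tau> \<in> I \<Longrightarrow> (d has_vector_derivative d' \<tau>) (at \<tau> within I)"
    and L: "\<And>\<tau>. \<tau> \<in> I \<Longrightarrow> norm (d' \<tau>) \<le> L * norm (d \<tau>)"
    for d d' :: "real \<Rightarrow> 'b" and s t I
  proof -
    have dst: "(d has_vector_derivative d' \<tau>) (at \<tau> within {s..t})" if "\<tau> \<in> {s..t}" for \<tau>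
      by (rule has_vector_derivative_within_subset[OF d]) (use that I in auto)
    have cd: "continuous_on {s..t} d"
      using dst has_vector_derivative_continuous unfolding continuous_on_eq_continuous_within by blast
    define w where "w \<tau> = exp (- (2 * L * (\<tau> - s))) * norm (d \<tau>)" for \<tau>
    have "continuous_on {s..t} w" unfolding w_def by (intro continuous_intros cd)
    then obtain \<mu> where \<mu>: "\<mu> \<in> {s..t}" "\<And>\<tau>. \<tau> \<in> {s..t} \<Longrightarrow> w \<tau> \<le> w \<mu>"
      using continuous_attains_sup[of "{s..t}" w] I by auto
    define m where "m = w \<mu>"
    have m0: "m \<ge> 0" by (simp add: m_def w_def)
    have bd: "norm (d \<tau>) \<le> m * exp (2 * L * (\<tau> - s))" if "\<tau> \<in> {s..t}" for \<tau>
    proof -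
      have "norm (d \<tau>) = w \<tau> * exp (2 * L * (\<tau> - s))"
        using exp_add[of "- (2 * L * (\<tau> - s))" "2 * L * (\<tau> - s)"] by (simp add: w_def)
      then show ?thesis using \<mu>(2)[OF that] by (simp add: m_def mult_right_mono)
    qed
    have "m \<le> 0"
    proof (cases "\<mu> = s")
      case True then show ?thesis by (simp add: m_def w_def d0)
    next
      case False
      then have lt: "s < \<mu>" using \<mu> by simp
      have "norm (d \<mu> - d s) \<le> m / 2 * exp (2 * L * (\<mu> - s)) - m / 2 * exp (2 * L * (s - s))"
      proof (rule differentiable_bound_general[OF lt, where f'=d' and \<phi>'="\<lambda>\<tau>. L * (m * exp (2 * L * (\<tau> - s)))"])
        show "continuous_on {s..\<mu>} d" by (rule continuous_on_subset[OF cd]) (use \<mu> in auto)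
        show "continuous_on {s..\<mu>} (\<lambda>\<tau>. m / 2 * exp (2 * L * (\<tau> - s)))" by (intro continuous_intros)
        fix \<tau> assume \<tau>: "s < \<tau>" "\<tau> < \<mu>"
        then have i: "\<tau> \<in> {s..t}" using \<mu> by auto
        have "(d has_vector_derivative d' \<tau>) (at \<tau> within {s<..<t})"
          by (rule has_vector_derivative_within_subset[OF dst[OF i]]) auto
        then show "(d has_vector_derivative d' \<tau>) (at \<tau>)"
          using at_within_open[of \<tau> "{s<..<t}"] \<tau> \<mu> by simp
        show "((\<lambda>\<tau>. m / 2 * exp (2 * L * (\<tau> - s))) has_vector_derivative L * (m * exp (2 * L * (\<tau> - s)))) (at \<tau>)"
          unfolding has_real_derivative_iff_has_vector_derivative[symmetric]
          by (auto intro!: derivative_eq_intros)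
        have "norm (d' \<tau>) \<le> L * norm (d \<tau>)" using L[of \<tau>] i I by blast
        also have "\<dots> \<le> L * (m * exp (2 * L * (\<tau> - s)))" by (rule mult_left_mono[OF bd[OF i] L0])
        finally show "norm (d' \<tau>) \<le> L * (m * exp (2 * L * (\<tau> - s)))" .
      qed
      moreover have "norm (d \<mu>) = m * exp (2 * L * (\<mu> - s))"
        using exp_add[of "- (2 * L * (\<mu> - s))" "2 * L * (\<mu> - s)"] by (simp add: m_def w_def)
      ultimately have "m * exp (2 * L * (\<mu> - s)) / 2 + m / 2 \<le> 0" by (simp add: d0)
      then have "m * (exp (2 * L * (\<mu> - s)) + 1) \<le> 0" by (simp add: field_simps)
      moreover have "exp (2 * L * (\<mu> - s)) + 1 > 0" by (simp add: add_pos_pos)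
      ultimately show ?thesis by (simp add: mult_le_0_iff)
    qed
    with bd[of t] I have "norm (d t) \<le> m * exp (2 * L * (t - s))" "m = 0" using m0 by auto
    then show ?thesis by simp
  qed
  show ?thesis
  proof (cases "s \<le> t")
    case True
    have "{s..t} \<subseteq> I" using I closed_segment_subset[OF I(2,3,1)] True by (simp add: closed_segment_eq_real_ivl)
    then show ?thesis by (rule fwd[OF _ True d0 d L])
  next
    case False
    have sub: "{t..s} \<subseteq> I" using I closed_segment_subset[OF I(3,2,1)] False by (simp add: closed_segment_eq_real_ivl)
    \<comment> \<open>Reflecting the time turns t < s into the case already settled; the growth
      bound is symmetric.\<close>
    have "(\<lambda>\<tau>. d (- \<tau>)) (- t) = 0"
    proof (rule fwd[of "- s" "- t" "uminus ` I"])
      show "{- s..- t} \<subseteq> uminus ` I"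
      proof
        fix x assume "x \<in> {- s..- t}"
        then have "- x \<in> I" using sub by auto
        then show "x \<in> uminus ` I" by (metis imageI minus_minus)
      qed
      fix \<tau> assume "\<tau> \<in> uminus ` I"
      then have \<tau>: "- \<tau> \<in> I" by auto
      have "((uminus :: real \<Rightarrow> real) has_vector_derivative - 1) (at \<tau> within uminus ` I)"
        unfolding has_real_derivative_iff_has_vector_derivative[symmetric]
      by (auto intro!: derivative_eq_intros)
      moreover have "(d has_vector_derivative d' (- \<tau>)) (at (- \<tau>) within uminus ` uminus ` I)"
        using d[OF \<tau>] by (simp add: image_comp)
      ultimately show "((\<lambda>\<tau>. d (- \<tau>)) has_vector_derivative - d' (- \<tau>)) (at \<tau> within uminus ` I)"
        using vector_diff_chain_within[of uminus "-1" \<tau> "uminus ` I" d "d' (- \<tau>)"] by (simp add: o_def)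
      show "norm (- d' (- \<tau>)) \<le> L * norm (d (- \<tau>))" using L[OF \<tau>] by simp
    qed (use False d0 in auto)
    then show ?thesis by simp
  qed
qed

lemma ode_unique:
  fixes y z :: "real \<Rightarrow> 'b::real_normed_vector"
  assumes I: "convex I" "s \<in> I" "t \<in> I" and "y s = z s" and L0: "L \<ge> 0"
    and y: "\<And>\<tau>. \<tau> \<in> I \<Longrightarrow> (y has_vector_derivative F \<tau> (y \<tau>)) (at \<tau> within I)"
    and z: "\<And>\<tau>. \<tau> \<in> I \<Longrightarrow> (z has_vector_derivative F \<tau> (z \<tau>)) (at \<tau> within I)"
    and L: "\<And>\<tau>. \<tau> \<in> I \<Longrightarrow> norm (F \<tau> (y \<tau>) - F \<tau> (z \<tau>)) \<le> L * norm (y \<tau> - z \<tau>)"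
  shows "y t = z t"
proof -
  have "(\<lambda>\<tau>. y \<tau> - z \<tau>) t = 0"
    by (rule ode_zero[OF I, where d'="\<lambda>\<tau>. F \<tau> (y \<tau>) - F \<tau> (z \<tau>)" and L=L])
       (use assms in \<open>auto intro!: has_vector_derivative_diff y z L\<close>)
  then show ?thesis by simp
qed

text \<open>The estimate behind the weighted norm in \<open>ode_exists\<close>: an exponential of
  rate 2L integrates to itself divided by 2L, so that a Lipschitz constant L in front leaves the
  factor 1/2.\<close>

lemma SI_norm_le:
  fixes h :: "real \<Rightarrow> 'b::banach"
  assumes cont: "continuous_on UNIV h" and L: "L > 0"
    and bd: "\<And>\<tau>. norm (h \<tau>) \<le> C + K * exp (2 * L * \<bar>\<tau> - s\<bar>)"
  shows "norm (SI h s t) \<le> \<bar>t - s\<bar> * C + K / (2 * L) * (exp (2 * L * \<bar>t - s\<bar>) - 1)"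
proof -
  define r where "r = \<bar>t - s\<bar>"
  have ci: "continuous_on {0..1} (\<lambda>\<theta>. h (s + \<theta> * (t - s)))"
    by (rule continuous_on_compose2[OF cont]) (auto intro!: continuous_intros)
  have i: "((\<lambda>\<theta>. r * (C + K * exp (2 * L * r * \<theta>))) has_integral
      (r * C * 1 + K / (2 * L) * exp (2 * L * r * 1)) - (r * C * 0 + K / (2 * L) * exp (2 * L * r * 0))) {0..1}"
  proof (rule fundamental_theorem_of_calculus)
    fix \<theta> :: real
    show "((\<lambda>\<theta>. r * C * \<theta> + K / (2 * L) * exp (2 * L * r * \<theta>)) has_vector_derivative r * (C + K * exp (2 * L * r * \<theta>))) (at \<theta> within {0..1})"
      unfolding has_real_derivative_iff_has_vector_derivative[symmetric]
      using L by (auto intro!: derivative_eq_intros simp: field_simps)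
  qed simp
  have "SI h s t = integral {0..1} (\<lambda>\<theta>. (t - s) *\<^sub>R h (s + \<theta> * (t - s)))" by (simp add: SI_def)
  also have "norm \<dots> \<le> integral {0..1} (\<lambda>\<theta>. r * (C + K * exp (2 * L * r * \<theta>)))"
  proof (rule integral_norm_bound_integral)
    show "(\<lambda>\<theta>. (t - s) *\<^sub>R h (s + \<theta> * (t - s))) integrable_on {0..1}"
      by (intro integrable_continuous_interval continuous_on_scaleR continuous_on_const ci)
    show "(\<lambda>\<theta>. r * (C + K * exp (2 * L * r * \<theta>))) integrable_on {0..1}" using i by blast
    fix \<theta> :: real assume \<theta>: "\<theta> \<in> {0..1}"
    have "\<bar>(s + \<theta> * (t - s)) - s\<bar> = r * \<theta>" using \<theta> by (simp add: r_def abs_mult)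
    then have "norm (h (s + \<theta> * (t - s))) \<le> C + K * exp (2 * L * (r * \<theta>))" using bd[of "s + \<theta> * (t - s)"] by simp
    then show "norm ((t - s) *\<^sub>R h (s + \<theta> * (t - s))) \<le> r * (C + K * exp (2 * L * r * \<theta>))"
      by (simp add: r_def mult_left_mono mult.assoc)
  qed
  also have "\<dots> = r * C + K / (2 * L) * (exp (2 * L * r) - 1)"
    using integral_unique[OF i] by (simp add: algebra_simps)
  finally show ?thesis by (simp add: r_def)
qed

lemma continuous_on_SI:
  fixes h :: "'a::topological_space \<Rightarrow> real \<Rightarrow> 'b::banach"
  assumes "continuous_on S s" "continuous_on S t"
    and "continuous_on (S \<times> {0..1}) (\<lambda>z. h (fst z) (s (fst z) + snd z * (t (fst z) - s (fst z))))"
  shows "continuous_on S (\<lambda>z. SI (h z) (s z) (t z))"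
  unfolding SI_def
  by (intro continuous_on_scaleR continuous_on_diff assms continuous_on_integral01)
     (use assms(3) in \<open>simp add: case_prod_beta\<close>)

text \<open>Banach's fixed point theorem with Bielecki's exponential weight, in one space of bounded
  continuous functions of initial time, time and parameter together. A single fixed point yields
  solutions for all times and their joint continuity at once, with no patching of short
  intervals.\<close>

lemma ode_exists:
  fixes F :: "real \<Rightarrow> 'p::metric_space \<Rightarrow> 'b::banach \<Rightarrow> 'b" and \<xi> :: "'p \<Rightarrow> 'b"
  assumes contF: "continuous_on UNIV (\<lambda>z. F (fst z) (fst (snd z)) (snd (snd z)))"
    and Lip: "\<And>t p y z. norm (F t p y - F t p z) \<le> L * norm (y - z)" and L: "L > 0"
    and bd: "\<And>t p. norm (F t p (\<xi> p)) \<le> C"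
    and contx: "continuous_on UNIV \<xi>"
  obtains X where "continuous_on UNIV (\<lambda>z. X (fst z) (fst (snd z)) (snd (snd z)))"
    "\<And>s p. X s s p = \<xi> p"
    "\<And>s t p. ((\<lambda>t. X s t p) has_vector_derivative F t p (X s t p)) (at t)"
proof -
  define E where "E r = exp (2 * L * \<bar>r\<bar>)" for r :: real
  have E1: "E r \<ge> 1" for r using L by (simp add: E_def)
  have E0: "E r > 0" for r by (simp add: E_def)
  have contE: "continuous_on S E" for S unfolding E_def by (intro continuous_intros)
  \<comment> \<open>The unknown u is (X - \<xi>) / E. Subtracting \<xi> admits unbounded initial
    values, such as the identity for a flow, and dividing by E absorbs the exponential growth of
    solutions.\<close>
  define h where "h u s p \<tau> = F \<tau> p (\<xi> p + E (\<tau> - s) *\<^sub>R apply_bcontfun u (s,\<tau>,p))"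
    for u :: "(real \<times> real \<times> 'p) \<Rightarrow>\<^sub>C 'b" and s p \<tau>
  define G where "G u z = (1 / E (fst (snd z) - fst z)) *\<^sub>R SI (h u (fst z) (snd (snd z))) (fst z) (fst (snd z))"
    for u :: "(real \<times> real \<times> 'p) \<Rightarrow>\<^sub>C 'b" and z
  have conth: "continuous_on S (\<lambda>z. h u (s z) (p z) (\<tau> z))"
    if "continuous_on S s" "continuous_on S p" "continuous_on S \<tau>" for u and S :: "'q::topological_space set" and s p \<tau>
  proof -
    have "continuous_on S (\<lambda>z. apply_bcontfun u (s z, \<tau> z, p z))"
      by (rule continuous_on_compose2[OF continuous_on_apply_bcontfun[of UNIV u]]) (intro continuous_on_Pair that, simp)
    then have "continuous_on S (\<lambda>z. (\<tau> z, p z, \<xi> (p z) + E (\<tau> z - s z) *\<^sub>R apply_bcontfun u (s z, \<tau> z, p z)))"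
      by (intro continuous_on_Pair continuous_on_add continuous_on_scaleR that
          continuous_on_compose2[OF contx that(2)] continuous_on_compose2[OF contE[of UNIV] continuous_on_diff[OF that(3,1)]]) auto
    from continuous_on_compose2[OF contF this] show ?thesis by (simp add: h_def)
  qed
  have conth1: "continuous_on UNIV (h u s p)" for u s p
    by (rule conth) (intro continuous_intros)+
  have nh: "norm (h u s p \<tau>) \<le> C + (L * norm u) * exp (2 * L * \<bar>\<tau> - s\<bar>)" for u s p \<tau>
  proof -
    have "norm (h u s p \<tau>) \<le> norm (F \<tau> p (\<xi> p)) + norm (h u s p \<tau> - F \<tau> p (\<xi> p))"
      by (metis add.commute diff_add_cancel norm_triangle_ineq)
    also have "\<dots> \<le> C + L * norm (E (\<tau> - s) *\<^sub>R apply_bcontfun u (s,\<tau>,p))"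
      using Lip[of \<tau> p "\<xi> p + E (\<tau> - s) *\<^sub>R apply_bcontfun u (s,\<tau>,p)" "\<xi> p"] bd[of \<tau> p]
      by (simp add: h_def)
    also have "\<dots> \<le> C + L * (E (\<tau> - s) * norm u)"
      using L E0[of "\<tau> - s"] norm_bounded[of u "(s,\<tau>,p)"] by (simp add: mult_left_mono)
    finally show ?thesis by (simp add: E_def mult_ac)
  qed
  have Gb: "G u \<in> bcontfun" for u
  proof (rule bcontfun_normI)
    show "continuous_on UNIV (G u)"
      unfolding G_def
    proof (intro continuous_on_scaleR continuous_on_SI continuous_intros conth)
      show "continuous_on UNIV (\<lambda>x::real \<times> real \<times> 'p. E (fst (snd x) - fst x))"
        by (rule continuous_on_compose2[OF contE[of UNIV]]) (auto intro!: continuous_intros)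
      show "\<forall>x::real \<times> real \<times> 'p\<in>UNIV. E (fst (snd x) - fst x) \<noteq> 0" using E0 by (metis less_irrefl)
    qed
    fix z :: "real \<times> real \<times> 'p"
    obtain s t p where z: "z = (s,t,p)" by (cases z) auto
    define r where "r = \<bar>t - s\<bar>"
    \<comment> \<open>The constant part C of the bound contributes a term linear in |t - s|, which
      the weight dominates as well: r / E r is at most 1/(2L).\<close>
    have "2 * L * r \<le> exp (2 * L * r)" using exp_ge_add_one_self[of "2 * L * r"] by linarith
    then have "2 * L * r \<le> E r" by (simp add: E_def r_def)
    then have r: "r / E r \<le> 1 / (2 * L)" using L E0[of r] by (simp add: field_simps)
    have Er: "E (t - s) = E r" by (simp add: E_def r_def)
    have C0: "C \<ge> 0" using bd[of 0 p] norm_ge_zero order_trans by blast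
    have "norm (G u z) \<le> (1 / E r) * (r * C + (L * norm u) / (2 * L) * (exp (2 * L * r) - 1))"
      using SI_norm_le[OF conth1 L nh, of u s p t] E0[of r]
      by (simp add: G_def z Er r_def[symmetric] divide_right_mono)
    also have "\<dots> = (r / E r) * C + norm u / 2 * ((E r - 1) / E r)"
      using L E0[of r] by (simp add: E_def r_def field_simps)
    also have "\<dots> \<le> 1 / (2 * L) * C + norm u / 2 * 1"
      using E0[of r] by (intro add_mono mult_right_mono mult_left_mono r C0) auto
    finally show "norm (G u z) \<le> 1 / (2 * L) * C + norm u / 2 * 1" .
  qed
  have "\<exists>!u. Bcontfun (G u) = u"
  proof (rule banach_fix_type[where c="1/2" and f="\<lambda>u. Bcontfun (G u)"])
    show "\<forall>u w. dist (Bcontfun (G u)) (Bcontfun (G w)) \<le> 1 / 2 * dist u w"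
    proof (intro allI dist_bound)
      fix u w and z :: "real \<times> real \<times> 'p"
      obtain s t p where z: "z = (s,t,p)" by (cases z) auto
      have n: "norm (h u s p \<tau> - h w s p \<tau>) \<le> 0 + (L * norm (u - w)) * exp (2 * L * \<bar>\<tau> - s\<bar>)" for \<tau>
      proof -
        have "norm (h u s p \<tau> - h w s p \<tau>) \<le> L * norm (E (\<tau> - s) *\<^sub>R (apply_bcontfun (u - w) (s,\<tau>,p)))"
          using Lip[of \<tau> p "\<xi> p + E (\<tau> - s) *\<^sub>R apply_bcontfun u (s,\<tau>,p)" "\<xi> p + E (\<tau> - s) *\<^sub>R apply_bcontfun w (s,\<tau>,p)"]
          by (simp add: h_def scaleR_diff_right)
        also have "\<dots> \<le> L * (E (\<tau> - s) * norm (u - w))"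
          using L E0[of "\<tau> - s"] norm_bounded[of "u - w" "(s,\<tau>,p)"] by (simp add: mult_left_mono)
        finally show ?thesis by (simp add: E_def mult_ac)
      qed
      have SId: "SI (h u s p) s t - SI (h w s p) s t = SI (\<lambda>\<tau>. h u s p \<tau> - h w s p \<tau>) s t"
      proof -
        have i: "(\<lambda>\<theta>. h v s p (s + \<theta> * (t - s))) integrable_on {0..1}" for v
          by (intro integrable_continuous_interval continuous_on_compose2[OF conth1[of v s p]] continuous_intros) auto
        show ?thesis unfolding SI_def by (simp add: integral_diff[OF i i] scaleR_diff_right)
      qed
      have "dist (G u z) (G w z) = norm ((1 / E (t - s)) *\<^sub>R SI (\<lambda>\<tau>. h u s p \<tau> - h w s p \<tau>) s t)"
        by (simp add: dist_norm G_def z SId[symmetric] scaleR_diff_right)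
      also have "\<dots> \<le> (1 / E (t - s)) * (\<bar>t - s\<bar> * 0 + (L * norm (u - w)) / (2 * L) * (exp (2 * L * \<bar>t - s\<bar>) - 1))"
        using SI_norm_le[OF continuous_on_diff[OF conth1[of u s p] conth1[of w s p]] L n, of t] E0[of "t - s"]
        by (simp add: divide_right_mono)
      also have "\<dots> = norm (u - w) / 2 * ((E (t - s) - 1) / E (t - s))"
        using L E0[of "t - s"] by (simp add: E_def field_simps)
      also have "\<dots> \<le> norm (u - w) / 2 * 1"
        using E0[of "t - s"] by (intro mult_left_mono) auto
      finally show "dist (apply_bcontfun (Bcontfun (G u)) z) (apply_bcontfun (Bcontfun (G w)) z) \<le> 1 / 2 * dist u w"
        by (simp add: Bcontfun_inverse[OF Gb] dist_norm)
    qed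
  qed auto
  then obtain u where u: "Bcontfun (G u) = u" by blast
  have uG: "apply_bcontfun u z = G u z" for z using Bcontfun_inverse[OF Gb[of u]] u by simp
  define X where "X s t p = \<xi> p + E (t - s) *\<^sub>R apply_bcontfun u (s,t,p)" for s t p
  have X: "X s t p = \<xi> p + SI (\<lambda>\<tau>. F \<tau> p (X s \<tau> p)) s t" for s t p
  proof -
    have "E (t - s) *\<^sub>R apply_bcontfun u (s,t,p) = SI (h u s p) s t"
      using E0[of "t - s"] by (simp add: uG G_def)
    moreover have "h u s p = (\<lambda>\<tau>. F \<tau> p (X s \<tau> p))" by (simp add: h_def X_def fun_eq_iff)
    ultimately show ?thesis by (simp add: X_def)
  qed
  have c1: "continuous_on UNIV (\<lambda>z::real \<times> real \<times> 'p. E (fst (snd z) - fst z))"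
    by (rule continuous_on_compose2[OF contE[of UNIV]]) (auto intro!: continuous_intros)
  have c2: "continuous_on UNIV (\<lambda>z::real \<times> real \<times> 'p. \<xi> (snd (snd z)))"
    by (rule continuous_on_compose2[OF contx]) (auto intro!: continuous_intros)
  have contX: "continuous_on UNIV (\<lambda>z. X (fst z) (fst (snd z)) (snd (snd z)))"
    unfolding X_def using c1 c2 by (auto intro!: continuous_on_add continuous_on_scaleR)
  show ?thesis
  proof (rule that[OF contX])
    show "X s s p = \<xi> p" for s p by (subst X) simp
    show "((\<lambda>t. X s t p) has_vector_derivative F t p (X s t p)) (at t)" for s t p
    proof -
      have "continuous_on UNIV (\<lambda>\<tau>. F \<tau> p (X s \<tau> p))"
        using conth1[of u s p] by (simp add: h_def X_def)
      from has_vector_derivative_add[OF has_vector_derivative_const[of "\<xi> p"] SI_has_vector_derivative[OF this, of s t]]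
      show ?thesis unfolding X[of s _ p, symmetric] by simp
    qed
  qed
qed

lemma norm_blinfun_of_le:
  fixes f :: "'a::euclidean_space \<Rightarrow> 'b::real_normed_vector"
  shows "norm (blinfun_of f) \<le> (\<Sum>b\<in>Basis. norm (f b))"
proof (rule norm_blinfun_bound)
  show "norm (blinfun_apply (blinfun_of f) x) \<le> (\<Sum>b\<in>Basis. norm (f b)) * norm x" for x
    unfolding blinfun_of_apply sum_distrib_right
  proof (rule sum_norm_le)
    fix b :: 'a assume "b \<in> Basis"
    then show "norm ((x \<bullet> b) *\<^sub>R f b) \<le> norm (f b) * norm x"
      by (simp add: Basis_le_norm mult_right_mono mult.commute[of "norm (f b)"])
  qed
qed (simp add: sum_nonneg)

section \<open>Linear equations for operators and their dependence on the point\<close>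

lemmas blinfun_compose_diff_left = bounded_bilinear.diff_left[OF bounded_bilinear_blinfun_compose]
  and blinfun_compose_diff_right = bounded_bilinear.diff_right[OF bounded_bilinear_blinfun_compose]
  and blinfun_compose_minus_left = bounded_bilinear.minus_left[OF bounded_bilinear_blinfun_compose]
  and blinfun_compose_minus_right = bounded_bilinear.minus_right[OF bounded_bilinear_blinfun_compose]
  and blinfun_compose_scaleR_left = bounded_bilinear.scaleR_left[OF bounded_bilinear_blinfun_compose]
  and blinfun_compose_scaleR_right = bounded_bilinear.scaleR_right[OF bounded_bilinear_blinfun_compose]
  and blinfun_compose_sum_left = bounded_bilinear.sum_left[OF bounded_bilinear_blinfun_compose]
  and blinfun_compose_sum_right = bounded_bilinear.sum_right[OF bounded_bilinear_blinfun_compose]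

lemma blinfun_compose_assoc: "(A o\<^sub>L B) o\<^sub>L C = A o\<^sub>L (B o\<^sub>L C)"
  by (rule blinfun_eqI) simp

lemma blinfun_compose_id [simp]: "id_blinfun o\<^sub>L A = A" "A o\<^sub>L id_blinfun = A"
  by (rule blinfun_eqI, simp)+

lemma blinfun_compose_vd:
  fixes A :: "real \<Rightarrow> 'b::real_normed_vector \<Rightarrow>\<^sub>L 'c::real_normed_vector" and B :: "real \<Rightarrow> 'a::real_normed_vector \<Rightarrow>\<^sub>L 'b"
  assumes "(A has_vector_derivative A') (at t within S)" "(B has_vector_derivative B') (at t within S)"
  shows "((\<lambda>t. A t o\<^sub>L B t) has_vector_derivative (A t o\<^sub>L B') + (A' o\<^sub>L B t)) (at t within S)"
  by (rule bounded_bilinear.has_vector_derivative[OF bounded_bilinear_blinfun_compose assms])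

lemma linear_ode_exists:
  fixes M :: "real \<Rightarrow> 'p::metric_space \<Rightarrow> 'h::banach \<Rightarrow>\<^sub>L 'h"
  assumes cont: "continuous_on UNIV (\<lambda>z. M (fst z) (snd z))" and bd: "\<And>t p. norm (M t p) \<le> C"
  obtains U V where "continuous_on UNIV (\<lambda>z. U (fst z) (fst (snd z)) (snd (snd z)))"
    "continuous_on UNIV (\<lambda>z. V (fst z) (fst (snd z)) (snd (snd z)))"
    "\<And>s p. U s s p = id_blinfun" "\<And>s p. V s s p = id_blinfun"
    "\<And>s t p. ((\<lambda>t. U s t p) has_vector_derivative (M t p o\<^sub>L U s t p)) (at t)"
    "\<And>s t p. ((\<lambda>t. V s t p) has_vector_derivative - (V s t p o\<^sub>L M t p)) (at t)"
    "\<And>s t p. V s t p o\<^sub>L U s t p = id_blinfun" "\<And>s t p. U s t p o\<^sub>L V s t p = id_blinfun"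
proof -
  define D where "D = \<bar>C\<bar> + 1"
  have D: "D > 0" "norm (M t p) \<le> D" for t p using bd[of t p] by (auto simp: D_def)
  have cM: "continuous_on UNIV (\<lambda>z. M (fst z) (fst (snd z)))"
    by (rule continuous_on_compose2[OF cont, of _ "\<lambda>z. (fst z, fst (snd z))", simplified]) (intro continuous_intros)
  have bdD: "norm (M t p o\<^sub>L Y) \<le> D * norm Y" "norm (Y o\<^sub>L M t p) \<le> D * norm Y" for t p and Y :: "'h \<Rightarrow>\<^sub>L 'h"
    using norm_blinfun_compose[of "M t p" Y] norm_blinfun_compose[of Y "M t p"] mult_right_mono[OF D(2)[of t p] norm_ge_zero[of Y]]
    by (auto simp: mult.commute)
  have cU: "continuous_on UNIV (\<lambda>z. M (fst z) (fst (snd z)) o\<^sub>L snd (snd z))"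
    and cV: "continuous_on UNIV (\<lambda>z. - (snd (snd z) o\<^sub>L M (fst z) (fst (snd z))))"
    by (intro continuous_on_minus bounded_bilinear.continuous_on[OF bounded_bilinear_blinfun_compose] cM continuous_intros)+
  have lU: "norm ((M t p o\<^sub>L y) - (M t p o\<^sub>L z)) \<le> D * norm (y - z)" for t p and y z :: "'h \<Rightarrow>\<^sub>L 'h"
    using bdD(1)[of t p "y - z"] by (simp add: blinfun_compose_diff_right)
  have lV: "norm (- (y o\<^sub>L M t p) - - (z o\<^sub>L M t p)) \<le> D * norm (y - z)" for t p and y z :: "'h \<Rightarrow>\<^sub>L 'h"
    using bdD(2)[of "z - y" t p] by (simp add: blinfun_compose_diff_left norm_minus_commute)
  have bU: "norm (M t p o\<^sub>L id_blinfun) \<le> D" and bV: "norm (- (id_blinfun o\<^sub>L M t p)) \<le> D" for t p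
    using D(2) by simp_all
  obtain U where U: "continuous_on UNIV (\<lambda>z. U (fst z) (fst (snd z)) (snd (snd z)))"
    "\<And>s p. U s s p = id_blinfun"
    "\<And>s t p. ((\<lambda>t. U s t p) has_vector_derivative (M t p o\<^sub>L U s t p)) (at t)"
    by (rule ode_exists[OF cU lU D(1) bU continuous_on_const], rule that)
  obtain V where V: "continuous_on UNIV (\<lambda>z. V (fst z) (fst (snd z)) (snd (snd z)))"
    "\<And>s p. V s s p = id_blinfun"
    "\<And>s t p. ((\<lambda>t. V s t p) has_vector_derivative - (V s t p o\<^sub>L M t p)) (at t)"
    by (rule ode_exists[OF cV lV D(1) bV continuous_on_const], rule that)
  have VU: "V s t p o\<^sub>L U s t p = id_blinfun" for s t p
  proof -
    have "(V s t p o\<^sub>L U s t p) - id_blinfun = 0"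
    proof (rule ode_zero[of UNIV s t "\<lambda>t. (V s t p o\<^sub>L U s t p) - id_blinfun" 0 "\<lambda>_. 0"])
      show "((\<lambda>t. (V s t p o\<^sub>L U s t p) - id_blinfun) has_vector_derivative 0) (at \<tau>)" for \<tau>
        using has_vector_derivative_diff[OF blinfun_compose_vd[OF V(3)[of s p \<tau>] U(3)[of s p \<tau>]] has_vector_derivative_const[of id_blinfun]]
        by (simp add: blinfun_compose_minus_left blinfun_compose_assoc)
    qed (simp_all add: U(2) V(2))
    then show ?thesis by simp
  qed
  have UV: "U s t p o\<^sub>L V s t p = id_blinfun" for s t p
  proof -
    \<comment> \<open>On an infinite-dimensional space a left inverse need not be a right inverse.
      The defect Z of U V satisfies the homogeneous equation Z' = M Z - Z M and starts at 0.\<close>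
    define Z where "Z t = (U s t p o\<^sub>L V s t p) - id_blinfun" for t
    have "Z t = 0"
    proof (rule ode_zero[of UNIV s t Z "2 * D" "\<lambda>t. (M t p o\<^sub>L Z t) - (Z t o\<^sub>L M t p)"])
      show "(Z has_vector_derivative (M \<tau> p o\<^sub>L Z \<tau>) - (Z \<tau> o\<^sub>L M \<tau> p)) (at \<tau>)" for \<tau>
        unfolding Z_def
        using has_vector_derivative_diff[OF blinfun_compose_vd[OF U(3)[of s p \<tau>] V(3)[of s p \<tau>]] has_vector_derivative_const[of id_blinfun]]
        by (simp add: blinfun_compose_minus_right blinfun_compose_assoc blinfun_compose_diff_left blinfun_compose_diff_right)
      show "norm ((M \<tau> p o\<^sub>L Z \<tau>) - (Z \<tau> o\<^sub>L M \<tau> p)) \<le> 2 * D * norm (Z \<tau>)" for \<tau>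
        using norm_triangle_ineq4[of "M \<tau> p o\<^sub>L Z \<tau>" "Z \<tau> o\<^sub>L M \<tau> p"] bdD(1)[of \<tau> p "Z \<tau>"] bdD(2)[of "Z \<tau>" \<tau> p] by auto
    qed (use D(1) in \<open>simp_all add: U(2) V(2) Z_def\<close>)
    then show ?thesis by (simp add: Z_def)
  qed
  show ?thesis by (rule that[OF U(1) V(1) U(2) V(2) U(3) V(3) VU UV])
qed

lemma SI_sum:
  fixes h :: "'i \<Rightarrow> real \<Rightarrow> 'b::banach"
  assumes "\<And>i. i \<in> I \<Longrightarrow> continuous_on UNIV (h i)"
  shows "SI (\<lambda>\<tau>. \<Sum>i\<in>I. c i *\<^sub>R h i \<tau>) s t = (\<Sum>i\<in>I. c i *\<^sub>R SI (h i) s t)"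
proof (cases "finite I")
  case True
  have "integral {0..1} (\<lambda>\<theta>. \<Sum>i\<in>I. c i *\<^sub>R h i (s + \<theta> * (t - s))) =
      (\<Sum>i\<in>I. integral {0..1} (\<lambda>\<theta>. c i *\<^sub>R h i (s + \<theta> * (t - s))))"
    by (rule integral_sum[OF True])
       (intro integrable_continuous_interval continuous_on_scaleR continuous_on_const
         continuous_on_compose2[OF assms] continuous_intros, auto)
  then show ?thesis by (simp add: SI_def scaleR_sum_right mult.commute)
qed (simp add: SI_def)

lemma Ckp_SI:
  fixes h :: "real \<times> real \<Rightarrow> 'a::euclidean_space \<Rightarrow> 'b::banach"
  assumes "open W" "Ckp k UNIV W h"
  shows "Ckp k UNIV W (\<lambda>q x. SI (\<lambda>\<tau>. h (fst q, \<tau>) x) (fst q) (snd q))"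
proof -
  have "Ckp k (UNIV \<times> {0..1}) W (\<lambda>r x. h (fst (fst r), fst (fst r) + snd r * (snd (fst r) - fst (fst r))) x)"
    by (rule Ckp_reparam[OF _ _ assms]) (auto intro!: continuous_intros)
  from Ckp_integral[OF assms(1) this]
  have "Ckp k UNIV W (\<lambda>q x. integral {0..1} (\<lambda>\<theta>. h (fst q, fst q + \<theta> * (snd q - fst q)) x))" by simp
  then show ?thesis unfolding SI_def
    by (intro bounded_bilinear.Ckp[OF bounded_bilinear_scaleR] Ckp_const assms(1)) (auto intro!: continuous_intros)
qed

lemma blinfun_expand: "blinfun_apply F h = (\<Sum>b\<in>Basis. (h \<bullet> b) *\<^sub>R blinfun_apply F b)"
  using blinfun_of_apply[of "blinfun_apply F" h] by (simp add: blinfun_of_blinfun)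

text \<open>\<open>U\<close> is the resolvent of \<open>y' = M y\<close> and \<open>V\<close> its inverse, which solves the adjoint equation; with
  \<open>V\<close> at hand the derivative of \<open>U\<close> in the point is given by variation of constants.\<close>

locale lin_ode =
  fixes M U V :: "real \<Rightarrow> real \<Rightarrow> 'e::euclidean_space \<Rightarrow> ('h::banach \<Rightarrow>\<^sub>L 'h)"
  assumes U0: "\<And>s x. U s s x = id_blinfun" and V0: "\<And>s x. V s s x = id_blinfun"
    and U': "\<And>s t x. ((\<lambda>t. U s t x) has_vector_derivative (M s t x o\<^sub>L U s t x)) (at t)"
    and V': "\<And>s t x. ((\<lambda>t. V s t x) has_vector_derivative - (V s t x o\<^sub>L M s t x)) (at t)"
    and VU: "\<And>s t x. V s t x o\<^sub>L U s t x = id_blinfun" and UV: "\<And>s t x. U s t x o\<^sub>L V s t x = id_blinfun"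
    and cU: "Ckp 0 UNIV UNIV (\<lambda>q. U (fst q) (snd q))" and cV: "Ckp 0 UNIV UNIV (\<lambda>q. V (fst q) (snd q))"
begin

text \<open>In the derivative of V at x composed with U at y only the difference of M survives;
  integrate and multiply by U at x. The formula is exact, so Hadamard's formula for M passes to
  U.\<close>

lemma U_diff:
  "U s t y - U s t x = U s t x o\<^sub>L SI (\<lambda>\<tau>. V s \<tau> x o\<^sub>L ((M s \<tau> y - M s \<tau> x) o\<^sub>L U s \<tau> y)) s t"
proof -
  have "((\<lambda>\<tau>. V s \<tau> x o\<^sub>L U s \<tau> y) has_vector_derivative V s \<tau> x o\<^sub>L ((M s \<tau> y - M s \<tau> x) o\<^sub>L U s \<tau> y)) (at \<tau>)" for \<tau>
    using blinfun_compose_vd[OF V'[of s x \<tau>] U'[of s y \<tau>]]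
    by (simp add: blinfun_compose_minus_left blinfun_compose_diff_left blinfun_compose_diff_right blinfun_compose_assoc)
  then have "(V s t x o\<^sub>L U s t y) - (V s s x o\<^sub>L U s s y) = SI (\<lambda>\<tau>. V s \<tau> x o\<^sub>L ((M s \<tau> y - M s \<tau> x) o\<^sub>L U s \<tau> y)) s t"
    by (intro SI_unique[of UNIV]) simp_all
  then have "U s t x o\<^sub>L ((V s t x o\<^sub>L U s t y) - id_blinfun) = U s t x o\<^sub>L SI (\<lambda>\<tau>. V s \<tau> x o\<^sub>L ((M s \<tau> y - M s \<tau> x) o\<^sub>L U s \<tau> y)) s t"
    by (simp add: U0 V0)
  then show ?thesis
    by (simp add: blinfun_compose_diff_right blinfun_compose_assoc[symmetric] UV)
qed

definition DM :: "real \<Rightarrow> real \<Rightarrow> 'e \<Rightarrow> 'e \<Rightarrow> 'h \<Rightarrow>\<^sub>L 'h" where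
  "DM s t x v = frechet_derivative (M s t) (at x) v"

text \<open>Duhamel's formula, the first-order part of \<open>U_diff\<close>.\<close>

definition DU :: "real \<Rightarrow> real \<Rightarrow> 'e \<Rightarrow> 'e \<Rightarrow> 'h \<Rightarrow>\<^sub>L 'h" where
  "DU s t x v = U s t x o\<^sub>L SI (\<lambda>\<tau>. V s \<tau> x o\<^sub>L (DM s \<tau> x v o\<^sub>L U s \<tau> x)) s t"

definition DV :: "real \<Rightarrow> real \<Rightarrow> 'e \<Rightarrow> 'e \<Rightarrow> 'h \<Rightarrow>\<^sub>L 'h" where
  "DV s t x v = - (V s t x o\<^sub>L (DU s t x v o\<^sub>L V s t x))"

lemma cont_U: "continuous_on S f \<Longrightarrow> continuous_on S g \<Longrightarrow> continuous_on S h \<Longrightarrow> continuous_on S (\<lambda>z. U (f z) (g z) (h z))"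
  using Ckp_cont2[OF cU, of S "\<lambda>z. (f z, g z)" h] by (simp add: continuous_on_Pair)

lemma cont_V: "continuous_on S f \<Longrightarrow> continuous_on S g \<Longrightarrow> continuous_on S h \<Longrightarrow> continuous_on S (\<lambda>z. V (f z) (g z) (h z))"
  using Ckp_cont2[OF cV, of S "\<lambda>z. (f z, g z)" h] by (simp add: continuous_on_Pair)

lemmas continuous_on_bcomp = bounded_bilinear.continuous_on[OF bounded_bilinear_blinfun_compose]

text \<open>Hadamard's formula for M, inserted into \<open>U_diff\<close>, writes the increment of U
  with continuous coefficients K, whose values at y = x assemble to \<open>DU\<close>.\<close>

lemma has_derivative_UV:
  assumes M: "Ckp (Suc k) UNIV UNIV (\<lambda>q. M (fst q) (snd q))"
  shows "(U s t has_derivative DU s t x) (at x)" "(V s t has_derivative DV s t x) (at x)"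
proof -
  have cDM: "continuous_on S (\<lambda>z. DM (f z) (g z) (h z) v)"
    if "continuous_on S f" "continuous_on S g" "continuous_on S h" for S :: "'q::topological_space set" and f g h v
    unfolding DM_def using Ckp_cont2[OF Ckp_SucD(2)[OF M, of v], of S "\<lambda>z. (f z, g z)" h] that
    by (simp add: continuous_on_Pair)
  define H where "H b \<tau> y = integral {0..1} (\<lambda>\<theta>. DM s \<tau> (x + \<theta> *\<^sub>R (y - x)) b)" for b \<tau> y
  have Md: "M s \<tau> y - M s \<tau> x = (\<Sum>b\<in>Basis. ((y - x) \<bullet> b) *\<^sub>R H b \<tau> y)" for \<tau> y
    using Ckp_Suc_hadamard[OF M, of "(s,\<tau>)" x y] by (simp add: H_def DM_def)
  have cH: "continuous_on S (\<lambda>z. H b (f z) (g z))"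
    if "continuous_on S f" "continuous_on S g" for S :: "'q::topological_space set" and f g b
    unfolding H_def
  proof (rule continuous_on_integral01, unfold case_prod_beta, rule cDM)
    show f1: "continuous_on (S \<times> {0..1}) (\<lambda>z. f (fst z))"
      by (rule continuous_on_compose2[OF that(1)]) (auto intro!: continuous_intros)
    have "continuous_on (S \<times> {0..1}) (\<lambda>z. g (fst z))"
      by (rule continuous_on_compose2[OF that(2)]) (auto intro!: continuous_intros)
    then show "continuous_on (S \<times> {0..1}) (\<lambda>z. x + snd z *\<^sub>R (g (fst z) - x))"
      by (intro continuous_on_add continuous_on_scaleR continuous_on_diff continuous_on_const continuous_on_snd continuous_on_id)
  qed (rule continuous_on_const)
  define K where "K b y = U s t x o\<^sub>L SI (\<lambda>\<tau>. V s \<tau> x o\<^sub>L (H b \<tau> y o\<^sub>L U s \<tau> y)) s t" for b y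
  have cK: "continuous_on UNIV (K b)" for b
    unfolding K_def
    by (intro continuous_on_bcomp continuous_on_SI cont_U cont_V cH continuous_intros)
  have Ud: "U s t y - U s t x = (\<Sum>b\<in>Basis. ((y - x) \<bullet> b) *\<^sub>R K b y)" for y
  proof -
    have "SI (\<lambda>\<tau>. V s \<tau> x o\<^sub>L ((M s \<tau> y - M s \<tau> x) o\<^sub>L U s \<tau> y)) s t
        = SI (\<lambda>\<tau>. \<Sum>b\<in>Basis. ((y - x) \<bullet> b) *\<^sub>R (V s \<tau> x o\<^sub>L (H b \<tau> y o\<^sub>L U s \<tau> y))) s t"
      by (simp add: Md blinfun_compose_sum_left blinfun_compose_sum_right blinfun_compose_scaleR_left blinfun_compose_scaleR_right)
    also have "\<dots> = (\<Sum>b\<in>Basis. ((y - x) \<bullet> b) *\<^sub>R SI (\<lambda>\<tau>. V s \<tau> x o\<^sub>L (H b \<tau> y o\<^sub>L U s \<tau> y)) s t)"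
      by (rule SI_sum) (intro continuous_on_bcomp cont_U cont_V cH continuous_intros)
    finally show ?thesis
      by (simp add: U_diff[of s t y x] K_def blinfun_compose_sum_right blinfun_compose_scaleR_right)
  qed
  have DMlin: "DM s \<tau> x v = (\<Sum>b\<in>Basis. (v \<bullet> b) *\<^sub>R DM s \<tau> x b)" for \<tau> v
  proof -
    have "(M s \<tau> has_derivative DM s \<tau> x) (at x)"
      using Ckp_SucD(1)[OF M, of "(s,\<tau>)" x] by (simp add: DM_def[abs_def])
    from blinfun_of_linear[OF has_derivative_linear[OF this], of v] show ?thesis by (simp add: blinfun_of_apply)
  qed
  have KD: "(\<Sum>b\<in>Basis. (v \<bullet> b) *\<^sub>R K b x) = DU s t x v" for v
  proof -
    have "SI (\<lambda>\<tau>. V s \<tau> x o\<^sub>L (DM s \<tau> x v o\<^sub>L U s \<tau> x)) s t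
        = SI (\<lambda>\<tau>. \<Sum>b\<in>Basis. (v \<bullet> b) *\<^sub>R (V s \<tau> x o\<^sub>L (DM s \<tau> x b o\<^sub>L U s \<tau> x))) s t"
      by (subst DMlin) (simp add: blinfun_compose_sum_left blinfun_compose_sum_right blinfun_compose_scaleR_left blinfun_compose_scaleR_right)
    also have "\<dots> = (\<Sum>b\<in>Basis. (v \<bullet> b) *\<^sub>R SI (\<lambda>\<tau>. V s \<tau> x o\<^sub>L (DM s \<tau> x b o\<^sub>L U s \<tau> x)) s t)"
      by (rule SI_sum) (intro continuous_on_bcomp cont_U cont_V cDM continuous_intros)
    finally show ?thesis
      by (simp add: DU_def K_def H_def blinfun_compose_sum_right blinfun_compose_scaleR_right)
  qed
  have iso: "isCont (K b) x" for b using cK[of b] by (simp add: continuous_on_eq_continuous_at)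
  show "(U s t has_derivative DU s t x) (at x)"
    using has_derivative_factorI[OF open_UNIV UNIV_I Ud iso] unfolding KD by simp
  \<comment> \<open>For mutually inverse operators V y - V x = - V y (U y - U x) V x, which
    transfers the coefficients from U to V.\<close>
  have Vd: "V s t y - V s t x = (\<Sum>b\<in>Basis. ((y - x) \<bullet> b) *\<^sub>R - (V s t y o\<^sub>L (K b y o\<^sub>L V s t x)))" for y
  proof -
    have "V s t y - V s t x = - (V s t y o\<^sub>L ((U s t y - U s t x) o\<^sub>L V s t x))"
      by (simp add: blinfun_compose_diff_left blinfun_compose_diff_right blinfun_compose_assoc UV)
         (simp add: blinfun_compose_assoc[symmetric] VU)
    then show ?thesis
      by (simp add: Ud blinfun_compose_sum_left blinfun_compose_sum_right blinfun_compose_scaleR_left blinfun_compose_scaleR_right sum_negf)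
  qed
  have "continuous_on UNIV (\<lambda>y. - (V s t y o\<^sub>L (K b y o\<^sub>L V s t x)))" for b
    by (intro continuous_on_minus continuous_on_bcomp cont_V continuous_on_const continuous_on_id cK)
  then have iso': "isCont (\<lambda>y. - (V s t y o\<^sub>L (K b y o\<^sub>L V s t x))) x" for b
    by (simp add: continuous_on_eq_continuous_at)
  have "(\<Sum>b\<in>Basis. (v \<bullet> b) *\<^sub>R - (V s t x o\<^sub>L (K b x o\<^sub>L V s t x))) = DV s t x v" for v
    by (simp add: DV_def KD[symmetric] blinfun_compose_sum_left blinfun_compose_sum_right blinfun_compose_scaleR_left
        blinfun_compose_scaleR_right sum_negf)
  with has_derivative_factorI[OF open_UNIV UNIV_I Vd iso']
  show "(V s t has_derivative DV s t x) (at x)" by simp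
qed

text \<open>Bootstrapping: \<open>DU\<close> and \<open>DV\<close> are built from U, V and the
  derivative of M by products and one integral, so order k of these ingredients gives order k + 1 of
  U and V.\<close>

lemma Ckp_UV:
  "Ckp k UNIV UNIV (\<lambda>q. M (fst q) (snd q)) \<Longrightarrow>
   Ckp k UNIV UNIV (\<lambda>q. U (fst q) (snd q)) \<and> Ckp k UNIV UNIV (\<lambda>q. V (fst q) (snd q))"
proof (induction k)
  case 0
  then show ?case using cU cV by blast
next
  case (Suc k)
  note bc = bounded_bilinear.Ckp[OF bounded_bilinear_blinfun_compose open_UNIV]
  have IH: "Ckp k UNIV UNIV (\<lambda>q. U (fst q) (snd q))" "Ckp k UNIV UNIV (\<lambda>q. V (fst q) (snd q))"
    using Suc Ckp_Suc_le by blast+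
  have cDM: "Ckp k UNIV UNIV (\<lambda>q x. DM (fst q) (snd q) x v)" for v
    unfolding DM_def by (rule Ckp_SucD(2)[OF Suc.prems])
  have "Ckp k UNIV UNIV (\<lambda>q x. V (fst q) (snd q) x o\<^sub>L (DM (fst q) (snd q) x v o\<^sub>L U (fst q) (snd q) x))" for v
    by (intro bc IH cDM)
  from Ckp_SI[OF open_UNIV this]
  have cDU: "Ckp k UNIV UNIV (\<lambda>q x. DU (fst q) (snd q) x v)" for v
    unfolding DU_def by (intro bc IH) simp
  have cDV: "Ckp k UNIV UNIV (\<lambda>q x. DV (fst q) (snd q) x v)" for v
    unfolding DV_def
    by (intro Ckp_bounded_linear[OF bounded_linear_minus[OF bounded_linear_ident]] open_UNIV bc IH cDU)
  show ?case
  proof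
    show "Ckp (Suc k) UNIV UNIV (\<lambda>q. U (fst q) (snd q))"
      by (rule Ckp_SucI[where D="\<lambda>q. DU (fst q) (snd q)", OF open_UNIV Ckp_cont[OF IH(1)]])
         (rule has_derivative_UV[OF Suc.prems] cDU)+
    show "Ckp (Suc k) UNIV UNIV (\<lambda>q. V (fst q) (snd q))"
      by (rule Ckp_SucI[where D="\<lambda>q. DV (fst q) (snd q)", OF open_UNIV Ckp_cont[OF IH(2)]])
         (rule has_derivative_UV[OF Suc.prems] cDV)+
  qed
qed

text \<open>Read off from Duhamel's formula by the product rule. Interchanging partial derivatives
  is no option here, as the coefficients are merely continuous in time.\<close>

lemma DU_time_derivative:
  assumes M: "Ckp 1 UNIV UNIV (\<lambda>q. M (fst q) (snd q))"
  shows "((\<lambda>t. frechet_derivative (U s t) (at x) v) has_vector_derivative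
     (M s t x o\<^sub>L frechet_derivative (U s t) (at x) v) + (frechet_derivative (M s t) (at x) v o\<^sub>L U s t x)) (at t)"
proof -
  have M': "Ckp (Suc 0) UNIV UNIV (\<lambda>q. M (fst q) (snd q))" using M by simp
  have fd: "frechet_derivative (U s t) (at x) = DU s t x" for t
    using frechet_derivative_at[OF has_derivative_UV(1)[OF M', of s t x]] by simp
  have "continuous_on UNIV (\<lambda>\<tau>. DM s \<tau> x v)"
    unfolding DM_def using Ckp_cont2[OF Ckp_SucD(2)[OF M', of v], of UNIV "\<lambda>\<tau>. (s, \<tau>)" "\<lambda>_. x"]
    by (simp add: continuous_on_Pair continuous_on_id)
  then have "continuous_on UNIV (\<lambda>\<tau>. V s \<tau> x o\<^sub>L (DM s \<tau> x v o\<^sub>L U s \<tau> x))"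
    by (intro continuous_on_bcomp cont_U cont_V continuous_intros)
  from blinfun_compose_vd[OF U'[of s x t] SI_has_vector_derivative[OF this, of s t]]
  show ?thesis unfolding fd unfolding DU_def DM_def[symmetric]
    by (simp add: blinfun_compose_assoc[symmetric] UV add.commute)
qed

end

text \<open>Two trajectories differ by a solution of a linear equation whose matrix \<open>A\<close>
  is Hadamard's coefficient along the segment between them. Its resolvent gives the increment of the
  flow exactly; for equal starting points it is the derivative of the flow and satisfies the
  variational equation. The coefficients of this equation are as smooth as the flow itself, so each
  order yields the next.\<close>

lemma flow_exists:
  fixes a :: "real \<Rightarrow> 'e::euclidean_space \<Rightarrow> 'e"
  assumes a: "csm UNIV UNIV a" and bd: "\<And>t x. norm (a t x) \<le> C"
    and bdD: "\<And>t x b. b \<in> Basis \<Longrightarrow> norm (frechet_derivative (a t) (at x) b) \<le> K"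
  obtains \<phi> where "csm UNIV UNIV (\<lambda>q. \<phi> (fst q) (snd q))" "\<And>s x. \<phi> s s x = x"
    "\<And>s t x. ((\<lambda>t. \<phi> s t x) has_vector_derivative a t (\<phi> s t x)) (at t)"
    "\<And>s t x v. ((\<lambda>t. frechet_derivative (\<phi> s t) (at x) v) has_vector_derivative
        frechet_derivative (a t) (at (\<phi> s t x)) (frechet_derivative (\<phi> s t) (at x) v)) (at t)"
    "\<And>s x v. frechet_derivative (\<phi> s s) (at x) v = v"
proof -
  have aS: "Ckp (Suc k) UNIV UNIV a" for k using a by (simp add: csm_def)
  define D where "D t z b = frechet_derivative (a t) (at z) b" for t z b
  have cD: "continuous_on S (\<lambda>z. D (f z) (g z) b)" if "continuous_on S f" "continuous_on S g"
    for S :: "'q::topological_space set" and f g b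
    unfolding D_def by (rule Ckp_cont2[OF Ckp_SucD(2)[OF aS]]) (use that in auto)
  define A where "A t x y = blinfun_of (\<lambda>b. integral {0..1} (\<lambda>\<theta>. D t (x + \<theta> *\<^sub>R (y - x)) b))" for t x y
  have Ad: "a t y - a t x = blinfun_apply (A t x y) (y - x)" for t x y
    using Ckp_Suc_hadamard[OF aS, of t x y] by (simp add: A_def D_def blinfun_of_apply)
  have cA: "continuous_on S (\<lambda>z. A (f z) (g z) (h z))"
    if "continuous_on S f" "continuous_on S g" "continuous_on S h" for S :: "'q::topological_space set" and f g h
    unfolding A_def
  proof (rule continuous_on_blinfun_of, rule continuous_on_integral01, unfold case_prod_beta, rule cD)
    show f1: "continuous_on (S \<times> {0..1}) (\<lambda>z. f (fst z))"
      by (rule continuous_on_compose2[OF that(1)]) (auto intro!: continuous_intros)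
    have g1: "continuous_on (S \<times> {0..1}) (\<lambda>z. g (fst z))"
      by (rule continuous_on_compose2[OF that(2)]) (auto intro!: continuous_intros)
    have h1: "continuous_on (S \<times> {0..1}) (\<lambda>z. h (fst z))"
      by (rule continuous_on_compose2[OF that(3)]) (auto intro!: continuous_intros)
    show "continuous_on (S \<times> {0..1}) (\<lambda>z. g (fst z) + snd z *\<^sub>R (h (fst z) - g (fst z)))"
      by (intro continuous_on_add continuous_on_scaleR continuous_on_diff continuous_on_snd continuous_on_id g1 h1)
  qed
  define N where "N = real DIM('e) * \<bar>K\<bar> + 1"
  have N: "N > 0" by (simp add: N_def add_nonneg_pos)
  have Ab: "norm (A t x y) \<le> N" for t x y
  proof -
    have "norm (integral {0..1} (\<lambda>\<theta>. D t (x + \<theta> *\<^sub>R (y - x)) b)) \<le> \<bar>K\<bar>" if "b \<in> Basis" for b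
    proof -
      have "norm (integral {0..1} (\<lambda>\<theta>. D t (x + \<theta> *\<^sub>R (y - x)) b)) \<le> \<bar>K\<bar> * (1 - 0)"
        by (rule integral_bound) (use bdD[OF that] in \<open>auto simp: D_def[symmetric] intro!: cD continuous_intros order_trans[OF _ abs_ge_self]\<close>)
      then show ?thesis by simp
    qed
    then have "(\<Sum>b\<in>Basis. norm (integral {0..1} (\<lambda>\<theta>. D t (x + \<theta> *\<^sub>R (y - x)) b))) \<le> real DIM('e) * \<bar>K\<bar>"
      by (rule sum_bounded_above)
    then show ?thesis using norm_blinfun_of_le[of "\<lambda>b. integral {0..1} (\<lambda>\<theta>. D t (x + \<theta> *\<^sub>R (y - x)) b)"]
      by (simp add: A_def N_def)
  qed
  have AN: "norm (blinfun_apply (A t x y) v) \<le> N * norm v" for t x y v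
    using norm_blinfun[of "A t x y" v] mult_right_mono[OF Ab[of t x y] norm_ge_zero[of v]] by linarith
  have lip: "norm (a t y - a t x) \<le> N * norm (y - x)" for t x y unfolding Ad by (rule AN)
  have ca: "continuous_on UNIV (\<lambda>z. a (fst z) (snd (snd z)))"
    by (rule Ckp_cont2[OF aS]) (auto intro!: continuous_intros)
  obtain \<phi> where \<phi>: "continuous_on UNIV (\<lambda>z. \<phi> (fst z) (fst (snd z)) (snd (snd z)))" "\<And>s x. \<phi> s s x = x"
    "\<And>s t x. ((\<lambda>t. \<phi> s t x) has_vector_derivative a t (\<phi> s t x)) (at t)"
    by (rule ode_exists[of "\<lambda>t x y. a t y" N "\<lambda>x. x" C, OF ca lip N bd continuous_on_id], rule that)
  have c\<phi>: "continuous_on S (\<lambda>z. \<phi> (f z) (g z) (h z))"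
    if "continuous_on S f" "continuous_on S g" "continuous_on S h" for S :: "'q::topological_space set" and f g h
    using continuous_on_compose2[OF \<phi>(1), of S "\<lambda>z. (f z, g z, h z)"] that by (simp add: continuous_on_Pair)
  \<comment> \<open>The matrix depends on the initial time and on two starting points. All three go
    into the parameter, so that the resolvent is jointly continuous in them.\<close>
  define Mg where "Mg t p = A t (\<phi> (fst p) t (fst (snd p))) (\<phi> (fst p) t (snd (snd p)))" for t and p :: "real \<times> 'e \<times> 'e"
  have cMg: "continuous_on UNIV (\<lambda>z. Mg (fst z) (snd z))"
    unfolding Mg_def by (intro cA c\<phi> continuous_intros)
  have bMg: "norm (Mg t p) \<le> N" for t p unfolding Mg_def by (rule Ab)
  obtain Ug Vg where g: "continuous_on UNIV (\<lambda>z. Ug (fst z) (fst (snd z)) (snd (snd z)))"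
    "continuous_on UNIV (\<lambda>z. Vg (fst z) (fst (snd z)) (snd (snd z)))"
    "\<And>s p. Ug s s p = id_blinfun" "\<And>s p. Vg s s p = id_blinfun"
    "\<And>s t p. ((\<lambda>t. Ug s t p) has_vector_derivative (Mg t p o\<^sub>L Ug s t p)) (at t)"
    "\<And>s t p. ((\<lambda>t. Vg s t p) has_vector_derivative - (Vg s t p o\<^sub>L Mg t p)) (at t)"
    "\<And>s t p. Vg s t p o\<^sub>L Ug s t p = id_blinfun" "\<And>s t p. Ug s t p o\<^sub>L Vg s t p = id_blinfun"
    by (rule linear_ode_exists[OF cMg bMg], rule that)
  \<comment> \<open>Equal starting points: here \<open>A\<close> is the derivative of the field
    along the trajectory.\<close>
  define M where "M s t x = Mg t (s,x,x)" for s t x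
  define U where "U s t x = Ug s t (s,x,x)" for s t x
  define V where "V s t x = Vg s t (s,x,x)" for s t x
  have ct: "continuous_on UNIV (\<lambda>q :: (real \<times> real) \<times> 'e. (fst (fst q), snd (fst q), fst (fst q), snd q, snd q))"
    by (intro continuous_intros)
  interpret lin_ode M U V
  proof
    show "Ckp 0 UNIV UNIV (\<lambda>q. U (fst q) (snd q))"
      using continuous_on_compose2[OF g(1) ct] by (simp add: case_prod_beta U_def)
    show "Ckp 0 UNIV UNIV (\<lambda>q. V (fst q) (snd q))"
      using continuous_on_compose2[OF g(2) ct] by (simp add: case_prod_beta V_def)
  qed (simp_all add: U_def V_def M_def g)
  have M_eq: "M s t x = blinfun_of (\<lambda>b. D t (\<phi> s t x) b)" for s t x
    by (simp add: M_def Mg_def A_def)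
  have \<phi>d: "\<phi> s t y - \<phi> s t x = blinfun_apply (Ug s t (s,x,y)) (y - x)" for s t x y
  proof -
    let ?d = "\<lambda>t. (\<phi> s t y - \<phi> s t x) - blinfun_apply (Ug s t (s,x,y)) (y - x)"
    have "?d t = 0"
    proof (rule ode_zero[of UNIV s t ?d N "\<lambda>t. blinfun_apply (Mg t (s,x,y)) (?d t)"])
      show "norm (blinfun_apply (Mg \<tau> (s,x,y)) (?d \<tau>)) \<le> N * norm (?d \<tau>)" for \<tau>
        unfolding Mg_def by (rule AN)
      have "((\<lambda>t. blinfun_apply (Ug s t (s,x,y)) (y - x)) has_vector_derivative blinfun_apply (Mg \<tau> (s,x,y) o\<^sub>L Ug s \<tau> (s,x,y)) (y - x)) (at \<tau>)" for \<tau>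
        by (rule bounded_linear.has_vector_derivative[OF blinfun.bounded_linear_left g(5)])
      from has_vector_derivative_diff[OF has_vector_derivative_diff[OF \<phi>(3)[of s y] \<phi>(3)[of s x]] this]
      show "(?d has_vector_derivative blinfun_apply (Mg \<tau> (s,x,y)) (?d \<tau>)) (at \<tau> within UNIV)" for \<tau>
        by (simp add: Ad Mg_def blinfun.diff_right)
    qed (use N in \<open>simp_all add: \<phi> g\<close>)
    then show ?thesis by simp
  qed
  have \<phi>U: "(\<phi> s t has_derivative blinfun_apply (U s t x)) (at x)" for s t x
  proof -
    have c: "continuous_on UNIV (\<lambda>y. blinfun_apply (Ug s t (s,x,y)) b)" for b
      using continuous_on_compose2[OF g(1), of UNIV "\<lambda>y. (s,t,s,x,y)"]
      by (intro bounded_linear.continuous_on[OF blinfun.bounded_linear_left]) (simp add: continuous_on_Pair continuous_on_id)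
    have "(\<phi> s t has_derivative (\<lambda>h. \<Sum>b\<in>Basis. (h \<bullet> b) *\<^sub>R blinfun_apply (Ug s t (s,x,x)) b)) (at x)"
    proof (rule has_derivative_factorI[where K="\<lambda>b y. blinfun_apply (Ug s t (s,x,y)) b", OF open_UNIV UNIV_I])
      show "\<phi> s t y - \<phi> s t x = (\<Sum>b\<in>Basis. ((y - x) \<bullet> b) *\<^sub>R blinfun_apply (Ug s t (s,x,y)) b)" for y
        unfolding \<phi>d by (rule blinfun_expand)
      show "isCont (\<lambda>y. blinfun_apply (Ug s t (s,x,y)) b) x" for b
        using c[of b] by (simp add: continuous_on_eq_continuous_at)
    qed
    moreover have "(\<lambda>h. \<Sum>b\<in>Basis. (h \<bullet> b) *\<^sub>R blinfun_apply (Ug s t (s,x,x)) b) = blinfun_apply (U s t x)"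
      by (simp add: U_def blinfun_expand[of "Ug s t (s,x,x)", symmetric])
    ultimately show ?thesis by simp
  qed
  have fd: "frechet_derivative (\<phi> s t) (at x) v = blinfun_apply (U s t x) v" for s t x v
    using frechet_derivative_at[OF \<phi>U[of s t x]] by simp
  have "Ckp k UNIV UNIV (\<lambda>q. \<phi> (fst q) (snd q))" for k
  proof (induction k)
    case 0
    show ?case by (simp add: case_prod_beta) (intro c\<phi> continuous_intros)
  next
    case (Suc k)
    have "Ckp k UNIV UNIV (\<lambda>q x. D (snd q) (\<phi> (fst q) (snd q) x) b)" for b
    proof (rule Ckp_compose[OF open_UNIV open_UNIV _ _ Suc.IH, where f="\<lambda>q x. D (snd q) x b"])
      show "Ckp k UNIV UNIV (\<lambda>q x. D (snd q) x b)" unfolding D_def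
        by (rule Ckp_reparam[OF _ _ open_UNIV Ckp_SucD(2)[OF aS], of _ snd]) (auto intro!: continuous_intros)
    qed simp
    then have "Ckp k UNIV UNIV (\<lambda>q. M (fst q) (snd q))"
      unfolding M_eq by (rule Ckp_blinfun_of[OF open_UNIV])
    then have "Ckp k UNIV UNIV (\<lambda>q. U (fst q) (snd q))" by (rule Ckp_UV[THEN conjunct1])
    then have "Ckp k UNIV UNIV (\<lambda>q x. blinfun_apply (U (fst q) (snd q) x) v)" for v
      by (rule Ckp_bounded_linear[OF blinfun.bounded_linear_left open_UNIV])
    from Ckp_SucI[where D="\<lambda>q x. blinfun_apply (U (fst q) (snd q) x)", OF open_UNIV Ckp_cont[OF Suc.IH] \<phi>U this]
    show ?case .
  qed
  then have sm\<phi>: "csm UNIV UNIV (\<lambda>q. \<phi> (fst q) (snd q))" by (simp add: csm_def)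
  show ?thesis
  proof (rule that[OF sm\<phi> \<phi>(2,3)])
    have lin: "D t z v = blinfun_apply (blinfun_of (D t z)) v" for t z v
      using blinfun_of_linear[OF has_derivative_linear[OF Ckp_SucD(1)[OF aS UNIV_I UNIV_I, of t z]], of v] by (simp add: D_def[abs_def])
    show "((\<lambda>t. frechet_derivative (\<phi> s t) (at x) v) has_vector_derivative
        frechet_derivative (a t) (at (\<phi> s t x)) (frechet_derivative (\<phi> s t) (at x) v)) (at t)" for s t x v
      unfolding fd D_def[symmetric] using bounded_linear.has_vector_derivative[OF blinfun.bounded_linear_left[of v] U'[of s x t]]
      by (simp add: M_eq lin[symmetric] blinfun_compose.rep_eq)
    show "frechet_derivative (\<phi> s s) (at x) v = v" for s x v unfolding fd by (simp add: U0)
  qed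
qed

text \<open>The coefficients may depend on the initial time, as they will be taken along a
  trajectory started at s. With s also in the parameter the equation has the form treated before,
  and afterwards the two are set equal.\<close>

lemma linear_flow_exists:
  fixes M :: "real \<Rightarrow> real \<Rightarrow> 'e::euclidean_space \<Rightarrow> 'h::banach \<Rightarrow>\<^sub>L 'h"
  assumes M: "csm UNIV UNIV (\<lambda>q. M (fst q) (snd q))" and bd: "\<And>s t x. norm (M s t x) \<le> C"
  obtains U V where "lin_ode M U V" "csm UNIV UNIV (\<lambda>q. U (fst q) (snd q))" "csm UNIV UNIV (\<lambda>q. V (fst q) (snd q))"
proof -
  have M0: "Ckp k UNIV UNIV (\<lambda>q. M (fst q) (snd q))" for k using M by (simp add: csm_def)
  have cM: "continuous_on UNIV (\<lambda>z. M (fst (snd z)) (fst z) (snd (snd z)))"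
    using Ckp_cont2[OF M0, of UNIV "\<lambda>z. (fst (snd z), fst z)" "\<lambda>z. snd (snd z)"]
    by (simp add: continuous_on_Pair continuous_on_fst continuous_on_snd)
  obtain Ug Vg where g: "continuous_on UNIV (\<lambda>z. Ug (fst z) (fst (snd z)) (snd (snd z)))"
    "continuous_on UNIV (\<lambda>z. Vg (fst z) (fst (snd z)) (snd (snd z)))"
    "\<And>s p. Ug s s p = id_blinfun" "\<And>s p. Vg s s p = id_blinfun"
    "\<And>s t p. ((\<lambda>t. Ug s t p) has_vector_derivative (M (fst p) t (snd p) o\<^sub>L Ug s t p)) (at t)"
    "\<And>s t p. ((\<lambda>t. Vg s t p) has_vector_derivative - (Vg s t p o\<^sub>L M (fst p) t (snd p))) (at t)"
    "\<And>s t p. Vg s t p o\<^sub>L Ug s t p = id_blinfun" "\<And>s t p. Ug s t p o\<^sub>L Vg s t p = id_blinfun"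
    by (rule linear_ode_exists[where M="\<lambda>t p. M (fst p) t (snd p)", OF cM bd], rule that)
  define U where "U s t x = Ug s t (s,x)" for s t x
  define V where "V s t x = Vg s t (s,x)" for s t x
  have ct: "continuous_on UNIV (\<lambda>q :: (real \<times> real) \<times> 'e. (fst (fst q), snd (fst q), fst (fst q), snd q))"
    by (intro continuous_intros)
  have l: "lin_ode M U V"
  proof
    show "Ckp 0 UNIV UNIV (\<lambda>q. U (fst q) (snd q))"
      using continuous_on_compose2[OF g(1) ct] by (simp add: case_prod_beta U_def)
    show "Ckp 0 UNIV UNIV (\<lambda>q. V (fst q) (snd q))"
      using continuous_on_compose2[OF g(2) ct] by (simp add: case_prod_beta V_def)
    show "((\<lambda>t. U s t x) has_vector_derivative (M s t x o\<^sub>L U s t x)) (at t)" for s t x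
      using g(5)[of s "(s,x)" t] by (simp add: U_def)
    show "((\<lambda>t. V s t x) has_vector_derivative - (V s t x o\<^sub>L M s t x)) (at t)" for s t x
      using g(6)[of s "(s,x)" t] by (simp add: V_def)
  qed (simp_all add: U_def V_def g)
  interpret lin_ode M U V by (rule l)
  show ?thesis by (rule that[OF l]) (use Ckp_UV[OF M0] in \<open>simp_all add: csm_def\<close>)
qed

section \<open>Rules for smoothness of all orders\<close>

lemma csmD: "csm P W f \<Longrightarrow> Ckp k P W f" by (simp add: csm_def)
lemma csmI: "(\<And>k. Ckp k P W f) \<Longrightarrow> csm P W f" by (simp add: csm_def)

lemma csm_cong: "open W \<Longrightarrow> (\<And>p x. p \<in> P \<Longrightarrow> x \<in> W \<Longrightarrow> f p x = g p x) \<Longrightarrow> csm P W f \<Longrightarrow> csm P W g"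
  by (rule csmI, rule Ckp_cong[of W P f g]) (auto dest: csmD)
lemma csm_subset: "csm P W f \<Longrightarrow> P' \<subseteq> P \<Longrightarrow> W' \<subseteq> W \<Longrightarrow> csm P' W' f"
  by (rule csmI, rule Ckp_subset[OF csmD])
lemma csm_const: "continuous_on P c \<Longrightarrow> open W \<Longrightarrow> csm P W (\<lambda>p x. c p)"
  by (rule csmI, rule Ckp_const)
lemma csm_id: "open W \<Longrightarrow> csm P W (\<lambda>p x. x)"
  by (rule csmI, rule Ckp_id)
lemma csm_linear: "linear L \<Longrightarrow> open W \<Longrightarrow> csm P W (\<lambda>p x. L x)"
  by (rule csmI, rule Ckp_linear)
lemma csm_bounded_linear: "bounded_linear L \<Longrightarrow> open W \<Longrightarrow> csm P W f \<Longrightarrow> csm P W (\<lambda>p x. L (f p x))"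
  by (rule csmI, rule Ckp_bounded_linear[OF _ _ csmD])
lemma csm_add: "open W \<Longrightarrow> csm P W f \<Longrightarrow> csm P W g \<Longrightarrow> csm P W (\<lambda>p x. f p x + g p x)"
  by (rule csmI, rule Ckp_add[OF _ csmD csmD])
lemma csm_minus: "open W \<Longrightarrow> csm P W f \<Longrightarrow> csm P W (\<lambda>p x. - f p x)"
  by (rule csm_bounded_linear[OF bounded_linear_minus[OF bounded_linear_ident]])
lemma csm_diff: "open W \<Longrightarrow> csm P W f \<Longrightarrow> csm P W g \<Longrightarrow> csm P W (\<lambda>p x. f p x - g p x)"
  using csm_add[OF _ _ csm_minus, of W P f g] by simp
lemma csm_sum: "open W \<Longrightarrow> (\<And>i. i \<in> I \<Longrightarrow> csm P W (f i)) \<Longrightarrow> csm P W (\<lambda>p x. \<Sum>i\<in>I. f i p x)"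
  by (rule csmI, rule Ckp_sum) (auto dest: csmD)
lemma csm_bilinear: "bounded_bilinear bil \<Longrightarrow> open W \<Longrightarrow> csm P W f \<Longrightarrow> csm P W g \<Longrightarrow> csm P W (\<lambda>p x. bil (f p x) (g p x))"
  by (rule csmI, rule bounded_bilinear.Ckp[OF _ _ csmD csmD])
lemmas csm_scaleR = csm_bilinear[OF bounded_bilinear_scaleR]
lemmas csm_mult = csm_bilinear[OF bounded_bilinear_mult]
lemmas csm_inner = csm_bilinear[OF bounded_bilinear_inner]
lemmas csm_apply = csm_bilinear[OF bounded_bilinear_blinfun_apply]
lemma csm_reparam: "continuous_on Q h \<Longrightarrow> h ` Q \<subseteq> P \<Longrightarrow> open W \<Longrightarrow> csm P W f \<Longrightarrow> csm Q W (\<lambda>q x. f (h q) x)"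
  by (rule csmI, rule Ckp_reparam[OF _ _ _ csmD])
lemma csm_local:
  assumes "\<And>p x. p \<in> P \<Longrightarrow> x \<in> W \<Longrightarrow> \<exists>S V. open S \<and> open V \<and> p \<in> S \<and> x \<in> V \<and> csm (P \<inter> S) (W \<inter> V) f"
  shows "csm P W f"
proof (rule csmI, rule Ckp_local)
  fix k p x assume "p \<in> P" "x \<in> W"
  from assms[OF this] show "\<exists>S V. open S \<and> open V \<and> p \<in> S \<and> x \<in> V \<and> Ckp k (P \<inter> S) (W \<inter> V) f"
    unfolding csm_def by blast
qed
lemma csm_compose:
  assumes "open W" "open W'" "\<And>p x. p \<in> P \<Longrightarrow> x \<in> W \<Longrightarrow> g p x \<in> W'" "csm P W' f" "csm P W g"
  shows "csm P W (\<lambda>p x. f p (g p x))"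
  by (rule csmI, rule Ckp_compose[OF assms(1-3) csmD[OF assms(4)] csmD[OF assms(5)]])
lemma csm_blinfun_of: "open W \<Longrightarrow> (\<And>b. b \<in> Basis \<Longrightarrow> csm P W (\<lambda>p x. f p x b)) \<Longrightarrow> csm P W (\<lambda>p x. blinfun_of (f p x))"
  by (rule csmI, rule Ckp_blinfun_of) (auto dest: csmD)
lemma csm_inverse:
  "open W \<Longrightarrow> (\<And>p x. p \<in> P \<Longrightarrow> x \<in> W \<Longrightarrow> f p x \<noteq> 0) \<Longrightarrow> csm P W f \<Longrightarrow> csm P W (\<lambda>p x. inverse (f p x :: real))"
  by (rule csmI, rule Ckp_inverse) (auto dest: csmD)
lemma csm_has_derivative:
  "csm P W f \<Longrightarrow> p \<in> P \<Longrightarrow> x \<in> W \<Longrightarrow> (f p has_derivative frechet_derivative (f p) (at x)) (at x)"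
  by (rule Ckp_SucD(1)[OF csmD])
lemma csm_frechet: "csm P W f \<Longrightarrow> csm P W (\<lambda>p x. frechet_derivative (f p) (at x) v)"
  by (rule csmI, rule Ckp_SucD(2)[OF csmD])
text \<open>\<open>csm\<close> speaks of derivatives in fixed directions; a moving direction is
  expanded in the standard basis.\<close>

lemma csm_frechet2:
  assumes f: "csm P W f" and "open W" and g: "csm P W g"
  shows "csm P W (\<lambda>p x. frechet_derivative (f p) (at x) (g p x))"
proof (rule csm_cong[OF assms(2)])
  show "csm P W (\<lambda>p x. \<Sum>b\<in>Basis. (g p x \<bullet> b) *\<^sub>R frechet_derivative (f p) (at x) b)"
    by (intro csm_sum assms(2) csm_scaleR csm_bounded_linear[OF bounded_linear_inner_left] g csm_frechet[OF f])
  show "(\<Sum>b\<in>Basis. (g p x \<bullet> b) *\<^sub>R frechet_derivative (f p) (at x) b) = frechet_derivative (f p) (at x) (g p x)"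
    if "p \<in> P" "x \<in> W" for p x
    using blinfun_of_linear[OF has_derivative_linear[OF csm_has_derivative[OF f that]], of "g p x"] by (simp add: blinfun_of_apply)
qed
lemma csm_cont: "csm P W f \<Longrightarrow> continuous_on (P \<times> W) (\<lambda>z. f (fst z) (snd z))"
  using Ckp_cont[OF csmD, of P W f] by (simp add: case_prod_beta)
lemma csm_cont_on: "csm P W f \<Longrightarrow> p \<in> P \<Longrightarrow> continuous_on W (f p)"
  by (rule Ckp_cont2[OF csmD, where g="\<lambda>_. p"]) (auto intro!: continuous_intros)
lemma csm_sm: "csm P W f \<Longrightarrow> p \<in> P \<Longrightarrow> open W \<Longrightarrow> sm W (f p)"
  using csm_reparam[of "{0}" "\<lambda>_. p" P W f] by (simp add: continuous_on_const)
lemma sm_csm: "sm W f \<Longrightarrow> open W \<Longrightarrow> csm P W (\<lambda>p. f)"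
  using csm_reparam[of P "\<lambda>_. 0" "{0}" W "\<lambda>_. f"] by (simp add: continuous_on_const image_subset_iff)
lemma sm_iff_Ck_on: "sm W f \<longleftrightarrow> (\<forall>k. Ck_on k W f)"
  using Ck_on_iff_Ckp[of "0::real" "{0}" _ W f] by (simp add: csm_def)
lemma sm_has_derivative: "sm W f \<Longrightarrow> x \<in> W \<Longrightarrow> (f has_derivative frechet_derivative f (at x)) (at x)"
  by (rule csm_has_derivative[where p=0]) auto
lemma sm_cong: "open W \<Longrightarrow> (\<And>x. x \<in> W \<Longrightarrow> f x = g x) \<Longrightarrow> sm W f \<Longrightarrow> sm W g"
  by (rule csm_cong) auto
lemma sm_subset: "sm W f \<Longrightarrow> W' \<subseteq> W \<Longrightarrow> sm W' f"
  by (rule csm_subset) auto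
lemma sm_cont: "sm W f \<Longrightarrow> continuous_on W f"
  by (rule csm_cont_on[where p=0]) auto
lemma sm_compose: "open W \<Longrightarrow> open W' \<Longrightarrow> g ` W \<subseteq> W' \<Longrightarrow> sm W' f \<Longrightarrow> sm W g \<Longrightarrow> sm W (\<lambda>x. f (g x))"
  by (rule csm_compose[of W W' "{0}" "\<lambda>_. g" "\<lambda>_. f"]) auto

subsection \<open>Bump functions\<close>

text \<open>The powers of 1/x are there because the derivative of the n-th function is a combination
  of two later ones, so that the whole family is smooth by induction on the order.\<close>

definition exp_bump :: "nat \<Rightarrow> real \<Rightarrow> real" where
  "exp_bump n x = (if x > 0 then exp (- (1 / x)) / x ^ n else 0)"

lemma exp_bump_tendsto: "(exp_bump n \<longlongrightarrow> 0) (at 0)"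
proof -
  have "((\<lambda>x::real. x ^ n / exp x) \<longlongrightarrow> 0) at_top" by (rule tendsto_power_div_exp_0)
  then have "((\<lambda>x::real. inverse x ^ n / exp (inverse x)) \<longlongrightarrow> 0) (at_right 0)"
    by (rule filterlim_compose[OF _ filterlim_inverse_at_top_right])
  moreover have "\<forall>\<^sub>F x::real in at_right 0. inverse x ^ n / exp (inverse x) = exp_bump n x"
    unfolding eventually_at_right_field
    by (rule exI[of _ 1]) (auto simp: exp_bump_def exp_minus field_simps)
  ultimately have r: "(exp_bump n \<longlongrightarrow> 0) (at_right 0)"
    by (rule Lim_transform_eventually)
  have "\<forall>\<^sub>F x::real in at_left 0. 0 = exp_bump n x"
    unfolding eventually_at_left_field by (rule exI[of _ "-1"]) (auto simp: exp_bump_def)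
  then have l: "(exp_bump n \<longlongrightarrow> 0) (at_left 0)" by (rule Lim_transform_eventually[OF tendsto_const])
  show ?thesis using l r by (simp add: filterlim_split_at)
qed

lemma exp_bump_deriv: "(exp_bump n has_real_derivative exp_bump (n + 2) x - real n * exp_bump (Suc n) x) (at x)"
proof -
  consider "x > 0" | "x < 0" | "x = 0" by linarith
  then show ?thesis
  proof cases
    case 1
    have "((\<lambda>x. exp (- (1 / x)) / x ^ n) has_real_derivative exp_bump (n + 2) x - real n * exp_bump (Suc n) x) (at x)"
      using 1 by (auto intro!: derivative_eq_intros simp: exp_bump_def field_simps power2_eq_square)
        (cases n; simp add: field_simps)
    then show ?thesis
      by (rule has_field_derivative_transform_within_open[where S="{0<..}"]) (use 1 in \<open>auto simp: exp_bump_def\<close>)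
  next
    case 2
    have "((\<lambda>x. 0) has_real_derivative exp_bump (n + 2) x - real n * exp_bump (Suc n) x) (at x)"
      using 2 by (auto simp: exp_bump_def)
    then show ?thesis
      by (rule has_field_derivative_transform_within_open[where S="{..<0}"]) (use 2 in \<open>auto simp: exp_bump_def\<close>)
  next
    case 3
    \<comment> \<open>At 0 the difference quotient is again a member of the family, and every member
      tends to 0 there.\<close>
    have "exp_bump n h / h = exp_bump (Suc n) h" for h by (simp add: exp_bump_def)
    then have "((\<lambda>h. (exp_bump n (0 + h) - exp_bump n 0) / h) \<longlongrightarrow> 0) (at 0)"
      using exp_bump_tendsto[of "Suc n"] by (simp add: exp_bump_def[of n 0])
    then show ?thesis using 3 by (simp add: DERIV_def exp_bump_def[of _ 0])
  qed
qed

lemma sm_exp_bump: "sm UNIV (exp_bump n)"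
proof (rule csmI)
  fix k show "Ckp k {0::real} UNIV (\<lambda>_. exp_bump n)"
  proof (induction k arbitrary: n)
    case 0
    have "continuous_on UNIV (exp_bump n)" using exp_bump_deriv DERIV_isCont continuous_at_imp_continuous_on by blast
    then show ?case by (auto simp: case_prod_beta intro!: continuous_on_compose2[of UNIV "exp_bump n"] continuous_intros)
  next
    case (Suc k)
    show ?case
    proof (rule Ckp_SucI[where D="\<lambda>_ x v. v * (exp_bump (n + 2) x - real n * exp_bump (Suc n) x)"])
      have "continuous_on UNIV (exp_bump n)" using exp_bump_deriv DERIV_isCont continuous_at_imp_continuous_on by blast
      then show "continuous_on ({0} \<times> UNIV) (\<lambda>(p::real, x). exp_bump n x)"
        by (auto simp: case_prod_beta intro!: continuous_on_compose2[of UNIV "exp_bump n"] continuous_intros)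
      show "(exp_bump n has_derivative (\<lambda>v. v * (exp_bump (n + 2) x - real n * exp_bump (Suc n) x))) (at x)" for x
        using exp_bump_deriv[of n x] by (simp add: has_field_derivative_def mult_commute_abs)
      have "Ckp k {0::real} UNIV (\<lambda>_ x. exp_bump (n + 2) x + (- real n) *\<^sub>R exp_bump (Suc n) x)"
        by (intro Ckp_add Ckp_bounded_linear[OF bounded_linear_scaleR_right] open_UNIV Suc.IH)
      then show "Ckp k {0::real} UNIV (\<lambda>_ x. v * (exp_bump (n + 2) x - real n * exp_bump (Suc n) x))" for v
        by (intro Ckp_bounded_linear[OF bounded_linear_mult_right] open_UNIV) simp
    qed simp
  qed
qed

text \<open>The quotient u / (u + v), where u is positive exactly inside radius r2 and v exactly
  outside radius r1. As r1 < r2 they never vanish together. Squared distances keep everything smooth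
  at the centre.\<close>

lemma bump_exists:
  fixes p0 :: "'e::euclidean_space"
  assumes "0 < r1" "r1 < r2"
  obtains \<beta> :: "'e \<Rightarrow> real" where "sm UNIV \<beta>" "\<And>p. dist p0 p \<le> r1 \<Longrightarrow> \<beta> p = 1" "\<And>p. r2 \<le> dist p0 p \<Longrightarrow> \<beta> p = 0"
proof -
  define q where "q p = (p - p0) \<bullet> (p - p0)" for p
  have qd: "q p = (dist p0 p)\<^sup>2" for p
    by (metis q_def dist_commute dist_norm power2_norm_eq_inner)
  have lin: "sm UNIV (\<lambda>p. p - p0)" by (intro csm_diff csm_id csm_const open_UNIV continuous_on_const)
  have smq: "sm UNIV q" unfolding q_def by (intro csm_inner lin open_UNIV)
  define u where "u p = exp_bump 0 (r2\<^sup>2 - q p)" for p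
  define v where "v p = exp_bump 0 (q p - r1\<^sup>2)" for p
  have smu: "sm UNIV u" unfolding u_def
    by (rule sm_compose[OF _ _ _ sm_exp_bump]) (auto intro!: csm_diff smq csm_const continuous_intros)
  have smv: "sm UNIV v" unfolding v_def
    by (rule sm_compose[OF _ _ _ sm_exp_bump]) (auto intro!: csm_diff smq csm_const continuous_intros)
  have eb0: "exp_bump 0 x \<ge> 0" "x > 0 \<Longrightarrow> exp_bump 0 x > 0" "x \<le> 0 \<Longrightarrow> exp_bump 0 x = 0" for x by (auto simp: exp_bump_def)
  have sq: "r1\<^sup>2 < r2\<^sup>2" using assms by (simp add: power_strict_mono)
  have pos: "u p + v p \<noteq> 0" for p
  proof -
    have "r2\<^sup>2 - q p > 0 \<or> q p - r1\<^sup>2 > 0" using sq by linarith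
    then show ?thesis using eb0 add_pos_nonneg add_nonneg_pos unfolding u_def v_def by (metis less_irrefl)
  qed
  define \<beta> where "\<beta> p = u p * inverse (u p + v p)" for p
  show ?thesis
  proof (rule that[of \<beta>])
    show "sm UNIV \<beta>" unfolding \<beta>_def
      by (intro csm_mult csm_inverse csm_add smu smv open_UNIV pos)
    show "\<beta> p = 1" if "dist p0 p \<le> r1" for p
    proof -
      have "q p \<le> r1\<^sup>2" unfolding qd using that by (simp add: power_mono)
      then have "v p = 0" unfolding v_def using eb0(3) by simp
      then show ?thesis using pos[of p] by (simp add: \<beta>_def)
    qed
    show "\<beta> p = 0" if "r2 \<le> dist p0 p" for p
    proof -
      have "r2\<^sup>2 \<le> q p" unfolding qd using that assms by (simp add: power_mono)
      then have "u p = 0" unfolding u_def using eb0(3) by simp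
      then show ?thesis by (simp add: \<beta>_def)
    qed
  qed
qed

text \<open>W and the complement of K are open and cover the space; on the one the product is
  smooth, on the other it is 0.\<close>

lemma csm_cutoff:
  assumes W: "open W" and f: "csm P W f" and \<beta>: "sm UNIV \<beta>" and K: "closed K" "K \<subseteq> W" "\<And>x. x \<notin> K \<Longrightarrow> \<beta> x = (0::real)"
  shows "csm P UNIV (\<lambda>p x. if x \<in> W then \<beta> x *\<^sub>R f p x else 0)"
proof (rule csm_local)
  fix p x assume "p \<in> P"
  let ?g = "\<lambda>p x. if x \<in> W then \<beta> x *\<^sub>R f p x else 0"
  have "csm P W ?g"
    by (rule csm_cong[OF W _ csm_scaleR[OF W sm_csm[OF sm_subset[OF \<beta>] W] f]]) auto
  moreover have "csm P (- K) ?g"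
    by (rule csm_cong[of _ _ "\<lambda>_ _. 0"]) (use K in \<open>auto intro: csm_const\<close>)
  ultimately show "\<exists>S V. open S \<and> open V \<and> p \<in> S \<and> x \<in> V \<and> csm (P \<inter> S) (UNIV \<inter> V) ?g"
  proof (cases "x \<in> W")
    case True
    then show ?thesis using W \<open>csm P W ?g\<close> by (intro exI[of _ UNIV] exI[of _ W]) simp
  next
    case False
    then show ?thesis using K \<open>csm P (- K) ?g\<close>
      by (intro exI[of _ UNIV] exI[of _ "- K"]) (auto simp: open_Compl)
  qed
qed

lemma subspace_proj_exists:
  fixes S :: "'a::euclidean_space set"
  assumes "subspace S"
  shows "\<exists>P. linear P \<and> range P \<subseteq> S \<and> (\<forall>x\<in>S. P x = x)"
  using linear_exists_left_inverse_on[OF linear_id assms] by (auto simp: image_subset_iff)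

text \<open>Some linear retraction onto S. Composing with it extends maps from a relatively open
  subset of a subspace to an open subset of the ambient space, where Frechet derivatives are
  taken.\<close>

definition proj :: "'a::euclidean_space set \<Rightarrow> 'a \<Rightarrow> 'a" where
  "proj S = (SOME P. linear P \<and> range P \<subseteq> S \<and> (\<forall>x\<in>S. P x = x))"

lemma proj:
  assumes "subspace S"
  shows "linear (proj S)" "proj S x \<in> S" "x \<in> S \<Longrightarrow> proj S x = x"
  using someI_ex[OF subspace_proj_exists[OF assms]] unfolding proj_def by auto

subsection \<open>Germs of smooth functions on a manifold\<close>

text \<open>Smoothness of a germ. As a chart maps into a subspace, f is factored through a function
  on an open set of the ambient space. One chart suffices; \<open>sm_atE\<close> changes to any
  other.\<close>

definition sm_at :: "('m::topological_space, 'e::euclidean_space, 'z) manifold_scheme \<Rightarrow> ('m \<Rightarrow> 'b::real_normed_vector) \<Rightarrow> 'm \<Rightarrow> bool" where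
  "sm_at M f x \<longleftrightarrow> (\<exists>U \<kappa> N W g. (U,\<kappa>) \<in> charts M \<and> open N \<and> x \<in> N \<and> N \<subseteq> U \<and> open W \<and> \<kappa> ` N \<subseteq> W \<and>
     sm W g \<and> (\<forall>y\<in>N. f y = g (\<kappa> y)))"

lemma sm_atI:
  "(U,\<kappa>) \<in> charts M \<Longrightarrow> open N \<Longrightarrow> x \<in> N \<Longrightarrow> N \<subseteq> U \<Longrightarrow> open W \<Longrightarrow> \<kappa> ` N \<subseteq> W \<Longrightarrow> sm W g \<Longrightarrow>
    (\<And>y. y \<in> N \<Longrightarrow> f y = g (\<kappa> y)) \<Longrightarrow> sm_at M f x"
  unfolding sm_at_def by blast

locale smfd =
  fixes M :: "('m::{t2_space,second_countable_topology}, 'e::euclidean_space, 'z) manifold_scheme"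
  assumes mfd: "smooth_manifold M"
begin

lemma model_subspace: "subspace (model_space M)"
  using mfd by (simp add: smooth_manifold_def)

lemma chart_ex: "\<exists>U \<kappa>. (U,\<kappa>) \<in> charts M \<and> x \<in> U"
proof -
  have "(\<Union>(U,\<kappa>)\<in>charts M. U) = UNIV" using mfd unfolding smooth_manifold_def by (elim conjE)
  then have "x \<in> (\<Union>(U,\<kappa>)\<in>charts M. U)" by simp
  then show ?thesis by auto
qed

lemma chart:
  assumes "(U,\<kappa>) \<in> charts M"
  shows "open U" "openin (top_of_set (model_space M)) (\<kappa> ` U)" "homeomorphism U (\<kappa> ` U) \<kappa> (inv_into U \<kappa>)"
    "inj_on \<kappa> U" "continuous_on U \<kappa>" "continuous_on (\<kappa> ` U) (inv_into U \<kappa>)"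
    "x \<in> U \<Longrightarrow> inv_into U \<kappa> (\<kappa> x) = x" "x \<in> U \<Longrightarrow> \<kappa> x \<in> model_space M"
proof -
  show "open U" and 1: "openin (top_of_set (model_space M)) (\<kappa> ` U)" and h: "homeomorphism U (\<kappa> ` U) \<kappa> (inv_into U \<kappa>)"
  proof -
    have "\<forall>(U,\<kappa>)\<in>charts M. open U \<and> openin (top_of_set (model_space M)) (\<kappa> ` U) \<and>
        homeomorphism U (\<kappa> ` U) \<kappa> (inv_into U \<kappa>)" using mfd unfolding smooth_manifold_def by (elim conjE)
    from bspec[OF this assms] show "open U" "openin (top_of_set (model_space M)) (\<kappa> ` U)"
      "homeomorphism U (\<kappa> ` U) \<kappa> (inv_into U \<kappa>)" by auto
  qed
  show "continuous_on U \<kappa>" "continuous_on (\<kappa> ` U) (inv_into U \<kappa>)" using h unfolding homeomorphism_def by auto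
  show "inj_on \<kappa> U" using h unfolding homeomorphism_def inj_on_def by metis
  show "x \<in> U \<Longrightarrow> inv_into U \<kappa> (\<kappa> x) = x" using h unfolding homeomorphism_def by auto
  show "x \<in> U \<Longrightarrow> \<kappa> x \<in> model_space M" using openin_imp_subset[OF 1] by auto
qed

lemma chart_vimage_open:
  assumes "(U,\<kappa>) \<in> charts M" "open W" "open N"
  shows "open {y \<in> U \<inter> N. \<kappa> y \<in> W}"
proof -
  have "open (\<kappa> -` W \<inter> (U \<inter> N))"
    by (rule continuous_on_open_vimage[THEN iffD1, rule_format, OF _ continuous_on_subset[OF chart(5)[OF assms(1)]] assms(2)])
       (use chart(1)[OF assms(1)] assms(3) in auto)
  then show ?thesis by (simp add: vimage_def Int_def conj_commute)
qed

lemma chart_image_open: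
  assumes "(U,\<kappa>) \<in> charts M" "open N" "N \<subseteq> U"
  shows "\<exists>W. open W \<and> \<kappa> ` N = W \<inter> model_space M"
proof -
  have "openin (top_of_set (\<kappa> ` U)) (\<kappa> ` N)"
    by (rule homeomorphism_imp_open_map[OF chart(3)[OF assms(1)] open_subset[OF assms(3,2)]])
  then have "openin (top_of_set (model_space M)) (\<kappa> ` N)"
    using chart(2)[OF assms(1)] openin_trans by blast
  then show ?thesis unfolding openin_open by blast
qed

lemma chart_change:
  assumes "(U,\<kappa>) \<in> charts M" "(U',\<kappa>') \<in> charts M" "x \<in> U" "x \<in> U'"
  obtains N W \<tau> where "open N" "x \<in> N" "N \<subseteq> U \<inter> U'" "open W" "\<kappa> ` N \<subseteq> W" "sm W \<tau>" "\<And>y. y \<in> N \<Longrightarrow> \<kappa>' y = \<tau> (\<kappa> y)"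
proof -
  have "smooth_on (\<kappa> ` (U \<inter> U')) (\<lambda>y. \<kappa>' (inv_into U \<kappa> y))"
  proof -
    have "\<forall>(U,\<kappa>)\<in>charts M. \<forall>(U',\<kappa>')\<in>charts M.
        smooth_on (\<kappa> ` (U \<inter> U')) (\<lambda>y. \<kappa>' (inv_into U \<kappa> y))" using mfd unfolding smooth_manifold_def by (elim conjE)
    from bspec[OF this assms(1)] bspec[where x="(U',\<kappa>')", OF _ assms(2)] show ?thesis by auto
  qed
  moreover have "\<kappa> x \<in> \<kappa> ` (U \<inter> U')" using assms by blast
  ultimately obtain W g where W: "open W" "\<kappa> x \<in> W" "\<forall>k. Ck_on k W g" "\<forall>y\<in>W \<inter> \<kappa> ` (U \<inter> U'). g y = \<kappa>' (inv_into U \<kappa> y)"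
    unfolding smooth_on_def by blast
  show ?thesis
  proof (rule that[of "{y \<in> U \<inter> U'. \<kappa> y \<in> W}" W g])
    show "open {y \<in> U \<inter> U'. \<kappa> y \<in> W}" by (rule chart_vimage_open[OF assms(1) W(1) chart(1)[OF assms(2)]])
    show "sm W g" using W(3) sm_iff_Ck_on by blast
    show "\<kappa>' y = g (\<kappa> y)" if "y \<in> {y \<in> U \<inter> U'. \<kappa> y \<in> W}" for y
      using W(4) that chart(7)[OF assms(1), of y] by auto
  qed (use W assms in auto)
qed

lemma sm_atE:
  assumes "sm_at M f x" "(U,\<kappa>) \<in> charts M" "x \<in> U"
  obtains N W g where "open N" "x \<in> N" "N \<subseteq> U" "open W" "\<kappa> ` N \<subseteq> W" "sm W g" "\<And>y. y \<in> N \<Longrightarrow> f y = g (\<kappa> y)"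
proof -
  obtain U' \<kappa>' N' W' g' where 1: "(U',\<kappa>') \<in> charts M" "open N'" "x \<in> N'" "N' \<subseteq> U'" "open W'" "\<kappa>' ` N' \<subseteq> W'" "sm W' g'"
    "\<forall>y\<in>N'. f y = g' (\<kappa>' y)" using assms(1) unfolding sm_at_def by blast
  have "x \<in> U'" using 1 by blast
  obtain N W \<tau> where 2: "open N" "x \<in> N" "N \<subseteq> U \<inter> U'" "open W" "\<kappa> ` N \<subseteq> W" "sm W \<tau>" "\<And>y. y \<in> N \<Longrightarrow> \<kappa>' y = \<tau> (\<kappa> y)"
    by (rule chart_change[OF assms(2) 1(1) assms(3) \<open>x \<in> U'\<close>], rule that)
  define V where "V = \<tau> -` W' \<inter> W"
  have oV: "open V" unfolding V_def using sm_cont[OF 2(6)] 2(4) 1(5) continuous_on_open_vimage by blast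
  have smg: "sm V (\<lambda>p. g' (\<tau> p))"
    by (rule sm_compose[OF oV 1(5) _ 1(7) sm_subset[OF 2(6)]]) (auto simp: V_def)
  show ?thesis
  proof (rule that[of "N \<inter> N'" V, OF _ _ _ oV _ smg])
    show "\<kappa> ` (N \<inter> N') \<subseteq> V" using 1(6) 2(5,7) unfolding V_def by force
    show "f y = g' (\<tau> (\<kappa> y))" if "y \<in> N \<inter> N'" for y using that 1(8) 2(7) by auto
  qed (use 1 2 in auto)
qed

lemma sm_at_cong:
  assumes "sm_at M f x" "open N" "x \<in> N" "\<And>y. y \<in> N \<Longrightarrow> f y = g y"
  shows "sm_at M g x"
proof -
  obtain U \<kappa> where c: "(U,\<kappa>) \<in> charts M" "x \<in> U" using chart_ex by blast
  obtain N' W h where 1: "open N'" "x \<in> N'" "N' \<subseteq> U" "open W" "\<kappa> ` N' \<subseteq> W" "sm W h" "\<And>y. y \<in> N' \<Longrightarrow> f y = h (\<kappa> y)"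
    by (rule sm_atE[OF assms(1) c], rule that)
  show ?thesis
    by (rule sm_atI[OF c(1), of "N \<inter> N'" x W h]) (use 1 assms(2,3) assms(4)[symmetric] in auto)
qed

lemma sm_at_nbhd: "sm_at M f x \<Longrightarrow> \<exists>N. open N \<and> x \<in> N \<and> (\<forall>y\<in>N. sm_at M f y)"
  unfolding sm_at_def by blast

lemma sm_at_const: "sm_at M (\<lambda>_. c) x"
proof -
  obtain U \<kappa> where c: "(U,\<kappa>) \<in> charts M" "x \<in> U" using chart_ex by blast
  show ?thesis
    by (rule sm_atI[OF c(1), of U x UNIV "\<lambda>_. c"]) (use c chart(1)[OF c(1)] in \<open>auto intro!: csm_const\<close>)
qed

lemma sm_at_comp:
  assumes "sm_at M f x" "open W'" "f x \<in> W'" "sm W' F"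
  shows "sm_at M (\<lambda>y. F (f y)) x"
proof -
  obtain U \<kappa> where c: "(U,\<kappa>) \<in> charts M" "x \<in> U" using chart_ex by blast
  obtain N W g where 1: "open N" "x \<in> N" "N \<subseteq> U" "open W" "\<kappa> ` N \<subseteq> W" "sm W g" "\<And>y. y \<in> N \<Longrightarrow> f y = g (\<kappa> y)"
    by (rule sm_atE[OF assms(1) c], rule that)
  define V where "V = g -` W' \<inter> W"
  have oV: "open V" unfolding V_def using sm_cont[OF 1(6)] 1(4) assms(2) continuous_on_open_vimage by blast
  have "open {y \<in> U \<inter> N. \<kappa> y \<in> V}" by (rule chart_vimage_open[OF c(1) oV 1(1)])
  moreover have "sm V (\<lambda>p. F (g p))"
    by (rule sm_compose[OF oV assms(2) _ assms(4) sm_subset[OF 1(6)]]) (auto simp: V_def)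
  moreover have "x \<in> {y \<in> U \<inter> N. \<kappa> y \<in> V}" using 1 c assms(3) by (auto simp: V_def)
  ultimately show ?thesis
    by (intro sm_atI[OF c(1), of "{y \<in> U \<inter> N. \<kappa> y \<in> V}" x V "\<lambda>p. F (g p)"]) (use 1 oV in auto)
qed

lemma sm_at_bilinear:
  assumes "bounded_bilinear bil" "sm_at M f x" "sm_at M g x"
  shows "sm_at M (\<lambda>y. bil (f y) (g y)) x"
proof -
  obtain U \<kappa> where c: "(U,\<kappa>) \<in> charts M" "x \<in> U" using chart_ex by blast
  obtain N W h where 1: "open N" "x \<in> N" "N \<subseteq> U" "open W" "\<kappa> ` N \<subseteq> W" "sm W h" "\<And>y. y \<in> N \<Longrightarrow> f y = h (\<kappa> y)"
    by (rule sm_atE[OF assms(2) c], rule that)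
  obtain N' W' h' where 2: "open N'" "x \<in> N'" "N' \<subseteq> U" "open W'" "\<kappa> ` N' \<subseteq> W'" "sm W' h'" "\<And>y. y \<in> N' \<Longrightarrow> g y = h' (\<kappa> y)"
    by (rule sm_atE[OF assms(3) c], rule that)
  have "sm (W \<inter> W') (\<lambda>p. bil (h p) (h' p))"
    by (intro csm_bilinear[OF assms(1)] sm_subset[OF 1(6)] sm_subset[OF 2(6)]) (use 1 2 in auto)
  then show ?thesis
    by (intro sm_atI[OF c(1), of "N \<inter> N'" x "W \<inter> W'" "\<lambda>p. bil (h p) (h' p)"]) (use 1 2 in auto)
qed

lemma sm_at_bounded_linear: "bounded_linear L \<Longrightarrow> sm_at M f x \<Longrightarrow> sm_at M (\<lambda>y. L (f y)) x"
proof -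
  assume L: "bounded_linear L" and f: "sm_at M f x"
  have "bounded_bilinear (\<lambda>(c::real) v. c *\<^sub>R L v)"
    by (rule bounded_bilinear.comp[OF bounded_bilinear_scaleR bounded_linear_ident L])
  from sm_at_bilinear[OF this sm_at_const[of 1] f] show ?thesis by simp
qed

lemma sm_at_add: "sm_at M f x \<Longrightarrow> sm_at M g x \<Longrightarrow> sm_at M (\<lambda>y. f y + g y) x"
proof -
  assume a: "sm_at M f x" "sm_at M g x"
  obtain U \<kappa> where c: "(U,\<kappa>) \<in> charts M" "x \<in> U" using chart_ex by blast
  obtain N W h where 1: "open N" "x \<in> N" "N \<subseteq> U" "open W" "\<kappa> ` N \<subseteq> W" "sm W h" "\<And>y. y \<in> N \<Longrightarrow> f y = h (\<kappa> y)"
    by (rule sm_atE[OF a(1) c], rule that)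
  obtain N' W' h' where 2: "open N'" "x \<in> N'" "N' \<subseteq> U" "open W'" "\<kappa> ` N' \<subseteq> W'" "sm W' h'" "\<And>y. y \<in> N' \<Longrightarrow> g y = h' (\<kappa> y)"
    by (rule sm_atE[OF a(2) c], rule that)
  have "sm (W \<inter> W') (\<lambda>p. h p + h' p)"
    by (intro csm_add sm_subset[OF 1(6)] sm_subset[OF 2(6)]) (use 1 2 in auto)
  then show ?thesis
    by (intro sm_atI[OF c(1), of "N \<inter> N'" x "W \<inter> W'" "\<lambda>p. h p + h' p"]) (use 1 2 in auto)
qed

lemma sm_at_sum: "(\<And>i. i \<in> I \<Longrightarrow> sm_at M (f i) x) \<Longrightarrow> sm_at M (\<lambda>y. \<Sum>i\<in>I. f i y) x"
  by (induction I rule: infinite_finite_induct) (simp_all add: sm_at_const sm_at_add)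

lemmas sm_at_scaleR = sm_at_bilinear[OF bounded_bilinear_scaleR]
lemmas sm_at_mult = sm_at_bilinear[OF bounded_bilinear_mult]
lemmas sm_at_inner_right = sm_at_bounded_linear[OF bounded_linear_inner_left]

lemma sm_at_chart:
  assumes "(U,\<kappa>) \<in> charts M" "x \<in> U" shows "sm_at M \<kappa> x"
  by (rule sm_atI[OF assms(1), of U x UNIV "\<lambda>p. p"]) (use assms chart(1)[OF assms(1)] in \<open>auto intro: csm_id\<close>)

lemma smooth_fun_on_iff:
  fixes f :: "'m \<Rightarrow> 'b::euclidean_space"
  assumes "open S"
  shows "smooth_fun_on M S f \<longleftrightarrow> (\<forall>x\<in>S. sm_at M f x)"
proof
  assume L: "smooth_fun_on M S f"
  show "\<forall>x\<in>S. sm_at M f x"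
  proof
    fix x assume x: "x \<in> S"
    obtain U \<kappa> where c: "(U,\<kappa>) \<in> charts M" "x \<in> U" using chart_ex by blast
    then have "smooth_on (\<kappa> ` (U \<inter> S)) (\<lambda>y. f (inv_into U \<kappa> y))" using L unfolding smooth_fun_on_def by blast
    moreover have "\<kappa> x \<in> \<kappa> ` (U \<inter> S)" using x c by blast
    ultimately obtain W g where W: "open W" "\<kappa> x \<in> W" "\<forall>k. Ck_on k W g" "\<forall>y\<in>W \<inter> \<kappa> ` (U \<inter> S). g y = f (inv_into U \<kappa> y)"
      unfolding smooth_on_def by blast
    show "sm_at M f x"
    proof (rule sm_atI[OF c(1), of "{y \<in> U \<inter> S. \<kappa> y \<in> W}" x W g])
      show "open {y \<in> U \<inter> S. \<kappa> y \<in> W}" by (rule chart_vimage_open[OF c(1) W(1) assms])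
      show "sm W g" using W(3) sm_iff_Ck_on by blast
      show "f y = g (\<kappa> y)" if "y \<in> {y \<in> U \<inter> S. \<kappa> y \<in> W}" for y
        using W(4) that chart(7)[OF c(1), of y] by auto
    qed (use W x c in auto)
  qed
next
  assume R: "\<forall>x\<in>S. sm_at M f x"
  have "smooth_on (\<kappa> ` (U \<inter> S)) (\<lambda>y. f (inv_into U \<kappa> y))" if c: "(U,\<kappa>) \<in> charts M" for U \<kappa>
    unfolding smooth_on_def
  proof
    fix p assume "p \<in> \<kappa> ` (U \<inter> S)"
    then obtain x where x: "p = \<kappa> x" "x \<in> U" "x \<in> S" by blast
    obtain N W g where 1: "open N" "x \<in> N" "N \<subseteq> U" "open W" "\<kappa> ` N \<subseteq> W" "sm W g" "\<And>y. y \<in> N \<Longrightarrow> f y = g (\<kappa> y)"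
      by (rule sm_atE[OF R[rule_format, OF x(3)] c x(2)], rule that)
    \<comment> \<open>The image of N is open in the model space only. Intersecting with V ensures
      that chart values close to p come from points of N, where g represents f.\<close>
    obtain V where V: "open V" "\<kappa> ` N = V \<inter> model_space M" using chart_image_open[OF c 1(1,3)] by blast
    show "\<exists>W g. open W \<and> p \<in> W \<and> (\<forall>k. Ck_on k W g) \<and> (\<forall>y\<in>W \<inter> \<kappa> ` (U \<inter> S). g y = f (inv_into U \<kappa> y))"
    proof (intro exI[of _ "V \<inter> W"] exI[of _ g] conjI)
      show "p \<in> V \<inter> W" using x 1 V by blast
      show "\<forall>k. Ck_on k (V \<inter> W) g" using sm_subset[OF 1(6), of "V \<inter> W"] sm_iff_Ck_on by blast
      show "\<forall>y\<in>V \<inter> W \<inter> \<kappa> ` (U \<inter> S). g y = f (inv_into U \<kappa> y)"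
      proof
        fix q assume q: "q \<in> V \<inter> W \<inter> \<kappa> ` (U \<inter> S)"
        then obtain y where y: "q = \<kappa> y" "y \<in> U" by blast
        have "q \<in> V \<inter> model_space M" using q y chart(8)[OF c y(2)] by simp
        then have "q \<in> \<kappa> ` N" using V(2) by simp
        then obtain y' where y': "q = \<kappa> y'" "y' \<in> N" by blast
        have "y = y'" by (rule inj_onD[OF chart(4)[OF c]]) (use y y' 1(3) in auto)
        then have "y \<in> N" using y' by simp
        then show "g q = f (inv_into U \<kappa> q)" using y 1(7) chart(7)[OF c y(2)] by simp
      qed
    qed (use V 1 in auto)
  qed
  then show "smooth_fun_on M S f" unfolding smooth_fun_on_def by blast
qed

lemma smooth_function_iff: "smooth_function M g \<longleftrightarrow> (\<forall>x. sm_at M g x)"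
  by (simp add: smooth_fun_on_iff)

lemma sm_at_pullback:
  assumes g: "sm_at M g (F x)" and N: "open N" "x \<in> N" "continuous_on N F"
    and c: "(U,\<kappa>) \<in> charts M" "F x \<in> U" and s: "sm_at M (\<lambda>y. \<kappa> (F y)) x"
  shows "sm_at M (\<lambda>y. g (F y)) x"
proof -
  obtain N' W h where 1: "open N'" "F x \<in> N'" "N' \<subseteq> U" "open W" "\<kappa> ` N' \<subseteq> W" "sm W h" "\<And>y. y \<in> N' \<Longrightarrow> g y = h (\<kappa> y)"
    by (rule sm_atE[OF g c], rule that)
  have "sm_at M (\<lambda>y. h (\<kappa> (F y))) x"
    by (rule sm_at_comp[OF s 1(4) _ 1(6)]) (use 1 in auto)
  moreover have "open (F -` N' \<inter> N)" using N 1(1) continuous_on_open_vimage by blast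
  ultimately show ?thesis
    by (rule sm_at_cong) (use 1 N in auto)
qed

text \<open>A bump function in the chart, extended by 0. It vanishes off the image of the compact
  set \<open>C\<close>, which is closed since M is Hausdorff; this makes the extension smooth.
  \<open>C\<close> is cut down to the model space, where the chart takes its values.\<close>

lemma bump:
  assumes "open S" "x \<in> S"
  obtains \<eta> N K where "\<And>y. sm_at M (\<eta> :: 'm \<Rightarrow> real) y" "open N" "x \<in> N" "N \<subseteq> S" "\<And>y. y \<in> N \<Longrightarrow> \<eta> y = 1"
    "closed K" "K \<subseteq> S" "\<And>y. y \<notin> K \<Longrightarrow> \<eta> y = 0"
proof -
  obtain U \<kappa> where c: "(U,\<kappa>) \<in> charts M" "x \<in> U" using chart_ex by blast
  obtain V where V: "open V" "\<kappa> ` (U \<inter> S) = V \<inter> model_space M"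
    using chart_image_open[OF c(1), of "U \<inter> S"] chart(1)[OF c(1)] assms(1) by auto
  have "\<kappa> x \<in> V" using V c assms by blast
  then obtain r where r: "r > 0" "cball (\<kappa> x) r \<subseteq> V" using V(1) open_contains_cball by blast
  obtain \<beta> :: "'e \<Rightarrow> real" where \<beta>: "sm UNIV \<beta>" "\<And>p. dist (\<kappa> x) p \<le> r/2 \<Longrightarrow> \<beta> p = 1" "\<And>p. r \<le> dist (\<kappa> x) p \<Longrightarrow> \<beta> p = 0"
    by (rule bump_exists[of "r/2" r "\<kappa> x"]) (use r(1) that in auto)
  define C where "C = cball (\<kappa> x) r \<inter> model_space M"
  have CU: "C \<subseteq> \<kappa> ` (U \<inter> S)" unfolding C_def V(2) using r by blast
  have "compact C" unfolding C_def by (rule compact_Int_closed[OF compact_cball closed_subspace[OF model_subspace]])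
  then have "compact (inv_into U \<kappa> ` C)"
    by (rule compact_continuous_image[rotated]) (rule continuous_on_subset[OF chart(6)[OF c(1)]], use CU in blast)
  then have cK: "closed (inv_into U \<kappa> ` C)" by (rule compact_imp_closed)
  have KS: "inv_into U \<kappa> ` C \<subseteq> U \<inter> S" using CU chart(7)[OF c(1)] by auto
  define \<eta> :: "'m \<Rightarrow> real" where "\<eta> y = (if y \<in> U then \<beta> (\<kappa> y) else 0)" for y
  have z: "\<eta> y = 0" if "y \<notin> inv_into U \<kappa> ` C" for y
  proof (cases "y \<in> U")
    case True
    have "\<kappa> y \<notin> C" using that chart(7)[OF c(1) True] by (metis image_eqI)
    then have "r \<le> dist (\<kappa> x) (\<kappa> y)" using chart(8)[OF c(1) True] by (auto simp: C_def)
    then show ?thesis using \<beta>(3) by (simp add: \<eta>_def)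
  qed (simp add: \<eta>_def)
  have smU: "sm_at M \<eta> y" if "y \<in> U" for y
    by (rule sm_at_cong[OF sm_at_comp[OF sm_at_chart[OF c(1) that] open_UNIV UNIV_I \<beta>(1)] chart(1)[OF c(1)] that])
       (simp add: \<eta>_def)
  have sm0: "sm_at M \<eta> y" if "y \<notin> inv_into U \<kappa> ` C" for y
    by (rule sm_at_cong[OF sm_at_const[of 0], of "- (inv_into U \<kappa> ` C)"]) (use that cK z in \<open>auto simp: open_Compl\<close>)
  show ?thesis
  proof (rule that[of \<eta> "{y \<in> U \<inter> S. \<kappa> y \<in> ball (\<kappa> x) (r/2)}" "inv_into U \<kappa> ` C"])
    show "sm_at M \<eta> y" for y using smU sm0 KS by blast
    show "open {y \<in> U \<inter> S. \<kappa> y \<in> ball (\<kappa> x) (r/2)}" by (rule chart_vimage_open[OF c(1) open_ball assms(1)])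
    show "\<eta> y = 1" if "y \<in> {y \<in> U \<inter> S. \<kappa> y \<in> ball (\<kappa> x) (r/2)}" for y
      using that \<beta>(2) by (simp add: \<eta>_def)
  qed (use c assms r cK KS z in auto)
qed

text \<open>Tangent vectors act properly on globally smooth functions only, so germs have to be
  represented by such functions.\<close>

lemma extend_fun:
  fixes f :: "'m \<Rightarrow> 'b::real_normed_vector"
  assumes "sm_at M f x"
  obtains g N where "\<And>y. sm_at M g y" "open N" "x \<in> N" "\<And>y. y \<in> N \<Longrightarrow> g y = f y"
proof -
  obtain S where S: "open S" "x \<in> S" "\<forall>y\<in>S. sm_at M f y" using sm_at_nbhd[OF assms] by blast
  obtain \<eta> N K where \<eta>: "\<And>y. sm_at M (\<eta> :: 'm \<Rightarrow> real) y" "open N" "x \<in> N" "N \<subseteq> S" "\<And>y. y \<in> N \<Longrightarrow> \<eta> y = 1"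
    "closed K" "K \<subseteq> S" "\<And>y. y \<notin> K \<Longrightarrow> \<eta> y = 0" by (rule bump[OF S(1,2)], rule that)
  define g where "g y = \<eta> y *\<^sub>R f y" for y
  have "sm_at M g y" for y
  proof (cases "y \<in> S")
    case True
    then show ?thesis unfolding g_def using sm_at_scaleR[OF \<eta>(1)] S(3) by blast
  next
    case False
    show ?thesis
      by (rule sm_at_cong[OF sm_at_const[of 0], of "- K"]) (use False \<eta> in \<open>auto simp: open_Compl g_def\<close>)
  qed
  then show ?thesis by (rule that[OF _ \<eta>(2,3)]) (simp_all add: g_def \<eta>(5))
qed

section \<open>Tangent vectors as derivations\<close>

lemma tangent_lin:
  assumes "D \<in> tangent_space M x" "\<And>y. sm_at M u y" "\<And>y. sm_at M v y"
  shows "D (\<lambda>y. c * u y + d * v y) = c * D u + d * D v"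
proof -
  have "smooth_function M u" "smooth_function M v" using assms by (auto simp: smooth_function_iff)
  with assms(1) show ?thesis unfolding tangent_space_def by blast
qed

lemma tangent_leibniz:
  assumes "D \<in> tangent_space M x" "\<And>y. sm_at M u y" "\<And>y. sm_at M v y"
  shows "D (\<lambda>y. u y * v y) = D u * v x + u x * D v"
proof -
  have "smooth_function M u" "smooth_function M v" using assms by (auto simp: smooth_function_iff)
  with assms(1) show ?thesis unfolding tangent_space_def by blast
qed

lemma tangent_const:
  assumes D: "D \<in> tangent_space M x" shows "D (\<lambda>_. c) = 0"
proof -
  have 1: "D (\<lambda>_. 1) = 0" using tangent_leibniz[OF D sm_at_const sm_at_const, of 1 1] by simp
  show ?thesis using tangent_lin[OF D sm_at_const sm_at_const, of c 1 0 1] 1 by simp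
qed

lemma tangent_sum:
  assumes D: "D \<in> tangent_space M x" and "\<And>i y. i \<in> I \<Longrightarrow> sm_at M (f i) y"
  shows "D (\<lambda>y. \<Sum>i\<in>I. f i y) = (\<Sum>i\<in>I. D (f i))"
  using assms(2)
proof (induction I rule: infinite_finite_induct)
  case (insert i I)
  have "D (\<lambda>y. 1 * f i y + 1 * (\<Sum>i\<in>I. f i y)) = 1 * D (f i) + 1 * D (\<lambda>y. \<Sum>i\<in>I. f i y)"
    by (rule tangent_lin[OF D]) (use insert in \<open>auto intro: sm_at_sum\<close>)
  then show ?case using insert by simp
qed (simp_all add: tangent_const[OF D])

text \<open>The difference u = g - h equals v u with v = 1 - \<eta>, and both factors vanish at x,
  so the Leibniz rule gives D u = 0.\<close>

lemma derivation_local: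
  assumes D: "D \<in> tangent_space M x" and g: "\<And>y. sm_at M g y" "\<And>y. sm_at M h y"
    and N: "open N" "x \<in> N" "\<And>y. y \<in> N \<Longrightarrow> g y = h y"
  shows "D g = D h"
proof -
  note lin = tangent_lin[OF D] and leib = tangent_leibniz[OF D]
  obtain \<eta> N' K where \<eta>: "\<And>y. sm_at M (\<eta> :: 'm \<Rightarrow> real) y" "open N'" "x \<in> N'" "N' \<subseteq> N" "\<And>y. y \<in> N' \<Longrightarrow> \<eta> y = 1"
    "closed K" "K \<subseteq> N" "\<And>y. y \<notin> K \<Longrightarrow> \<eta> y = 0" by (rule bump[OF N(1,2)], rule that)
  define u where "u = (\<lambda>y. 1 * g y + (-1) * h y)"
  define v where "v = (\<lambda>y. 1 * 1 + (-1) * \<eta> y)"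
  have smu: "sm_at M u y" for y unfolding u_def by (intro sm_at_add sm_at_mult sm_at_const g)
  have smv: "sm_at M v y" for y unfolding v_def by (intro sm_at_add sm_at_mult sm_at_const \<eta>)
  have "(\<lambda>y. v y * u y) = u"
  proof
    fix y show "v y * u y = u y"
      using N(3)[of y] \<eta>(7) \<eta>(8)[of y] by (cases "y \<in> K") (auto simp: u_def v_def)
  qed
  then have "D u = D v * u x + v x * D u" using leib[OF smv smu] by simp
  also have "\<dots> = 0" using \<eta>(5)[OF \<eta>(3)] N(3)[OF N(2)] by (simp add: u_def v_def)
  finally show ?thesis using lin[OF g, of 1 "-1"] by (simp add: u_def)
qed

text \<open>Near x, g is its value at x plus products of coordinate increments with Hadamard
  coefficients. The increments vanish at x, so in the Leibniz rule only the values of the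
  coefficients at x survive, and these are the partial derivatives.\<close>

lemma derivation_hadamard:
  assumes D: "D \<in> tangent_space M x" and c: "(U,\<kappa>) \<in> charts M" "x \<in> U" and g: "\<And>y. sm_at M g y"
    and N: "open N" "x \<in> N" "N \<subseteq> U" and W: "open W" "\<kappa> ` N \<subseteq> W" "sm W G" "\<And>y. y \<in> N \<Longrightarrow> g y = G (\<kappa> y)"
    and k: "\<And>b y. b \<in> Basis \<Longrightarrow> sm_at M (k b) y" "\<And>b y. b \<in> Basis \<Longrightarrow> y \<in> N \<Longrightarrow> k b y = \<kappa> y \<bullet> b"
  shows "D g = frechet_derivative G (at (\<kappa> x)) (\<Sum>b\<in>Basis. D (k b) *\<^sub>R b)"
proof -
  have "\<kappa> x \<in> W" using W N by blast
  then obtain r where r: "r > 0" "ball (\<kappa> x) r \<subseteq> W" using W(1) open_contains_ball by blast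
  define H where "H b p = integral {0..1} (\<lambda>\<theta>. frechet_derivative G (at (\<kappa> x + \<theta> *\<^sub>R (p - \<kappa> x))) b)" for b p
  have inb: "\<kappa> x + \<theta> *\<^sub>R (p - \<kappa> x) \<in> ball (\<kappa> x) r" if "p \<in> ball (\<kappa> x) r" "\<theta> \<in> {0..1}" for p \<theta>
  proof -
    have "norm (\<theta> *\<^sub>R (p - \<kappa> x)) \<le> norm (p - \<kappa> x)" using that by (simp add: mult_left_le_one_le)
    then show ?thesis using that by (simp add: dist_norm norm_minus_commute)
  qed
  have smb: "sm (ball (\<kappa> x) r) G" by (rule sm_subset[OF W(3) r(2)])
  have smH: "sm (ball (\<kappa> x) r) (H b)" for b
    unfolding H_def
  proof (rule csmI)
    fix k
    have "csm ({0::real} \<times> {0..1::real}) (ball (\<kappa> x) r) (\<lambda>q p. frechet_derivative G (at (\<kappa> x + snd q *\<^sub>R (p - \<kappa> x))) b)"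
    proof (rule csm_compose[where f="\<lambda>q z. frechet_derivative G (at z) b" and g="\<lambda>q p. \<kappa> x + snd q *\<^sub>R (p - \<kappa> x)", OF open_ball open_ball])
      show "csm ({0::real} \<times> {0..1::real}) (ball (\<kappa> x) r) (\<lambda>q z. frechet_derivative G (at z) b)"
        by (rule sm_csm[OF csm_frechet[OF smb] open_ball])
      show "csm ({0::real} \<times> {0..1::real}) (ball (\<kappa> x) r) (\<lambda>q p. \<kappa> x + snd q *\<^sub>R (p - \<kappa> x))"
        by (intro csm_add csm_scaleR csm_diff csm_const csm_id open_ball continuous_intros)
    qed (use inb in auto)
    from Ckp_integral[OF open_ball csmD[OF this]]
    show "Ckp k {0::real} (ball (\<kappa> x) r) (\<lambda>_ p. integral {0..1} (\<lambda>\<theta>. frechet_derivative G (at (\<kappa> x + \<theta> *\<^sub>R (p - \<kappa> x))) b))"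
      by simp
  qed
  have "sm_at M (\<lambda>y. H b (\<kappa> y)) x" for b
    by (rule sm_at_comp[OF sm_at_chart[OF c] open_ball _ smH]) (use r in simp)
  then have "\<exists>h S. (\<forall>y. sm_at M h y) \<and> open S \<and> x \<in> S \<and> (\<forall>y\<in>S. h y = H b (\<kappa> y))" for b
    using extend_fun[of "\<lambda>y. H b (\<kappa> y)" x] by metis
  then obtain h S where h: "\<And>b y. sm_at M (h b) y" "\<And>b. open (S b)" "\<And>b. x \<in> S b" "\<And>b y. y \<in> S b \<Longrightarrow> h b y = H b (\<kappa> y)"
    by metis
  define N' where "N' = {y \<in> U \<inter> N. \<kappa> y \<in> ball (\<kappa> x) r} \<inter> (\<Inter>b\<in>Basis. S b)"
  have oN': "open N'" unfolding N'_def
    by (intro open_Int chart_vimage_open[OF c(1) open_ball N(1)] open_INT ballI h(2) finite_Basis)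
  have xN': "x \<in> N'" using h(3) c N r by (simp add: N'_def)
  \<comment> \<open>All pieces are global functions with the right germ at x, so that D may be
    applied to each of them and locality identifies D R with D g.\<close>
  define R where "R = (\<lambda>y. 1 * G (\<kappa> x) + 1 * (\<Sum>b\<in>Basis. (1 * k b y + (- k b x) * 1) * h b y))"
  have smk: "sm_at M (\<lambda>y. 1 * k b y + (- k b x) * 1) y" if "b \<in> Basis" for b y
    by (intro sm_at_add sm_at_mult sm_at_const k(1) that)
  have smkh: "sm_at M (\<lambda>y. (1 * k b y + (- k b x) * 1) * h b y) y" if "b \<in> Basis" for b y
    by (intro sm_at_mult smk h(1) that)
  have smR: "sm_at M R y" for y unfolding R_def
    by (rule sm_at_add[OF sm_at_const sm_at_mult[OF sm_at_const sm_at_sum[OF smkh]]])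
  have gR: "g y = R y" if y: "y \<in> N'" for y
  proof -
    have p: "\<kappa> y \<in> ball (\<kappa> x) r" "y \<in> N" "\<And>b. b \<in> Basis \<Longrightarrow> y \<in> S b" using y by (auto simp: N'_def)
    have "closed_segment (\<kappa> x) (\<kappa> y) \<subseteq> ball (\<kappa> x) r" using p(1) r(1) by (intro closed_segment_subset) auto
    from Ckp_Suc_hadamard[OF csmD[OF smb] _ this, where p=0]
    have "G (\<kappa> y) - G (\<kappa> x) = (\<Sum>b\<in>Basis. ((\<kappa> y - \<kappa> x) \<bullet> b) *\<^sub>R H b (\<kappa> y))" by (simp add: H_def)
    also have "\<dots> = (\<Sum>b\<in>Basis. (1 * k b y + (- k b x) * 1) * h b y)"
      by (rule sum.cong) (use k(2) p N(2) h(4) in \<open>simp_all add: inner_diff_left\<close>)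
    finally show ?thesis using W(4)[OF p(2)] by (simp add: R_def)
  qed
  have "D g = D R" by (rule derivation_local[OF D g smR oN' xN' gR])
  also have "\<dots> = 1 * D (\<lambda>_. G (\<kappa> x)) + 1 * D (\<lambda>y. \<Sum>b\<in>Basis. (1 * k b y + (- k b x) * 1) * h b y)"
    unfolding R_def by (rule tangent_lin[OF D sm_at_const sm_at_sum[OF smkh]])
  also have "\<dots> = (\<Sum>b\<in>Basis. D (\<lambda>y. (1 * k b y + (- k b x) * 1) * h b y))"
    using tangent_const[OF D] tangent_sum[OF D, of Basis, OF smkh] by simp
  also have "\<dots> = (\<Sum>b\<in>Basis. D (k b) * frechet_derivative G (at (\<kappa> x)) b)"
  proof (rule sum.cong[OF refl])
    fix b :: 'e assume b: "b \<in> Basis"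
    have "D (\<lambda>y. (1 * k b y + (- k b x) * 1) * h b y)
        = D (\<lambda>y. 1 * k b y + (- k b x) * 1) * h b x + (1 * k b x + (- k b x) * 1) * D (h b)"
      by (rule tangent_leibniz[OF D smk[OF b] h(1)])
    moreover have "D (\<lambda>y. 1 * k b y + (- k b x) * 1) = 1 * D (k b) + (- k b x) * D (\<lambda>_. 1)"
      by (rule tangent_lin[OF D k(1)[OF b] sm_at_const])
    moreover have "h b x = frechet_derivative G (at (\<kappa> x)) b" using h(3,4) by (simp add: H_def)
    ultimately show "D (\<lambda>y. (1 * k b y + (- k b x) * 1) * h b y) = D (k b) * frechet_derivative G (at (\<kappa> x)) b"
      by (simp add: tangent_const[OF D])
  qed
  also have "\<dots> = frechet_derivative G (at (\<kappa> x)) (\<Sum>b\<in>Basis. D (k b) *\<^sub>R b)"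
    using has_derivative_linear[OF sm_has_derivative[OF W(3) \<open>\<kappa> x \<in> W\<close>]]
    by (simp add: linear_sum linear_cmul)
  finally show ?thesis .
qed

end

subsection \<open>Sections and brackets\<close>

locale vbundle =
  fixes A :: "('m::{t2_space,second_countable_topology}, 'e::euclidean_space,
    'v::real_vector, 'f::euclidean_space, 'z) vector_bundle_scheme"
  assumes vb: "smooth_vector_bundle A"

sublocale vbundle \<subseteq> smfd A
  using vb unfolding smooth_vector_bundle_def by unfold_locales (elim conjE)

context vbundle
begin

abbreviation "PF \<equiv> proj (typical_fibre A)"

lemma subspaces: "subspace (typical_fibre A)" "subspace (fibre A x)"
  using vb unfolding smooth_vector_bundle_def by (elim conjE, simp)+

lemmas PF = proj[OF subspaces(1)]

lemma fibre_ops: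
  "0 \<in> fibre A x" "a \<in> fibre A x \<Longrightarrow> b \<in> fibre A x \<Longrightarrow> a + b \<in> fibre A x"
  "a \<in> fibre A x \<Longrightarrow> b \<in> fibre A x \<Longrightarrow> a - b \<in> fibre A x"
  "a \<in> fibre A x \<Longrightarrow> c *\<^sub>R a \<in> fibre A x" "a \<in> fibre A x \<Longrightarrow> - a \<in> fibre A x"
  using subspaces(2)[of x] by (auto simp: subspace_0 subspace_add subspace_diff subspace_scale subspace_neg)

lemma fibre_sum: "(\<And>i. i \<in> I \<Longrightarrow> h i \<in> fibre A x) \<Longrightarrow> (\<Sum>i\<in>I. h i) \<in> fibre A x"
  using subspace_sum[OF subspaces(2)] by blast

lemma triv_ex: "\<exists>V \<psi>. (V,\<psi>) \<in> trivs A \<and> x \<in> V"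
proof -
  have "(\<Union>(U,\<psi>)\<in>trivs A. U) = UNIV" using vb unfolding smooth_vector_bundle_def by (elim conjE)
  then have "x \<in> (\<Union>(U,\<psi>)\<in>trivs A. U)" by simp
  then show ?thesis by auto
qed

abbreviation triv_inv :: "('m \<Rightarrow> 'v \<Rightarrow> 'f) \<Rightarrow> 'm \<Rightarrow> 'f \<Rightarrow> 'v" where
  "triv_inv \<psi> x \<equiv> inv_into (fibre A x) (\<psi> x)"

lemma assumes "(V,\<psi>) \<in> trivs A" shows triv_open: "open V"
  and triv_lb: "x \<in> V \<Longrightarrow> linear_between (fibre A x) (typical_fibre A) (\<psi> x)"
  and triv_bij: "x \<in> V \<Longrightarrow> bij_betw (\<psi> x) (fibre A x) (typical_fibre A)"
proof -
  have "\<forall>(U,\<psi>)\<in>trivs A. open U \<and> (\<forall>x\<in>U. linear_between (fibre A x) (typical_fibre A) (\<psi> x) \<and>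
               bij_betw (\<psi> x) (fibre A x) (typical_fibre A))"
    using vb unfolding smooth_vector_bundle_def by (elim conjE)
  from bspec[OF this assms] show "open V" "x \<in> V \<Longrightarrow> linear_between (fibre A x) (typical_fibre A) (\<psi> x)"
    "x \<in> V \<Longrightarrow> bij_betw (\<psi> x) (fibre A x) (typical_fibre A)" by auto
qed

lemma triv_smooth:
  assumes "(V,\<psi>) \<in> trivs A" "(V',\<psi>') \<in> trivs A" "w \<in> typical_fibre A" "x \<in> V" "x \<in> V'"
  shows "sm_at A (\<lambda>y. \<psi>' y (triv_inv \<psi> y w)) x"
proof -
  have "\<forall>(U,\<psi>)\<in>trivs A. \<forall>(U',\<psi>')\<in>trivs A. \<forall>w\<in>typical_fibre A.
        smooth_fun_on A (U \<inter> U') (\<lambda>x. \<psi>' x (inv_into (fibre A x) (\<psi> x) w))"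
    using vb unfolding smooth_vector_bundle_def by (elim conjE)
  from bspec[OF this assms(1)] bspec[where x="(V',\<psi>')", OF _ assms(2)] assms(3)
  have "smooth_fun_on A (V \<inter> V') (\<lambda>x. \<psi>' x (inv_into (fibre A x) (\<psi> x) w))" by auto
  moreover have "open (V \<inter> V')" using triv_open assms by blast
  ultimately show ?thesis using smooth_fun_on_iff assms(4,5) by blast
qed

context
  fixes V \<psi> x assumes V: "(V,\<psi>) \<in> trivs A" and x: "x \<in> V"
begin

lemma triv_in: "a \<in> fibre A x \<Longrightarrow> \<psi> x a \<in> typical_fibre A"
  using triv_lb[OF V x] by (auto simp: linear_between_def)

lemma triv_inv_in: "w \<in> typical_fibre A \<Longrightarrow> triv_inv \<psi> x w \<in> fibre A x"
  using triv_bij[OF V x] by (metis bij_betw_imp_surj_on inv_into_into)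

lemma triv_triv_inv: "w \<in> typical_fibre A \<Longrightarrow> \<psi> x (triv_inv \<psi> x w) = w"
  using bij_betw_inv_into_right[OF triv_bij[OF V x]] .

lemma triv_inv_triv: "a \<in> fibre A x \<Longrightarrow> triv_inv \<psi> x (\<psi> x a) = a"
  using bij_betw_inv_into_left[OF triv_bij[OF V x]] .

lemma triv_inj: "a \<in> fibre A x \<Longrightarrow> b \<in> fibre A x \<Longrightarrow> \<psi> x a = \<psi> x b \<Longrightarrow> a = b"
  by (metis triv_inv_triv)

lemma triv_lin: "a \<in> fibre A x \<Longrightarrow> b \<in> fibre A x \<Longrightarrow> \<psi> x (c *\<^sub>R a + d *\<^sub>R b) = c *\<^sub>R \<psi> x a + d *\<^sub>R \<psi> x b"
  using triv_lb[OF V x] by (auto simp: linear_between_def)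

lemma triv_ops:
  "\<psi> x 0 = 0" "a \<in> fibre A x \<Longrightarrow> b \<in> fibre A x \<Longrightarrow> \<psi> x (a + b) = \<psi> x a + \<psi> x b"
  "a \<in> fibre A x \<Longrightarrow> \<psi> x (c *\<^sub>R a) = c *\<^sub>R \<psi> x a" "a \<in> fibre A x \<Longrightarrow> \<psi> x (- a) = - \<psi> x a"
  "a \<in> fibre A x \<Longrightarrow> b \<in> fibre A x \<Longrightarrow> \<psi> x (a - b) = \<psi> x a - \<psi> x b"
  using triv_lin[of 0 0 0 0] triv_lin[of a b 1 1] triv_lin[of a a c 0] triv_lin[of a a "-1" 0] triv_lin[of a b 1 "-1"] fibre_ops
  by auto

lemma triv_sum: "(\<And>i. i \<in> I \<Longrightarrow> h i \<in> fibre A x) \<Longrightarrow> \<psi> x (\<Sum>i\<in>I. h i) = (\<Sum>i\<in>I. \<psi> x (h i))"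
  by (induction I rule: infinite_finite_induct) (simp_all add: triv_ops fibre_sum)

lemma triv_inv_lin:
  assumes "w \<in> typical_fibre A" "w' \<in> typical_fibre A"
  shows "triv_inv \<psi> x (c *\<^sub>R w + d *\<^sub>R w') = c *\<^sub>R triv_inv \<psi> x w + d *\<^sub>R triv_inv \<psi> x w'"
proof (rule triv_inj)
  have "c *\<^sub>R w + d *\<^sub>R w' \<in> typical_fibre A" using assms subspaces(1) by (simp add: subspace_add subspace_scale)
  then show "triv_inv \<psi> x (c *\<^sub>R w + d *\<^sub>R w') \<in> fibre A x"
    "\<psi> x (triv_inv \<psi> x (c *\<^sub>R w + d *\<^sub>R w')) = \<psi> x (c *\<^sub>R triv_inv \<psi> x w + d *\<^sub>R triv_inv \<psi> x w')"
    using assms by (simp_all add: triv_inv_in triv_triv_inv triv_lin)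
  show "c *\<^sub>R triv_inv \<psi> x w + d *\<^sub>R triv_inv \<psi> x w' \<in> fibre A x" using assms by (simp add: fibre_ops triv_inv_in)
qed

text \<open>The images \<open>PF b\<close> of the standard basis span the typical fibre; they serve as a redundant frame,
  which avoids choosing a basis of a subspace.\<close>

lemma triv_expand:
  assumes "a \<in> fibre A x"
  shows "a = (\<Sum>b\<in>Basis. (\<psi> x a \<bullet> b) *\<^sub>R triv_inv \<psi> x (PF b))"
proof (rule triv_inj[OF assms])
  have f: "(\<psi> x a \<bullet> b) *\<^sub>R triv_inv \<psi> x (PF b) \<in> fibre A x" for b by (intro fibre_ops triv_inv_in PF(2))
  then show "(\<Sum>b\<in>Basis. (\<psi> x a \<bullet> b) *\<^sub>R triv_inv \<psi> x (PF b)) \<in> fibre A x" by (rule fibre_sum)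
  have "\<psi> x (\<Sum>b\<in>Basis. (\<psi> x a \<bullet> b) *\<^sub>R triv_inv \<psi> x (PF b)) = (\<Sum>b\<in>Basis. (\<psi> x a \<bullet> b) *\<^sub>R PF b)"
    using f by (simp add: triv_sum triv_ops triv_inv_in triv_triv_inv PF(2))
  also have "\<dots> = PF (\<Sum>b\<in>Basis. (\<psi> x a \<bullet> b) *\<^sub>R b)" by (simp add: linear_sum[OF PF(1)] linear_cmul[OF PF(1)])
  also have "\<dots> = \<psi> x a" by (simp add: euclidean_representation PF(3) triv_in assms)
  finally show "\<psi> x a = \<psi> x (\<Sum>b\<in>Basis. (\<psi> x a \<bullet> b) *\<^sub>R triv_inv \<psi> x (PF b))" by simp
qed

end

text \<open>Transition maps are smooth on fixed vectors of the typical fibre; a moving vector is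
  expanded in the frame, with smooth coefficients.\<close>

lemma sm_at_section_change:
  assumes V: "(V,\<psi>) \<in> trivs A" "(V',\<psi>') \<in> trivs A" "x \<in> V" "x \<in> V'"
    and N: "open N" "x \<in> N" "\<And>y. y \<in> N \<Longrightarrow> X y \<in> fibre A y"
    and s: "sm_at A (\<lambda>y. \<psi> y (X y)) x"
  shows "sm_at A (\<lambda>y. \<psi>' y (X y)) x"
proof (rule sm_at_cong)
  show "sm_at A (\<lambda>y. \<Sum>b\<in>Basis. (\<psi> y (X y) \<bullet> b) *\<^sub>R \<psi>' y (triv_inv \<psi> y (PF b))) x"
    by (intro sm_at_sum sm_at_scaleR sm_at_inner_right s triv_smooth[OF V(1,2) _ V(3,4)] PF(2))
  show "open (N \<inter> V \<inter> V')" using N V triv_open by blast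
  show "(\<Sum>b\<in>Basis. (\<psi> y (X y) \<bullet> b) *\<^sub>R \<psi>' y (triv_inv \<psi> y (PF b))) = \<psi>' y (X y)" if y: "y \<in> N \<inter> V \<inter> V'" for y
  proof -
    have yV: "y \<in> V" "y \<in> V'" "X y \<in> fibre A y" using y N by auto
    have "\<psi>' y (X y) = \<psi>' y (\<Sum>b\<in>Basis. (\<psi> y (X y) \<bullet> b) *\<^sub>R triv_inv \<psi> y (PF b))"
      using triv_expand[OF V(1) yV(1,3)] by simp
    also have "\<dots> = (\<Sum>b\<in>Basis. (\<psi> y (X y) \<bullet> b) *\<^sub>R \<psi>' y (triv_inv \<psi> y (PF b)))"
      by (simp add: triv_sum[OF V(2) yV(2)] triv_ops[OF V(2) yV(2)] fibre_ops triv_inv_in[OF V(1) yV(1)] PF(2))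
    finally show ?thesis by simp
  qed
qed (use N V in auto)

section \<open>Sections: combination, extension, prescribed values\<close>

lemma sectionsD: "X \<in> sections A \<Longrightarrow> X x \<in> fibre A x"
  by (simp add: sections_def)

lemma sections_sm: "X \<in> sections A \<Longrightarrow> (V,\<psi>) \<in> trivs A \<Longrightarrow> x \<in> V \<Longrightarrow> sm_at A (\<lambda>y. \<psi> y (X y)) x"
proof -
  assume a: "X \<in> sections A" "(V,\<psi>) \<in> trivs A" "x \<in> V"
  then have "smooth_fun_on A V (\<lambda>y. \<psi> y (X y))" by (auto simp: sections_def)
  then show ?thesis using smooth_fun_on_iff[OF triv_open[OF a(2)]] a(3) by blast
qed

lemma sectionsI:
  assumes f: "\<And>x. X x \<in> fibre A x"
    and s: "\<And>x. \<exists>V \<psi>. (V,\<psi>) \<in> trivs A \<and> x \<in> V \<and> sm_at A (\<lambda>y. \<psi> y (X y)) x"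
  shows "X \<in> sections A"
proof -
  have "smooth_fun_on A V (\<lambda>x. \<psi> x (X x))" if V: "(V,\<psi>) \<in> trivs A" for V \<psi>
    unfolding smooth_fun_on_iff[OF triv_open[OF V]]
  proof
    fix x assume x: "x \<in> V"
    obtain V' \<psi>' where "(V',\<psi>') \<in> trivs A" "x \<in> V'" "sm_at A (\<lambda>y. \<psi>' y (X y)) x" using s by blast
    then show "sm_at A (\<lambda>y. \<psi> y (X y)) x" using sm_at_section_change[OF _ V _ x open_UNIV UNIV_I f] by blast
  qed
  then show ?thesis using f by (auto simp: sections_def)
qed

lemma sections_cong_near:
  assumes "X \<in> sections A" "open N" "x \<in> N" "\<And>y. y \<in> N \<Longrightarrow> X y = Y y"
  shows "\<exists>V \<psi>. (V,\<psi>) \<in> trivs A \<and> x \<in> V \<and> sm_at A (\<lambda>y. \<psi> y (Y y)) x"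
proof -
  obtain V \<psi> where V: "(V,\<psi>) \<in> trivs A" "x \<in> V" using triv_ex by blast
  have "sm_at A (\<lambda>y. \<psi> y (Y y)) x"
    by (rule sm_at_cong[OF sections_sm[OF assms(1) V] assms(2,3)]) (simp add: assms(4))
  then show ?thesis using V by blast
qed

lemma sections_scale_add:
  assumes "X \<in> sections A" "Y \<in> sections A" "\<And>y. sm_at A g y" "\<And>y. sm_at A h y"
  shows "(\<lambda>x. g x *\<^sub>R X x + h x *\<^sub>R Y x) \<in> sections A"
proof (rule sectionsI)
  fix x
  show "g x *\<^sub>R X x + h x *\<^sub>R Y x \<in> fibre A x" using assms by (intro fibre_ops sectionsD)
  obtain V \<psi> where V: "(V,\<psi>) \<in> trivs A" "x \<in> V" using triv_ex by blast
  have "sm_at A (\<lambda>y. \<psi> y (g y *\<^sub>R X y + h y *\<^sub>R Y y)) x"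
    by (rule sm_at_cong[OF sm_at_add[OF sm_at_scaleR[OF assms(3) sections_sm[OF assms(1) V]]
        sm_at_scaleR[OF assms(4) sections_sm[OF assms(2) V]]] triv_open[OF V(1)] V(2)])
      (simp add: triv_lin[OF V(1)] sectionsD assms)
  then show "\<exists>V \<psi>. (V,\<psi>) \<in> trivs A \<and> x \<in> V \<and> sm_at A (\<lambda>y. \<psi> y (g y *\<^sub>R X y + h y *\<^sub>R Y y)) x" using V by blast
qed

lemma sections_scale: "X \<in> sections A \<Longrightarrow> (\<And>y. sm_at A g y) \<Longrightarrow> (\<lambda>x. g x *\<^sub>R X x) \<in> sections A"
  using sections_scale_add[OF _ _ _ sm_at_const[of 0], of X X g] by simp

lemma sections_add: "X \<in> sections A \<Longrightarrow> Y \<in> sections A \<Longrightarrow> (\<lambda>x. X x + Y x) \<in> sections A"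
  using sections_scale_add[OF _ _ sm_at_const[of 1] sm_at_const[of 1], of X Y] by simp

lemma zero_section: "(\<lambda>x. 0) \<in> sections A"
proof (rule sectionsI)
  fix x
  obtain V \<psi> where V: "(V,\<psi>) \<in> trivs A" "x \<in> V" using triv_ex by blast
  have "sm_at A (\<lambda>y. \<psi> y 0) x"
    by (rule sm_at_cong[OF sm_at_const[of 0] triv_open[OF V(1)] V(2)]) (simp add: triv_ops[OF V(1)])
  then show "\<exists>V \<psi>. (V,\<psi>) \<in> trivs A \<and> x \<in> V \<and> sm_at A (\<lambda>y. \<psi> y 0) x" using V by blast
qed (rule fibre_ops)

lemma sections_sum: "(\<And>i. i \<in> I \<Longrightarrow> X i \<in> sections A) \<Longrightarrow> (\<lambda>x. \<Sum>i\<in>I. X i x) \<in> sections A"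
  by (induction I rule: infinite_finite_induct) (simp_all add: zero_section sections_add)

lemma extend_section:
  assumes V: "(V,\<psi>) \<in> trivs A" "x \<in> V" and S: "open S" "x \<in> S" "S \<subseteq> V" "\<And>y. y \<in> S \<Longrightarrow> X y \<in> fibre A y"
    "\<And>y. y \<in> S \<Longrightarrow> sm_at A (\<lambda>y. \<psi> y (X y)) y"
  obtains Y N where "Y \<in> sections A" "open N" "x \<in> N" "N \<subseteq> S" "\<And>y. y \<in> N \<Longrightarrow> Y y = X y"
proof -
  obtain \<eta> N K where \<eta>: "\<And>y. sm_at A (\<eta> :: 'm \<Rightarrow> real) y" "open N" "x \<in> N" "N \<subseteq> S" "\<And>y. y \<in> N \<Longrightarrow> \<eta> y = 1"
    "closed K" "K \<subseteq> S" "\<And>y. y \<notin> K \<Longrightarrow> \<eta> y = 0" by (rule bump[OF S(1,2)], rule that)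
  define Y where "Y y = (if y \<in> S then \<eta> y *\<^sub>R X y else 0)" for y
  have "Y \<in> sections A"
  proof (rule sectionsI)
    fix y
    show "Y y \<in> fibre A y" using S(4) by (simp add: Y_def fibre_ops)
    show "\<exists>V \<psi>. (V,\<psi>) \<in> trivs A \<and> y \<in> V \<and> sm_at A (\<lambda>y. \<psi> y (Y y)) y"
    proof (cases "y \<in> S")
      case True
      have "sm_at A (\<lambda>y. \<psi> y (Y y)) y"
        by (rule sm_at_cong[OF sm_at_scaleR[OF \<eta>(1) S(5)[OF True]] S(1) True])
           (use S(3,4) in \<open>simp add: Y_def triv_ops[OF V(1)] subset_iff\<close>)
      then show ?thesis using V True S(3) by blast
    next
      case False
      have "open (- K)" "y \<in> - K" using \<eta> False by (auto simp: open_Compl)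
      moreover have "0 = Y z" if "z \<in> - K" for z using that \<eta>(8) by (simp add: Y_def)
      ultimately show ?thesis by (rule sections_cong_near[OF zero_section])
    qed
  qed
  then show ?thesis by (rule that[OF _ \<eta>(2,3,4)]) (use \<eta>(4,5) in \<open>auto simp: Y_def\<close>)
qed

lemma section_through:
  assumes "a \<in> fibre A x" shows "\<exists>X\<in>sections A. X x = a"
proof -
  obtain V \<psi> where V: "(V,\<psi>) \<in> trivs A" "x \<in> V" using triv_ex by blast
  define X where "X y = triv_inv \<psi> y (\<psi> x a)" for y
  have w: "\<psi> x a \<in> typical_fibre A" by (rule triv_in[OF V assms])
  have f: "X y \<in> fibre A y" if "y \<in> V" for y unfolding X_def by (rule triv_inv_in[OF V(1) that w])
  have s: "sm_at A (\<lambda>y. \<psi> y (X y)) y" if "y \<in> V" for y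
    unfolding X_def by (rule triv_smooth[OF V(1) V(1) w that that])
  obtain Y N where Y: "Y \<in> sections A" "open N" "x \<in> N" "N \<subseteq> V" "\<And>y. y \<in> N \<Longrightarrow> Y y = X y"
    by (rule extend_section[where X=X and S=V, OF V triv_open[OF V(1)] V(2) subset_refl])
      (erule f | erule s | rule that; assumption)+
  have "Y x = a" using Y triv_inv_triv[OF V assms] by (simp add: X_def)
  then show ?thesis using Y(1) by blast
qed

end

section \<open>Bracket and anchor on sections\<close>

locale algebroid =
  fixes A :: "('m::{t2_space,second_countable_topology}, 'e::euclidean_space,
    'v::real_vector, 'f::euclidean_space, 'z) lie_algebroid_scheme"
  assumes la: "is_lie_algebroid A"

sublocale algebroid \<subseteq> vbundle A
  using la unfolding is_lie_algebroid_def by unfold_locales (elim conjE)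

context algebroid
begin

abbreviation "\<rho> \<equiv> anchor A"
abbreviation "br \<equiv> bracket A"

lemma la_axioms:
  "\<forall>x. \<forall>a\<in>fibre A x. anchor A x a \<in> tangent_space A x"
  "\<forall>x. \<forall>a\<in>fibre A x. \<forall>b\<in>fibre A x. \<forall>c d g.
        anchor A x (c *\<^sub>R a + d *\<^sub>R b) g = c * anchor A x a g + d * anchor A x b g"
  "\<forall>X\<in>sections A. smooth_vector_field A (\<lambda>x. anchor A x (X x))"
  "\<forall>X\<in>sections A. \<forall>Y\<in>sections A. bracket A X Y \<in> sections A"
  "\<forall>X\<in>sections A. \<forall>Y\<in>sections A. \<forall>Z\<in>sections A. \<forall>c d.
        bracket A (\<lambda>x. c *\<^sub>R X x + d *\<^sub>R Y x) Z =
          (\<lambda>x. c *\<^sub>R bracket A X Z x + d *\<^sub>R bracket A Y Z x)"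
  "\<forall>X\<in>sections A. \<forall>Y\<in>sections A. bracket A X Y = (\<lambda>x. - bracket A Y X x)"
  "\<forall>X\<in>sections A. \<forall>Y\<in>sections A. \<forall>Z\<in>sections A. \<forall>x.
        bracket A X (bracket A Y Z) x + bracket A Y (bracket A Z X) x
          + bracket A Z (bracket A X Y) x = 0"
  "\<forall>X\<in>sections A. \<forall>Y\<in>sections A. \<forall>g. smooth_function A g \<longrightarrow>
        bracket A X (\<lambda>x. g x *\<^sub>R Y x) =
          (\<lambda>x. g x *\<^sub>R bracket A X Y x + anchor A x (X x) g *\<^sub>R Y x)"
  using la unfolding is_lie_algebroid_def by - (elim conjE, assumption)+

lemma anchor_tangent: "a \<in> fibre A x \<Longrightarrow> \<rho> x a \<in> tangent_space A x"
  and anchor_lin: "a \<in> fibre A x \<Longrightarrow> b \<in> fibre A x \<Longrightarrow> \<rho> x (c *\<^sub>R a + d *\<^sub>R b) g = c * \<rho> x a g + d * \<rho> x b g"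
  and br_section: "X \<in> sections A \<Longrightarrow> Y \<in> sections A \<Longrightarrow> br X Y \<in> sections A"
  and br_lin_left: "X \<in> sections A \<Longrightarrow> Y \<in> sections A \<Longrightarrow> Z \<in> sections A \<Longrightarrow>
    br (\<lambda>x. c *\<^sub>R X x + d *\<^sub>R Y x) Z = (\<lambda>x. c *\<^sub>R br X Z x + d *\<^sub>R br Y Z x)"
  and br_skew: "X \<in> sections A \<Longrightarrow> Y \<in> sections A \<Longrightarrow> br X Y = (\<lambda>x. - br Y X x)"
  and br_jacobi: "X \<in> sections A \<Longrightarrow> Y \<in> sections A \<Longrightarrow> Z \<in> sections A \<Longrightarrow>
    br X (br Y Z) x + br Y (br Z X) x + br Z (br X Y) x = 0"
  by (rule la_axioms(1)[rule_format] la_axioms(2)[rule_format] la_axioms(4)[rule_format] la_axioms(5)[rule_format]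
      la_axioms(6)[rule_format] la_axioms(7)[rule_format]; assumption)+

lemma anchor_smooth:
  assumes "X \<in> sections A" "\<And>y. sm_at A g y" shows "sm_at A (\<lambda>x. \<rho> x (X x) g) y"
proof -
  have "smooth_function A g" using assms(2) smooth_function_iff by blast
  then have "smooth_function A (\<lambda>x. \<rho> x (X x) g)"
    using bspec[OF la_axioms(3) assms(1)] unfolding smooth_vector_field_def by simp
  then show ?thesis using smooth_function_iff by blast
qed

lemma br_leibniz:
  assumes "X \<in> sections A" "Y \<in> sections A" "\<And>y. sm_at A g y"
  shows "br X (\<lambda>x. g x *\<^sub>R Y x) = (\<lambda>x. g x *\<^sub>R br X Y x + \<rho> x (X x) g *\<^sub>R Y x)"
proof -
  have "smooth_function A g" using assms(3) smooth_function_iff by blast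
  then show ?thesis using la_axioms(8) assms(1,2) by simp
qed

lemma br_lin_right:
  assumes "X \<in> sections A" "Y \<in> sections A" "Z \<in> sections A"
  shows "br Z (\<lambda>x. c *\<^sub>R X x + d *\<^sub>R Y x) = (\<lambda>x. c *\<^sub>R br Z X x + d *\<^sub>R br Z Y x)"
proof
  fix x
  have "(\<lambda>x. c *\<^sub>R X x + d *\<^sub>R Y x) \<in> sections A" using sections_scale_add[OF assms(1,2) sm_at_const sm_at_const] .
  from br_skew[OF assms(3) this] br_lin_left[OF assms, of c d] br_skew[OF assms(1,3)] br_skew[OF assms(2,3)]
  show "br Z (\<lambda>x. c *\<^sub>R X x + d *\<^sub>R Y x) x = c *\<^sub>R br Z X x + d *\<^sub>R br Z Y x" by simp
qed

lemma br_sum_right: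
  assumes Z: "Z \<in> sections A" shows "(\<And>i. i \<in> I \<Longrightarrow> X i \<in> sections A) \<Longrightarrow>
    br Z (\<lambda>x. \<Sum>i\<in>I. X i x) x = (\<Sum>i\<in>I. br Z (X i) x)"
proof (induction I rule: infinite_finite_induct)
  case (insert i I)
  have "br Z (\<lambda>x. 1 *\<^sub>R X i x + 1 *\<^sub>R (\<Sum>i\<in>I. X i x)) = (\<lambda>x. 1 *\<^sub>R br Z (X i) x + 1 *\<^sub>R br Z (\<lambda>x. \<Sum>i\<in>I. X i x) x)"
    by (rule br_lin_right) (use insert Z in \<open>auto intro: sections_sum\<close>)
  then show ?case using insert by (simp add: fun_eq_iff)
qed (use br_lin_right[OF zero_section zero_section Z, of 0 0] in \<open>simp_all add: fun_eq_iff\<close>)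

text \<open>As for derivations: D = X - X' equals g D with g = 1 - \<eta>. In the Leibniz rule one
  term carries g x = 0 and the other D x = 0.\<close>

lemma br_local:
  assumes X: "X \<in> sections A" "X' \<in> sections A" and Y: "Y \<in> sections A"
    and N: "open N" "x \<in> N" "\<And>y. y \<in> N \<Longrightarrow> X y = X' y"
  shows "br Y X x = br Y X' x"
proof -
  obtain \<eta> N' K where \<eta>: "\<And>y. sm_at A (\<eta> :: 'm \<Rightarrow> real) y" "open N'" "x \<in> N'" "N' \<subseteq> N" "\<And>y. y \<in> N' \<Longrightarrow> \<eta> y = 1"
    "closed K" "K \<subseteq> N" "\<And>y. y \<notin> K \<Longrightarrow> \<eta> y = 0" by (rule bump[OF N(1,2)], rule that)
  define g where "g y = 1 + (- 1) * \<eta> y" for y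
  define D where "D = (\<lambda>y. 1 *\<^sub>R X y + (-1) *\<^sub>R X' y)"
  have smg: "sm_at A g y" for y unfolding g_def by (intro sm_at_add sm_at_mult sm_at_const \<eta>(1))
  have D: "D \<in> sections A" unfolding D_def by (rule sections_scale_add[OF X sm_at_const sm_at_const])
  have "D = (\<lambda>y. g y *\<^sub>R D y)"
  proof
    fix y show "D y = g y *\<^sub>R D y"
    proof (cases "y \<in> K")
      case True then show ?thesis using \<eta>(7) N(3) by (auto simp: D_def)
    next
      case False then show ?thesis using \<eta>(8) by (simp add: g_def)
    qed
  qed
  from fun_cong[OF br_leibniz[OF Y D smg], of x, folded this]
  have "br Y D x = g x *\<^sub>R br Y D x + \<rho> x (Y x) g *\<^sub>R D x" .
  also have "\<dots> = 0" using N(2,3) \<eta>(3,5) by (simp add: g_def D_def)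
  finally show ?thesis using fun_cong[OF br_lin_right[OF X Y, of 1 "-1"], of x] by (simp add: D_def)
qed

text \<open>Compare \<open>[[X,Y], g Z]\<close> with its Jacobi expansion. This determines the anchor only where some section is
  nonzero; otherwise the fibre is \<open>0\<close> and both sides vanish.\<close>

lemma anchor_bracket:
  assumes X: "X \<in> sections A" and Y: "Y \<in> sections A" and g: "\<And>y. sm_at A g y"
  shows "\<rho> x (br X Y x) g = \<rho> x (X x) (\<lambda>y. \<rho> y (Y y) g) - \<rho> x (Y x) (\<lambda>y. \<rho> y (X y) g)"
proof (cases "\<exists>a\<in>fibre A x. a \<noteq> 0")
  case True
  then obtain Z where Z: "Z \<in> sections A" "Z x \<noteq> 0" using section_through by metis
  define gZ where "gZ = (\<lambda>y. g y *\<^sub>R Z y)"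
  have gZ: "gZ \<in> sections A" unfolding gZ_def by (rule sections_scale[OF Z(1) g])
  have l2: "br P (br Q gZ) x = g x *\<^sub>R br P (br Q Z) x + \<rho> x (P x) g *\<^sub>R br Q Z x
      + (\<rho> x (Q x) g *\<^sub>R br P Z x + \<rho> x (P x) (\<lambda>y. \<rho> y (Q y) g) *\<^sub>R Z x)"
    if P: "P \<in> sections A" and Q: "Q \<in> sections A" for P Q
  proof -
    have 1: "br Q gZ = (\<lambda>y. 1 *\<^sub>R (g y *\<^sub>R br Q Z y) + 1 *\<^sub>R (\<rho> y (Q y) g *\<^sub>R Z y))"
      unfolding gZ_def using br_leibniz[OF Q Z(1) g] by simp
    show ?thesis unfolding 1
      using fun_cong[OF br_lin_right[OF sections_scale[OF br_section[OF Q Z(1)] g] sections_scale[OF Z(1) anchor_smooth[OF Q g]] P, of 1 1], of x]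
        fun_cong[OF br_leibniz[OF P br_section[OF Q Z(1)] g], of x]
        fun_cong[OF br_leibniz[OF P Z(1) anchor_smooth[OF Q g]], of x]
      by simp
  qed
  have jac: "br (br X Y) W x = br X (br Y W) x - br Y (br X W) x" if W: "W \<in> sections A" for W
  proof -
    have "br Y (br W X) x = - br Y (br X W) x"
    proof -
      have "br W X = (\<lambda>y. (-1) *\<^sub>R br X W y + 0 *\<^sub>R br X W y)" using br_skew[OF W X] by simp
      then show ?thesis using br_lin_right[OF br_section[OF X W] br_section[OF X W] Y, of "-1" 0] by simp
    qed
    moreover have "br W (br X Y) x = - br (br X Y) W x" using fun_cong[OF br_skew[OF W br_section[OF X Y]], of x] .
    ultimately show ?thesis using br_jacobi[OF X Y W, of x] by (simp add: algebra_simps)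
  qed
  have "br (br X Y) gZ x = g x *\<^sub>R br (br X Y) Z x + \<rho> x (br X Y x) g *\<^sub>R Z x"
    unfolding gZ_def using br_leibniz[OF br_section[OF X Y] Z(1) g] by simp
  then have "(\<rho> x (br X Y x) g - (\<rho> x (X x) (\<lambda>y. \<rho> y (Y y) g) - \<rho> x (Y x) (\<lambda>y. \<rho> y (X y) g))) *\<^sub>R Z x = 0"
    unfolding jac[OF gZ] jac[OF Z(1)] l2[OF X Y] l2[OF Y X] by (simp add: algebra_simps)
  then show ?thesis using Z(2) by simp
next
  case False
  then have z: "a = 0" if "a \<in> fibre A x" for a using that by blast
  have z0: "\<rho> x 0 h = 0" for h using anchor_lin[OF fibre_ops(1) fibre_ops(1), of x 0 0 h] by simp
  show ?thesis using z[OF sectionsD[OF X]] z[OF sectionsD[OF Y]] z[OF sectionsD[OF br_section[OF X Y]]]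
    by (simp add: z0)
qed

end

subsection \<open>Coordinates\<close>

text \<open>\<open>e w\<close> and \<open>k b\<close> are global sections and functions that on \<open>N0\<close> agree with the local frame and the
  coordinate functions. Functions on \<open>N0\<close> are read on an open set \<open>\<Omega>\<close> of the ambient space by composing the
  inverse chart with a projection onto the model space.\<close>

locale coords = algebroid A
  for A :: "('m::{t2_space,second_countable_topology}, 'e::euclidean_space,
    'v::real_vector, 'f::euclidean_space, 'z) lie_algebroid_scheme" +
  fixes U :: "'m set" and \<kappa> :: "'m \<Rightarrow> 'e" and V :: "'m set" and \<psi> :: "'m \<Rightarrow> 'v \<Rightarrow> 'f" and N0 :: "'m set"
    and e :: "'f \<Rightarrow> 'm \<Rightarrow> 'v" and k :: "'e \<Rightarrow> 'm \<Rightarrow> real"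
  assumes c: "(U,\<kappa>) \<in> charts A" and V: "(V,\<psi>) \<in> trivs A" and N0: "open N0" "N0 \<subseteq> U" "N0 \<subseteq> V"
    and e_sec: "e w \<in> sections A" and e_eq: "y \<in> N0 \<Longrightarrow> e w y = triv_inv \<psi> y (PF w)"
    and k_sm: "sm_at A (k b) y" and k_eq: "y \<in> N0 \<Longrightarrow> k b y = \<kappa> y \<bullet> b"

lemma (in algebroid) coords_exist:
  "\<exists>U \<kappa> V \<psi> N0 e k. coords A U \<kappa> V \<psi> N0 e k \<and> x0 \<in> N0"
proof -
  obtain U \<kappa> where c: "(U,\<kappa>) \<in> charts A" "x0 \<in> U" using chart_ex by blast
  obtain V \<psi> where V: "(V,\<psi>) \<in> trivs A" "x0 \<in> V" using triv_ex by blast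
  have o: "open (U \<inter> V)" "x0 \<in> U \<inter> V" using chart(1)[OF c(1)] triv_open[OF V(1)] c V by auto
  obtain \<eta> N K where \<eta>: "\<And>y. sm_at A (\<eta> :: 'm \<Rightarrow> real) y" "open N" "x0 \<in> N" "N \<subseteq> U \<inter> V" "\<And>y. y \<in> N \<Longrightarrow> \<eta> y = 1"
    "closed K" "K \<subseteq> U \<inter> V" "\<And>y. y \<notin> K \<Longrightarrow> \<eta> y = 0" by (rule bump[OF o], rule that)
  define e where "e w y = (if y \<in> U \<inter> V then \<eta> y *\<^sub>R triv_inv \<psi> y (PF w) else 0)" for w y
  define k where "k b y = (if y \<in> U \<inter> V then \<eta> y * (\<kappa> y \<bullet> b) else 0)" for b y
  have cK: "open (- K)" using \<eta>(6) by (simp add: open_Compl)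
  have "e w \<in> sections A" for w
  proof (rule sectionsI)
    fix y
    show "e w y \<in> fibre A y"
      using triv_inv_in[OF V(1), of y "PF w"] PF(2) by (auto simp: e_def intro: fibre_ops)
    show "\<exists>V \<psi>. (V,\<psi>) \<in> trivs A \<and> y \<in> V \<and> sm_at A (\<lambda>y. \<psi> y (e w y)) y"
    proof (cases "y \<in> U \<inter> V")
      case True
      then have yV: "y \<in> V" by simp
      have "sm_at A (\<lambda>y. \<eta> y *\<^sub>R \<psi> y (triv_inv \<psi> y (PF w))) y"
        by (rule sm_at_scaleR[OF \<eta>(1) triv_smooth[OF V(1) V(1) PF(2) yV yV]])
      then have "sm_at A (\<lambda>y. \<psi> y (e w y)) y"
        by (rule sm_at_cong[OF _ o(1) True])
           (simp add: e_def triv_ops(3)[OF V(1)] triv_inv_in[OF V(1)] PF(2))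
      then show ?thesis using V(1) yV by blast
    next
      case False
      then have "y \<in> - K" using \<eta>(7) by blast
      moreover have "0 = e w z" if "z \<in> - K" for z using that \<eta>(8) by (simp add: e_def)
      ultimately show ?thesis by (rule sections_cong_near[OF zero_section cK])
    qed
  qed
  moreover have "sm_at A (k b) y" for b y
  proof (cases "y \<in> U \<inter> V")
    case True
    then have yU: "y \<in> U" by simp
    show ?thesis
      by (rule sm_at_cong[OF sm_at_mult[OF \<eta>(1) sm_at_inner_right[OF sm_at_chart[OF c(1) yU], of b]] o(1) True])
         (simp add: k_def)
  next
    case False
    then have "y \<in> - K" using \<eta>(7) by blast
    then show ?thesis
      by (rule sm_at_cong[OF sm_at_const[of 0] cK]) (use \<eta>(8) in \<open>simp add: k_def\<close>)
  qed
  ultimately have "coords A U \<kappa> V \<psi> N e k"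
    by unfold_locales (use c V \<eta>(2-5) in \<open>auto simp: e_def k_def\<close>)
  then show ?thesis using \<eta>(3) by blast
qed

section \<open>The inverse chart on an open set of the ambient space\<close>

context coords
begin

abbreviation "E0 \<equiv> model_space A"
abbreviation "P \<equiv> proj E0"

definition \<mu> :: "'e \<Rightarrow> 'm" where "\<mu> p = inv_into U \<kappa> (P p)"
definition \<Omega> :: "'e set" where "\<Omega> = {p. P p \<in> \<kappa> ` N0}"

lemmas P = proj[OF model_subspace]

lemma PP [simp]: "P (P p) = P p" by (rule P(3)[OF P(2)])

lemma kappa_E0: "y \<in> N0 \<Longrightarrow> \<kappa> y \<in> E0" using chart(8)[OF c] N0 by blast

lemma kappa_Omega: "y \<in> N0 \<Longrightarrow> \<kappa> y \<in> \<Omega>" and mu_kappa: "y \<in> N0 \<Longrightarrow> \<mu> (\<kappa> y) = y" and P_kappa: "y \<in> N0 \<Longrightarrow> P (\<kappa> y) = \<kappa> y"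
proof -
  assume y: "y \<in> N0"
  show 1: "P (\<kappa> y) = \<kappa> y" by (rule P(3)[OF kappa_E0[OF y]])
  show "\<kappa> y \<in> \<Omega>" using y 1 by (simp add: \<Omega>_def)
  show "\<mu> (\<kappa> y) = y" using y N0 chart(7)[OF c] 1 by (auto simp: \<mu>_def)
qed

lemma mu_in: "p \<in> \<Omega> \<Longrightarrow> \<mu> p \<in> N0" and kappa_mu: "p \<in> \<Omega> \<Longrightarrow> \<kappa> (\<mu> p) = P p"
proof -
  assume "p \<in> \<Omega>"
  then obtain y where y: "P p = \<kappa> y" "y \<in> N0" by (auto simp: \<Omega>_def)
  then have "\<mu> p = y" using chart(7)[OF c, of y] N0 by (auto simp: \<mu>_def)
  then show "\<mu> p \<in> N0" "\<kappa> (\<mu> p) = P p" using y by auto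
qed

lemma mu_P [simp]: "\<mu> (P p) = \<mu> p" by (simp add: \<mu>_def)
lemma Omega_P [simp]: "P p \<in> \<Omega> \<longleftrightarrow> p \<in> \<Omega>" by (simp add: \<Omega>_def)

lemma P_cont: "continuous_on S P"
  using linear_continuous_on P(1) linear_conv_bounded_linear by blast

lemma open_Omega_sub:
  assumes "open N" "N \<subseteq> N0" shows "open {p \<in> \<Omega>. \<mu> p \<in> N}"
proof -
  obtain W where W: "open W" "\<kappa> ` N = W \<inter> E0" using chart_image_open[OF c, of N] assms N0 by auto
  have "{p \<in> \<Omega>. \<mu> p \<in> N} = P -` W"
  proof (intro set_eqI iffI)
    fix p assume "p \<in> {p \<in> \<Omega>. \<mu> p \<in> N}"
    then have "P p \<in> \<kappa> ` N" using kappa_mu by force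
    then show "p \<in> P -` W" using W by auto
  next
    fix p assume "p \<in> P -` W"
    then have "P p \<in> \<kappa> ` N" using W(2) P(2) by auto
    then obtain y where y: "P p = \<kappa> y" "y \<in> N" by blast
    then have "\<mu> p = y" using chart(7)[OF c, of y] N0 assms by (auto simp: \<mu>_def)
    then show "p \<in> {p \<in> \<Omega>. \<mu> p \<in> N}" using y assms by (auto simp: \<Omega>_def)
  qed
  then show ?thesis using open_vimage[OF W(1) P_cont[of UNIV]] by simp
qed

lemma open_Omega: "open \<Omega>"
proof -
  have "{p \<in> \<Omega>. \<mu> p \<in> N0} = \<Omega>" using mu_in by blast
  then show ?thesis using open_Omega_sub[OF N0(1) subset_refl] by simp
qed

lemma sm_hat:
  fixes f :: "'m \<Rightarrow> 'b::real_normed_vector"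
  assumes f: "\<And>y. y \<in> N0 \<Longrightarrow> sm_at A f y"
  shows "sm \<Omega> (\<lambda>p. f (\<mu> p))"
proof (rule csm_local)
  fix q :: real and p assume p: "p \<in> \<Omega>"
  have y: "\<mu> p \<in> N0" "\<mu> p \<in> U" using mu_in[OF p] N0 by auto
  obtain N W G where 1: "open N" "\<mu> p \<in> N" "N \<subseteq> U" "open W" "\<kappa> ` N \<subseteq> W" "sm W G" "\<And>y. y \<in> N \<Longrightarrow> f y = G (\<kappa> y)"
    by (rule sm_atE[OF f[OF y(1)] c y(2)], rule that)
  define O' where "O' = {p \<in> \<Omega>. \<mu> p \<in> N \<inter> N0}"
  have oO: "open O'" unfolding O'_def by (rule open_Omega_sub) (use 1 N0 in auto)
  have PW: "P q \<in> W" if "q \<in> O'" for q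
    using that kappa_mu[of q] 1(5) by (auto simp: O'_def)
  have "sm O' (\<lambda>p. G (P p))"
    by (rule sm_compose[OF oO 1(4) _ 1(6) csm_linear[OF P(1) oO]]) (use PW in auto)
  then have "sm O' (\<lambda>p. f (\<mu> p))"
    by (rule sm_cong[OF oO, rotated]) (use 1(7) kappa_mu in \<open>auto simp: O'_def\<close>)
  then have "csm ({0::real} \<inter> UNIV) (\<Omega> \<inter> O') (\<lambda>_ p. f (\<mu> p))"
    by (rule csm_subset) auto
  then show "\<exists>S V. open S \<and> open V \<and> q \<in> S \<and> p \<in> V \<and> csm ({0} \<inter> S) (\<Omega> \<inter> V) (\<lambda>_ p. f (\<mu> p))"
    using oO p 1(2) y(1) by (intro exI[of _ UNIV] exI[of _ O']) (simp add: O'_def)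
qed

definition hat :: "('m \<Rightarrow> 'v) \<Rightarrow> 'e \<Rightarrow> 'f" where "hat X p = \<psi> (\<mu> p) (X (\<mu> p))"

lemma hat_sm: "X \<in> sections A \<Longrightarrow> sm \<Omega> (hat X)"
  unfolding hat_def by (rule sm_hat) (use sections_sm[OF _ V] N0 in blast)

lemma hat_kappa: "y \<in> N0 \<Longrightarrow> hat X (\<kappa> y) = \<psi> y (X y)" by (simp add: hat_def mu_kappa)

lemma hat_in: "p \<in> \<Omega> \<Longrightarrow> X \<in> sections A \<Longrightarrow> hat X p \<in> typical_fibre A"
  unfolding hat_def by (rule triv_in[OF V]) (use mu_in N0 sectionsD in auto)

lemma hat_P: "hat X (P p) = hat X p" by (simp add: hat_def)

lemma hat_e: "p \<in> \<Omega> \<Longrightarrow> hat (e w) p = PF w"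
  using mu_in[of p] N0 by (simp add: hat_def e_eq triv_triv_inv[OF V] PF(2) subset_iff)

lemma fd_linear: "sm \<Omega> F \<Longrightarrow> p \<in> \<Omega> \<Longrightarrow> linear (frechet_derivative F (at p))"
  using sm_has_derivative has_derivative_linear by blast

text \<open>F does not change along the kernel of P, and the chain rule for F composed with P
  expresses this. In this way identities proved at chart points, which lie in the model space, reach
  all of \<Omega>.\<close>

lemma fd_P:
  assumes F: "sm \<Omega> F" "\<And>p. F (P p) = F p" and p: "p \<in> \<Omega>"
  shows "frechet_derivative F (at p) h = frechet_derivative F (at (P p)) (P h)"
proof -
  have "(P has_derivative P) (at p)" using P(1) by (simp add: linear_imp_has_derivative)
  then have "((\<lambda>p. F (P p)) has_derivative (\<lambda>h. frechet_derivative F (at (P p)) (P h))) (at p)"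
    by (rule has_derivative_compose[OF _ sm_has_derivative[OF F(1)]]) (use p in simp)
  from fun_cong[OF frechet_derivative_at[OF this], of h] show ?thesis by (simp add: F(2))
qed

lemma fd_const: "p \<in> \<Omega> \<Longrightarrow> (\<And>q. q \<in> \<Omega> \<Longrightarrow> F q = a) \<Longrightarrow> frechet_derivative F (at p) h = 0"
  using frechet_derivative_cong[OF open_Omega, of p F "\<lambda>_. a"] by (simp add: frechet_derivative_const)

text \<open>The matrix of the anchor in the redundant frame, through its action on the coordinate
  functions. The outer \<open>P\<close> makes the values visibly tangent to the model space.\<close>

definition rho :: "'e \<Rightarrow> 'f \<Rightarrow>\<^sub>L 'e" where
  "rho p = blinfun_of (\<lambda>b. P (\<Sum>i\<in>Basis. \<rho> (\<mu> p) (e b (\<mu> p)) (k i) *\<^sub>R i))"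

text \<open>The structure functions of the redundant frame.\<close>

definition C :: "'e \<Rightarrow> 'f \<Rightarrow>\<^sub>L 'f \<Rightarrow>\<^sub>L 'f" where
  "C p = blinfun_of (\<lambda>b. blinfun_of (\<lambda>c. hat (br (e b) (e c)) p))"

lemma rho_sm: "sm \<Omega> rho"
proof -
  have "sm \<Omega> (\<lambda>p. \<rho> (\<mu> p) (e b (\<mu> p)) (k i))" for b i
    by (rule sm_hat) (rule anchor_smooth[OF e_sec k_sm])
  then have "sm \<Omega> (\<lambda>p. P (\<Sum>i\<in>Basis. \<rho> (\<mu> p) (e b (\<mu> p)) (k i) *\<^sub>R i))" for b
    using P(1) linear_conv_bounded_linear
    by (intro csm_bounded_linear[of P] csm_sum csm_scaleR csm_const open_Omega continuous_on_const) blast+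
  then show ?thesis unfolding rho_def[abs_def] by (rule csm_blinfun_of[OF open_Omega])
qed

lemma C_sm: "sm \<Omega> C"
  unfolding C_def[abs_def] by (intro csm_blinfun_of open_Omega hat_sm br_section e_sec)

lemma rho_P: "rho (P p) = rho p" and C_P: "C (P p) = C p" by (simp_all add: rho_def C_def hat_P)

lemma rho_E0: "blinfun_apply (rho p) w \<in> E0"
  unfolding rho_def blinfun_of_apply
  by (intro subspace_sum[OF model_subspace] subspace_scale[OF model_subspace] P(2))

lemma expand_e: "y \<in> N0 \<Longrightarrow> a \<in> fibre A y \<Longrightarrow> a = (\<Sum>b\<in>Basis. (\<psi> y a \<bullet> b) *\<^sub>R e b y)"
  using triv_expand[OF V, of y a] N0 by (auto simp: e_eq)

lemma anchor_sum:
  "(\<And>i. i \<in> I \<Longrightarrow> h i \<in> fibre A y) \<Longrightarrow> \<rho> y (\<Sum>i\<in>I. c i *\<^sub>R h i) g = (\<Sum>i\<in>I. c i * \<rho> y (h i) g)"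
proof (induction I rule: infinite_finite_induct)
  case (insert i I)
  have "\<rho> y (c i *\<^sub>R h i + 1 *\<^sub>R (\<Sum>i\<in>I. c i *\<^sub>R h i)) g = c i * \<rho> y (h i) g + 1 * \<rho> y (\<Sum>i\<in>I. c i *\<^sub>R h i) g"
    by (rule anchor_lin) (use insert in \<open>auto intro!: fibre_sum fibre_ops\<close>)
  then show ?case using insert by simp
qed (use anchor_lin[OF fibre_ops(1) fibre_ops(1), of y 0 0 g] in simp_all)

lemma rho_kappa:
  assumes y: "y \<in> N0" "a \<in> fibre A y"
  shows "blinfun_apply (rho (\<kappa> y)) (\<psi> y a) = P (\<Sum>i\<in>Basis. \<rho> y a (k i) *\<^sub>R i)"
proof -
  have "\<rho> y a (k i) = (\<Sum>b\<in>Basis. (\<psi> y a \<bullet> b) * \<rho> y (e b y) (k i))" for i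
    by (subst expand_e[OF y], rule anchor_sum) (rule sectionsD[OF e_sec])
  then have "(\<Sum>i\<in>Basis. \<rho> y a (k i) *\<^sub>R i) = (\<Sum>i\<in>Basis. \<Sum>b\<in>Basis. (\<psi> y a \<bullet> b) *\<^sub>R \<rho> y (e b y) (k i) *\<^sub>R i)"
    by (simp add: scaleR_sum_left)
  also have "\<dots> = (\<Sum>b\<in>Basis. (\<psi> y a \<bullet> b) *\<^sub>R (\<Sum>i\<in>Basis. \<rho> y (e b y) (k i) *\<^sub>R i))"
    by (subst sum.swap) (simp add: scaleR_sum_right)
  finally show ?thesis
    using y by (simp add: rho_def blinfun_of_apply mu_kappa linear_sum[OF P(1)] linear_cmul[OF P(1)])
qed

lemma anchor_formula:
  assumes y: "y \<in> N0" "a \<in> fibre A y" and g: "\<And>z. sm_at A g z"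
  shows "\<rho> y a g = frechet_derivative (\<lambda>p. g (\<mu> p)) (at (\<kappa> y)) (blinfun_apply (rho (\<kappa> y)) (\<psi> y a))"
proof -
  have sg: "sm \<Omega> (\<lambda>p. g (\<mu> p))" by (rule sm_hat) (rule g)
  have "\<rho> y a g = frechet_derivative (\<lambda>p. g (\<mu> p)) (at (\<kappa> y)) (\<Sum>b\<in>Basis. \<rho> y a (k b) *\<^sub>R b)"
    by (rule derivation_hadamard[OF anchor_tangent[OF y(2)] c _ g N0(1) y(1) N0(2) open_Omega _ sg])
       (use y N0 kappa_Omega in \<open>auto simp: mu_kappa k_sm k_eq\<close>)
  also have "\<dots> = frechet_derivative (\<lambda>p. g (\<mu> p)) (at (\<kappa> y)) (blinfun_apply (rho (\<kappa> y)) (\<psi> y a))"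
    unfolding rho_kappa[OF y] by (subst fd_P[OF sg _ kappa_Omega[OF y(1)]]) (simp_all only: mu_P P_kappa[OF y(1)])
  finally show ?thesis .
qed

text \<open>The Leibniz rule holds for globally smooth coefficients, so the coefficients in the
  frame are extended from a neighbourhood of x.\<close>

lemma section_expand:
  assumes X: "X \<in> sections A" and x: "x \<in> N0"
  obtains f N where "\<And>b y. sm_at A (f b) y" "open N" "x \<in> N" "N \<subseteq> N0" "\<And>b y. b \<in> Basis \<Longrightarrow> y \<in> N \<Longrightarrow> f b y = \<psi> y (X y) \<bullet> b"
    "\<And>y. y \<in> N \<Longrightarrow> X y = (\<Sum>b\<in>Basis. f b y *\<^sub>R e b y)"
proof -
  have xV: "x \<in> V" using x N0 by blast
  have "\<exists>g S. (\<forall>y. sm_at A g y) \<and> open S \<and> x \<in> S \<and> (\<forall>y\<in>S. g y = \<psi> y (X y) \<bullet> b)" for b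
    using extend_fun[OF sm_at_inner_right[OF sections_sm[OF X V xV], of b]] by metis
  then obtain f S where f: "\<And>b y. sm_at A (f b) y" "\<And>b. open (S b)" "\<And>b. x \<in> S b" "\<And>b y. y \<in> S b \<Longrightarrow> f b y = \<psi> y (X y) \<bullet> b"
    by metis
  define N where "N = N0 \<inter> (\<Inter>b\<in>Basis. S b)"
  have "open N" unfolding N_def by (intro open_Int N0(1) open_INT ballI f(2) finite_Basis)
  moreover have "X y = (\<Sum>b\<in>Basis. f b y *\<^sub>R e b y)" if y: "y \<in> N" for y
  proof -
    have "X y = (\<Sum>b\<in>Basis. (\<psi> y (X y) \<bullet> b) *\<^sub>R e b y)" using y by (intro expand_e sectionsD X) (simp add: N_def)
    also have "\<dots> = (\<Sum>b\<in>Basis. f b y *\<^sub>R e b y)" by (rule sum.cong) (use y f(4) in \<open>auto simp: N_def\<close>)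
    finally show ?thesis .
  qed
  ultimately show ?thesis by (intro that[of f N] f(1)) (use x f in \<open>auto simp: N_def\<close>)
qed

text \<open>Only Y is expanded: locality of the bracket admits the expansion near x, and the Leibniz
  rule differentiates its coefficients along the anchor of Z. Used twice, with skew symmetry in
  between, this gives \<open>bracket_formula\<close>.\<close>

lemma bracket_half:
  assumes Z: "Z \<in> sections A" and Y: "Y \<in> sections A" and x: "x \<in> N0"
  shows "hat (br Z Y) (\<kappa> x) = (\<Sum>b\<in>Basis. (hat Y (\<kappa> x) \<bullet> b) *\<^sub>R hat (br Z (e b)) (\<kappa> x))
     + frechet_derivative (hat Y) (at (\<kappa> x)) (blinfun_apply (rho (\<kappa> x)) (hat Z (\<kappa> x)))"
proof -
  have xV: "x \<in> V" using x N0 by blast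
  note tv = triv_ops[OF V xV] and p = kappa_Omega[OF x]
  obtain f N where f: "\<And>b y. sm_at A (f b) y" "open N" "x \<in> N" "N \<subseteq> N0" "\<And>b y. b \<in> Basis \<Longrightarrow> y \<in> N \<Longrightarrow> f b y = \<psi> y (Y y) \<bullet> b"
    "\<And>y. y \<in> N \<Longrightarrow> Y y = (\<Sum>b\<in>Basis. f b y *\<^sub>R e b y)"
    by (rule section_expand[OF Y x], rule that)
  have fe: "(\<lambda>y. f b y *\<^sub>R e b y) \<in> sections A" for b by (rule sections_scale[OF e_sec f(1)])
  let ?h = "blinfun_apply (rho (\<kappa> x)) (hat Z (\<kappa> x))"
  have "br Z Y x = br Z (\<lambda>y. \<Sum>b\<in>Basis. f b y *\<^sub>R e b y) x"
    by (rule br_local[OF Y sections_sum[OF fe] Z f(2,3)]) (rule f(6))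
  also have "\<dots> = (\<Sum>b\<in>Basis. br Z (\<lambda>y. f b y *\<^sub>R e b y) x)" by (rule br_sum_right[OF Z fe])
  also have "\<dots> = (\<Sum>b\<in>Basis. f b x *\<^sub>R br Z (e b) x + \<rho> x (Z x) (f b) *\<^sub>R e b x)"
    by (simp add: br_leibniz[OF Z e_sec f(1)])
  finally have 1: "\<psi> x (br Z Y x) = (\<Sum>b\<in>Basis. f b x *\<^sub>R \<psi> x (br Z (e b) x) + \<rho> x (Z x) (f b) *\<^sub>R \<psi> x (e b x))"
    by (simp add: triv_sum[OF V xV] tv fibre_ops sectionsD[OF e_sec] sectionsD[OF br_section[OF Z e_sec]])
  have 2: "\<rho> x (Z x) (f b) = frechet_derivative (hat Y) (at (\<kappa> x)) ?h \<bullet> b" if b: "b \<in> Basis" for b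
  proof -
    have a1: "\<rho> x (Z x) (f b) = frechet_derivative (\<lambda>p. f b (\<mu> p)) (at (\<kappa> x)) ?h"
      unfolding hat_kappa[OF x] by (rule anchor_formula[OF x sectionsD[OF Z] f(1)])
    have a2: "frechet_derivative (\<lambda>p. f b (\<mu> p)) (at (\<kappa> x)) = frechet_derivative (\<lambda>p. hat Y p \<bullet> b) (at (\<kappa> x))"
      by (rule frechet_derivative_cong[OF open_Omega_sub[OF f(2,4)]]) (use p f(3,5) b x in \<open>auto simp: mu_kappa hat_def\<close>)
    have a3: "(\<lambda>h. frechet_derivative (hat Y) (at (\<kappa> x)) h \<bullet> b) = frechet_derivative (\<lambda>p. hat Y p \<bullet> b) (at (\<kappa> x))"
      by (rule frechet_derivative_at)
         (rule bounded_linear.has_derivative[OF bounded_linear_inner_left sm_has_derivative[OF hat_sm[OF Y] p]])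
    show ?thesis using a1 unfolding a2 a3[symmetric] .
  qed
  have 3: "\<psi> x (e b x) = PF b" for b using hat_e[OF p, of b] by (simp add: hat_kappa[OF x])
  have 4: "(\<Sum>b\<in>Basis. (w \<bullet> b) *\<^sub>R PF b) = PF w" for w
    using euclidean_representation[of w] by (simp add: linear_sum[OF PF(1), symmetric] linear_cmul[OF PF(1), symmetric])
  \<comment> \<open>A map into the typical fibre has its derivative there, so the projection caused
    by the redundant frame disappears.\<close>
  have "PF (frechet_derivative (hat Y) (at (\<kappa> x)) ?h) = frechet_derivative (hat Y) (at (\<kappa> x)) ?h"
  proof -
    have bl: "bounded_linear PF" using PF(1) linear_conv_bounded_linear by blast
    have "frechet_derivative (\<lambda>p. PF (hat Y p)) (at (\<kappa> x)) = frechet_derivative (hat Y) (at (\<kappa> x))"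
      by (rule frechet_derivative_cong[OF open_Omega p]) (rule PF(3)[OF hat_in[OF _ Y]])
    moreover have "frechet_derivative (\<lambda>p. PF (hat Y p)) (at (\<kappa> x)) = (\<lambda>h. PF (frechet_derivative (hat Y) (at (\<kappa> x)) h))"
      by (rule frechet_derivative_at[symmetric]) (rule bounded_linear.has_derivative[OF bl sm_has_derivative[OF hat_sm[OF Y] p]])
    ultimately show ?thesis by metis
  qed
  then show ?thesis
    unfolding hat_kappa[OF x] 1 using f(3,5) 4[of "frechet_derivative (hat Y) (at (\<kappa> x)) ?h"]
    by (simp add: sum.distrib 2 3 hat_kappa[OF x])
qed

lemma bracket_formula:
  assumes X: "X \<in> sections A" and Y: "Y \<in> sections A" and x: "x \<in> N0"
  shows "hat (br X Y) (\<kappa> x) = frechet_derivative (hat Y) (at (\<kappa> x)) (blinfun_apply (rho (\<kappa> x)) (hat X (\<kappa> x)))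
     - frechet_derivative (hat X) (at (\<kappa> x)) (blinfun_apply (rho (\<kappa> x)) (hat Y (\<kappa> x)))
     + blinfun_apply (blinfun_apply (C (\<kappa> x)) (hat X (\<kappa> x))) (hat Y (\<kappa> x))"
proof -
  note p = kappa_Omega[OF x]
  have xV: "x \<in> V" using x N0 by blast
  have skew: "hat (br W Z) (\<kappa> x) = - hat (br Z W) (\<kappa> x)" if "W \<in> sections A" "Z \<in> sections A" for W Z
    unfolding hat_kappa[OF x] fun_cong[OF br_skew[OF that], of x]
    by (rule triv_ops(4)[OF V xV sectionsD[OF br_section[OF that(2,1)]]])
  have lin: "linear (frechet_derivative (hat X) (at (\<kappa> x)))" by (rule fd_linear[OF hat_sm[OF X] p])
  have 1: "hat (br X (e b)) (\<kappa> x) = (\<Sum>c\<in>Basis. (hat X (\<kappa> x) \<bullet> c) *\<^sub>R hat (br (e c) (e b)) (\<kappa> x))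
     - frechet_derivative (hat X) (at (\<kappa> x)) (blinfun_apply (rho (\<kappa> x)) (PF b))" for b
    unfolding skew[OF X e_sec] bracket_half[OF e_sec X x] hat_e[OF p]
    by (simp add: skew[OF e_sec[of b] e_sec] sum_negf)
  have yf: "hat Y (\<kappa> x) = (\<Sum>b\<in>Basis. (hat Y (\<kappa> x) \<bullet> b) *\<^sub>R PF b)"
  proof -
    have "hat Y (\<kappa> x) = PF (\<Sum>b\<in>Basis. (hat Y (\<kappa> x) \<bullet> b) *\<^sub>R b)" using PF(3)[OF hat_in[OF p Y]] by (simp add: euclidean_representation)
    then show ?thesis by (simp add: linear_sum[OF PF(1)] linear_cmul[OF PF(1)])
  qed
  have 2: "(\<Sum>b\<in>Basis. (hat Y (\<kappa> x) \<bullet> b) *\<^sub>R frechet_derivative (hat X) (at (\<kappa> x)) (blinfun_apply (rho (\<kappa> x)) (PF b)))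
      = frechet_derivative (hat X) (at (\<kappa> x)) (blinfun_apply (rho (\<kappa> x)) (hat Y (\<kappa> x)))"
    by (subst (2) yf) (simp add: blinfun.sum_right blinfun.scaleR_right linear_sum[OF lin] linear_cmul[OF lin])
  have 3: "(\<Sum>b\<in>Basis. (hat Y (\<kappa> x) \<bullet> b) *\<^sub>R (\<Sum>c\<in>Basis. (hat X (\<kappa> x) \<bullet> c) *\<^sub>R hat (br (e c) (e b)) (\<kappa> x)))
      = blinfun_apply (blinfun_apply (C (\<kappa> x)) (hat X (\<kappa> x))) (hat Y (\<kappa> x))"
    unfolding C_def blinfun_of_apply blinfun.sum_left blinfun.scaleR_left scaleR_sum_right
    by (subst sum.swap) (simp add: mult.commute)
  show ?thesis
    unfolding bracket_half[OF X Y x] 1 scaleR_diff_right sum_subtractf 2 3 by simp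
qed

end

context coords
begin

text \<open>The coefficients of the equations for the flow of \<open>u\<close> on the base and on the fibres.\<close>

definition base_coeff :: "('m \<Rightarrow> 'v) \<Rightarrow> 'e \<Rightarrow> 'e" where "base_coeff u p = blinfun_apply (rho p) (hat u p)"
definition fibre_coeff :: "('m \<Rightarrow> 'v) \<Rightarrow> 'e \<Rightarrow> 'f \<Rightarrow>\<^sub>L 'f" where "fibre_coeff u p = blinfun_of (\<lambda>b. - hat (br u (e b)) p)"

lemma fibre_coeff_P: "fibre_coeff u (P p) = fibre_coeff u p"
  by (simp add: fibre_coeff_def hat_P)

lemma base_coeff_E0: "base_coeff u p \<in> E0" by (simp add: base_coeff_def rho_E0)

lemma fd_hat_e: "p \<in> \<Omega> \<Longrightarrow> frechet_derivative (hat (e w)) (at p) h = 0"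
  by (rule fd_const[where a="PF w"]) (auto simp: hat_e)

text \<open>In coordinates the frame section is the constant \<open>PF w\<close>, so one derivative
  term of \<open>bracket_formula\<close> vanishes.\<close>

lemma bracket_frame_form:
  assumes u: "u \<in> sections A" and x: "x \<in> N0"
  shows "- hat (br u (e w)) (\<kappa> x) = frechet_derivative (hat u) (at (\<kappa> x)) (blinfun_apply (rho (\<kappa> x)) (PF w))
     - blinfun_apply (blinfun_apply (C (\<kappa> x)) (hat u (\<kappa> x))) (PF w)"
  using bracket_formula[OF u e_sec x] kappa_Omega[OF x] by (simp add: hat_e fd_hat_e)

lemma fibre_coeff_form:
  assumes u: "u \<in> sections A" and x: "x \<in> N0"
  shows "blinfun_apply (fibre_coeff u (\<kappa> x)) w = frechet_derivative (hat u) (at (\<kappa> x)) (blinfun_apply (rho (\<kappa> x)) (PF w))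
     - blinfun_apply (blinfun_apply (C (\<kappa> x)) (hat u (\<kappa> x))) (PF w)"
proof -
  have lin: "linear (frechet_derivative (hat u) (at (\<kappa> x)))" by (rule fd_linear[OF hat_sm[OF u] kappa_Omega[OF x]])
  have w: "PF w = (\<Sum>b\<in>Basis. (w \<bullet> b) *\<^sub>R PF b)"
    using euclidean_representation[of w] by (simp add: linear_sum[OF PF(1), symmetric] linear_cmul[OF PF(1), symmetric])
  have g: "blinfun_apply G (PF w) = (\<Sum>b\<in>Basis. (w \<bullet> b) *\<^sub>R blinfun_apply G (PF b))" for G :: "'f \<Rightarrow>\<^sub>L 'g::real_normed_vector"
    by (subst w) (simp add: blinfun.sum_right blinfun.scaleR_right)
  show ?thesis
    unfolding fibre_coeff_def blinfun_of_apply bracket_frame_form[OF u x] scaleR_diff_right sum_subtractf g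
    by (simp add: linear_sum[OF lin] linear_cmul[OF lin])
qed

lemma bracket_frame:
  assumes u: "u \<in> sections A" and p: "p \<in> \<Omega>" and w: "w \<in> typical_fibre A"
  shows "hat (br u (e w)) p = - blinfun_apply (fibre_coeff u p) w"
proof -
  have x: "\<mu> p \<in> N0" by (rule mu_in[OF p])
  have "- hat (br u (e w)) (\<kappa> (\<mu> p)) = blinfun_apply (fibre_coeff u (\<kappa> (\<mu> p))) w"
    unfolding bracket_frame_form[OF u x] fibre_coeff_form[OF u x] ..
  then show ?thesis by (simp add: kappa_mu[OF p] hat_P fibre_coeff_P minus_equation_iff)
qed

lemma fibre_coeff_in: "u \<in> sections A \<Longrightarrow> p \<in> \<Omega> \<Longrightarrow> blinfun_apply (fibre_coeff u p) w \<in> typical_fibre A"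
  unfolding fibre_coeff_def blinfun_of_apply
  by (intro subspace_sum[OF subspaces(1)] subspace_scale[OF subspaces(1)] subspace_neg[OF subspaces(1)] hat_in br_section e_sec)

lemma bracket_coeff:
  assumes u: "u \<in> sections A" and X: "X \<in> sections A" and x: "x \<in> N0"
  shows "hat (br u X) (\<kappa> x) = frechet_derivative (hat X) (at (\<kappa> x)) (base_coeff u (\<kappa> x)) - blinfun_apply (fibre_coeff u (\<kappa> x)) (hat X (\<kappa> x))"
  using bracket_formula[OF u X x] PF(3)[OF hat_in[OF kappa_Omega[OF x] X]] by (simp add: fibre_coeff_form[OF u x] base_coeff_def)

lemma base_coeff_sm: "csm T \<Omega> (\<lambda>t. hat (u t)) \<Longrightarrow> csm T \<Omega> (\<lambda>t. base_coeff (u t))"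
  unfolding base_coeff_def[abs_def] by (intro csm_apply open_Omega sm_csm[OF rho_sm])

lemma fibre_coeff_sm:
  assumes u: "\<And>t. t \<in> T \<Longrightarrow> u t \<in> sections A" and s: "csm T \<Omega> (\<lambda>t. hat (u t))"
  shows "csm T \<Omega> (\<lambda>t. fibre_coeff (u t))"
  unfolding fibre_coeff_def[abs_def]
proof (rule csm_blinfun_of[OF open_Omega])
  fix b :: 'f
  \<comment> \<open>By itself the bracket with \<open>u t\<close> shows no regularity in t. Its
    coordinate form does, since it contains t only through \<open>hat (u t)\<close> and the
    derivative of this map.\<close>
  show "csm T \<Omega> (\<lambda>t p. - hat (br (u t) (e b)) p)"
  proof (rule csm_cong[OF open_Omega])
    show "csm T \<Omega> (\<lambda>t p. frechet_derivative (hat (u t)) (at p) (blinfun_apply (rho p) (PF b))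
         - blinfun_apply (blinfun_apply (C p) (hat (u t) p)) (PF b))"
      by (intro csm_diff csm_frechet2[OF s] csm_apply open_Omega sm_csm[OF rho_sm] sm_csm[OF C_sm] csm_const continuous_on_const s)
    fix t p assume t: "t \<in> T" and p: "p \<in> \<Omega>"
    have Pr: "P (blinfun_apply (rho p) w) = blinfun_apply (rho p) w" for w by (rule P(3)[OF rho_E0])
    show "frechet_derivative (hat (u t)) (at p) (blinfun_apply (rho p) (PF b))
         - blinfun_apply (blinfun_apply (C p) (hat (u t) p)) (PF b) = - hat (br (u t) (e b)) p"
      using bracket_frame_form[OF u[OF t] mu_in[OF p], of b] unfolding kappa_mu[OF p] hat_P rho_P C_P
      by (subst fd_P[OF hat_sm[OF u[OF t]] hat_P p]) (simp only: Pr)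
  qed
qed

lemma base_coeff_sm1: "u \<in> sections A \<Longrightarrow> sm \<Omega> (base_coeff u)" by (rule base_coeff_sm[of "{0}" "\<lambda>_. u"]) (rule hat_sm)
lemma fibre_coeff_sm1: "u \<in> sections A \<Longrightarrow> sm \<Omega> (fibre_coeff u)" by (rule fibre_coeff_sm[of "{0}" "\<lambda>_. u"]) (auto intro: hat_sm)

lemma anchor_k:
  assumes y: "y \<in> N0" "a \<in> fibre A y"
  shows "\<rho> y a (k i) = blinfun_apply (rho (\<kappa> y)) (\<psi> y a) \<bullet> i"
proof -
  have bl: "bounded_linear (\<lambda>p. P p \<bullet> i)"
    using P(1) linear_conv_bounded_linear bounded_linear_compose[OF bounded_linear_inner_left[of i]] by blast
  have "frechet_derivative (\<lambda>p. k i (\<mu> p)) (at (\<kappa> y)) = frechet_derivative (\<lambda>p. P p \<bullet> i) (at (\<kappa> y))"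
    by (rule frechet_derivative_cong[OF open_Omega kappa_Omega[OF y(1)]]) (simp add: k_eq mu_in kappa_mu)
  moreover have "(\<lambda>p. P p \<bullet> i) = frechet_derivative (\<lambda>p. P p \<bullet> i) (at (\<kappa> y))"
    by (rule frechet_derivative_at) (rule bounded_linear_imp_has_derivative[OF bl])
  ultimately have "frechet_derivative (\<lambda>p. k i (\<mu> p)) (at (\<kappa> y)) h = P h \<bullet> i" for h by metis
  then show ?thesis using anchor_formula[OF y k_sm, of i] by (simp add: P(3) rho_E0)
qed

lemma anchor_k_hat:
  assumes X: "X \<in> sections A" and p: "p \<in> \<Omega>"
  shows "\<rho> (\<mu> p) (X (\<mu> p)) (k i) = base_coeff X p \<bullet> i"
  using anchor_k[OF mu_in[OF p] sectionsD[OF X], of i] by (simp add: kappa_mu[OF p] rho_P base_coeff_def hat_def)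

text \<open>This is \<open>anchor_bracket\<close> for u and the frame section of w, tested on the
  coordinate functions. Its terms are those that arise in \<open>D\<phi>_rho\<close> when the anchor
  matrix is differentiated along the flow.\<close>

lemma anchor_defect_id:
  assumes u: "u \<in> sections A" and x: "x \<in> N0" and w: "w \<in> typical_fibre A"
  shows "frechet_derivative (\<lambda>p. blinfun_apply (rho p) w) (at (\<kappa> x)) (base_coeff u (\<kappa> x))
    - frechet_derivative (base_coeff u) (at (\<kappa> x)) (blinfun_apply (rho (\<kappa> x)) w)
    + blinfun_apply (rho (\<kappa> x)) (blinfun_apply (fibre_coeff u (\<kappa> x)) w) = 0"
proof (rule euclidean_eqI)
  fix i :: 'e assume "i \<in> Basis"
  note p = kappa_Omega[OF x]
  have g: "\<rho> x (Z x) (\<lambda>y. \<rho> y (X y) (k i)) = frechet_derivative (base_coeff X) (at (\<kappa> x)) (base_coeff Z (\<kappa> x)) \<bullet> i"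
    if Z: "Z \<in> sections A" and X: "X \<in> sections A" for Z X
  proof -
    have "\<rho> x (Z x) (\<lambda>y. \<rho> y (X y) (k i)) = frechet_derivative (\<lambda>p. \<rho> (\<mu> p) (X (\<mu> p)) (k i)) (at (\<kappa> x)) (blinfun_apply (rho (\<kappa> x)) (\<psi> x (Z x)))"
      by (rule anchor_formula[OF x sectionsD[OF Z] anchor_smooth[OF X k_sm]])
    moreover have "frechet_derivative (\<lambda>p. \<rho> (\<mu> p) (X (\<mu> p)) (k i)) (at (\<kappa> x)) = frechet_derivative (\<lambda>p. base_coeff X p \<bullet> i) (at (\<kappa> x))"
      by (rule frechet_derivative_cong[OF open_Omega p]) (rule anchor_k_hat[OF X])
    moreover have "(\<lambda>h. frechet_derivative (base_coeff X) (at (\<kappa> x)) h \<bullet> i) = frechet_derivative (\<lambda>p. base_coeff X p \<bullet> i) (at (\<kappa> x))"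
      by (rule frechet_derivative_at)
         (rule bounded_linear.has_derivative[OF bounded_linear_inner_left sm_has_derivative[OF base_coeff_sm1[OF X] p]])
    ultimately show ?thesis by (metis base_coeff_def hat_kappa[OF x])
  qed
  have ae: "base_coeff (e w) p = blinfun_apply (rho p) w" if "p \<in> \<Omega>" for p using that w by (simp add: base_coeff_def hat_e PF(3))
  have fe: "frechet_derivative (base_coeff (e w)) (at (\<kappa> x)) = frechet_derivative (\<lambda>p. blinfun_apply (rho p) w) (at (\<kappa> x))"
    by (rule frechet_derivative_cong[OF open_Omega p ae])
  have "\<rho> x (br u (e w) x) (k i) = - (blinfun_apply (rho (\<kappa> x)) (blinfun_apply (fibre_coeff u (\<kappa> x)) w) \<bullet> i)"
    using anchor_k[OF x sectionsD[OF br_section[OF u e_sec]], of w i] bracket_frame[OF u p w]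
    by (simp add: hat_kappa[OF x] blinfun.minus_right)
  moreover have "\<rho> x (br u (e w) x) (k i) = frechet_derivative (base_coeff (e w)) (at (\<kappa> x)) (base_coeff u (\<kappa> x)) \<bullet> i
      - frechet_derivative (base_coeff u) (at (\<kappa> x)) (base_coeff (e w) (\<kappa> x)) \<bullet> i"
    unfolding anchor_bracket[OF u e_sec k_sm] g[OF u e_sec] g[OF e_sec u] ..
  ultimately show "(frechet_derivative (\<lambda>p. blinfun_apply (rho p) w) (at (\<kappa> x)) (base_coeff u (\<kappa> x))
    - frechet_derivative (base_coeff u) (at (\<kappa> x)) (blinfun_apply (rho (\<kappa> x)) w)
    + blinfun_apply (rho (\<kappa> x)) (blinfun_apply (fibre_coeff u (\<kappa> x)) w)) \<bullet> i = 0 \<bullet> i"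
    by (simp add: inner_diff_left inner_add_left ae[OF p] fe)
qed

lemma br_ee:
  assumes p: "p \<in> \<Omega>" and w: "w \<in> typical_fibre A" "w' \<in> typical_fibre A"
  shows "hat (br (e w) (e w')) p = blinfun_apply (blinfun_apply (C p) w) w'"
  using bracket_formula[OF e_sec e_sec mu_in[OF p], of w w'] kappa_Omega[OF mu_in[OF p]] p w
  by (simp add: fd_hat_e hat_e PF(3) kappa_mu[OF p] hat_P C_P)

text \<open>The Jacobi identity for u and two frame sections. Frame sections are constant in
  coordinates, so all derivatives fall on the coefficients; the terms are those of the time
  derivative in \<open>D\<Phi>_C\<close>.\<close>

lemma bracket_defect_id:
  assumes u: "u \<in> sections A" and x: "x \<in> N0" and w: "w \<in> typical_fibre A" "w' \<in> typical_fibre A"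
  defines "p \<equiv> \<kappa> x"
  shows "frechet_derivative (\<lambda>p. blinfun_apply (fibre_coeff u p) w') (at p) (blinfun_apply (rho p) w)
    - frechet_derivative (\<lambda>p. blinfun_apply (fibre_coeff u p) w) (at p) (blinfun_apply (rho p) w')
    + frechet_derivative (\<lambda>p. blinfun_apply (blinfun_apply (C p) w) w') (at p) (base_coeff u p)
    + blinfun_apply (blinfun_apply (C p) (blinfun_apply (fibre_coeff u p) w)) w'
    + blinfun_apply (blinfun_apply (C p) w) (blinfun_apply (fibre_coeff u p) w')
    - blinfun_apply (fibre_coeff u p) (blinfun_apply (blinfun_apply (C p) w) w') = 0"
proof -
  have pO: "p \<in> \<Omega>" unfolding p_def by (rule kappa_Omega[OF x])
  have xV: "x \<in> V" using x N0 by blast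
  have sB: "sm \<Omega> (\<lambda>p. blinfun_apply (fibre_coeff u p) v)" for v
    by (rule csm_bounded_linear[OF blinfun.bounded_linear_left open_Omega fibre_coeff_sm1[OF u]])
  have fB: "frechet_derivative (hat (br u (e v))) (at p) h = - frechet_derivative (\<lambda>p. blinfun_apply (fibre_coeff u p) v) (at p) h"
    if v: "v \<in> typical_fibre A" for v h
  proof -
    have "frechet_derivative (hat (br u (e v))) (at p) = frechet_derivative (\<lambda>p. - blinfun_apply (fibre_coeff u p) v) (at p)"
      by (rule frechet_derivative_cong[OF open_Omega pO]) (rule bracket_frame[OF u _ v])
    moreover have "(\<lambda>h. - frechet_derivative (\<lambda>p. blinfun_apply (fibre_coeff u p) v) (at p) h) = frechet_derivative (\<lambda>p. - blinfun_apply (fibre_coeff u p) v) (at p)"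
      by (rule frechet_derivative_at, rule has_derivative_minus, rule sm_has_derivative[OF sB pO])
    ultimately show ?thesis by metis
  qed
  have h1: "hat (br u (br (e w) (e w'))) p = frechet_derivative (\<lambda>p. blinfun_apply (blinfun_apply (C p) w) w') (at p) (base_coeff u p)
     - blinfun_apply (fibre_coeff u p) (blinfun_apply (blinfun_apply (C p) w) w')"
  proof -
    have "frechet_derivative (hat (br (e w) (e w'))) (at p) = frechet_derivative (\<lambda>p. blinfun_apply (blinfun_apply (C p) w) w') (at p)"
      by (rule frechet_derivative_cong[OF open_Omega pO]) (rule br_ee[OF _ w])
    then show ?thesis using bracket_coeff[OF u br_section[OF e_sec e_sec] x, of w w'] br_ee[OF pO w] by (simp add: p_def)
  qed
  have h2: "hat (br (e w) (br u (e w'))) p = - frechet_derivative (\<lambda>p. blinfun_apply (fibre_coeff u p) w') (at p) (blinfun_apply (rho p) w)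
     - blinfun_apply (blinfun_apply (C p) w) (blinfun_apply (fibre_coeff u p) w')"
    using bracket_formula[OF e_sec br_section[OF u e_sec] x, of w w'] pO w
    by (simp add: p_def[symmetric] fd_hat_e hat_e PF(3) fB bracket_frame[OF u] blinfun.minus_right)
  have h3: "hat (br (br u (e w)) (e w')) p = frechet_derivative (\<lambda>p. blinfun_apply (fibre_coeff u p) w) (at p) (blinfun_apply (rho p) w')
     - blinfun_apply (blinfun_apply (C p) (blinfun_apply (fibre_coeff u p) w)) w'"
    using bracket_formula[OF br_section[OF u e_sec] e_sec x, of w w'] pO w
    by (simp add: p_def[symmetric] fd_hat_e hat_e PF(3) fB bracket_frame[OF u] blinfun.minus_right blinfun.minus_left)
  \<comment> \<open>The Jacobi identity rearranged: bracketing with u is a derivation of the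
    bracket.\<close>
  have "br u (br (e w) (e w')) x = br (br u (e w)) (e w') x + br (e w) (br u (e w')) x"
  proof -
    have s: "(\<lambda>y. - br u (e w') y) = (\<lambda>y. (-1) *\<^sub>R br u (e w') y + 0 *\<^sub>R br u (e w') y)" by simp
    have "br (e w) (br (e w') u) x = - br (e w) (br u (e w')) x"
      unfolding br_skew[OF e_sec u] s
      using fun_cong[OF br_lin_right[OF br_section[OF u e_sec[of w']] br_section[OF u e_sec[of w']] e_sec[of w], of "-1" 0], of x] by simp
    moreover have "br (e w') (br u (e w)) x = - br (br u (e w)) (e w') x"
      using fun_cong[OF br_skew[OF e_sec[of w'] br_section[OF u e_sec[of w]]], of x] .
    ultimately show ?thesis using br_jacobi[OF u e_sec[of w] e_sec[of w'], of x] by (simp add: algebra_simps add_eq_0_iff)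
  qed
  then have "hat (br u (br (e w) (e w'))) p = hat (br (br u (e w)) (e w')) p + hat (br (e w) (br u (e w'))) p"
    unfolding p_def hat_kappa[OF x]
    by (simp add: triv_ops(2)[OF V xV] sectionsD br_section u e_sec)
  then show ?thesis unfolding h1 h2 h3 by (simp add: algebra_simps)
qed

end

lemma has_vector_derivative_fd:
  assumes F: "sm W F" and x: "x t \<in> W" and d: "(x has_vector_derivative x') (at t within S)"
  shows "((\<lambda>t. F (x t)) has_vector_derivative frechet_derivative F (at (x t)) x') (at t within S)"
proof -
  have h: "(F has_derivative frechet_derivative F (at (x t))) (at (x t))" by (rule sm_has_derivative[OF F x])
  have "((\<lambda>t. F (x t)) has_derivative (\<lambda>h. frechet_derivative F (at (x t)) (h *\<^sub>R x'))) (at t within S)"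
    by (rule has_derivative_compose[OF d[unfolded has_vector_derivative_def] h])
  then show ?thesis by (simp add: has_vector_derivative_def linear_cmul[OF has_derivative_linear[OF h]])
qed

lemma fd_apply:
  fixes F :: "'a::euclidean_space \<Rightarrow> 'b::real_normed_vector \<Rightarrow>\<^sub>L 'c::real_normed_vector"
  assumes "sm W F" "p \<in> W"
  shows "frechet_derivative (\<lambda>p. blinfun_apply (F p) v) (at p) h = blinfun_apply (frechet_derivative F (at p) h) v"
  using frechet_derivative_at[OF bounded_linear.has_derivative[OF blinfun.bounded_linear_left sm_has_derivative[OF assms]], of v]
  by metis

lemma blinfun_apply_vd:
  assumes "(A has_vector_derivative A') (at t within S)" "(w has_vector_derivative w') (at t within S)"
  shows "((\<lambda>t. blinfun_apply (A t) (w t)) has_vector_derivative blinfun_apply (A t) w' + blinfun_apply A' (w t)) (at t within S)"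
  by (rule bounded_bilinear.has_vector_derivative[OF bounded_bilinear_blinfun_apply assms])

subsection \<open>The flow in coordinates\<close>

text \<open>\<open>ca\<close> and \<open>cB\<close> are the coefficients cut off outside a ball, so that their flows \<open>\<phi>\<close> and \<open>\<Phi>\<close> (with
  inverse \<open>\<Theta>\<close>) are defined for all times.\<close>

locale coord_flow = coords A U \<kappa> V \<psi> N0 e k
  for A :: "('m::{t2_space,second_countable_topology}, 'e::euclidean_space,
    'v::real_vector, 'f::euclidean_space, 'z) lie_algebroid_scheme"
    and U \<kappa> V \<psi> N0 e k +
  fixes u :: "real \<Rightarrow> 'm \<Rightarrow> 'v" and x0 :: 'm and r L :: real
    and ca :: "real \<Rightarrow> 'e \<Rightarrow> 'e" and cB :: "real \<Rightarrow> 'e \<Rightarrow> 'f \<Rightarrow>\<^sub>L 'f"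
    and \<phi> :: "real \<Rightarrow> real \<Rightarrow> 'e \<Rightarrow> 'e" and \<Phi> \<Theta> :: "real \<Rightarrow> real \<Rightarrow> 'e \<Rightarrow> 'f \<Rightarrow>\<^sub>L 'f"
  assumes u_sec: "u t \<in> sections A" and x0: "x0 \<in> N0" and r: "r > 0" "ball (\<kappa> x0) (2*r) \<subseteq> \<Omega>" and L: "L > 0"
    and ca_eq: "p \<in> ball (\<kappa> x0) (2*r) \<Longrightarrow> ca t p = base_coeff (u t) p"
    and cB_eq: "p \<in> ball (\<kappa> x0) (2*r) \<Longrightarrow> cB t p = fibre_coeff (u t) p"
    and ca_bd: "norm (ca t p) \<le> L" and ca_D: "norm (frechet_derivative (ca t) (at p) v) \<le> L * norm v"
    and cB_bd: "norm (cB t p) \<le> L"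
    and ca_E0: "ca t p \<in> model_space A" and cB_in: "blinfun_apply (cB t p) w \<in> typical_fibre A"
    and ca_csm: "csm UNIV UNIV ca" and cB_csm: "csm UNIV UNIV cB"
    and \<phi>_csm: "csm UNIV UNIV (\<lambda>q. \<phi> (fst q) (snd q))" and \<phi>_init: "\<phi> s s p = p"
    and \<phi>_ode: "((\<lambda>t. \<phi> s t p) has_vector_derivative ca t (\<phi> s t p)) (at t)"
    and D\<phi>_ode: "((\<lambda>t. frechet_derivative (\<phi> s t) (at p) v) has_vector_derivative
        frechet_derivative (ca t) (at (\<phi> s t p)) (frechet_derivative (\<phi> s t) (at p) v)) (at t)"
    and D\<phi>_init: "frechet_derivative (\<phi> s s) (at p) v = v"
    and lin: "lin_ode (\<lambda>s t p. cB t (\<phi> s t p)) \<Phi> \<Theta>"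
    and \<Phi>_csm: "csm UNIV UNIV (\<lambda>q. \<Phi> (fst q) (snd q))" and \<Theta>_csm: "csm UNIV UNIV (\<lambda>q. \<Theta> (fst q) (snd q))"
begin

text \<open>A point within r of \<open>\<kappa> x0\<close> moves with speed at most L, so for times
  shorter than r / L it stays in the ball of radius 2r, where the cut-off coefficients are the true
  ones.\<close>

definition \<delta> :: real where "\<delta> = r / L"
definition N1 :: "'m set" where "N1 = {x \<in> U \<inter> N0. \<kappa> x \<in> ball (\<kappa> x0) r}"
definition f :: "real \<Rightarrow> real \<Rightarrow> 'm \<Rightarrow> 'm" where "f s t x = \<mu> (\<phi> s t (\<kappa> x))"
definition Fw :: "real \<Rightarrow> real \<Rightarrow> 'm \<Rightarrow> 'v \<Rightarrow> 'v" where
  "Fw s t x a = triv_inv \<psi> (f s t x) (blinfun_apply (\<Phi> s t (\<kappa> x)) (\<psi> x a))"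
text \<open>The fibre map back from \<open>f s t x\<close> to x, written with \<Theta> instead of an
  abstract inverse so that its time derivative is a bracket, see \<open>Bw_ode\<close>.\<close>

definition Bw :: "real \<Rightarrow> real \<Rightarrow> 'm \<Rightarrow> 'v \<Rightarrow> 'v" where
  "Bw s t x a = triv_inv \<psi> x (blinfun_apply (\<Theta> s t (\<kappa> x)) (\<psi> (f s t x) a))"

lemma \<delta>_pos: "\<delta> > 0" using r L by (simp add: \<delta>_def)

lemma N1: "open N1" "x0 \<in> N1" "N1 \<subseteq> N0"
proof -
  show "open N1" unfolding N1_def by (rule chart_vimage_open[OF c open_ball N0(1)])
  show "x0 \<in> N1" using x0 subsetD[OF N0(2) x0] r(1) by (simp add: N1_def)
  show "N1 \<subseteq> N0" by (auto simp: N1_def)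
qed

lemma \<Phi>0: "\<Phi> s s p = id_blinfun"
  and \<Phi>': "((\<lambda>t. \<Phi> s t p) has_vector_derivative (cB t (\<phi> s t p) o\<^sub>L \<Phi> s t p)) (at t)"
  and \<Theta>': "((\<lambda>t. \<Theta> s t p) has_vector_derivative - (\<Theta> s t p o\<^sub>L cB t (\<phi> s t p))) (at t)"
  and \<Theta>0: "\<Theta> s s p = id_blinfun"
  and \<Theta>\<Phi>: "blinfun_apply (\<Theta> s t p) (blinfun_apply (\<Phi> s t p) w) = w"
  and \<Phi>\<Theta>: "blinfun_apply (\<Phi> s t p) (blinfun_apply (\<Theta> s t p) w) = w"
proof -
  interpret lin_ode "\<lambda>s t p. cB t (\<phi> s t p)" \<Phi> \<Theta> by (rule lin)
  show "\<Phi> s s p = id_blinfun" by (rule U0)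
  show "\<Theta> s s p = id_blinfun" by (rule V0)
  show "((\<lambda>t. \<Phi> s t p) has_vector_derivative (cB t (\<phi> s t p) o\<^sub>L \<Phi> s t p)) (at t)" by (rule U')
  show "((\<lambda>t. \<Theta> s t p) has_vector_derivative - (\<Theta> s t p o\<^sub>L cB t (\<phi> s t p))) (at t)" by (rule V')
  show "blinfun_apply (\<Theta> s t p) (blinfun_apply (\<Phi> s t p) w) = w"
    using arg_cong[OF VU[of s t p], of "\<lambda>F. blinfun_apply F w"] by simp
  show "blinfun_apply (\<Phi> s t p) (blinfun_apply (\<Theta> s t p) w) = w"
    using arg_cong[OF UV[of s t p], of "\<lambda>F. blinfun_apply F w"] by simp
qed

lemma \<phi>_dist: "norm (\<phi> s t p - p) \<le> L * \<bar>t - s\<bar>"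
proof -
  have "continuous_on UNIV (\<lambda>\<tau>. \<phi> s \<tau> p)"
    by (rule continuous_at_imp_continuous_on, rule ballI, rule has_vector_derivative_continuous[OF \<phi>_ode])
  then have "continuous_on UNIV (\<lambda>\<tau>. ca \<tau> (\<phi> s \<tau> p))"
    by (intro Ckp_cont2[OF csmD[OF ca_csm]] continuous_on_id) auto
  \<comment> \<open>The exponential part of the integral estimate is taken to be 0 and the constant
    part L; the rate 1 is then immaterial.\<close>
  from SI_norm_le[OF this, of 1 L 0 s t] ca_bd
  have "norm (SI (\<lambda>\<tau>. ca \<tau> (\<phi> s \<tau> p)) s t) \<le> \<bar>t - s\<bar> * L" by simp
  moreover have "\<phi> s t p - \<phi> s s p = SI (\<lambda>\<tau>. ca \<tau> (\<phi> s \<tau> p)) s t"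
    by (rule SI_unique[of UNIV]) (simp_all add: \<phi>_ode)
  ultimately show ?thesis by (simp add: \<phi>_init mult.commute)
qed

text \<open>Q = id - P annihilates the velocity, which lies in the model space, so Q is constant
  along the trajectory and starts at 0.\<close>

lemma \<phi>_E0:
  assumes "p \<in> E0" shows "\<phi> s t p \<in> E0"
proof -
  define Q where "Q y = y - P y" for y
  have bl: "bounded_linear Q" unfolding Q_def
    using P(1) linear_conv_bounded_linear by (intro bounded_linear_sub bounded_linear_ident) blast
  have Q0: "Q y = 0" if "y \<in> E0" for y using P(3)[OF that] by (simp add: Q_def)
  have "Q (\<phi> s t p) = 0"
  proof (rule ode_zero[of UNIV s t "\<lambda>t. Q (\<phi> s t p)" 0 "\<lambda>_. 0"])
    show "((\<lambda>t. Q (\<phi> s t p)) has_vector_derivative 0) (at \<tau>)" for \<tau>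
      using bounded_linear.has_vector_derivative[OF bl \<phi>_ode[of s p \<tau>]] by (simp add: Q0 ca_E0)
  qed (use assms in \<open>simp_all add: \<phi>_init Q0\<close>)
  then show ?thesis using P(2)[of "\<phi> s t p"] by (simp add: Q_def)
qed

lemma \<Phi>_in:
  assumes "w \<in> typical_fibre A" shows "blinfun_apply (\<Phi> s t p) w \<in> typical_fibre A"
proof -
  define Q where "Q y = y - PF y" for y
  have bl: "bounded_linear Q" unfolding Q_def
    using PF(1) linear_conv_bounded_linear by (intro bounded_linear_sub bounded_linear_ident) blast
  have Q0: "Q y = 0" if "y \<in> typical_fibre A" for y using PF(3)[OF that] by (simp add: Q_def)
  have "Q (blinfun_apply (\<Phi> s t p) w) = 0"
  proof (rule ode_zero[of UNIV s t "\<lambda>t. Q (blinfun_apply (\<Phi> s t p) w)" 0 "\<lambda>_. 0"])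
    show "((\<lambda>t. Q (blinfun_apply (\<Phi> s t p) w)) has_vector_derivative 0) (at \<tau>)" for \<tau>
      using bounded_linear.has_vector_derivative[OF bl bounded_linear.has_vector_derivative[OF blinfun.bounded_linear_left[of w] \<Phi>'[of s p \<tau>]]]
      by (simp add: Q0 cB_in)
  qed (use assms in \<open>simp_all add: \<Phi>0 Q0\<close>)
  then show ?thesis using PF(2)[of "blinfun_apply (\<Phi> s t p) w"] by (simp add: Q_def)
qed

text \<open>\<Phi> maps the typical fibre injectively into itself, hence onto by dimension, and so
  its inverse preserves the fibre too.\<close>

lemma \<Theta>_in:
  assumes w: "w \<in> typical_fibre A" shows "blinfun_apply (\<Theta> s t p) w \<in> typical_fibre A"
proof -
  let ?F = "blinfun_apply (\<Phi> s t p)"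
  have lin: "linear ?F" by (simp add: blinfun.bounded_linear_right bounded_linear.linear)
  have inj: "inj_on ?F (span (typical_fibre A))" by (rule inj_on_inverseI[where g="blinfun_apply (\<Theta> s t p)"]) (rule \<Theta>\<Phi>)
  have "?F ` typical_fibre A = typical_fibre A"
    by (rule subspace_dim_equal[OF linear_subspace_image[OF lin subspaces(1)] subspaces(1)])
       (use \<Phi>_in dim_image_eq[OF lin inj] in auto)
  then obtain w' where "w' \<in> typical_fibre A" "w = ?F w'" using w by blast
  then show ?thesis by (simp add: \<Theta>\<Phi>)
qed

context
  fixes x s t assumes x: "x \<in> N1" and st: "\<bar>t - s\<bar> < \<delta>"
begin

lemma \<phi>_ball: "\<phi> s t (\<kappa> x) \<in> ball (\<kappa> x0) (2*r)" and \<phi>_Omega: "\<phi> s t (\<kappa> x) \<in> \<Omega>"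
proof -
  have "dist (\<kappa> x0) (\<kappa> x) < r" using x by (simp add: N1_def)
  moreover have "dist (\<kappa> x) (\<phi> s t (\<kappa> x)) < r"
  proof -
    have "L * \<bar>t - s\<bar> < r" using st L by (simp add: \<delta>_def field_simps)
    then show ?thesis using \<phi>_dist[of s t "\<kappa> x"] norm_minus_commute[of "\<phi> s t (\<kappa> x)" "\<kappa> x"] unfolding dist_norm by linarith
  qed
  ultimately show 1: "\<phi> s t (\<kappa> x) \<in> ball (\<kappa> x0) (2*r)"
    using dist_triangle[of "\<kappa> x0" "\<phi> s t (\<kappa> x)" "\<kappa> x"] by simp
  show "\<phi> s t (\<kappa> x) \<in> \<Omega>" using 1 r by blast
qed

lemma xN0: "x \<in> N0" "x \<in> V" "\<kappa> x \<in> \<Omega>" "\<kappa> x \<in> E0"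
  using x N1(3) N0 kappa_Omega kappa_E0 by auto

lemma f_N0: "f s t x \<in> N0" "f s t x \<in> V" "f s t x \<in> U"
  using mu_in[OF \<phi>_Omega] N0 by (auto simp: f_def)

lemma kappa_f: "\<kappa> (f s t x) = \<phi> s t (\<kappa> x)"
  using kappa_mu[OF \<phi>_Omega] P(3)[OF \<phi>_E0[OF xN0(4)]] by (simp add: f_def)

lemma Fw: "a \<in> fibre A x \<Longrightarrow> Fw s t x a \<in> fibre A (f s t x)"
    "a \<in> fibre A x \<Longrightarrow> \<psi> (f s t x) (Fw s t x a) = blinfun_apply (\<Phi> s t (\<kappa> x)) (\<psi> x a)"
  using triv_inv_in[OF V f_N0(2)] triv_triv_inv[OF V f_N0(2)] triv_in[OF V xN0(2)] \<Phi>_in by (simp_all add: Fw_def)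

lemma Bw: "a \<in> fibre A (f s t x) \<Longrightarrow> Bw s t x a \<in> fibre A x"
    "a \<in> fibre A (f s t x) \<Longrightarrow> \<psi> x (Bw s t x a) = blinfun_apply (\<Theta> s t (\<kappa> x)) (\<psi> (f s t x) a)"
  using triv_inv_in[OF V xN0(2)] triv_triv_inv[OF V xN0(2)] triv_in[OF V f_N0(2)] \<Theta>_in by (simp_all add: Bw_def)

lemma Bw_Fw: "a \<in> fibre A x \<Longrightarrow> Bw s t x (Fw s t x a) = a"
  by (rule triv_inj[OF V xN0(2)]) (simp_all add: Fw Bw \<Theta>\<Phi>)

lemma Fw_Bw: "a \<in> fibre A (f s t x) \<Longrightarrow> Fw s t x (Bw s t x a) = a"
  by (rule triv_inj[OF V f_N0(2)]) (simp_all add: Fw Bw \<Phi>\<Theta>)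

lemma Fw_lin: "linear_between (fibre A x) (fibre A (f s t x)) (Fw s t x)"
  unfolding linear_between_def
proof (intro conjI ballI allI)
  show "Fw s t x ` fibre A x \<subseteq> fibre A (f s t x)" using Fw(1) by blast
  fix a b c d assume ab: "a \<in> fibre A x" "b \<in> fibre A x"
  show "Fw s t x (c *\<^sub>R a + d *\<^sub>R b) = c *\<^sub>R Fw s t x a + d *\<^sub>R Fw s t x b"
    by (rule triv_inj[OF V f_N0(2)])
       (simp_all add: Fw fibre_ops ab triv_lin[OF V f_N0(2)] triv_lin[OF V xN0(2)] blinfun.add_right blinfun.scaleR_right)
qed

lemma Bw_lin: "linear_between (fibre A (f s t x)) (fibre A x) (Bw s t x)"
  unfolding linear_between_def
proof (intro conjI ballI allI)
  show "Bw s t x ` fibre A (f s t x) \<subseteq> fibre A x" using Bw(1) by blast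
  fix a b c d assume ab: "a \<in> fibre A (f s t x)" "b \<in> fibre A (f s t x)"
  show "Bw s t x (c *\<^sub>R a + d *\<^sub>R b) = c *\<^sub>R Bw s t x a + d *\<^sub>R Bw s t x b"
    by (rule triv_inj[OF V xN0(2)])
       (simp_all add: Bw fibre_ops ab triv_lin[OF V f_N0(2)] triv_lin[OF V xN0(2)] blinfun.add_right blinfun.scaleR_right)
qed

lemma ca_\<phi>: "ca t (\<phi> s t (\<kappa> x)) = base_coeff (u t) (\<phi> s t (\<kappa> x))" and cB_\<phi>: "cB t (\<phi> s t (\<kappa> x)) = fibre_coeff (u t) (\<phi> s t (\<kappa> x))"
  by (rule ca_eq cB_eq; rule \<phi>_ball)+

lemma fd_ca_\<phi>: "frechet_derivative (ca t) (at (\<phi> s t (\<kappa> x))) = frechet_derivative (base_coeff (u t)) (at (\<phi> s t (\<kappa> x)))"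
  and fd_cB_\<phi>: "frechet_derivative (cB t) (at (\<phi> s t (\<kappa> x))) = frechet_derivative (fibre_coeff (u t)) (at (\<phi> s t (\<kappa> x)))"
  by (rule frechet_derivative_cong[OF open_ball \<phi>_ball]; rule ca_eq cB_eq; assumption)+

lemma f_ode:
  assumes g: "\<And>y. sm_at A g y"
  shows "((\<lambda>t. g (f s t x)) has_real_derivative \<rho> (f s t x) (u t (f s t x)) g) (at t)"
proof -
  have sg: "sm \<Omega> (\<lambda>p. g (\<mu> p))" by (rule sm_hat) (rule g)
  have "((\<lambda>t. g (\<mu> (\<phi> s t (\<kappa> x)))) has_vector_derivative
      frechet_derivative (\<lambda>p. g (\<mu> p)) (at (\<phi> s t (\<kappa> x))) (base_coeff (u t) (\<phi> s t (\<kappa> x)))) (at t)"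
    using has_vector_derivative_fd[where x="\<lambda>t. \<phi> s t (\<kappa> x)", OF sg \<phi>_Omega \<phi>_ode] by (simp add: ca_\<phi>)
  moreover have "base_coeff (u t) (\<phi> s t (\<kappa> x)) = blinfun_apply (rho (\<phi> s t (\<kappa> x))) (\<psi> (f s t x) (u t (f s t x)))"
    by (simp add: base_coeff_def hat_def f_def)
  ultimately show ?thesis
    using anchor_formula[OF f_N0(1) sectionsD[OF u_sec] g]
    unfolding has_real_derivative_iff_has_vector_derivative by (simp add: f_def kappa_f[unfolded f_def])
qed

text \<open>In the product rule the derivative of \<Theta> and the derivative of X along the
  trajectory combine to \<open>bracket_coeff\<close>: pulled back along the flow, X changes at the
  rate of the pulled back [u, X].\<close>

lemma \<Theta>_ode:
  assumes X: "X \<in> sections A"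
  shows "((\<lambda>t. blinfun_apply (\<Theta> s t (\<kappa> x)) (hat X (\<phi> s t (\<kappa> x)))) has_vector_derivative
     blinfun_apply (\<Theta> s t (\<kappa> x)) (hat (br (u t) X) (\<phi> s t (\<kappa> x)))) (at t)"
proof -
  have "((\<lambda>t. hat X (\<phi> s t (\<kappa> x))) has_vector_derivative frechet_derivative (hat X) (at (\<phi> s t (\<kappa> x))) (base_coeff (u t) (\<phi> s t (\<kappa> x)))) (at t)"
    using has_vector_derivative_fd[where x="\<lambda>t. \<phi> s t (\<kappa> x)", OF hat_sm[OF X] \<phi>_Omega \<phi>_ode] by (simp add: ca_\<phi>)
  from blinfun_apply_vd[OF \<Theta>'[of s "\<kappa> x" t] this]
  show ?thesis using bracket_coeff[OF u_sec X f_N0(1), of t]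
    by (simp add: kappa_f cB_\<phi> blinfun.minus_left blinfun.diff_right)
qed

end

lemma Bw_ode:
  assumes x: "x \<in> N1" and st: "\<bar>t - s\<bar> < \<delta>" and X: "X \<in> sections A"
  shows "((\<lambda>t. \<psi> x (Bw s t x (X (f s t x)))) has_vector_derivative \<psi> x (Bw s t x (br (u t) X (f s t x)))) (at t)"
proof -
  have eq: "\<psi> x (Bw s t x (Y (f s t x))) = blinfun_apply (\<Theta> s t (\<kappa> x)) (hat Y (\<phi> s t (\<kappa> x)))"
    if "\<bar>t - s\<bar> < \<delta>" "Y \<in> sections A" for t Y
    unfolding Bw(2)[OF x that(1) sectionsD[OF that(2)]] by (simp add: hat_def f_def)
  have t: "t \<in> {s - \<delta><..<s + \<delta>}" using st by (auto simp: abs_less_iff)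
  show ?thesis unfolding eq[OF st br_section[OF u_sec X]]
    by (rule has_vector_derivative_transform_within_open[OF \<Theta>_ode[OF x st X] open_greaterThanLessThan t])
       (use eq[OF _ X] in \<open>simp add: abs_less_iff\<close>)
qed

text \<open>The difference R of the two sides is 0 at time s, and by \<open>anchor_defect_id\<close>
  it solves the variational equation of the base flow, which is homogeneous.\<close>

lemma D\<phi>_rho:
  assumes x: "x \<in> N1" and st: "\<bar>t - s\<bar> < \<delta>" and w: "w \<in> typical_fibre A"
  shows "frechet_derivative (\<phi> s t) (at (\<kappa> x)) (blinfun_apply (rho (\<kappa> x)) w)
    = blinfun_apply (rho (\<phi> s t (\<kappa> x))) (blinfun_apply (\<Phi> s t (\<kappa> x)) w)"
proof -
  define p where "p = \<kappa> x"
  define R where "R t = frechet_derivative (\<phi> s t) (at p) (blinfun_apply (rho p) w)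
    - blinfun_apply (rho (\<phi> s t p)) (blinfun_apply (\<Phi> s t p) w)" for t
  have "R t = 0"
  proof (rule ode_zero[of "{s - \<delta><..<s + \<delta>}" s t R L "\<lambda>t. frechet_derivative (ca t) (at (\<phi> s t p)) (R t)"])
    show "s \<in> {s - \<delta><..<s + \<delta>}" "t \<in> {s - \<delta><..<s + \<delta>}" using st \<delta>_pos by (auto simp: abs_less_iff)
    show "R s = 0" by (simp add: R_def D\<phi>_init \<phi>_init \<Phi>0)
    fix \<tau> assume "\<tau> \<in> {s - \<delta><..<s + \<delta>}"
    then have \<tau>: "\<bar>\<tau> - s\<bar> < \<delta>" by (simp add: abs_less_iff)
    note pO = \<phi>_Omega[OF x \<tau>, folded p_def]
    let ?q = "\<phi> s \<tau> p" and ?w = "blinfun_apply (\<Phi> s \<tau> p) w"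
    have w1: "?w \<in> typical_fibre A" by (rule \<Phi>_in[OF w])
    have d1: "((\<lambda>t. blinfun_apply (\<Phi> s t p) w) has_vector_derivative blinfun_apply (cB \<tau> ?q) ?w) (at \<tau>)"
      using bounded_linear.has_vector_derivative[OF blinfun.bounded_linear_left[of w] \<Phi>'[of s p \<tau>]] by simp
    have d2: "((\<lambda>t. rho (\<phi> s t p)) has_vector_derivative frechet_derivative rho (at ?q) (ca \<tau> ?q)) (at \<tau>)"
      by (rule has_vector_derivative_fd[OF rho_sm pO \<phi>_ode])
    have d3: "(R has_vector_derivative frechet_derivative (ca \<tau>) (at ?q) (frechet_derivative (\<phi> s \<tau>) (at p) (blinfun_apply (rho p) w))
       - (blinfun_apply (rho ?q) (blinfun_apply (cB \<tau> ?q) ?w) + blinfun_apply (frechet_derivative rho (at ?q) (ca \<tau> ?q)) ?w)) (at \<tau>)"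
      unfolding R_def by (rule has_vector_derivative_diff[OF D\<phi>_ode blinfun_apply_vd[OF d2 d1]])
    have id: "blinfun_apply (rho ?q) (blinfun_apply (cB \<tau> ?q) ?w) + blinfun_apply (frechet_derivative rho (at ?q) (ca \<tau> ?q)) ?w
        = frechet_derivative (ca \<tau>) (at ?q) (blinfun_apply (rho ?q) ?w)"
      using anchor_defect_id[OF u_sec f_N0(1)[OF x \<tau>] w1, of \<tau>] ca_\<phi>[OF x \<tau>] cB_\<phi>[OF x \<tau>] fd_ca_\<phi>[OF x \<tau>]
      by (simp add: kappa_f[OF x \<tau>] p_def[symmetric] fd_apply[OF rho_sm pO] algebra_simps)
    have lin: "linear (frechet_derivative (ca \<tau>) (at ?q))"
      by (rule has_derivative_linear[OF csm_has_derivative[OF ca_csm UNIV_I UNIV_I]])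
    show "(R has_vector_derivative frechet_derivative (ca \<tau>) (at ?q) (R \<tau>)) (at \<tau> within {s - \<delta><..<s + \<delta>})"
      using d3 unfolding id linear_diff[OF lin, symmetric] R_def[of \<tau>, symmetric] by (rule has_vector_derivative_at_within)
    show "norm (frechet_derivative (ca \<tau>) (at ?q) (R \<tau>)) \<le> L * norm (R \<tau>)" by (rule ca_D)
  qed (use L in auto)
  then show ?thesis by (simp add: R_def p_def)
qed

text \<open>The bracket of transported frame sections against the transport of their bracket; the
  derivative terms appear because \<Phi> varies from point to point. The defect E vanishes at time
  s, and \<open>bracket_defect_id\<close> gives the homogeneous equation E' = cB E.\<close>

lemma D\<Phi>_C:
  assumes x: "x \<in> N1" and st: "\<bar>t - s\<bar> < \<delta>" and w: "w \<in> typical_fibre A" "w' \<in> typical_fibre A"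
  defines "p \<equiv> \<kappa> x"
  shows "blinfun_apply (frechet_derivative (\<Phi> s t) (at p) (blinfun_apply (rho p) w)) w'
    - blinfun_apply (frechet_derivative (\<Phi> s t) (at p) (blinfun_apply (rho p) w')) w
    + blinfun_apply (blinfun_apply (C (\<phi> s t p)) (blinfun_apply (\<Phi> s t p) w)) (blinfun_apply (\<Phi> s t p) w')
    = blinfun_apply (\<Phi> s t p) (blinfun_apply (blinfun_apply (C p) w) w')"
proof -
  interpret lo: lin_ode "\<lambda>s t p. cB t (\<phi> s t p)" \<Phi> \<Theta> by (rule lin)
  define T where "T v t = blinfun_apply (\<Phi> s t p) v" for v t
  define D where "D v t = frechet_derivative (\<Phi> s t) (at p) (blinfun_apply (rho p) v)" for v t
  define E where "E t = blinfun_apply (D w t) w' - blinfun_apply (D w' t) w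
    + blinfun_apply (blinfun_apply (C (\<phi> s t p)) (T w t)) (T w' t)
    - blinfun_apply (\<Phi> s t p) (blinfun_apply (blinfun_apply (C p) w) w')" for t
  have Mcsm: "csm UNIV UNIV (\<lambda>q p. cB (snd q) (\<phi> (fst q) (snd q) p))"
    by (rule csm_compose[where f="\<lambda>q. cB (snd q)" and g="\<lambda>q. \<phi> (fst q) (snd q)", OF open_UNIV open_UNIV _ _ \<phi>_csm])
       (auto intro!: csm_reparam[OF _ _ _ cB_csm, of _ snd] continuous_intros)
  have "E t = 0"
  proof (rule ode_zero[of "{s - \<delta><..<s + \<delta>}" s t E L "\<lambda>t. blinfun_apply (cB t (\<phi> s t p)) (E t)"])
    show "s \<in> {s - \<delta><..<s + \<delta>}" "t \<in> {s - \<delta><..<s + \<delta>}" using st \<delta>_pos by (auto simp: abs_less_iff)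
    have D0: "D v s = 0" for v
    proof -
      have "\<Phi> s s = (\<lambda>_. id_blinfun)" by (simp add: \<Phi>0 fun_eq_iff)
      then show ?thesis by (simp add: D_def frechet_derivative_const)
    qed
    show "E s = 0" by (simp add: E_def D0 T_def \<Phi>0 \<phi>_init)
    fix \<tau> assume "\<tau> \<in> {s - \<delta><..<s + \<delta>}"
    then have \<tau>: "\<bar>\<tau> - s\<bar> < \<delta>" by (simp add: abs_less_iff)
    note pO = \<phi>_Omega[OF x \<tau>, folded p_def]
    let ?q = "\<phi> s \<tau> p"
    have Tin: "T v \<tau> \<in> typical_fibre A" if "v \<in> typical_fibre A" for v unfolding T_def by (rule \<Phi>_in[OF that])
    have dT: "(T v has_vector_derivative blinfun_apply (cB \<tau> ?q) (T v \<tau>)) (at \<tau>)" for v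
      unfolding T_def using bounded_linear.has_vector_derivative[OF blinfun.bounded_linear_left[of v] \<Phi>'[of s p \<tau>]] by simp
    have dC: "((\<lambda>t. C (\<phi> s t p)) has_vector_derivative frechet_derivative C (at ?q) (ca \<tau> ?q)) (at \<tau>)"
      by (rule has_vector_derivative_fd[OF C_sm pO \<phi>_ode])
    \<comment> \<open>The chain rule differentiates cB in the direction of the anchor moved by the
      derivative of \<phi>. By \<open>D\<phi>_rho\<close> this is the anchor at the moved point, the
      form in which \<open>bracket_defect_id\<close> applies.\<close>
    have dM: "frechet_derivative (\<lambda>p. cB \<tau> (\<phi> s \<tau> p)) (at p) (blinfun_apply (rho p) v)
        = frechet_derivative (cB \<tau>) (at ?q) (blinfun_apply (rho ?q) (T v \<tau>))" if v: "v \<in> typical_fibre A" for v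
    proof -
      have d\<phi>: "(\<phi> s \<tau> has_derivative frechet_derivative (\<phi> s \<tau>) (at p)) (at p)"
        using csm_has_derivative[OF \<phi>_csm UNIV_I[of "(s,\<tau>)"] UNIV_I[of p]] by simp
      have "((\<lambda>p. cB \<tau> (\<phi> s \<tau> p)) has_derivative (\<lambda>h. frechet_derivative (cB \<tau>) (at ?q) (frechet_derivative (\<phi> s \<tau>) (at p) h))) (at p)"
        by (rule has_derivative_compose[OF d\<phi> csm_has_derivative[OF cB_csm UNIV_I UNIV_I]])
      from fun_cong[OF frechet_derivative_at[OF this], of "blinfun_apply (rho p) v"]
      show ?thesis using D\<phi>_rho[OF x \<tau> v] by (simp add: p_def T_def)
    qed
    have dD: "((\<lambda>t. blinfun_apply (D v t) v') has_vector_derivative blinfun_apply (cB \<tau> ?q) (blinfun_apply (D v \<tau>) v')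
        + blinfun_apply (frechet_derivative (cB \<tau>) (at ?q) (blinfun_apply (rho ?q) (T v \<tau>))) (T v' \<tau>)) (at \<tau>)"
      if v: "v \<in> typical_fibre A" for v v'
      using bounded_linear.has_vector_derivative[OF blinfun.bounded_linear_left[of v'] lo.DU_time_derivative[OF csmD[OF Mcsm], of s p "blinfun_apply (rho p) v" \<tau>]]
      unfolding D_def[symmetric] dM[OF v] by (simp add: blinfun.add_left T_def)
    have dE: "(E has_vector_derivative
        (blinfun_apply (cB \<tau> ?q) (blinfun_apply (D w \<tau>) w') + blinfun_apply (frechet_derivative (cB \<tau>) (at ?q) (blinfun_apply (rho ?q) (T w \<tau>))) (T w' \<tau>))
        - (blinfun_apply (cB \<tau> ?q) (blinfun_apply (D w' \<tau>) w) + blinfun_apply (frechet_derivative (cB \<tau>) (at ?q) (blinfun_apply (rho ?q) (T w' \<tau>))) (T w \<tau>))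
        + (blinfun_apply (blinfun_apply (C ?q) (T w \<tau>)) (blinfun_apply (cB \<tau> ?q) (T w' \<tau>))
           + blinfun_apply (blinfun_apply (C ?q) (blinfun_apply (cB \<tau> ?q) (T w \<tau>)) + blinfun_apply (frechet_derivative C (at ?q) (ca \<tau> ?q)) (T w \<tau>)) (T w' \<tau>))
        - blinfun_apply (cB \<tau> ?q) (T (blinfun_apply (blinfun_apply (C p) w) w') \<tau>)) (at \<tau>)"
      unfolding E_def T_def[of "blinfun_apply (blinfun_apply (C p) w) w'", symmetric]
      by (intro has_vector_derivative_diff has_vector_derivative_add dD w blinfun_apply_vd dC dT)
    have "frechet_derivative (\<lambda>p. blinfun_apply (blinfun_apply (C p) (T w \<tau>)) (T w' \<tau>)) (at ?q) h
        = blinfun_apply (blinfun_apply (frechet_derivative C (at ?q) h) (T w \<tau>)) (T w' \<tau>)" for h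
    proof -
      have "((\<lambda>p. blinfun_apply (blinfun_apply (C p) (T w \<tau>)) (T w' \<tau>)) has_derivative
         (\<lambda>h. blinfun_apply (blinfun_apply (frechet_derivative C (at ?q) h) (T w \<tau>)) (T w' \<tau>))) (at ?q)"
        by (rule bounded_linear.has_derivative[OF blinfun.bounded_linear_left
             bounded_linear.has_derivative[OF blinfun.bounded_linear_left sm_has_derivative[OF C_sm pO]]])
      from fun_cong[OF frechet_derivative_at[OF this], of h] show ?thesis by simp
    qed
    then have id: "blinfun_apply (frechet_derivative (cB \<tau>) (at ?q) (blinfun_apply (rho ?q) (T w \<tau>))) (T w' \<tau>)
       - blinfun_apply (frechet_derivative (cB \<tau>) (at ?q) (blinfun_apply (rho ?q) (T w' \<tau>))) (T w \<tau>)
       + (blinfun_apply (blinfun_apply (C ?q) (T w \<tau>)) (blinfun_apply (cB \<tau> ?q) (T w' \<tau>))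
           + (blinfun_apply (blinfun_apply (C ?q) (blinfun_apply (cB \<tau> ?q) (T w \<tau>))) (T w' \<tau>)
           + blinfun_apply (blinfun_apply (frechet_derivative C (at ?q) (ca \<tau> ?q)) (T w \<tau>)) (T w' \<tau>)))
       = blinfun_apply (cB \<tau> ?q) (blinfun_apply (blinfun_apply (C ?q) (T w \<tau>)) (T w' \<tau>))"
      using bracket_defect_id[OF u_sec f_N0(1)[OF x \<tau>] Tin[OF w(1)] Tin[OF w(2)], of \<tau>]
        ca_\<phi>[OF x \<tau>, folded p_def] cB_\<phi>[OF x \<tau>, folded p_def] fd_cB_\<phi>[OF x \<tau>, folded p_def]
      by (simp add: kappa_f[OF x \<tau>, folded p_def] fd_apply[OF fibre_coeff_sm1[OF u_sec] pO] algebra_simps)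
    have "(blinfun_apply (cB \<tau> ?q) (blinfun_apply (D w \<tau>) w') + blinfun_apply (frechet_derivative (cB \<tau>) (at ?q) (blinfun_apply (rho ?q) (T w \<tau>))) (T w' \<tau>))
        - (blinfun_apply (cB \<tau> ?q) (blinfun_apply (D w' \<tau>) w) + blinfun_apply (frechet_derivative (cB \<tau>) (at ?q) (blinfun_apply (rho ?q) (T w' \<tau>))) (T w \<tau>))
        + (blinfun_apply (blinfun_apply (C ?q) (T w \<tau>)) (blinfun_apply (cB \<tau> ?q) (T w' \<tau>))
           + blinfun_apply (blinfun_apply (C ?q) (blinfun_apply (cB \<tau> ?q) (T w \<tau>)) + blinfun_apply (frechet_derivative C (at ?q) (ca \<tau> ?q)) (T w \<tau>)) (T w' \<tau>))
        - blinfun_apply (cB \<tau> ?q) (T (blinfun_apply (blinfun_apply (C p) w) w') \<tau>) = blinfun_apply (cB \<tau> ?q) (E \<tau>)"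
      using id unfolding E_def T_def[of "blinfun_apply (blinfun_apply (C p) w) w'", symmetric] blinfun.add_left blinfun.add_right blinfun.diff_right
      by (simp add: algebra_simps)
    with dE show "(E has_vector_derivative blinfun_apply (cB \<tau> ?q) (E \<tau>)) (at \<tau> within {s - \<delta><..<s + \<delta>})"
      by (metis has_vector_derivative_at_within)
    show "norm (blinfun_apply (cB \<tau> ?q) (E \<tau>)) \<le> L * norm (E \<tau>)"
      using norm_blinfun[of "cB \<tau> ?q" "E \<tau>"] mult_right_mono[OF cB_bd[of \<tau> ?q] norm_ge_zero[of "E \<tau>"]] by linarith
  qed (use L in auto)
  then show ?thesis by (simp add: E_def D_def T_def)
qed

context
  fixes x s t assumes x: "x \<in> N1" and st: "\<bar>t - s\<bar> < \<delta>"
begin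

lemma \<phi>_sm: "sm UNIV (\<phi> s t)" and \<Phi>_sm: "sm UNIV (\<Phi> s t)" and \<Theta>_sm: "sm UNIV (\<Theta> s t)"
  using csm_sm[OF \<phi>_csm, of "(s,t)"] csm_sm[OF \<Phi>_csm, of "(s,t)"] csm_sm[OF \<Theta>_csm, of "(s,t)"] by simp_all

lemma f_cont: "continuous_on N1 (f s t)"
proof -
  have "continuous_on \<Omega> \<mu>" unfolding \<mu>_def
    by (rule continuous_on_compose2[OF chart(6)[OF c] P_cont]) (use N0 in \<open>auto simp: \<Omega>_def\<close>)
  moreover have "continuous_on N1 (\<lambda>y. \<phi> s t (\<kappa> y))"
    by (rule continuous_on_compose2[OF sm_cont[OF \<phi>_sm] continuous_on_subset[OF chart(5)[OF c]]]) (use N1 N0 in auto)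
  ultimately show ?thesis unfolding f_def
    by (rule continuous_on_compose2) (use \<phi>_Omega[OF _ st] in auto)
qed

lemma f_sm: "sm_at A (\<lambda>y. \<kappa> (f s t y)) x"
proof (rule sm_at_cong[OF _ N1(1) x])
  show "sm_at A (\<lambda>y. \<phi> s t (\<kappa> y)) x"
    by (rule sm_at_comp[OF sm_at_chart[OF c] open_UNIV UNIV_I \<phi>_sm]) (use xN0[OF x st] N0 in auto)
qed (simp add: kappa_f[OF _ st])

text \<open>H and G composed with \<phi> are known to agree at chart points only, that is, on the
  model space. After composition with P the identity holds on an open set, and P fixes the direction
  h.\<close>

lemma fd_pull:
  assumes G: "sm \<Omega> G" and H: "\<And>p. H (P p) = H p" "\<And>y. y \<in> N1 \<Longrightarrow> H (\<kappa> y) = G (\<phi> s t (\<kappa> y))" and h: "h \<in> E0"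
  shows "frechet_derivative H (at (\<kappa> x)) h = frechet_derivative G (at (\<phi> s t (\<kappa> x))) (frechet_derivative (\<phi> s t) (at (\<kappa> x)) h)"
proof -
  define O1 where "O1 = {p \<in> \<Omega>. \<mu> p \<in> N1}"
  have O1: "open O1" "\<kappa> x \<in> O1" unfolding O1_def
    using open_Omega_sub[OF N1(1,3)] xN0[OF x st] x by (auto simp: mu_kappa)
  have "frechet_derivative H (at (\<kappa> x)) = frechet_derivative (\<lambda>p. G (\<phi> s t (P p))) (at (\<kappa> x))"
  proof (rule frechet_derivative_cong[OF O1])
    fix p assume "p \<in> O1"
    then have p: "p \<in> \<Omega>" "\<mu> p \<in> N1" by (auto simp: O1_def)
    show "H p = G (\<phi> s t (P p))" using H(2)[OF p(2)] by (simp add: kappa_mu[OF p(1)] H(1))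
  qed
  moreover have "((\<lambda>p. G (\<phi> s t (P p))) has_derivative (\<lambda>h. frechet_derivative G (at (\<phi> s t (\<kappa> x))) (frechet_derivative (\<phi> s t) (at (\<kappa> x)) (P h)))) (at (\<kappa> x))"
  proof (rule has_derivative_compose[of "\<lambda>p. \<phi> s t (P p)" "\<lambda>h. frechet_derivative (\<phi> s t) (at (\<kappa> x)) (P h)"])
    have "(P has_derivative P) (at (\<kappa> x))" using P(1) by (simp add: linear_imp_has_derivative)
    then show "((\<lambda>p. \<phi> s t (P p)) has_derivative (\<lambda>h. frechet_derivative (\<phi> s t) (at (\<kappa> x)) (P h))) (at (\<kappa> x))"
      by (rule has_derivative_compose) (use sm_has_derivative[OF \<phi>_sm UNIV_I] P_kappa[OF xN0(1)[OF x st]] in simp)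
    show "(G has_derivative frechet_derivative G (at (\<phi> s t (\<kappa> x)))) (at (\<phi> s t (P (\<kappa> x))))"
      using sm_has_derivative[OF G \<phi>_Omega[OF x st]] P_kappa[OF xN0(1)[OF x st]] by simp
  qed
  ultimately show ?thesis using frechet_derivative_at P(3)[OF h] by metis
qed

lemma anchor_compat:
  assumes g: "\<And>y. sm_at A g y" and g': "\<And>y. sm_at A g' y" and eq: "\<And>y. y \<in> N1 \<Longrightarrow> g' y = g (f s t y)" and a: "a \<in> fibre A x"
  shows "\<rho> (f s t x) (Fw s t x a) g = \<rho> x a g'"
proof -
  have sg: "sm \<Omega> (\<lambda>p. g (\<mu> p))" by (rule sm_hat) (rule g)
  have w: "\<psi> x a \<in> typical_fibre A" by (rule triv_in[OF V xN0(2)[OF x st] a])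
  have "\<rho> (f s t x) (Fw s t x a) g = frechet_derivative (\<lambda>p. g (\<mu> p)) (at (\<phi> s t (\<kappa> x)))
      (frechet_derivative (\<phi> s t) (at (\<kappa> x)) (blinfun_apply (rho (\<kappa> x)) (\<psi> x a)))"
    using anchor_formula[OF f_N0(1)[OF x st] Fw(1)[OF x st a] g] by (simp add: kappa_f[OF x st] Fw(2)[OF x st a] D\<phi>_rho[OF x st w])
  also have "\<dots> = frechet_derivative (\<lambda>p. g' (\<mu> p)) (at (\<kappa> x)) (blinfun_apply (rho (\<kappa> x)) (\<psi> x a))"
    by (rule fd_pull[symmetric, OF sg _ _ rho_E0]) (use eq N1(3) in \<open>auto simp: mu_kappa f_def subset_iff\<close>)
  also have "\<dots> = \<rho> x a g'" by (rule anchor_formula[symmetric, OF xN0(1)[OF x st] a g'])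
  finally show ?thesis .
qed

text \<open>\<open>bracket_formula\<close> at the moved point, with the derivatives of X' and Y'
  obtained by the product and chain rules from those of X and Y. Two terms with the derivative of
  \<Phi> remain; by \<open>D\<Phi>_C\<close> they combine with C at the moved point into \<Phi>
  applied to C at the old one.\<close>

lemma bracket_compat:
  assumes X: "X \<in> sections A" "X' \<in> sections A" "\<And>y. y \<in> N1 \<Longrightarrow> X' (f s t y) = Fw s t y (X y)"
    and Y: "Y \<in> sections A" "Y' \<in> sections A" "\<And>y. y \<in> N1 \<Longrightarrow> Y' (f s t y) = Fw s t y (Y y)"
  shows "br X' Y' (f s t x) = Fw s t x (br X Y x)"
proof -
  note xN = xN0[OF x st]
  have hatF: "hat Z' (\<phi> s t (\<kappa> y)) = blinfun_apply (\<Phi> s t (\<kappa> y)) (hat Z (\<kappa> y))"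
    if Z: "Z \<in> sections A" "\<And>y. y \<in> N1 \<Longrightarrow> Z' (f s t y) = Fw s t y (Z y)" and y: "y \<in> N1" for Z Z' y
    using Fw(2)[OF y st sectionsD[OF Z(1)]] hat_kappa[OF f_N0(1)[OF y st], of Z'] hat_kappa[OF xN0(1)[OF y st], of Z]
    by (simp add: kappa_f[OF y st] Z(2)[OF y])
  have fdF: "frechet_derivative (hat Z') (at (\<phi> s t (\<kappa> x))) (frechet_derivative (\<phi> s t) (at (\<kappa> x)) h)
      = blinfun_apply (frechet_derivative (\<Phi> s t) (at (\<kappa> x)) h) (hat Z (\<kappa> x))
        + blinfun_apply (\<Phi> s t (\<kappa> x)) (frechet_derivative (hat Z) (at (\<kappa> x)) h)"
    if Z: "Z \<in> sections A" "Z' \<in> sections A" "\<And>y. y \<in> N1 \<Longrightarrow> Z' (f s t y) = Fw s t y (Z y)" and h: "h \<in> E0" for Z Z' h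
  proof -
    let ?H = "\<lambda>p. blinfun_apply (\<Phi> s t (P p)) (hat Z p)"
    have "frechet_derivative ?H (at (\<kappa> x)) h = frechet_derivative (hat Z') (at (\<phi> s t (\<kappa> x))) (frechet_derivative (\<phi> s t) (at (\<kappa> x)) h)"
      by (rule fd_pull[OF hat_sm[OF Z(2)] _ _ h])
         (use N1(3) hatF[OF Z(1,3)] in \<open>auto simp: hat_P P_kappa subset_iff\<close>)
    moreover have "frechet_derivative ?H (at (\<kappa> x)) h = blinfun_apply (\<Phi> s t (\<kappa> x)) (frechet_derivative (hat Z) (at (\<kappa> x)) h)
       + blinfun_apply (frechet_derivative (\<Phi> s t) (at (\<kappa> x)) (P h)) (hat Z (\<kappa> x))"
    proof -
      have "(P has_derivative P) (at (\<kappa> x))" using P(1) by (simp add: linear_imp_has_derivative)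
      then have d: "((\<lambda>p. \<Phi> s t (P p)) has_derivative (\<lambda>h. frechet_derivative (\<Phi> s t) (at (\<kappa> x)) (P h))) (at (\<kappa> x))"
        by (rule has_derivative_compose) (use sm_has_derivative[OF \<Phi>_sm UNIV_I] P_kappa[OF xN(1)] in simp)
      have "(?H has_derivative (\<lambda>h. blinfun_apply (\<Phi> s t (P (\<kappa> x))) (frechet_derivative (hat Z) (at (\<kappa> x)) h)
         + blinfun_apply (frechet_derivative (\<Phi> s t) (at (\<kappa> x)) (P h)) (hat Z (\<kappa> x)))) (at (\<kappa> x))"
        by (rule bounded_bilinear.FDERIV[OF bounded_bilinear_blinfun_apply d sm_has_derivative[OF hat_sm[OF Z(1)] xN(3)]])
      from fun_cong[OF frechet_derivative_at[OF this], of h] show ?thesis by (simp add: P_kappa[OF xN(1)])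
    qed
    ultimately show ?thesis by (simp add: P(3)[OF h] add.commute)
  qed
  let ?q = "\<phi> s t (\<kappa> x)" and ?F = "blinfun_apply (\<Phi> s t (\<kappa> x))" and ?a = "hat X (\<kappa> x)" and ?b = "hat Y (\<kappa> x)"
  have a: "?a \<in> typical_fibre A" and b: "?b \<in> typical_fibre A" by (rule hat_in[OF xN(3)]; fact)+
  have rF: "blinfun_apply (rho ?q) (?F v) = frechet_derivative (\<phi> s t) (at (\<kappa> x)) (blinfun_apply (rho (\<kappa> x)) v)"
    if "v \<in> typical_fibre A" for v using D\<phi>_rho[OF x st that] by simp
  have hX: "hat X' ?q = ?F ?a" by (rule hatF[OF X(1) _ x]) (rule X(3))
  have hY: "hat Y' ?q = ?F ?b" by (rule hatF[OF Y(1) _ x]) (rule Y(3))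
  have fX: "frechet_derivative (hat X') (at ?q) (frechet_derivative (\<phi> s t) (at (\<kappa> x)) (blinfun_apply (rho (\<kappa> x)) v))
      = blinfun_apply (frechet_derivative (\<Phi> s t) (at (\<kappa> x)) (blinfun_apply (rho (\<kappa> x)) v)) ?a
        + ?F (frechet_derivative (hat X) (at (\<kappa> x)) (blinfun_apply (rho (\<kappa> x)) v))" for v
    by (rule fdF[OF X(1,2) _ rho_E0]) (rule X(3))
  have fY: "frechet_derivative (hat Y') (at ?q) (frechet_derivative (\<phi> s t) (at (\<kappa> x)) (blinfun_apply (rho (\<kappa> x)) v))
      = blinfun_apply (frechet_derivative (\<Phi> s t) (at (\<kappa> x)) (blinfun_apply (rho (\<kappa> x)) v)) ?b
        + ?F (frechet_derivative (hat Y) (at (\<kappa> x)) (blinfun_apply (rho (\<kappa> x)) v))" for v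
    by (rule fdF[OF Y(1,2) _ rho_E0]) (rule Y(3))
  have "hat (br X' Y') ?q = blinfun_apply (frechet_derivative (\<Phi> s t) (at (\<kappa> x)) (blinfun_apply (rho (\<kappa> x)) ?a)) ?b
        + ?F (frechet_derivative (hat Y) (at (\<kappa> x)) (blinfun_apply (rho (\<kappa> x)) ?a))
      - (blinfun_apply (frechet_derivative (\<Phi> s t) (at (\<kappa> x)) (blinfun_apply (rho (\<kappa> x)) ?b)) ?a
        + ?F (frechet_derivative (hat X) (at (\<kappa> x)) (blinfun_apply (rho (\<kappa> x)) ?b)))
      + blinfun_apply (blinfun_apply (C ?q) (?F ?a)) (?F ?b)"
    using bracket_formula[OF X(2) Y(2) f_N0(1)[OF x st]]
    unfolding kappa_f[OF x st] hX hY rF[OF a] rF[OF b] fX fY .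
  also have "\<dots> = ?F (frechet_derivative (hat Y) (at (\<kappa> x)) (blinfun_apply (rho (\<kappa> x)) ?a)
      - frechet_derivative (hat X) (at (\<kappa> x)) (blinfun_apply (rho (\<kappa> x)) ?b) + blinfun_apply (blinfun_apply (C (\<kappa> x)) ?a) ?b)"
    unfolding blinfun.add_right blinfun.diff_right D\<Phi>_C[OF x st a b, symmetric] by simp
  also have "\<dots> = ?F (hat (br X Y) (\<kappa> x))" by (simp only: bracket_formula[OF X(1) Y(1) xN(1)])
  finally have "\<psi> (f s t x) (br X' Y' (f s t x)) = \<psi> (f s t x) (Fw s t x (br X Y x))"
    using hat_kappa[OF f_N0(1)[OF x st], of "br X' Y'"] hat_kappa[OF xN(1), of "br X Y"]
    by (simp add: kappa_f[OF x st] Fw(2)[OF x st sectionsD[OF br_section[OF X(1) Y(1)]]])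
  then show ?thesis
    by (rule triv_inj[OF V f_N0(2)[OF x st], rotated 2]) (intro sectionsD br_section X Y Fw(1)[OF x st])+
qed

end

end

section \<open>Existence of the flow in coordinates\<close>

lemma linear_betweenD:
  assumes "linear_between S T F"
  shows "a \<in> S \<Longrightarrow> F a \<in> T" "a \<in> S \<Longrightarrow> b \<in> S \<Longrightarrow> F (c *\<^sub>R a + d *\<^sub>R b) = c *\<^sub>R F a + d *\<^sub>R F b"
  using assms by (auto simp: linear_between_def)

lemma linear_between_sum:
  assumes F: "linear_between S T F" and S: "subspace S" and h: "\<And>i. i \<in> I \<Longrightarrow> h i \<in> S"
  shows "F (\<Sum>i\<in>I. c i *\<^sub>R h i) = (\<Sum>i\<in>I. c i *\<^sub>R F (h i))"
  using h
proof (induction I rule: infinite_finite_induct)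
  case (insert i I)
  have "F (c i *\<^sub>R h i + 1 *\<^sub>R (\<Sum>i\<in>I. c i *\<^sub>R h i)) = c i *\<^sub>R F (h i) + 1 *\<^sub>R F (\<Sum>i\<in>I. c i *\<^sub>R h i)"
    by (rule linear_betweenD(2)[OF F]) (use insert in \<open>auto intro!: subspace_sum[OF S] subspace_scale[OF S]\<close>)
  then show ?case using insert by simp
qed (use linear_betweenD(2)[OF F, of 0 0 0 0] subspace_0[OF S] in simp_all)

definition clamp01 :: "real \<Rightarrow> real" where "clamp01 t = max 0 (min 1 t)"

lemma clamp01: "clamp01 t \<in> {0..1}" "t \<in> {0..1} \<Longrightarrow> clamp01 t = t" "continuous_on S clamp01"
  unfolding clamp01_def by (auto intro!: continuous_intros)

text \<open>Clamping confines the time to [0,1] and the support confines the point to K, so all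
  nonzero values are already taken on a compact set.\<close>

lemma csm_bounded:
  fixes F :: "real \<Rightarrow> 'a::euclidean_space \<Rightarrow> 'b::real_normed_vector"
  assumes F: "csm UNIV UNIV F" and clamp: "\<And>t. F t = F (clamp01 t)" and K: "compact K" "\<And>t p. p \<notin> K \<Longrightarrow> F t p = 0"
  shows "\<exists>B. \<forall>t p. norm (F t p) \<le> B"
proof -
  have "compact ((\<lambda>z. F (fst z) (snd z)) ` ({0..1} \<times> K))"
    by (rule compact_continuous_image[OF continuous_on_subset[OF csm_cont[OF F]] compact_Times[OF compact_Icc K(1)]]) simp
  from compact_imp_bounded[OF this]
  obtain B where B: "\<forall>y\<in>(\<lambda>z. F (fst z) (snd z)) ` ({0..1} \<times> K). norm y \<le> B"
    unfolding bounded_iff by (rule exE)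
  have "norm (F t p) \<le> max B 0" for t p
  proof (cases "p \<in> K")
    case True
    then have "norm (F (clamp01 t) p) \<le> B" using bspec[OF B imageI[of "(clamp01 t, p)" "{0..1} \<times> K"]] clamp01(1)[of t] by simp
    then show ?thesis using clamp[of t] by simp
  next
    case False
    then show ?thesis using K(2) by simp
  qed
  then show ?thesis by blast
qed

lemma (in coords) coord_flow_exists:
  assumes u_sec: "\<And>t. u t \<in> sections A" and u_csm: "csm {0..1} \<Omega> (\<lambda>t. hat (u t))"
    and clamp: "\<And>t. u t = u (clamp01 t)" and x0: "x0 \<in> N0"
  shows "\<exists>r L ca cB \<phi> \<Phi> \<Theta>. coord_flow A U \<kappa> V \<psi> N0 e k u x0 r L ca cB \<phi> \<Phi> \<Theta>"
proof -
  obtain R where R: "R > 0" "cball (\<kappa> x0) R \<subseteq> \<Omega>" using open_Omega kappa_Omega[OF x0] open_contains_cball by blast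
  \<comment> \<open>Three radii: points start within r and stay within 2r, where the cutoff is 1,
    and the cutoff vanishes beyond 3r = R.\<close>
  define r where "r = R / 3"
  have r: "r > 0" "R = 3 * r" using R by (simp_all add: r_def)
  define K where "K = cball (\<kappa> x0) (3 * r)"
  obtain \<beta> :: "'e \<Rightarrow> real" where \<beta>: "sm UNIV \<beta>" "\<And>p. dist (\<kappa> x0) p \<le> 2 * r \<Longrightarrow> \<beta> p = 1" "\<And>p. 3 * r \<le> dist (\<kappa> x0) p \<Longrightarrow> \<beta> p = 0"
    by (rule bump_exists[of "2 * r" "3 * r" "\<kappa> x0"]) (use r that in auto)
  have K: "closed K" "K \<subseteq> \<Omega>" "\<And>p. p \<notin> K \<Longrightarrow> \<beta> p = 0" "compact K"
    using R \<beta>(3) by (auto simp: K_def r(2)[symmetric])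
  have uc: "csm UNIV \<Omega> (\<lambda>t. hat (u t))"
  proof -
    \<comment> \<open>The constant extension in time beyond [0,1] is continuous in t and smooth in
      the point, which is all that \<open>csm\<close> asks.\<close>
    have "csm UNIV \<Omega> (\<lambda>t. hat (u (clamp01 t)))"
      by (rule csm_reparam[OF clamp01(3) _ open_Omega u_csm]) (use clamp01(1) in blast)
    then show ?thesis using clamp by simp
  qed
  define ca where "ca t p = (if p \<in> \<Omega> then \<beta> p *\<^sub>R base_coeff (u t) p else 0)" for t p
  define cB where "cB t p = (if p \<in> \<Omega> then \<beta> p *\<^sub>R fibre_coeff (u t) p else 0)" for t p
  have ca: "csm UNIV UNIV ca" unfolding ca_def[abs_def] by (rule csm_cutoff[OF open_Omega base_coeff_sm[OF uc] \<beta>(1) K(1-3)])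
  have cB: "csm UNIV UNIV cB" unfolding cB_def[abs_def] by (rule csm_cutoff[OF open_Omega fibre_coeff_sm[OF u_sec uc] \<beta>(1) K(1-3)])
  have z: "ca t p = 0" "cB t p = 0" if "p \<notin> K" for t p using K(3)[OF that] by (simp_all add: ca_def cB_def)
  have cl: "ca t = ca (clamp01 t)" "cB t = cB (clamp01 t)" for t
    by (auto simp: ca_def cB_def fun_eq_iff clamp[of t, symmetric])
  obtain L1 where L1: "\<And>t p. norm (ca t p) \<le> L1" using csm_bounded[OF ca cl(1) K(4) z(1)] by blast
  obtain L2 where L2: "\<And>t p. norm (cB t p) \<le> L2" using csm_bounded[OF cB cl(2) K(4) z(2)] by blast
  have fd0: "frechet_derivative (ca t) (at p) b = 0" if "p \<notin> K" for t p b
  proof -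
    have "frechet_derivative (ca t) (at p) = frechet_derivative (\<lambda>_. 0) (at p)"
      by (rule frechet_derivative_cong[of "- K"]) (use that K(1) z(1) in \<open>simp_all add: open_Compl\<close>)
    then show ?thesis by (simp add: frechet_derivative_const)
  qed
  have "\<exists>B. \<forall>t p. norm (frechet_derivative (ca t) (at p) b) \<le> B" for b
    by (rule csm_bounded[OF csm_frechet[OF ca] _ K(4) fd0]) (simp only: cl(1)[symmetric])
  then obtain B where B: "\<And>b t p. norm (frechet_derivative (ca t) (at p) b) \<le> B b" by metis
  define L3 where "L3 = (\<Sum>b\<in>Basis. \<bar>B b\<bar>)"
  have L3: "norm (frechet_derivative (ca t) (at p) b) \<le> L3" if "b \<in> Basis" for b t p
  proof -
    have "norm (frechet_derivative (ca t) (at p) b) \<le> \<bar>B b\<bar>" using B[of t p b] by linarith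
    also have "\<dots> \<le> L3" unfolding L3_def by (rule member_le_sum[OF that]) auto
    finally show ?thesis .
  qed
  have L3v: "norm (frechet_derivative (ca t) (at p) v) \<le> L3 * norm v" for t p v
  proof -
    have "frechet_derivative (ca t) (at p) v = blinfun_apply (blinfun_of (frechet_derivative (ca t) (at p))) v"
      by (rule blinfun_of_linear[symmetric, OF has_derivative_linear[OF csm_has_derivative[OF ca UNIV_I UNIV_I]]])
    also have "norm \<dots> \<le> norm (blinfun_of (frechet_derivative (ca t) (at p))) * norm v" by (rule norm_blinfun)
    also have "\<dots> \<le> L3 * norm v"
    proof (rule mult_right_mono[OF _ norm_ge_zero])
      have "(\<Sum>b\<in>Basis. norm (frechet_derivative (ca t) (at p) b)) \<le> L3"
        unfolding L3_def by (rule sum_mono) (use B in \<open>meson abs_ge_self order_trans\<close>)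
      then show "norm (blinfun_of (frechet_derivative (ca t) (at p))) \<le> L3" using norm_blinfun_of_le order_trans by blast
    qed
    finally show ?thesis .
  qed
  \<comment> \<open>One constant bounds the field, its derivative and the fibre coefficients; the
    summand 1 makes it positive.\<close>
  define L where "L = \<bar>L1\<bar> + \<bar>L2\<bar> + L3 + 1"
  have L3p: "L3 \<ge> 0" by (simp add: L3_def sum_nonneg)
  obtain \<phi> where \<phi>: "csm UNIV UNIV (\<lambda>q. \<phi> (fst q) (snd q))" "\<And>s x. \<phi> s s x = x"
    "\<And>s t x. ((\<lambda>t. \<phi> s t x) has_vector_derivative ca t (\<phi> s t x)) (at t)"
    "\<And>s t x v. ((\<lambda>t. frechet_derivative (\<phi> s t) (at x) v) has_vector_derivative
        frechet_derivative (ca t) (at (\<phi> s t x)) (frechet_derivative (\<phi> s t) (at x) v)) (at t)"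
    "\<And>s x v. frechet_derivative (\<phi> s s) (at x) v = v"
    by (rule flow_exists[OF ca L1 L3], assumption, rule that)
  have Mcsm: "csm UNIV UNIV (\<lambda>q p. cB (snd q) (\<phi> (fst q) (snd q) p))"
    by (rule csm_compose[where f="\<lambda>q. cB (snd q)" and g="\<lambda>q. \<phi> (fst q) (snd q)", OF open_UNIV open_UNIV _ _ \<phi>(1)])
       (auto intro!: csm_reparam[OF _ _ _ cB, of _ snd] continuous_intros)
  obtain \<Phi> \<Theta> where \<Phi>: "lin_ode (\<lambda>s t p. cB t (\<phi> s t p)) \<Phi> \<Theta>" "csm UNIV UNIV (\<lambda>q. \<Phi> (fst q) (snd q))" "csm UNIV UNIV (\<lambda>q. \<Theta> (fst q) (snd q))"
    by (rule linear_flow_exists[where M="\<lambda>s t p. cB t (\<phi> s t p)", OF Mcsm L2], rule that)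
  have "coord_flow A U \<kappa> V \<psi> N0 e k u x0 r L ca cB \<phi> \<Phi> \<Theta>"
  proof (intro coord_flow.intro coord_flow_axioms.intro)
    show "coords A U \<kappa> V \<psi> N0 e k" by unfold_locales
    show "ball (\<kappa> x0) (2 * r) \<subseteq> \<Omega>" using R(2) r by (auto simp: subset_iff)
    then show "ca t p = base_coeff (u t) p" "cB t p = fibre_coeff (u t) p" if "p \<in> ball (\<kappa> x0) (2 * r)" for t p
      using that \<beta>(2)[of p] by (auto simp: ca_def cB_def)
    show "L > 0" using L3p by (simp add: L_def)
    show "norm (ca t p) \<le> L" for t p using L1[of t p] L3p unfolding L_def by linarith
    show "norm (cB t p) \<le> L" for t p using L2[of t p] L3p unfolding L_def by linarith
    show "norm (frechet_derivative (ca t) (at p) v) \<le> L * norm v" for t p v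
    proof -
      have "L3 * norm v \<le> L * norm v" by (rule mult_right_mono) (simp_all add: L_def)
      then show ?thesis using L3v[of t p v] by linarith
    qed
    show "ca t p \<in> model_space A" for t p
      using subspace_scale[OF model_subspace base_coeff_E0] subspace_0[OF model_subspace] by (simp add: ca_def)
    show "blinfun_apply (cB t p) w \<in> typical_fibre A" for t p w
      using subspace_scale[OF subspaces(1) fibre_coeff_in[OF u_sec]] subspace_0[OF subspaces(1)] by (simp add: cB_def blinfun.scaleR_left)
  qed (rule u_sec x0 r ca cB \<phi> \<Phi>)+
  then show ?thesis by blast
qed

text \<open>This makes derivatives within [0,1], which are one-sided at the ends, unique.\<close>

lemma at_within_interval_nontrivial:
  assumes "t \<in> {0..1::real}" shows "at t within {0..1} \<noteq> bot"
  using assms islimpt_Icc[of 0 1 t] by (simp add: trivial_limit_within)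

section \<open>Transport of the almost complex structures\<close>

context coord_flow
begin

text \<open>\<open>Jder\<close> says \<open>dJ/dt = - L\<^sub>u J\<close>, so the pullback of \<open>J t\<close> along the flow of \<open>u\<close> has derivative \<open>0\<close>.\<close>

lemma J_compat:
  assumes st: "s \<in> {0..1}" "t \<in> {0..1}" "\<bar>t - s\<bar> < \<delta>" and x: "x \<in> N1" and a: "a \<in> fibre A x"
    and Jlin: "\<And>t y. t \<in> {0..1} \<Longrightarrow> linear_between (fibre A y) (fibre A y) (J t y)"
    and Jsec: "\<And>t X. t \<in> {0..1} \<Longrightarrow> X \<in> sections A \<Longrightarrow> (\<lambda>y. J t y (X y)) \<in> sections A"
    and Jder: "\<And>t y X. t \<in> {0..1} \<Longrightarrow> y \<in> N0 \<Longrightarrow> X \<in> sections A \<Longrightarrow>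
      ((\<lambda>t. \<psi> y (J t y (X y))) has_vector_derivative
         \<psi> y (J t y (br (u t) X y) - br (u t) (\<lambda>y. J t y (X y)) y)) (at t within {0..1})"
    and Jdiff: "\<And>t p b. t \<in> {0..1} \<Longrightarrow> p \<in> \<Omega> \<Longrightarrow>
      \<exists>D. ((\<lambda>z. hat (\<lambda>y. J (fst z) y (e b y)) (snd z)) has_derivative D) (at (t,p) within {0..1} \<times> \<Omega>)"
  shows "J t (f s t x) (Fw s t x a) = Fw s t x (J s x a)"
proof -
  define Jh where "Jh b t p = hat (\<lambda>y. J t y (e b y)) p" for b t p
  define Jm where "Jm t p = blinfun_of (\<lambda>b. Jh b t p)" for t p
  have Jin: "J t y a \<in> fibre A y" if "t \<in> {0..1}" "a \<in> fibre A y" for t y a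
    using Jlin[OF that(1), of y] that(2) by (auto simp: linear_between_def)
  note Jsum = linear_between_sum[OF Jlin subspaces(2)]
  have Jm: "blinfun_apply (Jm t (\<kappa> y)) (\<psi> y a) = \<psi> y (J t y a)" if t: "t \<in> {0..1}" and y: "y \<in> N0" and a: "a \<in> fibre A y" for t y a
  proof -
    have yV: "y \<in> V" using y N0 by blast
    have "\<psi> y (J t y a) = \<psi> y (J t y (\<Sum>b\<in>Basis. (\<psi> y a \<bullet> b) *\<^sub>R e b y))" using expand_e[OF y a] by simp
    also have "\<dots> = (\<Sum>b\<in>Basis. (\<psi> y a \<bullet> b) *\<^sub>R \<psi> y (J t y (e b y)))"
      by (simp add: Jsum[OF t, of Basis] sectionsD[OF e_sec] triv_sum[OF V yV] triv_ops[OF V yV] fibre_ops Jin[OF t])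
    finally show ?thesis by (simp add: Jm_def blinfun_of_apply Jh_def hat_kappa[OF y])
  qed
  define p where "p = \<kappa> x"
  \<comment> \<open>The family J is controlled on [0,1] only, so the argument runs inside this
    interval, with one-sided derivatives at its ends.\<close>
  define I where "I = {0..1} \<inter> {s - \<delta><..<s + \<delta>}"
  define w where "w = \<psi> x a"
  have w: "w \<in> typical_fibre A" unfolding w_def by (rule triv_in[OF V xN0(2)[OF x st(3)] a])
  \<comment> \<open>J at time t, pulled back along the flow to the fibre at x and applied to w. It
    will turn out to be constant.\<close>
  define G where "G t = blinfun_apply (\<Theta> s t p) (blinfun_apply (Jm t (\<phi> s t p)) (blinfun_apply (\<Phi> s t p) w))" for t
  have dG: "(G has_vector_derivative 0) (at \<tau> within I)" if \<tau>I: "\<tau> \<in> I" for \<tau>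
  proof -
    have \<tau>: "\<tau> \<in> {0..1}" "\<bar>\<tau> - s\<bar> < \<delta>" using \<tau>I by (auto simp: I_def abs_less_iff)
    define q where "q = \<phi> s \<tau> p"
    define y where "y = f s \<tau> x"
    have q: "q = \<kappa> y" "q \<in> \<Omega>" "y \<in> N0"
      using kappa_f[OF x \<tau>(2)] \<phi>_Omega[OF x \<tau>(2)] f_N0[OF x \<tau>(2)] by (simp_all add: q_def y_def p_def)
    have yV: "y \<in> V" using q N0 by blast
    have ca_q: "ca \<tau> q = base_coeff (u \<tau>) q" and cB_q: "cB \<tau> q = fibre_coeff (u \<tau>) q"
      using ca_\<phi>[OF x \<tau>(2)] cB_\<phi>[OF x \<tau>(2)] by (simp_all add: q_def p_def)
    have dJ: "((\<lambda>t. Jh b t (\<phi> s t p)) has_vector_derivative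
       blinfun_apply (cB \<tau> q) (blinfun_apply (Jm \<tau> q) (PF b)) - blinfun_apply (Jm \<tau> q) (blinfun_apply (cB \<tau> q) (PF b))) (at \<tau> within I)" for b
    proof -
      let ?S = "{0..1} \<times> \<Omega>"
      obtain D where D: "((\<lambda>z. Jh b (fst z) (snd z)) has_derivative D) (at (\<tau>,q) within ?S)"
        using Jdiff[OF \<tau>(1) q(2), of b] unfolding Jh_def by blast
      have lin: "linear D" by (rule has_derivative_linear[OF D])
      \<comment> \<open>The derivative in time and point is split: the time part is known from
        \<open>Jder\<close>, by uniqueness of derivatives, and the space part occurs also in the
        bracket with u.\<close>
      have D1: "D (1, 0) = \<psi> y (J \<tau> y (br (u \<tau>) (e b) y) - br (u \<tau>) (\<lambda>y. J \<tau> y (e b y)) y)"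
      proof -
        have A1: "((\<lambda>t. (t,q)) has_derivative (\<lambda>h. (h,0))) (at \<tau> within {0..1})"
          by (intro has_derivative_Pair has_derivative_ident has_derivative_const)
        have A2: "((\<lambda>z. Jh b (fst z) (snd z)) has_derivative D) (at (\<tau>,q) within (\<lambda>t. (t,q)) ` {0..1})"
          by (rule has_derivative_subset[OF D]) (use q(2) in auto)
        from has_derivative_in_compose[OF A1 A2] have "((\<lambda>t. Jh b t q) has_derivative (\<lambda>h. D (h,0))) (at \<tau> within {0..1})"
          by simp
        moreover have "(\<lambda>h. D (h, 0)) = (\<lambda>h. h *\<^sub>R D (1,0))"
        proof
          show "D (h, 0) = h *\<^sub>R D (1,0)" for h using linear_cmul[OF lin, of h "(1,0)"] by simp
        qed
        ultimately have "((\<lambda>t. Jh b t q) has_vector_derivative D (1,0)) (at \<tau> within {0..1})"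
          unfolding has_vector_derivative_def by (rule subst[rotated])
        moreover have "Jh b t q = \<psi> y (J t y (e b y))" for t unfolding Jh_def q(1) by (rule hat_kappa[OF q(3)])
        ultimately show ?thesis
          using vector_derivative_unique_within[OF at_within_interval_nontrivial[OF \<tau>(1)] _ Jder[OF \<tau>(1) q(3) e_sec]] by simp
      qed
      have D2: "D (0, h) = frechet_derivative (hat (\<lambda>y. J \<tau> y (e b y))) (at q) h" for h
      proof -
        have A1: "((\<lambda>z. (\<tau>,z)) has_derivative (\<lambda>h. (0,h))) (at q within \<Omega>)"
          by (intro has_derivative_Pair has_derivative_ident has_derivative_const)
        have A2: "((\<lambda>z. Jh b (fst z) (snd z)) has_derivative D) (at (\<tau>,q) within (\<lambda>z. (\<tau>,z)) ` \<Omega>)"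
          by (rule has_derivative_subset[OF D]) (use \<tau>(1) in auto)
        from has_derivative_in_compose[OF A1 A2] have "((\<lambda>z. Jh b \<tau> z) has_derivative (\<lambda>h. D (0,h))) (at q within \<Omega>)"
          by simp
        then have "(Jh b \<tau> has_derivative (\<lambda>h. D (0,h))) (at q)"
          by (simp add: at_within_open[OF q(2) open_Omega])
        from fun_cong[OF frechet_derivative_at[OF this], of h] show ?thesis by (simp add: Jh_def[abs_def])
      qed
      have A1: "((\<lambda>t. (t, \<phi> s t p)) has_derivative (\<lambda>h. (h, h *\<^sub>R ca \<tau> q))) (at \<tau> within I)"
        using has_vector_derivative_at_within[OF \<phi>_ode[of s p \<tau>], of I] unfolding q_def has_vector_derivative_def
        by (intro has_derivative_Pair has_derivative_ident)
      have A2: "((\<lambda>z. Jh b (fst z) (snd z)) has_derivative D) (at (\<tau>, \<phi> s \<tau> p) within (\<lambda>t. (t, \<phi> s t p)) ` I)"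
        using has_derivative_subset[OF D] \<phi>_Omega[OF x] unfolding q_def by (auto simp: I_def p_def abs_less_iff image_subset_iff)
      from has_derivative_in_compose[OF A1 A2] have "((\<lambda>t. Jh b t (\<phi> s t p)) has_derivative (\<lambda>h. D (h, h *\<^sub>R ca \<tau> q))) (at \<tau> within I)"
        by simp
      moreover have "(\<lambda>h. D (h, h *\<^sub>R ca \<tau> q)) = (\<lambda>h. h *\<^sub>R (D (1,0) + D (0, ca \<tau> q)))"
      proof
        show "D (h, h *\<^sub>R ca \<tau> q) = h *\<^sub>R (D (1,0) + D (0, ca \<tau> q))" for h
          using linear_cmul[OF lin, of h "(1, ca \<tau> q)"] linear_add[OF lin, of "(1,0)" "(0, ca \<tau> q)"] by simp
      qed
      ultimately have vd: "((\<lambda>t. Jh b t (\<phi> s t p)) has_vector_derivative D (1,0) + D (0, ca \<tau> q)) (at \<tau> within I)"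
        unfolding has_vector_derivative_def by (rule subst[rotated])
      have Je: "(\<lambda>y. J \<tau> y (e b y)) \<in> sections A" by (rule Jsec[OF \<tau>(1) e_sec])
      have ebr: "br (u \<tau>) (e b) y \<in> fibre A y" by (rule sectionsD[OF br_section[OF u_sec e_sec]])
      have PFb: "\<psi> y (e b y) = PF b" using hat_e[OF q(2), of b] by (simp add: q(1) hat_kappa[OF q(3)])
      have "- hat (br (u \<tau>) (e b)) (\<kappa> y) = blinfun_apply (fibre_coeff (u \<tau>) (\<kappa> y)) (PF b)"
        unfolding bracket_frame_form[OF u_sec q(3)] fibre_coeff_form[OF u_sec q(3)] PF(3)[OF PF(2)] ..
      from arg_cong[OF this, of uminus]
      have "\<psi> y (br (u \<tau>) (e b) y) = - blinfun_apply (cB \<tau> q) (PF b)"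
        unfolding cB_q by (simp add: hat_kappa[OF q(3)] q(1))
      then have a1: "\<psi> y (J \<tau> y (br (u \<tau>) (e b) y)) = - blinfun_apply (Jm \<tau> q) (blinfun_apply (cB \<tau> q) (PF b))"
        using Jm[OF \<tau>(1) q(3) ebr] by (simp add: q(1) blinfun.minus_right)
      have a2: "hat (\<lambda>y. J \<tau> y (e b y)) q = blinfun_apply (Jm \<tau> q) (PF b)"
        using Jm[OF \<tau>(1) q(3) sectionsD[OF e_sec], of b] by (simp add: q(1) hat_kappa[OF q(3)] PFb[unfolded q(1)])
      have a3: "\<psi> y (br (u \<tau>) (\<lambda>y. J \<tau> y (e b y)) y) = frechet_derivative (hat (\<lambda>y. J \<tau> y (e b y))) (at q) (ca \<tau> q)
          - blinfun_apply (cB \<tau> q) (blinfun_apply (Jm \<tau> q) (PF b))"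
        using bracket_coeff[OF u_sec Je q(3), of \<tau>] unfolding q(1)[symmetric] a2 ca_q cB_q by (simp add: q(1) hat_kappa[OF q(3)])
      \<comment> \<open>The space derivative of J along u contained in the bracket cancels the one
        along the trajectory. What is left is the commutator of cB with J, which the derivatives of
        \<Theta> and \<Phi> cancel in turn.\<close>
      have "D (1,0) + D (0, ca \<tau> q) = blinfun_apply (cB \<tau> q) (blinfun_apply (Jm \<tau> q) (PF b)) - blinfun_apply (Jm \<tau> q) (blinfun_apply (cB \<tau> q) (PF b))"
        unfolding D1 D2 triv_ops(5)[OF V yV Jin[OF \<tau>(1) ebr] sectionsD[OF br_section[OF u_sec Je]]] a1 a3 by simp
      with vd show ?thesis by simp
    qed
    have dJm: "((\<lambda>t. Jm t (\<phi> s t p)) has_vector_derivative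
        blinfun_of (\<lambda>b. blinfun_apply (cB \<tau> q) (blinfun_apply (Jm \<tau> q) (PF b)) - blinfun_apply (Jm \<tau> q) (blinfun_apply (cB \<tau> q) (PF b)))) (at \<tau> within I)"
      unfolding Jm_def[abs_def] blinfun_of_def
      by (intro has_vector_derivative_sum bounded_linear.has_vector_derivative[OF bounded_linear_rank_one] dJ[unfolded Jm_def blinfun_of_def])
    have mkv: "blinfun_apply (blinfun_of (\<lambda>b. blinfun_apply (cB \<tau> q) (blinfun_apply (Jm \<tau> q) (PF b)) - blinfun_apply (Jm \<tau> q) (blinfun_apply (cB \<tau> q) (PF b)))) v
        = blinfun_apply (cB \<tau> q) (blinfun_apply (Jm \<tau> q) v) - blinfun_apply (Jm \<tau> q) (blinfun_apply (cB \<tau> q) v)"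
      if v: "v \<in> typical_fibre A" for v
    proof -
      have "linear (\<lambda>v. blinfun_apply (cB \<tau> q) (blinfun_apply (Jm \<tau> q) (PF v)) - blinfun_apply (Jm \<tau> q) (blinfun_apply (cB \<tau> q) (PF v)))"
        by (rule linearI) (simp_all add: linear_add[OF PF(1)] linear_cmul[OF PF(1)] blinfun.add_right blinfun.scaleR_right algebra_simps)
      from blinfun_of_linear[OF this, of v] show ?thesis by (simp add: PF(3)[OF v])
    qed
    have d\<Phi>: "((\<lambda>t. blinfun_apply (\<Phi> s t p) w) has_vector_derivative blinfun_apply (cB \<tau> q) (blinfun_apply (\<Phi> s \<tau> p) w)) (at \<tau> within I)"
      using has_vector_derivative_at_within[OF bounded_linear.has_vector_derivative[OF blinfun.bounded_linear_left[of w] \<Phi>'[of s p \<tau>]]]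
      by (simp add: q_def)
    have "((\<lambda>t. blinfun_apply (Jm t (\<phi> s t p)) (blinfun_apply (\<Phi> s t p) w)) has_vector_derivative
       blinfun_apply (cB \<tau> q) (blinfun_apply (Jm \<tau> q) (blinfun_apply (\<Phi> s \<tau> p) w))) (at \<tau> within I)"
      using blinfun_apply_vd[OF dJm d\<Phi>] by (simp add: q_def[symmetric] mkv[OF \<Phi>_in[OF w]])
    from blinfun_apply_vd[OF has_vector_derivative_at_within[OF \<Theta>'[of s p \<tau>]] this]
    show ?thesis unfolding G_def[abs_def] by (simp add: q_def blinfun.minus_left)
  qed
  have "(\<lambda>t. G t - G s) t = 0"
  proof (rule ode_zero[of I s t "\<lambda>t. G t - G s" 0 "\<lambda>_. 0"])
    show "convex I" unfolding I_def by (intro convex_Int convex_real_interval)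
    show "((\<lambda>t. G t - G s) has_vector_derivative 0) (at \<tau> within I)" if "\<tau> \<in> I" for \<tau>
      using has_vector_derivative_diff[OF dG[OF that] has_vector_derivative_const[of "G s"]] by simp
  qed (use st \<delta>_pos in \<open>auto simp: I_def abs_less_iff\<close>)
  then have "blinfun_apply (\<Phi> s t p) (G t) = blinfun_apply (\<Phi> s t p) (G s)" by simp
  then have 1: "blinfun_apply (Jm t (\<phi> s t p)) (blinfun_apply (\<Phi> s t p) w) = blinfun_apply (\<Phi> s t p) (blinfun_apply (Jm s p) w)"
    by (simp add: G_def \<Phi>\<Theta> \<Phi>0 \<Theta>0 \<phi>_init)
  have fa: "Fw s t x a \<in> fibre A (f s t x)" by (rule Fw(1)[OF x st(3) a])
  have "\<psi> (f s t x) (J t (f s t x) (Fw s t x a)) = \<psi> (f s t x) (Fw s t x (J s x a))"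
    using 1 Jm[OF st(2) f_N0(1)[OF x st(3)] fa] Jm[OF st(1) xN0(1)[OF x st(3)] a]
    by (simp add: kappa_f[OF x st(3)] Fw(2)[OF x st(3)] a Jin[OF st(1) a] p_def w_def)
  then show ?thesis
    by (rule triv_inj[OF V f_N0(2)[OF x st(3)], rotated 2])
       (intro Jin[OF st(2)] fa, intro Fw(1)[OF x st(3)] Jin[OF st(1)] a)
qed

end

section \<open>Smooth families in coordinates\<close>

context coords
begin

text \<open>The product on which a family is smooth need not be open, neither in time nor in the
  ambient space of the chart. The local extension G lives on an open box, and composing with P reads
  it on \<Omega>.\<close>

lemma family_local:
  fixes F :: "real \<Rightarrow> 'm \<Rightarrow> 'b::euclidean_space"
  assumes F: "smooth_family_on A T S F" and S: "N0 \<subseteq> S" and t: "t \<in> T" and p: "p \<in> \<Omega>"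
  obtains S1 W1 G where "open S1" "open W1" "t \<in> S1" "P p \<in> W1" "\<And>k. Ck_on k (S1 \<times> W1) G"
    "\<And>t q. t \<in> T \<inter> S1 \<Longrightarrow> q \<in> \<Omega> \<Longrightarrow> P q \<in> W1 \<Longrightarrow> F t (\<mu> q) = G (t, P q)"
proof -
  have s: "smooth_on (T \<times> \<kappa> ` (U \<inter> S)) (\<lambda>(t,y). F t (inv_into U \<kappa> y))"
    using F c unfolding smooth_family_on_def by auto
  have inK: "P q \<in> \<kappa> ` (U \<inter> S)" if "q \<in> \<Omega>" for q
    using mu_in[OF that] kappa_mu[OF that] N0 S by (metis IntI imageI subsetD)
  have "(t, P p) \<in> T \<times> \<kappa> ` (U \<inter> S)" using t inK[OF p] by simp
  then obtain W G where W: "open W" "(t, P p) \<in> W" "\<forall>k. Ck_on k W G"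
    "\<forall>y\<in>W \<inter> (T \<times> \<kappa> ` (U \<inter> S)). G y = (\<lambda>(t,y). F t (inv_into U \<kappa> y)) y"
    using s unfolding smooth_on_def by blast
  obtain S1 W1 where SW: "open S1" "open W1" "t \<in> S1" "P p \<in> W1" "S1 \<times> W1 \<subseteq> W"
    using open_prod_elim[OF W(1,2)] by (metis SigmaE2 mem_Sigma_iff)
  have "Ck_on k (S1 \<times> W1) G" for k
    using W(3) Ck_on_iff_Ckp[of "0::real" "{0}" k] Ckp_subset[OF _ subset_refl SW(5)] by blast
  moreover have "F t' (\<mu> q) = G (t', P q)" if "t' \<in> T \<inter> S1" "q \<in> \<Omega>" "P q \<in> W1" for t' q
    using bspec[OF W(4), of "(t', P q)"] that SW(5) inK[OF that(2)] by (auto simp: \<mu>_def)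
  ultimately show ?thesis by (intro that[OF SW(1-4)])
qed

lemma family_csm:
  fixes F :: "real \<Rightarrow> 'm \<Rightarrow> 'b::euclidean_space"
  assumes F: "smooth_family_on A T S F" and S: "N0 \<subseteq> S"
  shows "csm T \<Omega> (\<lambda>t p. F t (\<mu> p))"
proof (rule csm_local)
  fix t p assume tp: "t \<in> T" "p \<in> \<Omega>"
  obtain S1 W1 G where G: "open S1" "open W1" "t \<in> S1" "P p \<in> W1" "\<And>k. Ck_on k (S1 \<times> W1) G"
    "\<And>t q. t \<in> T \<inter> S1 \<Longrightarrow> q \<in> \<Omega> \<Longrightarrow> P q \<in> W1 \<Longrightarrow> F t (\<mu> q) = G (t, P q)"
    by (rule family_local[OF F S tp], rule that)
  define W2 where "W2 = \<Omega> \<inter> P -` W1"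
  have oW2: "open W2" unfolding W2_def using open_vimage[OF G(2) P_cont[of UNIV]] open_Omega by blast
  have g: "csm (T \<inter> S1) W1 (\<lambda>t x. G (t,x))"
    by (rule csmI, rule Ckp_joint[OF _ G(2) G(5)]) auto
  have "csm (T \<inter> S1) W2 (\<lambda>t x. G (t, P x))"
    by (rule csm_compose[where f="\<lambda>t x. G (t,x)" and g="\<lambda>t. P", OF oW2 G(2) _ g csm_linear[OF P(1) oW2]]) (auto simp: W2_def)
  then have "csm (T \<inter> S1) W2 (\<lambda>t p. F t (\<mu> p))"
    by (rule csm_cong[OF oW2, rotated]) (use G(6) in \<open>auto simp: W2_def\<close>)
  moreover have "\<Omega> \<inter> W2 = W2" by (auto simp: W2_def)
  ultimately show "\<exists>S V. open S \<and> open V \<and> t \<in> S \<and> p \<in> V \<and> csm (T \<inter> S) (\<Omega> \<inter> V) (\<lambda>t p. F t (\<mu> p))"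
    using G(1,3,4) oW2 tp by (intro exI[of _ S1] exI[of _ W2]) (simp add: W2_def)
qed

text \<open>\<open>csm\<close> forgets differentiability in time. For J it is needed jointly with
  the point, so it is recovered here from the local extension.\<close>

lemma family_diff:
  fixes F :: "real \<Rightarrow> 'm \<Rightarrow> 'b::euclidean_space"
  assumes F: "smooth_family_on A T S F" and S: "N0 \<subseteq> S" and tp: "t \<in> T" "p \<in> \<Omega>"
  shows "\<exists>D. ((\<lambda>z. F (fst z) (\<mu> (snd z))) has_derivative D) (at (t,p) within T \<times> \<Omega>)"
proof -
  obtain S1 W1 G where G: "open S1" "open W1" "t \<in> S1" "P p \<in> W1" "\<And>k. Ck_on k (S1 \<times> W1) G"
    "\<And>t q. t \<in> T \<inter> S1 \<Longrightarrow> q \<in> \<Omega> \<Longrightarrow> P q \<in> W1 \<Longrightarrow> F t (\<mu> q) = G (t, P q)"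
    by (rule family_local[OF F S tp], rule that)
  have "G differentiable (at (t, P p))" using G(5)[of "Suc 0"] G(3,4) by simp
  then obtain D where D: "(G has_derivative D) (at (t, P p))" unfolding differentiable_def by blast
  have "bounded_linear (\<lambda>z::real \<times> 'e. (fst z, P (snd z)))"
    using P(1) by (intro bounded_linear_Pair bounded_linear_fst
        bounded_linear_compose[OF _ bounded_linear_snd, of P]) (simp add: linear_conv_bounded_linear)
  then have "((\<lambda>z. (fst z, P (snd z))) has_derivative (\<lambda>h. (fst h, P (snd h)))) (at (t,p))"
    by (rule bounded_linear_imp_has_derivative)
  from has_derivative_compose[OF this, of G D] D
  have 1: "((\<lambda>z. G (fst z, P (snd z))) has_derivative (\<lambda>h. D (fst h, P (snd h)))) (at (t,p) within T \<times> \<Omega>)"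
    by (simp add: has_derivative_at_withinI)
  have "open (S1 \<times> (P -` W1))" using open_vimage[OF G(2) P_cont[of UNIV]] G(1) by (rule open_Times[rotated])
  moreover have "(t,p) \<in> S1 \<times> (P -` W1)" using G by simp
  ultimately obtain d where d: "d > 0" "ball (t,p) d \<subseteq> S1 \<times> (P -` W1)" using open_contains_ball by blast
  have "((\<lambda>z. F (fst z) (\<mu> (snd z))) has_derivative (\<lambda>h. D (fst h, P (snd h)))) (at (t,p) within T \<times> \<Omega>)"
  proof (rule has_derivative_transform_within[OF 1 d(1)])
    fix z assume z: "z \<in> T \<times> \<Omega>" "dist z (t,p) < d"
    then have "z \<in> S1 \<times> (P -` W1)" using subsetD[OF d(2), of z] by (simp only: mem_ball dist_commute)
    then show "G (fst z, P (snd z)) = F (fst z) (\<mu> (snd z))" using z(1) G(6) by auto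
  qed (use tp in auto)
  then show ?thesis by blast
qed

end

section \<open>Integral pairs\<close>

context algebroid
begin

text \<open>A coordinate-free description of the flow: \<open>\<gamma>\<close> is an integral curve of the anchor of \<open>u\<close>, and \<open>q\<close> pulls
  the fibres along \<open>\<gamma>\<close> back to a fixed space, with the equation tested on sections. Local flows are compared
  through their integral pairs.\<close>

definition integral_pair :: "(real \<Rightarrow> 'm \<Rightarrow> 'v) \<Rightarrow> real set \<Rightarrow> (real \<Rightarrow> 'm) \<Rightarrow> (real \<Rightarrow> 'v \<Rightarrow> 'f) \<Rightarrow> bool" where
  "integral_pair u I \<gamma> q \<longleftrightarrow> continuous_on I \<gamma> \<and> (\<forall>t\<in>I. linear_between (fibre A (\<gamma> t)) UNIV (q t)) \<and>
    (\<forall>g. (\<forall>y. sm_at A g y) \<longrightarrow> (\<forall>t\<in>I. ((\<lambda>t. g (\<gamma> t)) has_real_derivative \<rho> (\<gamma> t) (u t (\<gamma> t)) g) (at t within I))) \<and>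
    (\<forall>X\<in>sections A. \<forall>t\<in>I. ((\<lambda>t. q t (X (\<gamma> t))) has_vector_derivative q t (br (u t) X (\<gamma> t))) (at t within I))"

lemma integral_pair_subset: "integral_pair u I \<gamma> q \<Longrightarrow> J \<subseteq> I \<Longrightarrow> integral_pair u J \<gamma> q"
  unfolding integral_pair_def
  by (elim conjE, intro conjI ballI allI impI; (rule continuous_on_subset has_field_derivative_subset has_vector_derivative_within_subset)?)
     (assumption | blast)+

text \<open>Only values on the fibre count; elsewhere in the container the maps q are
  arbitrary.\<close>

definition agree :: "(real \<Rightarrow> 'm) \<Rightarrow> (real \<Rightarrow> 'v \<Rightarrow> 'f) \<Rightarrow> (real \<Rightarrow> 'm) \<Rightarrow> (real \<Rightarrow> 'v \<Rightarrow> 'f) \<Rightarrow> real \<Rightarrow> bool" where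
  "agree \<gamma> q \<gamma>' q' t \<longleftrightarrow> \<gamma> t = \<gamma>' t \<and> (\<forall>a\<in>fibre A (\<gamma> t). q t a = q' t a)"

end

context coord_flow
begin

lemma ca_lip: "norm (ca t p - ca t q) \<le> L * norm (p - q)"
  by (rule differentiable_bound[OF convex_UNIV])
     (auto intro: has_derivative_at_withinI csm_has_derivative[OF ca_csm] onorm_le ca_D)

lemma N1_eq: "N1 \<subseteq> N0" "y \<in> N1 \<Longrightarrow> \<kappa> y \<in> ball (\<kappa> x0) (2*r)"
  using N1(3) r(1) by (auto simp: N1_def)

text \<open>Tested on the coordinate functions, the condition on \<gamma> is the ordinary
  differential equation of the base flow.\<close>

lemma integral_pair_base:
  assumes ip: "integral_pair u I \<gamma> q" and \<gamma>: "\<And>t. t \<in> I \<Longrightarrow> \<gamma> t \<in> N1" and t: "t \<in> I"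
  shows "((\<lambda>t. \<kappa> (\<gamma> t)) has_vector_derivative ca t (\<kappa> (\<gamma> t))) (at t within I)"
proof -
  have gN0: "\<gamma> t \<in> N0" if "t \<in> I" for t using \<gamma>[OF that] N1_eq(1) by blast
  have ua: "\<rho> (\<gamma> t) (u t (\<gamma> t)) (k b) = base_coeff (u t) (\<kappa> (\<gamma> t)) \<bullet> b" for b
    using anchor_k[OF gN0[OF t] sectionsD[OF u_sec]] by (simp add: base_coeff_def hat_kappa[OF gN0[OF t]])
  have "((\<lambda>t. k b (\<gamma> t)) has_vector_derivative base_coeff (u t) (\<kappa> (\<gamma> t)) \<bullet> b) (at t within I)" for b
    using ip k_sm[of b] t ua[of b] unfolding integral_pair_def has_real_derivative_iff_has_vector_derivative by metis
  then have "((\<lambda>t. \<Sum>b\<in>Basis. k b (\<gamma> t) *\<^sub>R b) has_vector_derivative (\<Sum>b\<in>Basis. (base_coeff (u t) (\<kappa> (\<gamma> t)) \<bullet> b) *\<^sub>R b)) (at t within I)"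
    by (intro has_vector_derivative_sum bounded_linear.has_vector_derivative[OF bounded_linear_scaleR_left])
  then have "((\<lambda>t. \<Sum>b\<in>Basis. k b (\<gamma> t) *\<^sub>R b) has_vector_derivative ca t (\<kappa> (\<gamma> t))) (at t within I)"
    by (simp only: euclidean_representation ca_eq[OF N1_eq(2)[OF \<gamma>[OF t]]])
  then show ?thesis
    by (rule has_vector_derivative_transform[OF t, rotated]) (simp add: k_eq[OF gN0] euclidean_representation)
qed

text \<open>In coordinates the bracket of u with a frame section is -cB applied to a constant
  vector. So testing on the frame sections turns the condition on q into a linear equation for its
  matrix Q.\<close>

lemma integral_pair_fibre:
  assumes ip: "integral_pair u I \<gamma> q" and \<gamma>: "\<And>t. t \<in> I \<Longrightarrow> \<gamma> t \<in> N1" and t: "t \<in> I"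
  defines "Q \<equiv> \<lambda>t. blinfun_of (\<lambda>b. q t (e b (\<gamma> t)))"
  shows "a \<in> fibre A (\<gamma> t) \<Longrightarrow> q t a = blinfun_apply (Q t) (\<psi> (\<gamma> t) a)"
    and "(Q has_vector_derivative blinfun_of (\<lambda>b. - blinfun_apply (Q t) (blinfun_apply (cB t (\<kappa> (\<gamma> t))) (PF b)))) (at t within I)"
proof -
  have gN0: "\<gamma> t \<in> N0" using \<gamma>[OF t] N1_eq(1) by blast
  have lin: "linear_between (fibre A (\<gamma> t)) UNIV (q t)" using ip t unfolding integral_pair_def by blast
  show qQ: "q t a = blinfun_apply (Q t) (\<psi> (\<gamma> t) a)" if a: "a \<in> fibre A (\<gamma> t)" for a
  proof -
    have "q t a = q t (\<Sum>b\<in>Basis. (\<psi> (\<gamma> t) a \<bullet> b) *\<^sub>R e b (\<gamma> t))" using expand_e[OF gN0 a] by simp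
    also have "\<dots> = (\<Sum>b\<in>Basis. (\<psi> (\<gamma> t) a \<bullet> b) *\<^sub>R q t (e b (\<gamma> t)))"
      by (rule linear_between_sum[OF lin subspaces(2)]) (rule sectionsD[OF e_sec])
    finally show ?thesis by (simp add: Q_def blinfun_of_apply)
  qed
  have "((\<lambda>t. q t (e b (\<gamma> t))) has_vector_derivative q t (br (u t) (e b) (\<gamma> t))) (at t within I)" for b
    using ip e_sec[of b] t unfolding integral_pair_def by blast
  moreover have "q t (br (u t) (e b) (\<gamma> t)) = - blinfun_apply (Q t) (blinfun_apply (cB t (\<kappa> (\<gamma> t))) (PF b))" for b
  proof -
    have "- hat (br (u t) (e b)) (\<kappa> (\<gamma> t)) = blinfun_apply (fibre_coeff (u t) (\<kappa> (\<gamma> t))) (PF b)"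
      unfolding bracket_frame_form[OF u_sec gN0] fibre_coeff_form[OF u_sec gN0] PF(3)[OF PF(2)] ..
    from arg_cong[OF this, of uminus]
    have "\<psi> (\<gamma> t) (br (u t) (e b) (\<gamma> t)) = - blinfun_apply (cB t (\<kappa> (\<gamma> t))) (PF b)"
      unfolding cB_eq[OF N1_eq(2)[OF \<gamma>[OF t]]] by (simp add: hat_kappa[OF gN0])
    then show ?thesis using qQ[OF sectionsD[OF br_section[OF u_sec e_sec]]] by (simp add: blinfun.minus_right)
  qed
  ultimately have d: "((\<lambda>t. q t (e b (\<gamma> t))) has_vector_derivative - blinfun_apply (Q t) (blinfun_apply (cB t (\<kappa> (\<gamma> t))) (PF b))) (at t within I)" for b
    by metis
  have Qd: "Q = (\<lambda>t. \<Sum>b\<in>Basis. rank_one b (q t (e b (\<gamma> t))))" by (simp add: Q_def blinfun_of_def)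
  show "(Q has_vector_derivative blinfun_of (\<lambda>b. - blinfun_apply (Q t) (blinfun_apply (cB t (\<kappa> (\<gamma> t))) (PF b)))) (at t within I)"
    unfolding blinfun_of_def by (subst Qd) (intro has_vector_derivative_sum bounded_linear.has_vector_derivative[OF bounded_linear_rank_one] d)
qed

lemma integral_pair_unique_local:
  assumes ip: "integral_pair u I \<gamma> q" "integral_pair u I \<gamma>' q'" and I: "convex I" "s \<in> I" "t \<in> I"
    and \<gamma>: "\<And>t. t \<in> I \<Longrightarrow> \<gamma> t \<in> N1" "\<And>t. t \<in> I \<Longrightarrow> \<gamma>' t \<in> N1" and s: "agree \<gamma> q \<gamma>' q' s"
  shows "agree \<gamma> q \<gamma>' q' t"
proof -
  have base: "\<gamma> t = \<gamma>' t" if t: "t \<in> I" for t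
  proof -
    have "\<kappa> (\<gamma> t) = \<kappa> (\<gamma>' t)"
      by (rule ode_unique[where F=ca and L=L and s=s and I=I])
         (use s I t L in \<open>auto simp: agree_def intro!: integral_pair_base[OF ip(1) \<gamma>(1)] integral_pair_base[OF ip(2) \<gamma>(2)] ca_lip\<close>)
    moreover have "\<gamma> t \<in> U" "\<gamma>' t \<in> U" using \<gamma>[OF t] N1_eq(1) N0 by auto
    ultimately show ?thesis using chart(4)[OF c] by (auto dest: inj_onD)
  qed
  define Q where "Q = (\<lambda>t. blinfun_of (\<lambda>b. q t (e b (\<gamma> t))))"
  define Q' where "Q' = (\<lambda>t. blinfun_of (\<lambda>b. q' t (e b (\<gamma>' t))))"
  \<comment> \<open>By \<open>base\<close> the two curves coincide, so one coefficient, taken along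
    \<gamma>, serves both matrices.\<close>
  define F where "F t Z = blinfun_of (\<lambda>b. - blinfun_apply Z (blinfun_apply (cB t (\<kappa> (\<gamma> t))) (PF b)))" for t and Z :: "'f \<Rightarrow>\<^sub>L 'f"
  define L' where "L' = (\<Sum>b\<in>(Basis::'f set). L * norm (PF b))"
  have "Q t = Q' t"
  proof (rule ode_unique[where F=F and L=L' and s=s and I=I])
    show "Q s = Q' s" using s sectionsD[OF e_sec, of _ "\<gamma> s"] by (simp add: Q_def Q'_def agree_def)
    show "L' \<ge> 0" unfolding L'_def by (intro sum_nonneg mult_nonneg_nonneg) (use L in auto)
    fix \<tau> assume \<tau>: "\<tau> \<in> I"
    show "(Q has_vector_derivative F \<tau> (Q \<tau>)) (at \<tau> within I)"
      unfolding Q_def F_def by (rule integral_pair_fibre(2)[OF ip(1) \<gamma>(1) \<tau>])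
    show "(Q' has_vector_derivative F \<tau> (Q' \<tau>)) (at \<tau> within I)"
      unfolding Q'_def F_def base[OF \<tau>] by (rule integral_pair_fibre(2)[OF ip(2) \<gamma>(2) \<tau>])
    have "F \<tau> (Q \<tau>) - F \<tau> (Q' \<tau>) = blinfun_of (\<lambda>b. - blinfun_apply (Q \<tau> - Q' \<tau>) (blinfun_apply (cB \<tau> (\<kappa> (\<gamma> \<tau>))) (PF b)))"
      by (rule blinfun_eqI) (simp add: F_def blinfun_of_apply blinfun.diff_left scaleR_diff_right sum_subtractf sum_negf)
    also have "norm \<dots> \<le> (\<Sum>b\<in>Basis. norm (- blinfun_apply (Q \<tau> - Q' \<tau>) (blinfun_apply (cB \<tau> (\<kappa> (\<gamma> \<tau>))) (PF b))))"
      by (rule norm_blinfun_of_le)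
    also have "\<dots> \<le> (\<Sum>b\<in>(Basis::'f set). L * norm (PF b) * norm (Q \<tau> - Q' \<tau>))"
    proof (rule sum_mono)
      fix b :: 'f
      have "norm (blinfun_apply (Q \<tau> - Q' \<tau>) (blinfun_apply (cB \<tau> (\<kappa> (\<gamma> \<tau>))) (PF b))) \<le> norm (Q \<tau> - Q' \<tau>) * norm (blinfun_apply (cB \<tau> (\<kappa> (\<gamma> \<tau>))) (PF b))"
        by (rule norm_blinfun)
      also have "\<dots> \<le> norm (Q \<tau> - Q' \<tau>) * (L * norm (PF b))"
        using norm_blinfun[of "cB \<tau> (\<kappa> (\<gamma> \<tau>))" "PF b"] mult_right_mono[OF cB_bd[of \<tau> "\<kappa> (\<gamma> \<tau>)"] norm_ge_zero[of "PF b"]]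
        by (intro mult_left_mono) auto
      finally show "norm (- blinfun_apply (Q \<tau> - Q' \<tau>) (blinfun_apply (cB \<tau> (\<kappa> (\<gamma> \<tau>))) (PF b))) \<le> L * norm (PF b) * norm (Q \<tau> - Q' \<tau>)"
        by (simp add: mult.commute)
    qed
    also have "\<dots> = L' * norm (Q \<tau> - Q' \<tau>)" by (simp add: L'_def sum_distrib_right)
    finally show "norm (F \<tau> (Q \<tau>) - F \<tau> (Q' \<tau>)) \<le> L' * norm (Q \<tau> - Q' \<tau>)" .
  qed (use I in auto)
  then show ?thesis
    using base[OF I(3)] integral_pair_fibre(1)[OF ip(1) \<gamma>(1) I(3)] integral_pair_fibre(1)[OF ip(2) \<gamma>(2) I(3)]
    by (simp add: agree_def Q_def Q'_def)
qed

text \<open>The free test map l allows a comparison with flows started elsewhere: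
  \<open>flow_inverse\<close> takes for l a trivialisation composed with a further backward
  map.\<close>

lemma integral_pair_flow:
  assumes x: "x \<in> N1" and l: "linear_between (fibre A x) UNIV l"
  shows "integral_pair u {s - \<delta><..<s + \<delta>} (\<lambda>t. f s t x) (\<lambda>t a. l (Bw s t x a))"
  unfolding integral_pair_def
proof (intro conjI ballI allI impI)
  have ab: "\<bar>t - s\<bar> < \<delta>" if "t \<in> {s - \<delta><..<s + \<delta>}" for t using that by (simp add: abs_less_iff)
  show "continuous_on {s - \<delta><..<s + \<delta>} (\<lambda>t. f s t x)"
  proof -
    have "continuous_on \<Omega> \<mu>" unfolding \<mu>_def
      by (rule continuous_on_compose2[OF chart(6)[OF c] P_cont]) (use N0 in \<open>auto simp: \<Omega>_def\<close>)
    moreover have "continuous_on {s - \<delta><..<s + \<delta>} (\<lambda>t. \<phi> s t (\<kappa> x))"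
      by (rule continuous_at_imp_continuous_on, rule ballI, rule has_vector_derivative_continuous[OF \<phi>_ode])
    ultimately show ?thesis unfolding f_def
      by (rule continuous_on_compose2) (use \<phi>_Omega[OF x ab] in auto)
  qed
  fix t assume t: "t \<in> {s - \<delta><..<s + \<delta>}"
  show "linear_between (fibre A (f s t x)) UNIV (\<lambda>a. l (Bw s t x a))"
    using linear_betweenD[OF l] linear_betweenD[OF Bw_lin[OF x ab[OF t]]] by (simp add: linear_between_def)
  show "((\<lambda>t. g (f s t x)) has_real_derivative \<rho> (f s t x) (u t (f s t x)) g) (at t within {s - \<delta><..<s + \<delta>})"
    if "\<forall>y. sm_at A g y" for g
    by (rule has_field_derivative_at_within[OF f_ode[OF x ab[OF t]]]) (use that in blast)
  show "((\<lambda>t. l (Bw s t x (X (f s t x)))) has_vector_derivative l (Bw s t x (br (u t) X (f s t x)))) (at t within {s - \<delta><..<s + \<delta>})"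
    if X: "X \<in> sections A" for X
  proof -
    \<comment> \<open>The map l is linear on a fibre, which carries no norm. Precomposed with the
      inverse trivialisation it becomes a linear map of Euclidean spaces, and such a map commutes
      with derivatives.\<close>
    define K where "K w = l (triv_inv \<psi> x (PF w))" for w
    have xV: "x \<in> V" using x N1_eq N0 by blast
    have "linear K" unfolding K_def
    proof (rule linearI)
      fix v w :: 'f and c :: real
      show "l (triv_inv \<psi> x (PF (v + w))) = l (triv_inv \<psi> x (PF v)) + l (triv_inv \<psi> x (PF w))"
        using triv_inv_lin[OF V xV PF(2) PF(2), of 1 v 1 w] linear_betweenD(2)[OF l triv_inv_in[OF V xV PF(2)] triv_inv_in[OF V xV PF(2)], of 1 v 1 w]
        by (simp add: linear_add[OF PF(1)])
      show "l (triv_inv \<psi> x (PF (c *\<^sub>R v))) = c *\<^sub>R l (triv_inv \<psi> x (PF v))"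
        using triv_inv_lin[OF V xV PF(2) PF(2), of c v 0 v] linear_betweenD(2)[OF l triv_inv_in[OF V xV PF(2)] triv_inv_in[OF V xV PF(2)], of c v 0 v]
        by (simp add: linear_cmul[OF PF(1)])
    qed
    then have bl: "bounded_linear K" using linear_conv_bounded_linear by blast
    have eq: "K (\<psi> x (Bw s t x a)) = l (Bw s t x a)" if "\<bar>t - s\<bar> < \<delta>" "a \<in> fibre A (f s t x)" for t a
      using Bw(1)[OF x that] by (simp add: K_def PF(3) triv_in[OF V xV] triv_inv_triv[OF V xV])
    have "((\<lambda>t. K (\<psi> x (Bw s t x (X (f s t x))))) has_vector_derivative l (Bw s t x (br (u t) X (f s t x)))) (at t)"
      using bounded_linear.has_vector_derivative[OF bl Bw_ode[OF x ab[OF t] X]]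
      by (simp add: eq[OF ab[OF t] sectionsD[OF br_section[OF u_sec X]]])
    then have "((\<lambda>t. l (Bw s t x (X (f s t x)))) has_vector_derivative l (Bw s t x (br (u t) X (f s t x)))) (at t)"
      by (rule has_vector_derivative_transform_within_open[OF _ open_greaterThanLessThan t])
         (simp add: eq[OF ab sectionsD[OF X]])
    then show ?thesis by (rule has_vector_derivative_at_within)
  qed
qed

end

subsection \<open>Uniqueness and gluing of flows\<close>

lemma (in vbundle) sm_at_along_change:
  assumes V: "(V,\<psi>) \<in> trivs A" "(V',\<psi>') \<in> trivs A" "F x \<in> V" "F x \<in> V'"
    and N: "open N" "x \<in> N" "continuous_on N F" "\<And>y. y \<in> N \<Longrightarrow> Z y \<in> fibre A (F y)"
    and c: "(U,\<kappa>) \<in> charts A" "F x \<in> U" "sm_at A (\<lambda>y. \<kappa> (F y)) x"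
    and s: "sm_at A (\<lambda>y. \<psi> (F y) (Z y)) x"
  shows "sm_at A (\<lambda>y. \<psi>' (F y) (Z y)) x"
proof (rule sm_at_cong)
  show "sm_at A (\<lambda>y. \<Sum>b\<in>Basis. (\<psi> (F y) (Z y) \<bullet> b) *\<^sub>R \<psi>' (F y) (triv_inv \<psi> (F y) (PF b))) x"
    by (intro sm_at_sum sm_at_scaleR sm_at_inner_right s
        sm_at_pullback[OF triv_smooth[OF V(1,2) PF(2) V(3,4)] N(1-3) c])
  show "open (F -` (V \<inter> V') \<inter> N)"
    by (rule continuous_on_open_vimage[THEN iffD1, rule_format, OF N(1,3) open_Int[OF triv_open[OF V(1)] triv_open[OF V(2)]]])
  show "x \<in> F -` (V \<inter> V') \<inter> N" using V N by simp
  fix y assume y: "y \<in> F -` (V \<inter> V') \<inter> N"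
  then have yV: "F y \<in> V" "F y \<in> V'" and Z: "Z y \<in> fibre A (F y)" using N(4) by auto
  have i: "triv_inv \<psi> (F y) (PF b) \<in> fibre A (F y)" for b by (rule triv_inv_in[OF V(1) yV(1) PF(2)])
  have "\<psi>' (F y) (Z y) = \<psi>' (F y) (\<Sum>b\<in>Basis. (\<psi> (F y) (Z y) \<bullet> b) *\<^sub>R triv_inv \<psi> (F y) (PF b))"
    using triv_expand[OF V(1) yV(1) Z] by simp
  also have "\<dots> = (\<Sum>b\<in>Basis. (\<psi> (F y) (Z y) \<bullet> b) *\<^sub>R \<psi>' (F y) (triv_inv \<psi> (F y) (PF b)))"
    by (simp add: triv_sum[OF V(2) yV(2)] triv_ops(3)[OF V(2) yV(2)] fibre_ops(4) i)
  finally show "(\<Sum>b\<in>Basis. (\<psi> (F y) (Z y) \<bullet> b) *\<^sub>R \<psi>' (F y) (triv_inv \<psi> (F y) (PF b))) = \<psi>' (F y) (Z y)" ..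
qed

text \<open>What the construction takes from the hypotheses. \<open>clamp\<close> lets the flow
  start at any time, while J is controlled on [0,1] only. \<open>Jder\<close> is Moser's equation,
  and \<open>Jfam\<close> supplies the differentiability of J jointly in time and point.\<close>

locale flow_data = algebroid A
  for A :: "('m::{t2_space,second_countable_topology}, 'e::euclidean_space,
    'v::real_vector, 'f::euclidean_space, 'z) lie_algebroid_scheme" +
  fixes u :: "real \<Rightarrow> 'm \<Rightarrow> 'v" and J :: "real \<Rightarrow> 'm \<Rightarrow> 'v \<Rightarrow> 'v"
  assumes u_sec: "u t \<in> sections A" and clamp: "u t = u (clamp01 t)"
    and u_fam: "(V,\<psi>) \<in> trivs A \<Longrightarrow> smooth_family_on A {0..1} V (\<lambda>t x. \<psi> x (u t x))"
    and Jlin: "t \<in> {0..1} \<Longrightarrow> linear_between (fibre A y) (fibre A y) (J t y)"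
    and Jsec: "t \<in> {0..1} \<Longrightarrow> X \<in> sections A \<Longrightarrow> (\<lambda>y. J t y (X y)) \<in> sections A"
    and Jder: "t \<in> {0..1} \<Longrightarrow> (V,\<psi>) \<in> trivs A \<Longrightarrow> y \<in> V \<Longrightarrow> X \<in> sections A \<Longrightarrow>
      ((\<lambda>t. \<psi> y (J t y (X y))) has_vector_derivative
         \<psi> y (J t y (br (u t) X y) - br (u t) (\<lambda>y. J t y (X y)) y)) (at t within {0..1})"
    and Jfam: "(V,\<psi>) \<in> trivs A \<Longrightarrow> w \<in> typical_fibre A \<Longrightarrow>
      smooth_family_on A {0..1} V (\<lambda>t x. \<psi> x (J t x (inv_into (fibre A x) (\<psi> x) w)))"
begin

lemma coord_flow_at:
  "\<exists>U \<kappa> V \<psi> N0 e k r L ca cB \<phi> \<Phi> \<Theta>. coord_flow A U \<kappa> V \<psi> N0 e k u x0 r L ca cB \<phi> \<Phi> \<Theta>"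
proof -
  obtain U \<kappa> V \<psi> N0 e k where co: "coords A U \<kappa> V \<psi> N0 e k" "x0 \<in> N0" using coords_exist by blast
  interpret coords A U \<kappa> V \<psi> N0 e k by (rule co(1))
  have "csm {0..1} \<Omega> (\<lambda>t. hat (u t))"
    using family_csm[OF u_fam[OF V] N0(3)] unfolding hat_def .
  from coord_flow_exists[OF u_sec this clamp co(2)] show ?thesis by blast
qed

text \<open>A connectedness argument: around each time either the curves stay apart, by the
  Hausdorff property, or both run in one coordinate domain, where local uniqueness spreads agreement
  from any time to any other.\<close>

lemma integral_pair_unique:
  assumes ip: "integral_pair u I \<gamma> q" "integral_pair u I \<gamma>' q'" and I: "convex I" "s \<in> I" "t \<in> I"
    and s: "agree \<gamma> q \<gamma>' q' s"
  shows "agree \<gamma> q \<gamma>' q' t"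
proof (rule connected_induction_simple[where P="agree \<gamma> q \<gamma>' q'", OF convex_connected[OF I(1)] I(2,3) s])
  fix \<tau> assume \<tau>: "\<tau> \<in> I"
  have cont: "continuous_on I \<gamma>" "continuous_on I \<gamma>'" using ip unfolding integral_pair_def by blast+
  show "\<exists>T. openin (top_of_set I) T \<and> \<tau> \<in> T \<and> (\<forall>x\<in>T. \<forall>y\<in>T. agree \<gamma> q \<gamma>' q' x \<longrightarrow> agree \<gamma> q \<gamma>' q' y)"
  proof (cases "\<gamma> \<tau> = \<gamma>' \<tau>")
    case False
    obtain U1 U2 where U: "open U1" "open U2" "\<gamma> \<tau> \<in> U1" "\<gamma>' \<tau> \<in> U2" "U1 \<inter> U2 = {}"
      using hausdorff[OF False] by (elim exE conjE) (rule that)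
    have "openin (top_of_set I) ((I \<inter> \<gamma> -` U1) \<inter> (I \<inter> \<gamma>' -` U2))"
      by (intro openin_Int continuous_openin_preimage_gen cont U)
    moreover have "\<not> agree \<gamma> q \<gamma>' q' x" if "x \<in> (I \<inter> \<gamma> -` U1) \<inter> (I \<inter> \<gamma>' -` U2)" for x
    proof
      assume "agree \<gamma> q \<gamma>' q' x"
      then have "\<gamma> x \<in> U1 \<inter> U2" using that unfolding agree_def by simp
      then show False using U(5) by simp
    qed
    ultimately show ?thesis using \<tau> U(3,4)
      by (intro exI[of _ "(I \<inter> \<gamma> -` U1) \<inter> (I \<inter> \<gamma>' -` U2)"]) simp
  next
    case True
    obtain U \<kappa> V \<psi> N0 e k r L ca cB \<phi> \<Phi> \<Theta> where cf: "coord_flow A U \<kappa> V \<psi> N0 e k u (\<gamma> \<tau>) r L ca cB \<phi> \<Phi> \<Theta>"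
      using coord_flow_at[of "\<gamma> \<tau>"] by (elim exE) (rule that)
    interpret cf: coord_flow A U \<kappa> V \<psi> N0 e k u "\<gamma> \<tau>" r L ca cB \<phi> \<Phi> \<Theta> by (rule cf)
    define S where "S = (I \<inter> \<gamma> -` cf.N1) \<inter> (I \<inter> \<gamma>' -` cf.N1)"
    have "openin (top_of_set I) S" unfolding S_def
      by (intro openin_Int continuous_openin_preimage_gen cont cf.N1(1))
    moreover have "\<tau> \<in> S" using \<tau> True cf.N1(2) by (simp add: S_def)
    ultimately obtain d where d: "d > 0" "ball \<tau> d \<inter> I \<subseteq> S" unfolding openin_contains_ball by blast
    define T where "T = I \<inter> ball \<tau> d"
    have T: "convex T" "T \<subseteq> I" "T \<subseteq> S"
      unfolding T_def by (intro convex_Int I(1) convex_ball) (use d(2) in blast)+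
    have "agree \<gamma> q \<gamma>' q' y" if "x \<in> T" "y \<in> T" "agree \<gamma> q \<gamma>' q' x" for x y
      by (rule cf.integral_pair_unique_local[OF integral_pair_subset[OF ip(1) T(2)] integral_pair_subset[OF ip(2) T(2)] T(1) that(1,2) _ _ that(3)])
         (use T(3) in \<open>auto simp: S_def\<close>)
    moreover have "openin (top_of_set I) T" unfolding T_def by (rule openin_open_Int[OF open_ball])
    moreover have "\<tau> \<in> T" using \<tau> d by (simp add: T_def)
    ultimately show ?thesis by (intro exI[of _ T] conjI ballI impI)
  qed
qed

end

text \<open>The bound \<epsilon> is the same for all initial times. Compatibility is stated for
  global functions and sections that are related over N: such statements can be proved in
  coordinates, and they glue, since a relation over all of M holds over each N.\<close>

locale local_flow = flow_data A u J
  for A :: "('m::{t2_space,second_countable_topology}, 'e::euclidean_space,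
    'v::real_vector, 'f::euclidean_space, 'z) lie_algebroid_scheme" and u J +
  fixes \<epsilon> :: real and N :: "'m set" and f :: "real \<Rightarrow> real \<Rightarrow> 'm \<Rightarrow> 'm" and F B :: "real \<Rightarrow> real \<Rightarrow> 'm \<Rightarrow> 'v \<Rightarrow> 'v"
  assumes oN: "open N" and \<epsilon>: "\<epsilon> > 0"
    and f0: "x \<in> N \<Longrightarrow> f s s x = x" and B0: "x \<in> N \<Longrightarrow> a \<in> fibre A x \<Longrightarrow> B s s x a = a"
    and ip: "x \<in> N \<Longrightarrow> linear_between (fibre A x) UNIV l \<Longrightarrow> integral_pair u {s-\<epsilon><..<s+\<epsilon>} (\<lambda>t. f s t x) (\<lambda>t a. l (B s t x a))"
    and f_cont: "\<bar>t - s\<bar> < \<epsilon> \<Longrightarrow> continuous_on N (f s t)"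
    and F_lin: "\<bar>t - s\<bar> < \<epsilon> \<Longrightarrow> x \<in> N \<Longrightarrow> linear_between (fibre A x) (fibre A (f s t x)) (F s t x)"
    and B_lin: "\<bar>t - s\<bar> < \<epsilon> \<Longrightarrow> x \<in> N \<Longrightarrow> linear_between (fibre A (f s t x)) (fibre A x) (B s t x)"
    and BF: "\<bar>t - s\<bar> < \<epsilon> \<Longrightarrow> x \<in> N \<Longrightarrow> a \<in> fibre A x \<Longrightarrow> B s t x (F s t x a) = a"
    and FB: "\<bar>t - s\<bar> < \<epsilon> \<Longrightarrow> x \<in> N \<Longrightarrow> b \<in> fibre A (f s t x) \<Longrightarrow> F s t x (B s t x b) = b"
    and f_sm: "\<bar>t - s\<bar> < \<epsilon> \<Longrightarrow> x \<in> N \<Longrightarrow> (U,\<kappa>) \<in> charts A \<Longrightarrow> f s t x \<in> U \<Longrightarrow> sm_at A (\<lambda>y. \<kappa> (f s t y)) x"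
    and F_sm: "\<bar>t - s\<bar> < \<epsilon> \<Longrightarrow> x \<in> N \<Longrightarrow> (V,\<psi>) \<in> trivs A \<Longrightarrow> f s t x \<in> V \<Longrightarrow> X \<in> sections A \<Longrightarrow>
      sm_at A (\<lambda>y. \<psi> (f s t y) (F s t y (X y))) x"
    and F_anchor: "\<bar>t - s\<bar> < \<epsilon> \<Longrightarrow> x \<in> N \<Longrightarrow> (\<And>y. sm_at A g y) \<Longrightarrow> (\<And>y. sm_at A g' y) \<Longrightarrow>
      (\<And>y. y \<in> N \<Longrightarrow> g' y = g (f s t y)) \<Longrightarrow> a \<in> fibre A x \<Longrightarrow> \<rho> (f s t x) (F s t x a) g = \<rho> x a g'"
    and F_bracket: "\<bar>t - s\<bar> < \<epsilon> \<Longrightarrow> x \<in> N \<Longrightarrow> X \<in> sections A \<Longrightarrow> X' \<in> sections A \<Longrightarrow> (\<And>y. y \<in> N \<Longrightarrow> X' (f s t y) = F s t y (X y)) \<Longrightarrow>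
      Y \<in> sections A \<Longrightarrow> Y' \<in> sections A \<Longrightarrow> (\<And>y. y \<in> N \<Longrightarrow> Y' (f s t y) = F s t y (Y y)) \<Longrightarrow>
      br X' Y' (f s t x) = F s t x (br X Y x)"
    and F_J: "\<bar>t - s\<bar> < \<epsilon> \<Longrightarrow> x \<in> N \<Longrightarrow> s \<in> {0..1} \<Longrightarrow> t \<in> {0..1} \<Longrightarrow> a \<in> fibre A x \<Longrightarrow>
      J t (f s t x) (F s t x a) = F s t x (J s x a)"

lemma (in flow_data) local_flow_at: "\<exists>\<epsilon> N f F B. x0 \<in> N \<and> local_flow A u J \<epsilon> N f F B"
proof -
  obtain U \<kappa> V \<psi> N0 e k r L ca cB \<phi> \<Phi> \<Theta> where cf: "coord_flow A U \<kappa> V \<psi> N0 e k u x0 r L ca cB \<phi> \<Phi> \<Theta>"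
    using coord_flow_at[of x0] by (elim exE) (rule that)
  interpret cf: coord_flow A U \<kappa> V \<psi> N0 e k u x0 r L ca cB \<phi> \<Phi> \<Theta> by (rule cf)
  \<comment> \<open>Over \<Omega> the global frame section is the pulled back constant
    \<open>PF b\<close>, the form in which \<open>Jfam\<close> speaks about J.\<close>
  have Jdiff: "\<exists>D. ((\<lambda>z. cf.hat (\<lambda>y. J (fst z) y (e b y)) (snd z)) has_derivative D) (at (t,p) within {0..1} \<times> cf.\<Omega>)"
    if tp: "t \<in> {0..1}" "p \<in> cf.\<Omega>" for t p b
  proof -
    obtain D where D: "((\<lambda>z. \<psi> (cf.\<mu> (snd z)) (J (fst z) (cf.\<mu> (snd z)) (triv_inv \<psi> (cf.\<mu> (snd z)) (PF b)))) has_derivative D) (at (t,p) within {0..1} \<times> cf.\<Omega>)"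
      using cf.family_diff[OF Jfam[OF cf.V PF(2)] cf.N0(3) tp] by (rule exE)
    have "((\<lambda>z. cf.hat (\<lambda>y. J (fst z) y (e b y)) (snd z)) has_derivative D) (at (t,p) within {0..1} \<times> cf.\<Omega>)"
      by (rule has_derivative_transform[OF _ _ D]) (use tp in \<open>auto simp: cf.hat_def cf.e_eq cf.mu_in\<close>)
    then show ?thesis by (rule exI[of _ D])
  qed
  have fsm: "sm_at A (\<lambda>y. \<kappa>' (cf.f s t y)) x"
    if "\<bar>t - s\<bar> < cf.\<delta>" "x \<in> cf.N1" "(U',\<kappa>') \<in> charts A" "cf.f s t x \<in> U'" for s t x U' \<kappa>'
    by (rule sm_at_pullback[OF sm_at_chart[OF that(3,4)] cf.N1(1) that(2) cf.f_cont[OF that(2,1)] cf.c _ cf.f_sm[OF that(2,1)]])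
       (rule cf.f_N0(3)[OF that(2,1)])
  have "local_flow A u J cf.\<delta> cf.N1 cf.f cf.Fw cf.Bw"
  proof (intro local_flow.intro local_flow_axioms.intro)
    show "flow_data A u J" by unfold_locales
    show "cf.f s s x = x" if "x \<in> cf.N1" for s x
      using that cf.N1(3) by (auto simp: cf.f_def cf.\<phi>_init cf.mu_kappa)
    then show "cf.Bw s s x a = a" if "x \<in> cf.N1" "a \<in> fibre A x" for s x a
      using that cf.N1(3) cf.N0(3) by (auto simp: cf.Bw_def cf.\<Theta>0 triv_inv_triv[OF cf.V])
    show "continuous_on cf.N1 (cf.f s t)" if st: "\<bar>t - s\<bar> < cf.\<delta>" for s t
      by (rule cf.f_cont[OF cf.N1(2) st])
    show "J t (cf.f s t x) (cf.Fw s t x a) = cf.Fw s t x (J s x a)"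
      if "\<bar>t - s\<bar> < cf.\<delta>" "x \<in> cf.N1" "s \<in> {0..1}" "t \<in> {0..1}" "a \<in> fibre A x" for s t x a
      by (rule cf.J_compat[OF that(3,4,1,2,5) Jlin Jsec Jder[OF _ cf.V] Jdiff]) (use cf.N0(3) in auto)
    show "sm_at A (\<lambda>y. \<psi>' (cf.f s t y) (cf.Fw s t y (X y))) x"
      if st: "\<bar>t - s\<bar> < cf.\<delta>" and x: "x \<in> cf.N1" and V': "(V',\<psi>') \<in> trivs A" "cf.f s t x \<in> V'" and X: "X \<in> sections A" for s t x V' \<psi>' X
    proof -
      have xVU: "x \<in> V" "x \<in> U" using cf.xN0[OF x st] cf.N0 by auto
      have "sm_at A (\<lambda>y. blinfun_apply (\<Phi> s t (\<kappa> y)) (\<psi> y (X y))) x"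
        by (rule sm_at_bilinear[OF bounded_bilinear_blinfun_apply
            sm_at_comp[OF sm_at_chart[OF cf.c xVU(2)] open_UNIV UNIV_I cf.\<Phi>_sm[OF x st]] sections_sm[OF X cf.V xVU(1)]])
      then have "sm_at A (\<lambda>y. \<psi> (cf.f s t y) (cf.Fw s t y (X y))) x"
        by (rule sm_at_cong[OF _ cf.N1(1) x]) (simp add: cf.Fw(2)[OF _ st sectionsD[OF X]])
      then show ?thesis
        by (rule sm_at_along_change[OF cf.V V'(1) cf.f_N0(2)[OF x st] V'(2) cf.N1(1) x cf.f_cont[OF x st] _ cf.c cf.f_N0(3)[OF x st] cf.f_sm[OF x st], rotated])
           (rule cf.Fw(1)[OF _ st sectionsD[OF X]])
    qed
    show "\<rho> (cf.f s t x) (cf.Fw s t x a) g = \<rho> x a g'"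
      if "\<bar>t - s\<bar> < cf.\<delta>" "x \<in> cf.N1" "\<And>y. sm_at A g y" "\<And>y. sm_at A g' y" "\<And>y. y \<in> cf.N1 \<Longrightarrow> g' y = g (cf.f s t y)" "a \<in> fibre A x" for s t x g g' a
      by (rule cf.anchor_compat[OF that(2,1)]) (rule that, assumption?)+
    show "br X' Y' (cf.f s t x) = cf.Fw s t x (br X Y x)"
      if "\<bar>t - s\<bar> < cf.\<delta>" "x \<in> cf.N1" "X \<in> sections A" "X' \<in> sections A" "\<And>y. y \<in> cf.N1 \<Longrightarrow> X' (cf.f s t y) = cf.Fw s t y (X y)"
        "Y \<in> sections A" "Y' \<in> sections A" "\<And>y. y \<in> cf.N1 \<Longrightarrow> Y' (cf.f s t y) = cf.Fw s t y (Y y)" for s t x X X' Y Y'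
      by (rule cf.bracket_compat[OF that(2,1)]) (rule that, assumption?)+
  qed (rule cf.N1 cf.\<delta>_pos cf.integral_pair_flow cf.Fw_lin cf.Bw_lin cf.Bw_Fw cf.Fw_Bw fsm; assumption)+
  then show ?thesis using cf.N1(2) by blast
qed

text \<open>Both flows give integral pairs with the same start. A trivialisation at x serves as test
  map; being injective on the fibre it recovers B, and F follows as the inverse of B.\<close>

lemma (in flow_data) local_flow_unique:
  assumes lf: "local_flow A u J \<epsilon> N f F B" and lf': "local_flow A u J \<epsilon>' N' f' F' B'" and x: "x \<in> N" "x \<in> N'"
    and st: "\<bar>t - s\<bar> < \<epsilon>" "\<bar>t - s\<bar> < \<epsilon>'"
  shows "f s t x = f' s t x" and "b \<in> fibre A (f s t x) \<Longrightarrow> B s t x b = B' s t x b"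
    and "a \<in> fibre A x \<Longrightarrow> F s t x a = F' s t x a"
proof -
  interpret L: local_flow A u J \<epsilon> N f F B by (rule lf)
  interpret L': local_flow A u J \<epsilon>' N' f' F' B' by (rule lf')
  obtain V \<psi> where V: "(V,\<psi>) \<in> trivs A" "x \<in> V" using triv_ex[of x] by (elim exE conjE) (rule that)
  have l: "linear_between (fibre A x) UNIV (\<psi> x)"
    using triv_lb[OF V] by (simp add: linear_between_def)
  define I where "I = {s-\<epsilon><..<s+\<epsilon>} \<inter> {s-\<epsilon>'<..<s+\<epsilon>'}"
  have "agree (\<lambda>t. f s t x) (\<lambda>t a. \<psi> x (B s t x a)) (\<lambda>t. f' s t x) (\<lambda>t a. \<psi> x (B' s t x a)) t"
  proof (rule integral_pair_unique[where I=I and s=s])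
    show "integral_pair u I (\<lambda>t. f s t x) (\<lambda>t a. \<psi> x (B s t x a))" "integral_pair u I (\<lambda>t. f' s t x) (\<lambda>t a. \<psi> x (B' s t x a))"
      unfolding I_def by (rule integral_pair_subset[OF L.ip[OF x(1) l] Int_lower1], rule integral_pair_subset[OF L'.ip[OF x(2) l] Int_lower2])
    show "convex I" unfolding I_def by (intro convex_Int convex_real_interval)
    show "agree (\<lambda>t. f s t x) (\<lambda>t a. \<psi> x (B s t x a)) (\<lambda>t. f' s t x) (\<lambda>t a. \<psi> x (B' s t x a)) s"
      unfolding agree_def using x by (simp add: L.f0 L'.f0 L.B0 L'.B0)
  qed (use st L.\<epsilon> L'.\<epsilon> in \<open>auto simp: I_def abs_less_iff\<close>)
  then have 1: "f s t x = f' s t x" and 2: "\<And>b. b \<in> fibre A (f s t x) \<Longrightarrow> \<psi> x (B s t x b) = \<psi> x (B' s t x b)"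
    unfolding agree_def by auto
  show "f s t x = f' s t x" by (rule 1)
  show 3: "B s t x b = B' s t x b" if b: "b \<in> fibre A (f s t x)" for b
  proof (rule triv_inj[OF V _ _ 2[OF b]])
    show "B s t x b \<in> fibre A x" by (rule linear_betweenD(1)[OF L.B_lin[OF st(1) x(1)] b])
    show "B' s t x b \<in> fibre A x" by (rule linear_betweenD(1)[OF L'.B_lin[OF st(2) x(2)]]) (use b 1 in simp)
  qed
  show "F s t x a = F' s t x a" if a: "a \<in> fibre A x"
  proof -
    have "F' s t x a \<in> fibre A (f s t x)" using linear_betweenD(1)[OF L'.F_lin[OF st(2) x(2)] a] 1 by simp
    from 3[OF this] L.FB[OF st(1) x(1) this] L'.BF[OF st(2) x(2) a] show ?thesis by simp
  qed
qed

text \<open>Each point uses the flow of one chosen domain. By uniqueness, near any given point this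
  is the flow of a single domain, so all local properties carry over; finiteness of the cover keeps
  the common time bound positive.\<close>

lemma (in flow_data) global_flow_exists:
  assumes "compact (UNIV :: 'm set)"
  obtains \<epsilon> f F B where "local_flow A u J \<epsilon> UNIV f F B"
proof -
  have "\<exists>p. x \<in> fst (snd p) \<and> local_flow A u J (fst p) (fst (snd p)) (fst (snd (snd p))) (fst (snd (snd (snd p)))) (snd (snd (snd (snd p))))" for x
  proof -
    obtain \<epsilon> N f F B where "x \<in> N" "local_flow A u J \<epsilon> N f F B" using local_flow_at[of x] by (elim exE conjE) (rule that)
    then show ?thesis by (intro exI[of _ "(\<epsilon>, N, f, F, B)"]) simp
  qed
  then obtain p where p: "\<And>x. x \<in> fst (snd (p x)) \<and> local_flow A u J (fst (p x)) (fst (snd (p x)))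
      (fst (snd (snd (p x)))) (fst (snd (snd (snd (p x))))) (snd (snd (snd (snd (p x)))))" by metis
  define E where "E x = fst (p x)" for x
  define NN where "NN x = fst (snd (p x))" for x
  define ff where "ff x = fst (snd (snd (p x)))" for x
  define FF where "FF x = fst (snd (snd (snd (p x))))" for x
  define BB where "BB x = snd (snd (snd (snd (p x))))" for x
  have lf: "x \<in> NN x" "local_flow A u J (E x) (NN x) (ff x) (FF x) (BB x)" for x
    using p[of x] unfolding E_def NN_def ff_def FF_def BB_def by blast+
  have oN: "open (NN x)" and E: "E x > 0" for x
    by (rule local_flow.oN[OF lf(2)], rule local_flow.\<epsilon>[OF lf(2)])
  obtain C where C: "finite C" "UNIV \<subseteq> (\<Union>c\<in>C. NN c)"
    by (rule compactE_image[OF assms, of UNIV NN]) (use oN lf(1) that in auto)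
  define \<epsilon> where "\<epsilon> = Min (E ` C)"
  define i where "i x = (SOME c. c \<in> C \<and> x \<in> NN c)" for x
  have i: "i x \<in> C" "x \<in> NN (i x)" for x
    using someI_ex[of "\<lambda>c. c \<in> C \<and> x \<in> NN c"] C(2) unfolding i_def by auto
  have C0: "C \<noteq> {}" using i(1) by blast
  have \<epsilon>E: "\<epsilon> \<le> E c" if "c \<in> C" for c using that C(1) by (simp add: \<epsilon>_def)
  have \<epsilon>0: "\<epsilon> > 0" using E C(1) C0 by (simp add: \<epsilon>_def)
  have lt: "\<bar>t - s\<bar> < E (i x)" if "\<bar>t - s\<bar> < \<epsilon>" for s t x using that \<epsilon>E[OF i(1)[of x]] by linarith
  define f where "f s t x = ff (i x) s t x" for s t x
  define F where "F s t x = FF (i x) s t x" for s t x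
  define B where "B s t x = BB (i x) s t x" for s t x
  have eqf: "f s t y = ff c s t y" and eqF: "a \<in> fibre A y \<Longrightarrow> F s t y a = FF c s t y a"
    if "\<bar>t - s\<bar> < \<epsilon>" "c \<in> C" "y \<in> NN c" for s t c y a
  proof -
    have "\<bar>t - s\<bar> < E c" using that(1) \<epsilon>E[OF that(2)] by linarith
    from local_flow_unique[OF lf(2) lf(2) i(2) that(3) lt[OF that(1)] this]
    show "f s t y = ff c s t y" "a \<in> fibre A y \<Longrightarrow> F s t y a = FF c s t y a" by (simp_all add: f_def F_def)
  qed
  have "local_flow A u J \<epsilon> UNIV f F B"
  proof (intro local_flow.intro local_flow_axioms.intro)
    show "flow_data A u J" by unfold_locales
    show "\<epsilon> > 0" by (rule \<epsilon>0)
    show "f s s x = x" for s x unfolding f_def by (rule local_flow.f0[OF lf(2) i(2)])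
    show "B s s x a = a" if "a \<in> fibre A x" for s x a unfolding B_def by (rule local_flow.B0[OF lf(2) i(2) that])
    show "integral_pair u {s-\<epsilon><..<s+\<epsilon>} (\<lambda>t. f s t x) (\<lambda>t a. l (B s t x a))" if "linear_between (fibre A x) UNIV l" for x l s
      unfolding f_def B_def by (rule integral_pair_subset[OF local_flow.ip[OF lf(2) i(2) that]]) (use \<epsilon>E[OF i(1)[of x]] in auto)
    fix s t :: real assume st: "\<bar>t - s\<bar> < \<epsilon>"
    have "continuous_on (\<Union>c\<in>C. NN c) (f s t)"
    proof (rule continuous_on_open_UN[OF oN])
      fix c assume c: "c \<in> C"
      then have "continuous_on (NN c) (ff c s t)" using local_flow.f_cont[OF lf(2), of t s c] st \<epsilon>E[OF c] by simp
      then show "continuous_on (NN c) (f s t)" by (rule continuous_on_eq) (simp add: eqf[OF st c])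
    qed
    then show "continuous_on UNIV (f s t)" by (rule continuous_on_subset) (rule C(2))
    fix x
    note ltx = lt[OF st, of x] note L = lf(2)[of "i x"] note eq = eqf[OF st i(1)[of x]] eqF[OF st i(1)[of x]]
    show Flin: "linear_between (fibre A x) (fibre A (f s t x)) (F s t x)" unfolding f_def F_def by (rule local_flow.F_lin[OF L ltx i(2)])
    show "linear_between (fibre A (f s t x)) (fibre A x) (B s t x)" unfolding f_def B_def by (rule local_flow.B_lin[OF L ltx i(2)])
    show "B s t x (F s t x a) = a" if "a \<in> fibre A x" for a unfolding F_def B_def by (rule local_flow.BF[OF L ltx i(2) that])
    show "F s t x (B s t x b) = b" if "b \<in> fibre A (f s t x)" for b
      unfolding F_def B_def by (rule local_flow.FB[OF L ltx i(2) that[unfolded f_def]])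
    show "sm_at A (\<lambda>y. \<kappa> (f s t y)) x" if "(U,\<kappa>) \<in> charts A" "f s t x \<in> U" for U \<kappa>
      by (rule sm_at_cong[OF local_flow.f_sm[OF L ltx i(2) that(1) that(2)[unfolded f_def]] oN i(2)]) (simp add: eq)
    show "sm_at A (\<lambda>y. \<psi> (f s t y) (F s t y (X y))) x" if "(V,\<psi>) \<in> trivs A" "f s t x \<in> V" "X \<in> sections A" for V \<psi> X
      by (rule sm_at_cong[OF local_flow.F_sm[OF L ltx i(2) that(1) that(2)[unfolded f_def] that(3)] oN i(2)]) (simp add: eq sectionsD[OF that(3)])
    show "\<rho> (f s t x) (F s t x a) g = \<rho> x a g'"
      if "\<And>y. sm_at A g y" "\<And>y. sm_at A g' y" "\<And>y. y \<in> UNIV \<Longrightarrow> g' y = g (f s t y)" "a \<in> fibre A x" for g g' a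
      unfolding f_def F_def by (rule local_flow.F_anchor[OF L ltx i(2) that(1,2) _ that(4)]) (simp add: that(3) eq)
    show "br X' Y' (f s t x) = F s t x (br X Y x)"
      if "X \<in> sections A" "X' \<in> sections A" "\<And>y. y \<in> UNIV \<Longrightarrow> X' (f s t y) = F s t y (X y)"
        "Y \<in> sections A" "Y' \<in> sections A" "\<And>y. y \<in> UNIV \<Longrightarrow> Y' (f s t y) = F s t y (Y y)" for X X' Y Y'
    proof -
      have "X' (ff (i x) s t y) = FF (i x) s t y (X y)" "Y' (ff (i x) s t y) = FF (i x) s t y (Y y)" if "y \<in> NN (i x)" for y
        using \<open>\<And>y. y \<in> UNIV \<Longrightarrow> X' (f s t y) = F s t y (X y)\<close>[of y] \<open>\<And>y. y \<in> UNIV \<Longrightarrow> Y' (f s t y) = F s t y (Y y)\<close>[of y]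
        by (simp_all add: eq[OF that] sectionsD \<open>X \<in> sections A\<close> \<open>Y \<in> sections A\<close>)
      then show ?thesis
        unfolding f_def F_def by (rule local_flow.F_bracket[OF L ltx i(2) that(1,2) _ that(4,5)])
    qed
    show "J t (f s t x) (F s t x a) = F s t x (J s x a)" if "s \<in> {0..1}" "t \<in> {0..1}" "a \<in> fibre A x" for a
      unfolding f_def F_def by (rule local_flow.F_J[OF L ltx i(2) that])
  qed simp
  then show ?thesis by (rule that)
qed

section \<open>Automorphisms and conjugacy\<close>

lemma (in smfd) smooth_map_iff:
  "smooth_map M f \<longleftrightarrow> continuous_on UNIV f \<and> (\<forall>U \<kappa> x. (U,\<kappa>) \<in> charts M \<longrightarrow> f x \<in> U \<longrightarrow> sm_at M (\<lambda>x. \<kappa> (f x)) x)"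
proof -
  have "smooth_fun_on M (f -` U) (\<lambda>x. \<kappa> (f x)) \<longleftrightarrow> (\<forall>x. f x \<in> U \<longrightarrow> sm_at M (\<lambda>x. \<kappa> (f x)) x)"
    if "continuous_on UNIV f" "(U,\<kappa>) \<in> charts M" for U \<kappa>
    using smooth_fun_on_iff[OF open_vimage[OF chart(1)[OF that(2)] that(1)], of "\<lambda>x. \<kappa> (f x)"] by (simp add: Ball_def)
  then show ?thesis unfolding smooth_map_def by auto
qed

lemma (in smfd) smooth_map_pullback:
  assumes f: "smooth_map M f" and g: "sm_at M g (f x)"
  shows "sm_at M (\<lambda>y. g (f y)) x"
proof -
  obtain U \<kappa> where c: "(U,\<kappa>) \<in> charts M" "f x \<in> U" using chart_ex[of "f x"] by (elim exE conjE) (rule that)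
  show ?thesis by (rule sm_at_pullback[where F=f and g=g and N=UNIV, OF g open_UNIV UNIV_I _ c]) (use f c in \<open>simp_all add: smooth_map_iff\<close>)
qed

context vbundle
begin

text \<open>Smoothness of \<Phi> is tested by its effect on sections: extend a local frame section
  globally, push it forward, and pull the result back along f.\<close>

lemma bundle_mapI:
  assumes f: "smooth_map A f" and lin: "\<And>x. linear_between (fibre A x) (fibre A (f x)) (\<Phi> x)"
    and X: "\<And>X. X \<in> sections A \<Longrightarrow> \<exists>X'\<in>sections A. \<forall>x. X' (f x) = \<Phi> x (X x)"
  shows "bundle_map A f \<Phi>"
  unfolding bundle_map_def
proof (intro conjI f allI lin ballI, clarify)
  fix V \<psi> V' \<psi>' w assume V: "(V,\<psi>) \<in> trivs A" "(V',\<psi>') \<in> trivs A" and w: "w \<in> typical_fibre A"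
  have "continuous_on UNIV f" using f by (simp add: smooth_map_def)
  then have o: "open (V \<inter> f -` V')" by (intro open_Int open_vimage triv_open[OF V(1)] triv_open[OF V(2)])
  show "smooth_fun_on A (V \<inter> f -` V') (\<lambda>x. \<psi>' (f x) (\<Phi> x (triv_inv \<psi> x w)))"
    unfolding smooth_fun_on_iff[OF o]
  proof
    fix x assume x: "x \<in> V \<inter> f -` V'"
    obtain Y N where Y: "Y \<in> sections A" "open N" "x \<in> N" "N \<subseteq> V" "\<And>y. y \<in> N \<Longrightarrow> Y y = triv_inv \<psi> y w"
      by (rule extend_section[where X="\<lambda>y. triv_inv \<psi> y w" and \<psi>=\<psi>, OF V(1) _ triv_open[OF V(1)], of x])
         (use x in \<open>auto intro: triv_inv_in[OF V(1) _ w] triv_smooth[OF V(1) V(1) w] that\<close>)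
    obtain Y' where Y': "Y' \<in> sections A" "\<And>x. Y' (f x) = \<Phi> x (Y x)" using X[OF Y(1)] by blast
    have "sm_at A (\<lambda>y. \<psi>' (f y) (Y' (f y))) x"
      by (rule smooth_map_pullback[OF f sections_sm[OF Y'(1) V(2)]]) (use x in simp)
    then show "sm_at A (\<lambda>y. \<psi>' (f y) (\<Phi> y (triv_inv \<psi> y w))) x"
      by (rule sm_at_cong[OF _ Y(2,3)]) (simp add: Y' Y(5))
  qed
qed

end

context algebroid
begin

text \<open>The inverse is carried along, and smoothness of the fibre maps is phrased as carrying
  sections to sections. In this form composition is plain substitution.\<close>

definition aut_pair :: "('m \<Rightarrow> 'm) \<Rightarrow> ('m \<Rightarrow> 'v \<Rightarrow> 'v) \<Rightarrow> ('m \<Rightarrow> 'm) \<Rightarrow> ('m \<Rightarrow> 'v \<Rightarrow> 'v) \<Rightarrow> bool" where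
  "aut_pair f \<Phi> f' \<Phi>' \<longleftrightarrow> smooth_map A f \<and> smooth_map A f' \<and> (\<forall>x. f' (f x) = x \<and> f (f' x) = x) \<and>
     (\<forall>x. linear_between (fibre A x) (fibre A (f x)) (\<Phi> x) \<and> linear_between (fibre A x) (fibre A (f' x)) (\<Phi>' x)) \<and>
     (\<forall>x. \<forall>a\<in>fibre A x. \<Phi>' (f x) (\<Phi> x a) = a \<and> \<Phi> (f' x) (\<Phi>' x a) = a) \<and>
     (\<forall>X\<in>sections A. (\<lambda>y. \<Phi> (f' y) (X (f' y))) \<in> sections A \<and> (\<lambda>y. \<Phi>' (f y) (X (f y))) \<in> sections A) \<and>
     (\<forall>g. (\<forall>y. sm_at A g y) \<longrightarrow> (\<forall>x. \<forall>a\<in>fibre A x. \<rho> (f x) (\<Phi> x a) g = \<rho> x a (\<lambda>y. g (f y)))) \<and>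
     (\<forall>X\<in>sections A. \<forall>Y\<in>sections A. \<forall>y.
        br (\<lambda>y. \<Phi> (f' y) (X (f' y))) (\<lambda>y. \<Phi> (f' y) (Y (f' y))) y = \<Phi> (f' y) (br X Y (f' y)))"

lemma aut_pairD:
  assumes "aut_pair f \<Phi> f' \<Phi>'"
  shows "smooth_map A f" "smooth_map A f'" "f' (f x) = x" "f (f' x) = x"
    "linear_between (fibre A x) (fibre A (f x)) (\<Phi> x)" "linear_between (fibre A x) (fibre A (f' x)) (\<Phi>' x)"
    "a \<in> fibre A x \<Longrightarrow> \<Phi>' (f x) (\<Phi> x a) = a" "a \<in> fibre A x \<Longrightarrow> \<Phi> (f' x) (\<Phi>' x a) = a"
    "X \<in> sections A \<Longrightarrow> (\<lambda>y. \<Phi> (f' y) (X (f' y))) \<in> sections A" "X \<in> sections A \<Longrightarrow> (\<lambda>y. \<Phi>' (f y) (X (f y))) \<in> sections A"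
    "\<forall>y. sm_at A g y \<Longrightarrow> a \<in> fibre A x \<Longrightarrow> \<rho> (f x) (\<Phi> x a) g = \<rho> x a (\<lambda>y. g (f y))"
    "X \<in> sections A \<Longrightarrow> Y \<in> sections A \<Longrightarrow>
        br (\<lambda>y. \<Phi> (f' y) (X (f' y))) (\<lambda>y. \<Phi> (f' y) (Y (f' y))) y = \<Phi> (f' y) (br X Y (f' y))"
    "a \<in> fibre A x \<Longrightarrow> \<Phi> x a \<in> fibre A (f x)" "a \<in> fibre A x \<Longrightarrow> \<Phi>' x a \<in> fibre A (f' x)"
  using assms unfolding aut_pair_def linear_between_def by (simp_all add: image_subset_iff)

lemma aut_pair_automorphism:
  assumes a: "aut_pair f \<Phi> f' \<Phi>'"
  shows "lie_algebroid_automorphism A f \<Phi>"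
proof -
  note D = aut_pairD[OF a]
  have bij: "bij f" by (rule o_bij[of f' f]) (simp_all add: fun_eq_iff D(3,4))
  have inv: "inv f = f'" by (rule inv_unique_comp) (simp_all add: fun_eq_iff D(3,4))
  have bb: "bij_betw (\<Phi> x) (fibre A x) (fibre A (f x))" for x
  proof (rule bij_betw_byWitness[where f'="\<Phi>' (f x)"])
    show "\<forall>b\<in>fibre A (f x). \<Phi> x (\<Phi>' (f x) b) = b" using D(8)[of _ "f x"] by (simp add: D(3))
    show "\<Phi>' (f x) ` fibre A (f x) \<subseteq> fibre A x" using D(14)[of _ "f x"] by (auto simp: D(3))
  qed (use D(7,13) in auto)
  have invF: "inv_into (fibre A (f' y)) (\<Phi> (f' y)) b = \<Phi>' y b" if "b \<in> fibre A y" for y b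
    using bij_betw_inv_into_left[OF bb[of "f' y"] D(14)[OF that]] D(8)[OF that] by simp
  have "bundle_map A f \<Phi>"
  proof (rule bundle_mapI[OF D(1,5)])
    show "\<exists>X'\<in>sections A. \<forall>x. X' (f x) = \<Phi> x (X x)" if "X \<in> sections A" for X
      by (rule bexI[OF _ D(9)[OF that]]) (simp add: D(3))
  qed
  moreover have "bundle_map A f' (\<lambda>y. inv_into (fibre A (f' y)) (\<Phi> (f' y)))"
  proof (rule bundle_mapI[OF D(2)])
    fix y
    show "linear_between (fibre A y) (fibre A (f' y)) (inv_into (fibre A (f' y)) (\<Phi> (f' y)))"
      using linear_betweenD[OF D(6)[of y]] unfolding linear_between_def by (simp add: invF fibre_ops image_subset_iff)
    show "\<exists>X'\<in>sections A. \<forall>x. X' (f' x) = inv_into (fibre A (f' x)) (\<Phi> (f' x)) (X x)" if "X \<in> sections A" for X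
      by (rule bexI[OF _ D(10)[OF that]]) (simp add: D(4) invF sectionsD[OF that])
  qed
  moreover have "\<rho> (f x) (\<Phi> x b) = tangent_map A f (\<rho> x b)" if b: "b \<in> fibre A x" for x b
  proof
    fix g
    show "\<rho> (f x) (\<Phi> x b) g = tangent_map A f (\<rho> x b) g"
    proof (cases "smooth_function A g")
      case True
      then show ?thesis using D(11)[OF _ b, of g] by (simp add: tangent_map_def smooth_function_iff)
    next
      case False
      \<comment> \<open>Tangent vectors are extended by 0 to functions that are not smooth, so both
        sides are 0.\<close>
      then show ?thesis using anchor_tangent[OF D(13)[OF b]] by (simp add: tangent_map_def tangent_space_def)
    qed
  qed
  moreover have "(\<lambda>y. \<Phi> (f' y) (br X Y (f' y))) = br (\<lambda>y. \<Phi> (f' y) (X (f' y))) (\<lambda>y. \<Phi> (f' y) (Y (f' y)))"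
    if "X \<in> sections A" "Y \<in> sections A" for X Y
    using D(12)[OF that] by (simp add: fun_eq_iff)
  ultimately show ?thesis
    unfolding lie_algebroid_automorphism_def bundle_automorphism_def diffeomorphism_def inv Let_def
    using bij bb D(1,2) by blast
qed

lemma aut_pair_id: "aut_pair (\<lambda>x. x) (\<lambda>x a. a) (\<lambda>x. x) (\<lambda>x a. a)"
  unfolding aut_pair_def by (simp add: smooth_map_iff continuous_on_id sm_at_chart linear_between_def)

lemma smooth_map_comp: "smooth_map A f \<Longrightarrow> smooth_map A g \<Longrightarrow> smooth_map A (\<lambda>x. g (f x))"
proof -
  assume f: "smooth_map A f" and g: "smooth_map A g"
  have "continuous_on UNIV (\<lambda>x. g (f x))"
    by (rule continuous_on_compose2[of UNIV g UNIV f]) (use f g in \<open>simp_all add: smooth_map_def\<close>)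
  moreover have "sm_at A (\<lambda>x. \<kappa> (g (f x))) x" if "(U,\<kappa>) \<in> charts A" "g (f x) \<in> U" for U \<kappa> x
    by (rule smooth_map_pullback[OF f, where g="\<lambda>y. \<kappa> (g y)"]) (use g that in \<open>simp add: smooth_map_iff\<close>)
  ultimately show ?thesis unfolding smooth_map_iff by simp
qed

lemma linear_between_comp: "linear_between S T F \<Longrightarrow> linear_between T W G \<Longrightarrow> linear_between S W (\<lambda>a. G (F a))"
  unfolding linear_between_def by (simp add: image_subset_iff)

lemma aut_pair_comp:
  assumes a: "aut_pair f \<Phi> f' \<Phi>'" and b: "aut_pair g \<Psi> g' \<Psi>'"
  shows "aut_pair (\<lambda>x. g (f x)) (\<lambda>x a. \<Psi> (f x) (\<Phi> x a)) (\<lambda>x. f' (g' x)) (\<lambda>x a. \<Phi>' (g' x) (\<Psi>' x a))"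
proof -
  note D = aut_pairD[OF a] note E = aut_pairD[OF b]
  show ?thesis unfolding aut_pair_def
  proof (intro conjI allI ballI impI)
    show "smooth_map A (\<lambda>x. g (f x))" "smooth_map A (\<lambda>x. f' (g' x))"
      by (rule smooth_map_comp[OF D(1) E(1)], rule smooth_map_comp[OF E(2) D(2)])
    fix x
    show "f' (g' (g (f x))) = x" "g (f (f' (g' x))) = x" by (simp_all add: D(3,4) E(3,4))
    show "linear_between (fibre A x) (fibre A (g (f x))) (\<lambda>a. \<Psi> (f x) (\<Phi> x a))" by (rule linear_between_comp[OF D(5) E(5)])
    show "linear_between (fibre A x) (fibre A (f' (g' x))) (\<lambda>a. \<Phi>' (g' x) (\<Psi>' x a))" by (rule linear_between_comp[OF E(6) D(6)])
    show "\<Phi>' (g' (g (f x))) (\<Psi>' (g (f x)) (\<Psi> (f x) (\<Phi> x a))) = a" if "a \<in> fibre A x" for a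
      using that by (simp add: E(3) E(7) D(13) D(7))
    show "\<Psi> (f (f' (g' x))) (\<Phi> (f' (g' x)) (\<Phi>' (g' x) (\<Psi>' x a))) = a" if "a \<in> fibre A x" for a
      using that by (simp add: D(4) D(8) E(14) E(8))
  next
    fix X assume X: "X \<in> sections A"
    show "(\<lambda>y. \<Psi> (f (f' (g' y))) (\<Phi> (f' (g' y)) (X (f' (g' y))))) \<in> sections A"
      using E(9)[OF D(9)[OF X]] by (simp add: D(4))
    show "(\<lambda>y. \<Phi>' (g' (g (f y))) (\<Psi>' (g (f y)) (X (g (f y))))) \<in> sections A"
      using D(10)[OF E(10)[OF X]] by (simp add: E(3))
  next
    fix h x a assume h: "\<forall>y. sm_at A (h::'m \<Rightarrow> real) y" and a: "a \<in> fibre A x"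
    have "sm_at A (\<lambda>y. h (g y)) y" for y by (rule smooth_map_pullback[OF E(1)]) (use h in blast)
    then show "\<rho> (g (f x)) (\<Psi> (f x) (\<Phi> x a)) h = \<rho> x a (\<lambda>y. h (g (f y)))"
      using E(11)[OF _ D(13)[OF a], of h] D(11)[OF _ a, of "\<lambda>y. h (g y)"] h by simp
  next
    fix X Y y assume XY: "X \<in> sections A" "Y \<in> sections A"
    show "br (\<lambda>y. \<Psi> (f (f' (g' y))) (\<Phi> (f' (g' y)) (X (f' (g' y))))) (\<lambda>y. \<Psi> (f (f' (g' y))) (\<Phi> (f' (g' y)) (Y (f' (g' y))))) y
      = \<Psi> (f (f' (g' y))) (\<Phi> (f' (g' y)) (br X Y (f' (g' y))))"
      using E(12)[OF D(9)[OF XY(1)] D(9)[OF XY(2)], of y] D(12)[OF XY, of "g' y"] by (simp add: D(4))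
  qed
qed

text \<open>An intertwining relation, free of the inverse of \<Phi>, so that steps can be chained by
  composing.\<close>

definition conjugate :: "('m \<Rightarrow> 'v \<Rightarrow> 'v) \<Rightarrow> ('m \<Rightarrow> 'v \<Rightarrow> 'v) \<Rightarrow> bool" where
  "conjugate j0 j1 \<longleftrightarrow> (\<exists>f \<Phi> f' \<Phi>'. aut_pair f \<Phi> f' \<Phi>' \<and> (\<forall>x. \<forall>a\<in>fibre A x. j0 (f x) (\<Phi> x a) = \<Phi> x (j1 x a)))"

lemma conjugate_refl: "conjugate j j"
  unfolding conjugate_def by (intro exI conjI, rule aut_pair_id) simp

lemma conjugate_trans:
  assumes "conjugate j0 j1" "conjugate j1 j2" and j: "\<And>x a. a \<in> fibre A x \<Longrightarrow> j2 x a \<in> fibre A x"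
  shows "conjugate j0 j2"
proof -
  obtain g \<Psi> g' \<Psi>' where g: "aut_pair g \<Psi> g' \<Psi>'" "\<forall>x. \<forall>a\<in>fibre A x. j0 (g x) (\<Psi> x a) = \<Psi> x (j1 x a)"
    using assms(1) unfolding conjugate_def by (elim exE conjE) (rule that)
  obtain f \<Phi> f' \<Phi>' where f: "aut_pair f \<Phi> f' \<Phi>'" "\<forall>x. \<forall>a\<in>fibre A x. j1 (f x) (\<Phi> x a) = \<Phi> x (j2 x a)"
    using assms(2) unfolding conjugate_def by (elim exE conjE) (rule that)
  show ?thesis unfolding conjugate_def
  proof (intro exI conjI, rule aut_pair_comp[OF f(1) g(1)], intro allI ballI)
    fix x a assume "a \<in> fibre A x"
    then show "j0 (g (f x)) (\<Psi> (f x) (\<Phi> x a)) = \<Psi> (f x) (\<Phi> x (j2 x a))"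
      using f(2) g(2) aut_pairD(13)[OF f(1)] by simp
  qed
qed

lemma conjugate_isomorphic:
  assumes c: "conjugate j0 j1" and j: "\<And>x a. a \<in> fibre A x \<Longrightarrow> j1 x a \<in> fibre A x"
  shows "isomorphic_acs A j0 j1"
proof -
  obtain f \<Phi> f' \<Phi>' where f: "aut_pair f \<Phi> f' \<Phi>'" "\<forall>x. \<forall>a\<in>fibre A x. j0 (f x) (\<Phi> x a) = \<Phi> x (j1 x a)"
    using c unfolding conjugate_def by (elim exE conjE) (rule that)
  have "inj_on (\<Phi> x) (fibre A x)" for x
    by (rule inj_on_inverseI[where g="\<Phi>' (f x)"]) (rule aut_pairD(7)[OF f(1)])
  then show ?thesis unfolding isomorphic_acs_def
    using aut_pair_automorphism[OF f(1)] f(2) j by (intro exI[of _ f] exI[of _ \<Phi>]) simp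
qed

end

section \<open>The global flow and the passage from 0 to 1\<close>

locale global_flow = local_flow A u J \<epsilon> UNIV f F B
  for A :: "('m::{t2_space,second_countable_topology}, 'e::euclidean_space,
    'v::real_vector, 'f::euclidean_space, 'z) lie_algebroid_scheme" and u J \<epsilon> f F B
begin

text \<open>The trajectory of x from time s and that of y = f s t x from time t meet at time t. By
  uniqueness they agree back at time s, where the first one is at x.\<close>

lemma flow_inverse:
  assumes st: "\<bar>t - s\<bar> < \<epsilon>"
  shows "f t s (f s t x) = x" and "a \<in> fibre A x \<Longrightarrow> F t s (f s t x) (F s t x a) = a"
proof -
  have ts: "\<bar>s - t\<bar> < \<epsilon>" using st by simp
  define y where "y = f s t x"
  obtain V \<psi> where V: "(V,\<psi>) \<in> trivs A" "x \<in> V" using triv_ex[of x] by (elim exE conjE) (rule that)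
  have l: "linear_between (fibre A x) UNIV (\<psi> x)"
    using triv_lb[OF V] by (simp add: linear_between_def)
  \<comment> \<open>The second test map contains \<open>B s t x\<close>, so that both pairs pull
    back to the fibre at x and agree at time t.\<close>
  have l': "linear_between (fibre A y) UNIV (\<lambda>b. \<psi> x (B s t x b))"
    unfolding y_def by (rule linear_between_comp[OF B_lin[OF st UNIV_I] l])
  define I where "I = {s-\<epsilon><..<s+\<epsilon>} \<inter> {t-\<epsilon><..<t+\<epsilon>}"
  have "agree (\<lambda>\<tau>. f s \<tau> x) (\<lambda>\<tau> a. \<psi> x (B s \<tau> x a)) (\<lambda>\<tau>. f t \<tau> y) (\<lambda>\<tau> a. \<psi> x (B s t x (B t \<tau> y a))) s"
  proof (rule integral_pair_unique[where I=I and s=t])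
    show "integral_pair u I (\<lambda>\<tau>. f s \<tau> x) (\<lambda>\<tau> a. \<psi> x (B s \<tau> x a))" "integral_pair u I (\<lambda>\<tau>. f t \<tau> y) (\<lambda>\<tau> a. \<psi> x (B s t x (B t \<tau> y a)))"
      unfolding I_def by (rule integral_pair_subset[OF ip[OF UNIV_I l] Int_lower1], rule integral_pair_subset[OF ip[OF UNIV_I l'] Int_lower2])
    show "convex I" unfolding I_def by (intro convex_Int convex_real_interval)
    show "agree (\<lambda>\<tau>. f s \<tau> x) (\<lambda>\<tau> a. \<psi> x (B s \<tau> x a)) (\<lambda>\<tau>. f t \<tau> y) (\<lambda>\<tau> a. \<psi> x (B s t x (B t \<tau> y a))) t"
      unfolding agree_def by (simp add: f0[OF UNIV_I] B0[OF UNIV_I] y_def)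
  qed (use st \<epsilon> in \<open>auto simp: I_def abs_less_iff\<close>)
  then have 1: "f t s y = x" and 2: "\<And>a. a \<in> fibre A x \<Longrightarrow> \<psi> x a = \<psi> x (B s t x (B t s y a))"
    unfolding agree_def f0[OF UNIV_I] using B0[OF UNIV_I] by auto
  show "f t s (f s t x) = x" using 1 by (simp add: y_def)
  show "F t s (f s t x) (F s t x a) = a" if a: "a \<in> fibre A x"
  proof -
    have b: "B t s y a \<in> fibre A y" using linear_betweenD(1)[OF B_lin[OF ts UNIV_I[of y]]] a 1 by simp
    have "B s t x (B t s y a) \<in> fibre A x" using linear_betweenD(1)[OF B_lin[OF st UNIV_I[of x]]] b by (simp add: y_def)
    from triv_inj[OF V a this 2[OF a]] have "F s t x a = B t s y a"
      using FB[OF st UNIV_I[of x], of "B t s y a"] b by (simp add: y_def)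
    then show ?thesis using FB[OF ts UNIV_I[of y], of a] a by (simp add: 1 y_def[symmetric])
  qed
qed

lemma flow_smooth: "\<bar>t - s\<bar> < \<epsilon> \<Longrightarrow> smooth_map A (f s t)"
  unfolding smooth_map_iff using f_cont f_sm by blast

lemma flow_push:
  assumes st: "\<bar>t - s\<bar> < \<epsilon>" and X: "X \<in> sections A"
  shows "(\<lambda>y. F s t (f t s y) (X (f t s y))) \<in> sections A"
proof (rule sectionsI)
  fix y
  have ts: "\<bar>s - t\<bar> < \<epsilon>" using st by simp
  have eq: "f s t (f t s y) = y" for y by (rule flow_inverse(1)[OF ts])
  show "F s t (f t s y) (X (f t s y)) \<in> fibre A y"
    using linear_betweenD(1)[OF F_lin[OF st UNIV_I[of "f t s y"]] sectionsD[OF X]] by (simp add: eq)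
  obtain V \<psi> where V: "(V,\<psi>) \<in> trivs A" "y \<in> V" using triv_ex[of y] by (elim exE conjE) (rule that)
  have "sm_at A (\<lambda>z. \<psi> (f s t (f t s z)) (F s t (f t s z) (X (f t s z)))) y"
    by (rule smooth_map_pullback[OF flow_smooth[OF ts] F_sm[OF st UNIV_I V(1) _ X]]) (simp add: eq V)
  then show "\<exists>V \<psi>. (V,\<psi>) \<in> trivs A \<and> y \<in> V \<and> sm_at A (\<lambda>y. \<psi> y (F s t (f t s y) (X (f t s y)))) y"
    using V unfolding eq by blast
qed

lemma flow_aut_pair:
  assumes st: "\<bar>t - s\<bar> < \<epsilon>"
  shows "aut_pair (f s t) (F s t) (f t s) (F t s)"
proof -
  have ts: "\<bar>s - t\<bar> < \<epsilon>" using st by simp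
  note i = flow_inverse[OF st] and i' = flow_inverse[OF ts]
  show ?thesis unfolding aut_pair_def
  proof (intro conjI allI ballI impI)
    fix g x a assume g: "\<forall>y. sm_at A (g::'m \<Rightarrow> real) y" and a: "a \<in> fibre A x"
    show "\<rho> (f s t x) (F s t x a) g = \<rho> x a (\<lambda>y. g (f s t y))"
      by (rule F_anchor[OF st UNIV_I _ smooth_map_pullback[OF flow_smooth[OF st]] _ a]) (use g in auto)
  next
    fix X Y y assume XY: "X \<in> sections A" "Y \<in> sections A"
    show "br (\<lambda>y. F s t (f t s y) (X (f t s y))) (\<lambda>y. F s t (f t s y) (Y (f t s y))) y = F s t (f t s y) (br X Y (f t s y))"
      using F_bracket[OF st UNIV_I XY(1) flow_push[OF st XY(1)] _ XY(2) flow_push[OF st XY(2)], of "f t s y"]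
      by (simp add: i i')
  qed (intro flow_smooth st ts i i' F_lin UNIV_I flow_push; assumption)+
qed

lemma flow_conjugate:
  assumes "s \<in> {0..1}" "t \<in> {0..1}" "\<bar>t - s\<bar> < \<epsilon>"
  shows "conjugate (J t) (J s)"
  unfolding conjugate_def by (intro exI conjI allI ballI, rule flow_aut_pair[OF assms(3)]) (rule F_J[OF assms(3) UNIV_I assms(1,2)])

end

theorem (in flow_data) conjugate_endpoints:
  assumes "compact (UNIV :: 'm set)"
  shows "conjugate (J 0) (J 1)"
proof -
  obtain \<epsilon> f F B where "local_flow A u J \<epsilon> UNIV f F B" by (rule global_flow_exists[OF assms])
  then interpret global_flow A u J \<epsilon> f F B by (rule global_flow.intro)
  \<comment> \<open>As \<epsilon> does not depend on the initial time, n equal steps of length 1/n <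
    \<epsilon> lead from 0 to 1.\<close>
  obtain n where n: "n \<noteq> 0" "inverse (real n) < \<epsilon>" using reals_Archimedean[OF \<epsilon>] by (metis Suc_neq_Zero)
  have "conjugate (J 0) (J (real k / real n))" if "k \<le> n" for k
    using that
  proof (induction k)
    case (Suc k)
    have I: "real k / real n \<in> {0..1}" "real (Suc k) / real n \<in> {0..1}" using Suc.prems n by (auto simp: field_simps)
    have "real (Suc k) / real n - real k / real n = inverse (real n)"
      by (simp add: diff_divide_distrib[symmetric] inverse_eq_divide)
    then have d: "\<bar>real k / real n - real (Suc k) / real n\<bar> < \<epsilon>" using n(2) n(1) by (subst abs_minus_commute) (simp only: abs_of_nonneg inverse_nonnegative_iff_nonnegative of_nat_0_le_iff)
    \<comment> \<open>The flow from s to t gives \<open>conjugate (J t) (J s)\<close>, so this step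
      uses the flow backwards in time, from (k+1)/n to k/n.\<close>
    show ?case
      by (rule conjugate_trans[OF Suc.IH flow_conjugate[OF I(2,1) d]])
         (use Suc.prems linear_betweenD(1)[OF Jlin[OF I(2)]] in auto)
  qed (simp add: conjugate_refl)
  from this[of n] show ?thesis using n by simp
qed

subsection \<open>From the Dolbeault condition to the flow\<close>

lemma (in smfd) smooth_family_on_bounded_linear:
  assumes F: "smooth_family_on M T S F" and L: "bounded_linear L"
    and eq: "\<And>t x. t \<in> T \<Longrightarrow> x \<in> S \<Longrightarrow> G t x = L (F t x)"
  shows "smooth_family_on M T S G"
  unfolding smooth_family_on_def
proof (intro ballI, clarify)
  fix U \<kappa> assume c: "(U,\<kappa>) \<in> charts M"
  have s: "smooth_on (T \<times> \<kappa> ` (U \<inter> S)) (\<lambda>(t,y). F t (inv_into U \<kappa> y))"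
    using F c unfolding smooth_family_on_def by auto
  show "smooth_on (T \<times> \<kappa> ` (U \<inter> S)) (\<lambda>(t,y). G t (inv_into U \<kappa> y))"
    unfolding smooth_on_def
  proof
    fix p assume p: "p \<in> T \<times> \<kappa> ` (U \<inter> S)"
    obtain W g where W: "open W" "p \<in> W" "\<forall>k. Ck_on k W g"
      "\<forall>y\<in>W \<inter> (T \<times> \<kappa> ` (U \<inter> S)). g y = (\<lambda>(t,y). F t (inv_into U \<kappa> y)) y"
      using bspec[OF s[unfolded smooth_on_def] p] by (elim exE conjE) (rule that)
    show "\<exists>W g. open W \<and> p \<in> W \<and> (\<forall>k. Ck_on k W g) \<and>
        (\<forall>y\<in>W \<inter> (T \<times> \<kappa> ` (U \<inter> S)). g y = (\<lambda>(t,y). G t (inv_into U \<kappa> y)) y)"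
    proof (intro exI conjI allI ballI)
      show "Ck_on k W (\<lambda>y. L (g y))" for k
        using Ckp_bounded_linear[OF L W(1), of k "{0::real}" "\<lambda>_. g"] W(3)
          Ck_on_iff_Ckp[of "0::real" "{0}" k W g] Ck_on_iff_Ckp[of "0::real" "{0}" k W "\<lambda>y. L (g y)"] by simp
      fix y assume y: "y \<in> W \<inter> (T \<times> \<kappa> ` (U \<inter> S))"
      then obtain t x where tx: "y = (t, \<kappa> x)" "t \<in> T" "x \<in> U" "x \<in> S" by auto
      show "L (g y) = (\<lambda>(t,y). G t (inv_into U \<kappa> y)) y"
        using W(4)[rule_format, OF y] by (simp add: tx(1) chart(7)[OF c tx(3)] eq[OF tx(2,4)])
    qed (use W in simp_all)
  qed
qed

lemma (in vbundle) bundle_map_sections: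
  assumes b: "bundle_map A id \<Phi>" and X: "X \<in> sections A"
  shows "(\<lambda>y. \<Phi> y (X y)) \<in> sections A"
proof (rule sectionsI)
  have lin: "linear_between (fibre A x) (fibre A x) (\<Phi> x)" for x using b by (simp add: bundle_map_def)
  show "\<Phi> x (X x) \<in> fibre A x" for x by (rule linear_betweenD(1)[OF lin sectionsD[OF X]])
  fix x
  obtain V \<psi> where V: "(V,\<psi>) \<in> trivs A" "x \<in> V" using triv_ex[of x] by (elim exE conjE) (rule that)
  have sm: "sm_at A (\<lambda>y. \<psi> y (\<Phi> y (triv_inv \<psi> y (PF c)))) x" for c
  proof -
    have "smooth_fun_on A (V \<inter> id -` V) (\<lambda>x. \<psi> (id x) (\<Phi> x (triv_inv \<psi> x (PF c))))"
      using b V(1) PF(2)[of c] unfolding bundle_map_def by blast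
    then show ?thesis using smooth_fun_on_iff[OF triv_open[OF V(1)], of "\<lambda>x. \<psi> x (\<Phi> x (triv_inv \<psi> x (PF c)))"] V(2) by simp
  qed
  have "sm_at A (\<lambda>y. \<Sum>c\<in>Basis. (\<psi> y (X y) \<bullet> c) *\<^sub>R \<psi> y (\<Phi> y (triv_inv \<psi> y (PF c)))) x"
    by (intro sm_at_sum sm_at_scaleR sm_at_inner_right sections_sm[OF X V] sm)
  then have "sm_at A (\<lambda>y. \<psi> y (\<Phi> y (X y))) x"
  proof (rule sm_at_cong[OF _ triv_open[OF V(1)] V(2)])
    fix y assume y: "y \<in> V"
    have i: "triv_inv \<psi> y (PF c) \<in> fibre A y" for c by (rule triv_inv_in[OF V(1) y PF(2)])
    have "\<Phi> y (X y) = \<Phi> y (\<Sum>c\<in>Basis. (\<psi> y (X y) \<bullet> c) *\<^sub>R triv_inv \<psi> y (PF c))"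
      using triv_expand[OF V(1) y sectionsD[OF X]] by simp
    also have "\<dots> = (\<Sum>c\<in>Basis. (\<psi> y (X y) \<bullet> c) *\<^sub>R \<Phi> y (triv_inv \<psi> y (PF c)))"
      by (rule linear_between_sum[OF lin subspaces(2) i])
    finally show "(\<Sum>c\<in>Basis. (\<psi> y (X y) \<bullet> c) *\<^sub>R \<psi> y (\<Phi> y (triv_inv \<psi> y (PF c)))) = \<psi> y (\<Phi> y (X y))"
      by (simp add: triv_sum[OF V(1) y] triv_ops(3)[OF V(1) y] fibre_ops(4) linear_betweenD(1)[OF lin i])
  qed
  then show "\<exists>V \<psi>. (V,\<psi>) \<in> trivs A \<and> x \<in> V \<and> sm_at A (\<lambda>y. \<psi> y (\<Phi> y (X y))) x" using V by blast
qed

text \<open>The \<open>THE\<close> in \<open>fibre_vector_derivative\<close> is legitimate. With a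
  read as a fixed vector w of the typical fibre, joint smoothness of the family gives a derivative
  in one trivialisation; the linear change of trivialisation carries it to all others; and
  derivatives within [0,1] are unique.\<close>

lemma (in algebroid) fibre_vector_derivative_endo_family:
  assumes j: "smooth_endo_family A {0..1} j" and jin: "\<And>t. t \<in> {0..1} \<Longrightarrow> j t y a \<in> fibre A y"
    and a: "a \<in> fibre A y" and t: "t \<in> {0..1}"
  defines "d \<equiv> fibre_vector_derivative A y {0..1} (\<lambda>s. j s y a) t"
  shows "d \<in> fibre A y" and "(V,\<psi>) \<in> trivs A \<Longrightarrow> y \<in> V \<Longrightarrow>
    ((\<lambda>s. \<psi> y (j s y a)) has_vector_derivative \<psi> y d) (at t within {0..1})"
proof -
  let ?P = "\<lambda>b. b \<in> fibre A y \<and> (\<forall>(U,\<psi>)\<in>trivs A. y \<in> U \<longrightarrow>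
        ((\<lambda>s. \<psi> y (j s y a)) has_vector_derivative \<psi> y b) (at t within {0..1}))"
  obtain U \<kappa> V \<psi> N0 e k where co: "coords A U \<kappa> V \<psi> N0 e k" and y: "y \<in> N0"
    using coords_exist[of y] by (elim exE conjE) (rule that)
  interpret co: coords A U \<kappa> V \<psi> N0 e k by (rule co)
  have yV: "y \<in> V" using y co.N0 by blast
  define w where "w = \<psi> y a"
  have w: "w \<in> typical_fibre A" "triv_inv \<psi> y w = a"
    unfolding w_def by (rule triv_in[OF co.V yV a], rule triv_inv_triv[OF co.V yV a])
  have "smooth_family_on A {0..1} (V \<inter> V) (\<lambda>t x. \<psi> x (j t x (triv_inv \<psi> x w)))"
    using j co.V w(1) unfolding smooth_endo_family_def by blast
  then have sf: "smooth_family_on A {0..1} V (\<lambda>t x. \<psi> x (j t x (triv_inv \<psi> x w)))" by simp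
  obtain D where D: "((\<lambda>z. \<psi> (co.\<mu> (snd z)) (j (fst z) (co.\<mu> (snd z)) (triv_inv \<psi> (co.\<mu> (snd z)) w))) has_derivative D)
      (at (t, \<kappa> y) within {0..1} \<times> co.\<Omega>)"
    using co.family_diff[OF sf co.N0(3) t co.kappa_Omega[OF y]] by (rule exE)
  have A1: "((\<lambda>t. (t, \<kappa> y)) has_derivative (\<lambda>h. (h, 0))) (at t within {0..1})"
    by (intro has_derivative_Pair has_derivative_ident has_derivative_const)
  have A2: "((\<lambda>z. \<psi> (co.\<mu> (snd z)) (j (fst z) (co.\<mu> (snd z)) (triv_inv \<psi> (co.\<mu> (snd z)) w))) has_derivative D)
      (at (t, \<kappa> y) within (\<lambda>t. (t, \<kappa> y)) ` {0..1})"
    by (rule has_derivative_subset[OF D]) (use co.kappa_Omega[OF y] in auto)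
  from has_derivative_in_compose[OF A1 A2]
  have "((\<lambda>s. \<psi> y (j s y a)) has_derivative (\<lambda>h. D (h,0))) (at t within {0..1})"
    by (simp add: co.mu_kappa[OF y] w(2))
  then have "(\<lambda>s. \<psi> y (j s y a)) differentiable (at t within {0..1})" unfolding differentiable_def by (rule exI[of _ "\<lambda>h. D (h,0)"])
  then obtain v where v: "((\<lambda>s. \<psi> y (j s y a)) has_vector_derivative v) (at t within {0..1})"
    using vector_derivative_works by blast
  \<comment> \<open>A priori v is just a vector of \<open>'f\<close>, so it is projected before
    being pulled back to the fibre; the curve itself is fixed by the projection.\<close>
  define b where "b = triv_inv \<psi> y (PF v)"
  have b: "b \<in> fibre A y" unfolding b_def by (rule triv_inv_in[OF co.V yV PF(2)])
  have P: "?P b"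
  proof (intro conjI b ballI, clarify)
    fix V' \<psi>' assume V': "(V',\<psi>') \<in> trivs A" "y \<in> V'"
    have lin: "linear (\<lambda>w. \<psi>' y (triv_inv \<psi> y (PF w)))"
      by (rule linearI)
         (use triv_inv_lin[OF co.V yV PF(2) PF(2), of 1 _ 1] triv_inv_lin[OF co.V yV PF(2) PF(2), of _ _ 0 0] in
          \<open>simp_all add: linear_add[OF PF(1)] linear_cmul[OF PF(1)] triv_ops[OF V'] triv_inv_in[OF co.V yV PF(2)]\<close>)
    have "((\<lambda>s. \<psi>' y (triv_inv \<psi> y (PF (\<psi> y (j s y a))))) has_vector_derivative \<psi>' y (triv_inv \<psi> y (PF v))) (at t within {0..1})"
      by (rule bounded_linear.has_vector_derivative[OF _ v]) (use lin linear_conv_bounded_linear in blast)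
    then show "((\<lambda>s. \<psi>' y (j s y a)) has_vector_derivative \<psi>' y b) (at t within {0..1})"
      unfolding b_def
      by (rule has_vector_derivative_transform[OF t, rotated])
         (simp add: PF(3)[OF triv_in[OF co.V yV jin]] triv_inv_triv[OF co.V yV jin])
  qed
  have "d = b" unfolding d_def fibre_vector_derivative_def
  proof (rule the_equality[where P="?P", OF P])
    fix b' assume b': "?P b'"
    then have "((\<lambda>s. \<psi> y (j s y a)) has_vector_derivative \<psi> y b') (at t within {0..1})" using co.V yV by blast
    moreover have "((\<lambda>s. \<psi> y (j s y a)) has_vector_derivative \<psi> y b) (at t within {0..1})" using P co.V yV by blast
    ultimately have "\<psi> y b' = \<psi> y b" by (rule vector_derivative_unique_within[OF at_within_interval_nontrivial[OF t]])
    then show "b' = b" using b' b triv_inj[OF co.V yV] by blast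
  qed
  then show "d \<in> fibre A y" "(V',\<psi>') \<in> trivs A \<Longrightarrow> y \<in> V' \<Longrightarrow>
    ((\<lambda>s. \<psi>' y (j s y a)) has_vector_derivative \<psi>' y d) (at t within {0..1})" for V' \<psi>'
    using P by auto
qed

text \<open>Only the real part of the complex equation is used. Projecting to the (1,0)-part costs a
  factor 1/2, the Nijenhuis identity doubles the terms that remain, and so the -2 of the hypothesis
  turns into -1/2.\<close>

lemma (in algebroid) dbar_condition:
  assumes J: "integrable_acs A J" and z: "z \<in> sections01 A J"
    and db: "\<And>X x. X \<in> sections01 A J \<Longrightarrow> dbar A J (\<lambda>y. cconj (z y)) X x = (-2) *\<^sub>R cext (Jd x) (X x)"
    and X: "X \<in> sections A"
  shows "Jd x (X x) = (-1/2) *\<^sub>R (br (\<lambda>y. J y (X y)) (\<lambda>y. snd (z y)) x - J x (br X (\<lambda>y. snd (z y)) x))"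
proof -
  have bm: "bundle_map A id J" and sq: "\<And>x a. a \<in> fibre A x \<Longrightarrow> J x (J x a) = - a"
    and N: "\<And>X Y x. X \<in> sections A \<Longrightarrow> Y \<in> sections A \<Longrightarrow> br (\<lambda>y. J y (X y)) (\<lambda>y. J y (Y y)) x - br X Y x
        - J x (br (\<lambda>y. J y (X y)) Y x + br X (\<lambda>y. J y (Y y)) x) = 0"
    using J unfolding integrable_acs_def by auto
  have lin: "linear_between (fibre A x) (fibre A x) (J x)" for x using bm by (simp add: bundle_map_def)
  note Jsec = bundle_map_sections[OF bm]
  define a where "a y = fst (z y)" for y
  define b where "b y = snd (z y)" for y
  have ab: "a \<in> sections A" "b \<in> sections A"
    using z unfolding sections01_def csections_def a_def[abs_def] b_def[abs_def] by auto
  have Jab: "J y (a y) = b y" for y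
    using z by (auto simp: sections01_def bundle01_def cext_def cscale_def a_def b_def)
  define JX where "JX y = J y (X y)" for y
  have JX: "JX \<in> sections A" unfolding JX_def[abs_def] by (rule Jsec[OF X])
  \<comment> \<open>The (0,1)-section with real part X; it makes the equation available for every
    real section.\<close>
  have X01: "(\<lambda>y. (X y, JX y)) \<in> sections01 A J"
    using X JX[unfolded JX_def[abs_def]] sectionsD[OF X] sectionsD[OF JX]
    by (auto simp: sections01_def csections_def bundle01_def cext_def cscale_def JX_def sq)
  have nb: "br Y (\<lambda>y. - b y) x = - br Y b x" if "Y \<in> sections A" for Y
    using fun_cong[OF br_lin_right[OF ab(2,2) that, of "-1" 0], of x] by simp
  define p where "p = br X a x + br JX b x"
  define q where "q = - br X b x + br JX a x"
  have brin: "br Y Z x \<in> fibre A x" if "Y \<in> sections A" "Z \<in> sections A" for Y Z by (rule sectionsD[OF br_section[OF that]])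
  have pq: "p \<in> fibre A x" "q \<in> fibre A x" unfolding p_def q_def by (intro fibre_ops brin X JX ab)+
  have cb: "cbracket A (\<lambda>y. (X y, JX y)) (\<lambda>y. cconj (z y)) x = (p, q)"
    unfolding cbracket_def Let_def p_def q_def
    by (simp add: cconj_def a_def[symmetric] b_def[symmetric] nb[OF X] nb[OF JX, unfolded b_def] nb[OF X, unfolded b_def] nb[OF JX] cong: if_cong)
  have "(-2) *\<^sub>R Jd x (X x) = fst (pr10 A J x (p, q))"
    using arg_cong[OF db[OF X01, of x], of fst] by (simp add: dbar_def cb cext_def)
  also have "pr10 A J x (p, q) = (1/2) *\<^sub>R ((p, q) - cscale \<i> (cext (J x) (p, q)))"
    by (rule pr10_eq(1)[OF subspaces(2) lin sq]) (use pq in auto)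
  finally have 1: "(-2) *\<^sub>R Jd x (X x) = (1/2) *\<^sub>R (p + J x q)" by (simp add: cext_def cscale_def)
  \<comment> \<open>The identity expresses J [JX, a] by [X, a] and brackets with b, so that a
    disappears from p + J q.\<close>
  have "br JX b x - br X a x - J x (br JX a x + br X b x) = 0"
    using N[OF X ab(1), of x] by (simp add: Jab JX_def[abs_def])
  moreover have "J x (br JX a x + br X b x) = J x (br JX a x) + J x (br X b x)"
    using linear_betweenD(2)[OF lin brin[OF JX ab(1)] brin[OF X ab(2)], of 1 1] by simp
  moreover have "J x q = J x (br JX a x) - J x (br X b x)"
    using linear_betweenD(2)[OF lin brin[OF JX ab(1)] brin[OF X ab(2)], of 1 "-1"] by (simp add: q_def)
  ultimately have "p + J x q = 2 *\<^sub>R (br JX b x - J x (br X b x))"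
    unfolding p_def by (simp add: scaleR_2 algebra_simps)
  with 1 have "(-2) *\<^sub>R Jd x (X x) = br JX b x - J x (br X b x)" by simp
  then have "(-1/2) *\<^sub>R ((-2) *\<^sub>R Jd x (X x)) = (-1/2) *\<^sub>R (br JX b x - J x (br X b x))" by simp
  then show ?thesis by (simp add: JX_def[abs_def] b_def[abs_def])
qed

theorem corollary5p3:
  fixes A :: "('m::{t2_space,second_countable_topology}, 'e::euclidean_space,
               'v::real_vector, 'f::euclidean_space) lie_algebroid"
    and j :: "real \<Rightarrow> 'm \<Rightarrow> 'v \<Rightarrow> 'v"
    and j0 j1 :: "'m \<Rightarrow> 'v \<Rightarrow> 'v"
    and z :: "real \<Rightarrow> 'm \<Rightarrow> 'v \<times> 'v"
  assumes "is_lie_algebroid A"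
    and "compact (UNIV :: 'm set)"
    and "integrable_acs A j0" and "integrable_acs A j1"
    and "\<forall>t\<in>{0..1}. integrable_acs A (j t)"
    and "smooth_endo_family A {0..1} j"
    and "\<forall>x. \<forall>a\<in>fibre A x. j 0 x a = j0 x a \<and> j 1 x a = j1 x a"
    and "smooth_csection_family A {0..1} z"
    and "\<forall>t\<in>{0..1}. z t \<in> sections01 A (j t)"
    and "\<forall>t\<in>{0..1}. \<forall>X\<in>sections01 A (j t). \<forall>x.
           dbar A (j t) (\<lambda>y. cconj (z t y)) X x
             = (-2) *\<^sub>R cext (acs_derivative A j t x) (X x)"
  shows "isomorphic_acs A j0 j1"
proof -
  interpret algebroid A by (rule algebroid.intro[OF assms(1)])
  have bm: "bundle_map A id (j t)" if "t \<in> {0..1}" for t using assms(5) that by (auto simp: integrable_acs_def)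
  have jlin: "linear_between (fibre A y) (fibre A y) (j t y)" if "t \<in> {0..1}" for t y
    using bm[OF that] by (simp add: bundle_map_def)
  define b where "b t y = snd (z t y)" for t y
  \<comment> \<open>Beyond [0,1], where z is not controlled, the section is frozen at its end
    values.\<close>
  define u where "u t y = (-1/2) *\<^sub>R b (clamp01 t) y" for t y
  have b: "b t \<in> sections A" if "t \<in> {0..1}" for t
    using assms(9) that unfolding sections01_def csections_def b_def[abs_def] by auto
  have u: "u t \<in> sections A" for t
    unfolding u_def[abs_def] by (rule sections_scale[OF b[OF clamp01(1)] sm_at_const])
  have brb: "br (u t) Y y = (1/2) *\<^sub>R br Y (b t) y" if "t \<in> {0..1}" "Y \<in> sections A" for t Y y
    using fun_cong[OF br_lin_right[OF b[OF that(1)] b[OF that(1)] that(2), of "-1/2" 0], of y] fun_cong[OF br_skew[OF u[of t] that(2)], of y]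
    by (simp add: u_def[abs_def] clamp01(2)[OF that(1)])
  interpret flow_data A u j
  proof
    show "u t \<in> sections A" for t by (rule u)
    show "u t = u (clamp01 t)" for t unfolding u_def[abs_def] by (simp add: clamp01(2)[OF clamp01(1)])
    show "linear_between (fibre A y) (fibre A y) (j t y)" if "t \<in> {0..1}" for t y by (rule jlin[OF that])
    show "(\<lambda>y. j t y (X y)) \<in> sections A" if "t \<in> {0..1}" "X \<in> sections A" for t X
      by (rule bundle_map_sections[OF bm[OF that(1)] that(2)])
    fix V \<psi> assume V: "(V,\<psi>) \<in> trivs A"
    have "smooth_family_on A {0..1} V (\<lambda>t x. \<psi> x (snd (z t x)))"
      using assms(8) V unfolding smooth_csection_family_def by auto
    then show "smooth_family_on A {0..1} V (\<lambda>t x. \<psi> x (u t x))"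
    proof (rule smooth_family_on_bounded_linear[OF _ bounded_linear_scaleR_right])
      show "\<psi> x (u t x) = (-1/2) *\<^sub>R \<psi> x (snd (z t x))" if "t \<in> {0..1}" "x \<in> V" for t x
        unfolding u_def clamp01(2)[OF that(1)] b_def
        by (rule triv_ops(3)[OF V that(2) sectionsD[OF b[OF that(1)], unfolded b_def]])
    qed
    show "smooth_family_on A {0..1} V (\<lambda>t x. \<psi> x (j t x (triv_inv \<psi> x w)))" if "w \<in> typical_fibre A" for w
    proof -
      have "smooth_family_on A {0..1} (V \<inter> V) (\<lambda>t x. \<psi> x (j t x (triv_inv \<psi> x w)))"
        using assms(6) V that unfolding smooth_endo_family_def by blast
      then show ?thesis by simp
    qed
    show "((\<lambda>t. \<psi> y (j t y (X y))) has_vector_derivative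
         \<psi> y (j t y (br (u t) X y) - br (u t) (\<lambda>y. j t y (X y)) y)) (at t within {0..1})"
      if t: "t \<in> {0..1}" and y: "y \<in> V" and X: "X \<in> sections A" for t y X
    proof -
      have jX: "(\<lambda>y. j t y (X y)) \<in> sections A" by (rule bundle_map_sections[OF bm[OF t] X])
      have "acs_derivative A j t y (X y) = (-1/2) *\<^sub>R (br (\<lambda>y. j t y (X y)) (b t) y - j t y (br X (b t) y))"
        unfolding b_def[abs_def]
        by (rule dbar_condition[OF _ _ _ X, where z="z t" and Jd="acs_derivative A j t"]) (use assms(5,9,10) t in auto)
      \<comment> \<open>By \<open>brb\<close> the bracket of Y with b is twice that of u with Y,
        which absorbs the factor 1/2 and reverses the order of the arguments.\<close>
      also have "\<dots> = j t y (br (u t) X y) - br (u t) (\<lambda>y. j t y (X y)) y"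
        using linear_betweenD(2)[OF jlin[OF t], of "br X (b t) y" y "br X (b t) y" "1/2" 0] sectionsD[OF br_section[OF X b[OF t]], of y]
        by (simp add: brb[OF t X] brb[OF t jX] algebra_simps)
      finally show ?thesis
        using fibre_vector_derivative_endo_family(2)[OF assms(6) _ sectionsD[OF X] t V y] linear_betweenD(1)[OF jlin sectionsD[OF X]]
        by (simp add: acs_derivative_def)
    qed
  qed
  have "conjugate (j 0) (j 1)" by (rule conjugate_endpoints[OF assms(2)])
  then obtain f \<Phi> f' \<Phi>' where f: "aut_pair f \<Phi> f' \<Phi>'" "\<forall>x. \<forall>a\<in>fibre A x. j 0 (f x) (\<Phi> x a) = \<Phi> x (j 1 x a)"
    unfolding conjugate_def by (elim exE conjE) (rule that)
  \<comment> \<open>The endpoints of the family agree with j0 and j1 on the fibres only, so the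
    relation is transferred element by element.\<close>
  have "conjugate j0 j1"
    unfolding conjugate_def
    by (intro exI conjI, rule f(1)) (use f(2) assms(7) aut_pairD(13)[OF f(1)] in simp)
  then show ?thesis
  proof (rule conjugate_isomorphic)
    show "j1 x a \<in> fibre A x" if "a \<in> fibre A x" for x a
      using linear_betweenD(1)[OF jlin[of 1 x] that] assms(7) that by simp
  qed
qed

end
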